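(* Let $\mathcal{S}$ be a rigid semigroup category. Then the presheaf category $\widehat{\mathcal{S}}=[\mathcal{S}^{\mathrm{op}},\mathbf{Vec}_{\Bbbk}]$, with Day convolution as tensor product, is a monoidal category, and the Yoneda embedding $\mathcal{S}\hookrightarrow\widehat{\mathcal{S}}$ is a (fully faithful) semigroup functor whose image lies in the full subcategory $\widehat{\mathcal{S}}_{\mathrm{rig}}$ of rigid objects of $\widehat{\mathcal{S}}$ (objects admitting both a left and a right dual). The monoidal unit of $\widehat{\mathcal{S}}$ is given by the presheaf $$F\longmapsto \operatorname{Hom}_{\mathcal{S}\text{-Mod}(\mathcal{S},\mathcal{S})}(-\boxtimes F,\ \mathrm{Id}_{\mathcal{S}}),$$ and this presheaf is isomorphic to the presheaf $$F\longmapsto \operatorname{Hom}_{\text{Mod-}\mathcal{S}(\mathcal{S},\mathcal{S})}(F\boxtimes -,\ \mathrm{Id}_{\mathcal{S}}).$$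
   Context: $\Bbbk$ is a field; all categories and functors are $\Bbbk$-linear, and $\mathcal{S}$ is small. A *semigroup category* is a category $\mathcal{S}$ with a bilinear functor $\boxtimes:\mathcal{S}\otimes_{\Bbbk}\mathcal{S}\to\mathcal{S}$ and an associativity isomorphism satisfying the pentagon axiom; no unit object is required. Semigroup functors, left/right $\mathcal{S}$-module categories, $\mathcal{S}$-module functors and $\mathcal{S}$-module transformations are defined as for monoidal categories, dropping all unit data and unit axioms. Associators are suppressed below. $\mathcal{S}$ is a left and a right module category over itself; $\mathcal{S}\text{-Mod}(\mathcal{S},\mathcal{S})$ (resp. $\text{Mod-}\mathcal{S}(\mathcal{S},\mathcal{S})$) is the category of left (resp. right) $\mathcal{S}$-module endofunctors of $\mathcal{S}$ and module transformations, monoidal under composition. For $F\in\mathcal{S}$, $-\boxtimes F$ is a left and $F\boxtimes-$ a right $\mathcal{S}$-module endofunctor. An *adjunction* in $\mathcal{S}$ is a tuple $(F,F^{\diamond},\eta^{l},\eta^{r},\varepsilon^{l},\varepsilon^{r})$ with $F,F^{\diamond}\in\mathcal{S}$, left $\mathcal{S}$-module transformations $\eta^{l}:\mathrm{Id}\to -\boxtimes(F^{\diamond}\boxtimes F)$, $\varepsilon^{l}:-\boxtimes(F\boxtimes F^{\diamond})\to\mathrm{Id}$, and right $\mathcal{S}$-module transformations $\eta^{r}:\mathrm{Id}\to(F^{\diamond}\boxtimes F)\boxtimes-$, $\varepsilon^{r}:(F\boxtimes F^{\diamond})\boxtimes-\to\mathrm{Id}$, such that: (I) $(-\boxtimes F^{\diamond},-\boxtimes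 F,\eta^{l},\varepsilon^{l})$ is an adjunction (left adjoint listed first) in $\mathcal{S}\text{-Mod}(\mathcal{S},\mathcal{S})$; (II) $(F\boxtimes-,F^{\diamond}\boxtimes-,\eta^{r},\varepsilon^{r})$ is an adjunction in $\text{Mod-}\mathcal{S}(\mathcal{S},\mathcal{S})$; (III) $\varepsilon^{r}_{F}\circ\eta^{l}_{F}=\mathrm{id}_{F}$ and $\varepsilon^{l}_{F^{\diamond}}\circ\eta^{r}_{F^{\diamond}}=\mathrm{id}_{F^{\diamond}}$; (IV) for all $H,K\in\mathcal{S}$, $H\boxtimes\eta^{r}_{K}=\eta^{l}_{H}\boxtimes K$ and $H\boxtimes\varepsilon^{r}_{K}=\varepsilon^{l}_{H}\boxtimes K$. Then $F^{\diamond}$ is called a right dual of $F$ and $F$ a left dual of $F^{\diamond}$. $\mathcal{S}$ is *rigid* if every object has both a left and a right dual in this sense. Day convolution: for presheaves $P,Q\in[\mathcal{S}^{\mathrm{op}},\mathbf{Vec}_{\Bbbk}]$, $(P\circledast Q)(-)=\int^{H,K\in\mathcal{S}}\operatorname{Hom}_{\mathcal{S}}(-,H\boxtimes K)\otimes_{\Bbbk}P(H)\otimes_{\Bbbk}Q(K)$; this makes $[\mathcal{S}^{\mathrm{op}},\mathbf{Vec}_{\Bbbk}]$ a semigroup category. A semigroup category is called monoidal if it admits a unit object. *)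

theory Defs
  imports "HOL-Algebra.Module" "HOL-Library.Equipollence"
begin

section \<open>Linear categories\<close>

text \<open>
  A vector space over the field \<open>K\<close> is a \<^term>\<open>V\<close> with \<^term>\<open>module K V\<close>; the ring
  multiplication and the ring unit that the record type carries along are never used.
  Maps of vector spaces are compared on carriers only, hence the extensionality in \<open>lin_maps\<close>.
\<close>

definition linear_on ::
  "('k,'x) ring_scheme \<Rightarrow> ('k,'a,'y) module_scheme \<Rightarrow> ('k,'b,'z) module_scheme \<Rightarrow> ('a \<Rightarrow> 'b) \<Rightarrow> bool"
where
  "linear_on K V W h \<longleftrightarrow>
     h \<in> carrier V \<rightarrow> carrier W \<and>
     (\<forall>x\<in>carrier V. \<forall>y\<in>carrier V. h (x \<oplus>\<^bsub>V\<^esub> y) = h x \<oplus>\<^bsub>W\<^esub> h y) \<and>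
     (\<forall>c\<in>carrier K. \<forall>x\<in>carrier V. h (c \<odot>\<^bsub>V\<^esub> x) = c \<odot>\<^bsub>W\<^esub> h x)"

definition lin_maps ::
  "('k,'x) ring_scheme \<Rightarrow> ('k,'a,'y) module_scheme \<Rightarrow> ('k,'b,'z) module_scheme \<Rightarrow> ('a \<Rightarrow> 'b) set"
where
  "lin_maps K V W = {h \<in> extensional (carrier V). linear_on K V W h}"

text \<open>
  Arrows of a category have a unique domain and codomain. \<open>Hom C A B\<close> is the hom-space together
  with its vector space structure; \<open>g \<cdot>\<^bsub>C\<^esub> f\<close> means first \<open>f\<close>, then \<open>g\<close>.
\<close>

record ('k,'o,'m) lcat =
  Obj :: "'o set"
  Arr :: "'m set"
  Dom :: "'m \<Rightarrow> 'o"
  Cod :: "'m \<Rightarrow> 'o"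
  Ide :: "'o \<Rightarrow> 'm"
  Cmp :: "'m \<Rightarrow> 'm \<Rightarrow> 'm"  (infixr "\<cdot>\<index>" 75)
  Hom :: "'o \<Rightarrow> 'o \<Rightarrow> ('k,'m) module"

definition hom_set :: "('k,'o,'m,'y) lcat_scheme \<Rightarrow> 'o \<Rightarrow> 'o \<Rightarrow> 'm set" where
  "hom_set C A B = {f \<in> Arr C. Dom C f = A \<and> Cod C f = B}"

locale lin_category = field K
  for K :: "('k,'x) ring_scheme" and C :: "('k,'o,'m,'y) lcat_scheme" +
  assumes Dom_closed: "f \<in> Arr C \<Longrightarrow> Dom C f \<in> Obj C"
    and Cod_closed: "f \<in> Arr C \<Longrightarrow> Cod C f \<in> Obj C"
    and Hom_module: "\<lbrakk>A \<in> Obj C; B \<in> Obj C\<rbrakk> \<Longrightarrow> module K (Hom C A B)"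
    and Hom_carrier: "\<lbrakk>A \<in> Obj C; B \<in> Obj C\<rbrakk> \<Longrightarrow> carrier (Hom C A B) = hom_set C A B"
    and Ide_in_hom: "A \<in> Obj C \<Longrightarrow> Ide C A \<in> hom_set C A A"
    and Cmp_linear_right: "\<lbrakk>A \<in> Obj C; g \<in> hom_set C B D\<rbrakk> \<Longrightarrow>
          linear_on K (Hom C A B) (Hom C A D) (\<lambda>f. g \<cdot>\<^bsub>C\<^esub> f)"
    and Cmp_linear_left: "\<lbrakk>f \<in> hom_set C A B; D \<in> Obj C\<rbrakk> \<Longrightarrow>
          linear_on K (Hom C B D) (Hom C A D) (\<lambda>g. g \<cdot>\<^bsub>C\<^esub> f)"
    and Cmp_Ide_right: "f \<in> hom_set C A B \<Longrightarrow> f \<cdot>\<^bsub>C\<^esub> Ide C A = f"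
    and Cmp_Ide_left: "f \<in> hom_set C A B \<Longrightarrow> Ide C B \<cdot>\<^bsub>C\<^esub> f = f"
    and Cmp_assoc: "\<lbrakk>f \<in> hom_set C A B; g \<in> hom_set C B D; h \<in> hom_set C D E\<rbrakk> \<Longrightarrow>
          (h \<cdot>\<^bsub>C\<^esub> g) \<cdot>\<^bsub>C\<^esub> f = h \<cdot>\<^bsub>C\<^esub> (g \<cdot>\<^bsub>C\<^esub> f)"

definition inverse_arrs :: "('k,'o,'m,'y) lcat_scheme \<Rightarrow> 'm \<Rightarrow> 'm \<Rightarrow> bool" where
  "inverse_arrs C f g \<longleftrightarrow>
     f \<in> Arr C \<and> g \<in> hom_set C (Cod C f) (Dom C f) \<and>
     g \<cdot>\<^bsub>C\<^esub> f = Ide C (Dom C f) \<and> f \<cdot>\<^bsub>C\<^esub> g = Ide C (Cod C f)"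

definition iso_arr :: "('k,'o,'m,'y) lcat_scheme \<Rightarrow> 'm \<Rightarrow> bool" where
  "iso_arr C f \<longleftrightarrow> (\<exists>g. inverse_arrs C f g)"

definition inv_arr :: "('k,'o,'m,'y) lcat_scheme \<Rightarrow> 'm \<Rightarrow> 'm" where
  "inv_arr C f = (THE g. inverse_arrs C f g)"

definition isomorphic_objs :: "('k,'o,'m,'y) lcat_scheme \<Rightarrow> 'o \<Rightarrow> 'o \<Rightarrow> bool" where
  "isomorphic_objs C A B \<longleftrightarrow> (\<exists>f \<in> hom_set C A B. iso_arr C f)"

definition full_subcategory ::
  "('k,'o,'m,'y) lcat_scheme \<Rightarrow> 'o set \<Rightarrow> ('k,'o,'m) lcat" where
  "full_subcategory C X =
     \<lparr>Obj = Obj C \<inter> X, Arr = {f \<in> Arr C. Dom C f \<in> X \<and> Cod C f \<in> X},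
      Dom = Dom C, Cod = Cod C, Ide = Ide C, Cmp = Cmp C, Hom = Hom C\<rparr>"

definition op_cat :: "('k,'o,'m,'y) lcat_scheme \<Rightarrow> ('k,'o,'m) lcat" where
  "op_cat C = \<lparr>Obj = Obj C, Arr = Arr C, Dom = Cod C, Cod = Dom C, Ide = Ide C,
     Cmp = (\<lambda>g f. f \<cdot>\<^bsub>C\<^esub> g), Hom = (\<lambda>A B. Hom C B A)\<rparr>"

record ('o,'m,'p,'n) fctr =
  fobj :: "'o \<Rightarrow> 'p"
  farr :: "'m \<Rightarrow> 'n"

locale lin_functor = C: lin_category K C + D: lin_category K D
  for K :: "('k,'x) ring_scheme" and C :: "('k,'o,'m,'y) lcat_scheme"
    and D :: "('k,'p,'n,'z) lcat_scheme" +
  fixes F :: "('o,'m,'p,'n,'w) fctr_scheme"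
  assumes fobj_closed: "A \<in> Obj C \<Longrightarrow> fobj F A \<in> Obj D"
    and farr_linear: "\<lbrakk>A \<in> Obj C; B \<in> Obj C\<rbrakk> \<Longrightarrow>
          linear_on K (Hom C A B) (Hom D (fobj F A) (fobj F B)) (farr F)"
    and farr_Ide: "A \<in> Obj C \<Longrightarrow> farr F (Ide C A) = Ide D (fobj F A)"
    and farr_Cmp: "\<lbrakk>f \<in> hom_set C A B; g \<in> hom_set C B E\<rbrakk> \<Longrightarrow>
          farr F (g \<cdot>\<^bsub>C\<^esub> f) = farr F g \<cdot>\<^bsub>D\<^esub> farr F f"

definition fully_faithful ::
  "('k,'o,'m,'y) lcat_scheme \<Rightarrow> ('k,'p,'n,'z) lcat_scheme \<Rightarrow> ('o,'m,'p,'n,'w) fctr_scheme \<Rightarrow> bool"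
where
  "fully_faithful C D F \<longleftrightarrow>
     (\<forall>A\<in>Obj C. \<forall>B\<in>Obj C. bij_betw (farr F) (hom_set C A B) (hom_set D (fobj F A) (fobj F B)))"

definition id_functor :: "('o,'m,'o,'m) fctr" where
  "id_functor = \<lparr>fobj = (\<lambda>A. A), farr = (\<lambda>f. f)\<rparr>"

definition nat_trans ::
  "('k,'o,'m,'y) lcat_scheme \<Rightarrow> ('k,'p,'n,'z) lcat_scheme \<Rightarrow>
   ('o,'m,'p,'n,'w) fctr_scheme \<Rightarrow> ('o,'m,'p,'n,'w) fctr_scheme \<Rightarrow> ('o \<Rightarrow> 'n) set"
where
  "nat_trans C D F G =
     {t \<in> extensional (Obj C).
       (\<forall>A\<in>Obj C. t A \<in> hom_set D (fobj F A) (fobj G A)) \<and>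
       (\<forall>f\<in>Arr C. t (Cod C f) \<cdot>\<^bsub>D\<^esub> farr F f = farr G f \<cdot>\<^bsub>D\<^esub> t (Dom C f))}"

text \<open>
  In categories whose arrows are maps or transformations, an arrow records its source and target.
\<close>

datatype ('a,'t) marr = MArr (src: 'a) (tgt: 'a) (cpt: 't)

text \<open>
  The category with objects \<open>Ob\<close> (functors from \<open>C\<close> to \<open>D\<close>, possibly with additional structure),
  arrows \<open>F \<rightarrow> G\<close> the transformations in \<open>Tr F G\<close>, vertical composition and pointwise linear
  structure.
\<close>

definition trans_cat ::
  "('k,'o,'m,'y) lcat_scheme \<Rightarrow> ('k,'p,'n,'z) lcat_scheme \<Rightarrow> ('o,'m,'p,'n,'w) fctr_scheme set \<Rightarrow>
   (('o,'m,'p,'n,'w) fctr_scheme \<Rightarrow> ('o,'m,'p,'n,'w) fctr_scheme \<Rightarrow> ('o \<Rightarrow> 'n) set) \<Rightarrow>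
   ('k, ('o,'m,'p,'n,'w) fctr_scheme, (('o,'m,'p,'n,'w) fctr_scheme, 'o \<Rightarrow> 'n) marr) lcat"
where
  "trans_cat C D Ob Tr =
     \<lparr>Obj = Ob,
      Arr = {MArr F G t | F G t. F \<in> Ob \<and> G \<in> Ob \<and> t \<in> Tr F G},
      Dom = src,
      Cod = tgt,
      Ide = (\<lambda>F. MArr F F (\<lambda>A\<in>Obj C. Ide D (fobj F A))),
      Cmp = (\<lambda>s t. MArr (src t) (tgt s) (\<lambda>A\<in>Obj C. cpt s A \<cdot>\<^bsub>D\<^esub> cpt t A)),
      Hom = (\<lambda>F G.
        \<lparr>carrier = MArr F G ` Tr F G,
         mult = undefined,
         one = undefined,
         zero = MArr F G (\<lambda>A\<in>Obj C. \<zero>\<^bsub>Hom D (fobj F A) (fobj G A)\<^esub>),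
         add = (\<lambda>s t. MArr F G (\<lambda>A\<in>Obj C. cpt s A \<oplus>\<^bsub>Hom D (fobj F A) (fobj G A)\<^esub> cpt t A)),
         smult = (\<lambda>c t. MArr F G (\<lambda>A\<in>Obj C. c \<odot>\<^bsub>Hom D (fobj F A) (fobj G A)\<^esub> cpt t A))\<rparr>)\<rparr>"

definition fun_cat ::
  "('k,'x) ring_scheme \<Rightarrow> ('k,'o,'m,'y) lcat_scheme \<Rightarrow> ('k,'p,'n,'z) lcat_scheme \<Rightarrow>
   ('k, ('o,'m,'p,'n) fctr, (('o,'m,'p,'n) fctr, 'o \<Rightarrow> 'n) marr) lcat"
where
  "fun_cat K C D = trans_cat C D {F. lin_functor K C D F} (nat_trans C D)"


section \<open>Semigroup categories\<close>

text \<open>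
  \<open>\<box>\<close> is the tensor product of objects, \<open>\<diamondop>\<close> the tensor product of arrows and
  \<open>asc S A B C : (A \<box> B) \<box> C \<rightarrow> A \<box> (B \<box> C)\<close>.
\<close>

record ('k,'o,'m) sgcat = "('k,'o,'m) lcat" +
  tobj :: "'o \<Rightarrow> 'o \<Rightarrow> 'o"  (infixr "\<box>\<index>" 80)
  tarr :: "'m \<Rightarrow> 'm \<Rightarrow> 'm"  (infixr "\<diamondop>\<index>" 80)
  asc :: "'o \<Rightarrow> 'o \<Rightarrow> 'o \<Rightarrow> 'm"

locale semigroup_category = lin_category K S
  for K :: "('k,'x) ring_scheme" and S :: "('k,'o,'m,'y) sgcat_scheme" +
  assumes tobj_closed: "\<lbrakk>A \<in> Obj S; B \<in> Obj S\<rbrakk> \<Longrightarrow> A \<box>\<^bsub>S\<^esub> B \<in> Obj S"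
    and tarr_linear_right: "\<lbrakk>f \<in> hom_set S A A'; B \<in> Obj S; B' \<in> Obj S\<rbrakk> \<Longrightarrow>
          linear_on K (Hom S B B') (Hom S (A \<box>\<^bsub>S\<^esub> B) (A' \<box>\<^bsub>S\<^esub> B')) (\<lambda>g. f \<diamondop>\<^bsub>S\<^esub> g)"
    and tarr_linear_left: "\<lbrakk>A \<in> Obj S; A' \<in> Obj S; g \<in> hom_set S B B'\<rbrakk> \<Longrightarrow>
          linear_on K (Hom S A A') (Hom S (A \<box>\<^bsub>S\<^esub> B) (A' \<box>\<^bsub>S\<^esub> B')) (\<lambda>f. f \<diamondop>\<^bsub>S\<^esub> g)"
    and tarr_Ide: "\<lbrakk>A \<in> Obj S; B \<in> Obj S\<rbrakk> \<Longrightarrow> Ide S A \<diamondop>\<^bsub>S\<^esub> Ide S B = Ide S (A \<box>\<^bsub>S\<^esub> B)"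
    and tarr_Cmp:
      "\<lbrakk>f \<in> hom_set S A A'; f' \<in> hom_set S A' A''; g \<in> hom_set S B B'; g' \<in> hom_set S B' B''\<rbrakk> \<Longrightarrow>
          (f' \<cdot>\<^bsub>S\<^esub> f) \<diamondop>\<^bsub>S\<^esub> (g' \<cdot>\<^bsub>S\<^esub> g) = (f' \<diamondop>\<^bsub>S\<^esub> g') \<cdot>\<^bsub>S\<^esub> (f \<diamondop>\<^bsub>S\<^esub> g)"
    and asc_in_hom: "\<lbrakk>A \<in> Obj S; B \<in> Obj S; C \<in> Obj S\<rbrakk> \<Longrightarrow>
          asc S A B C \<in> hom_set S ((A \<box>\<^bsub>S\<^esub> B) \<box>\<^bsub>S\<^esub> C) (A \<box>\<^bsub>S\<^esub> (B \<box>\<^bsub>S\<^esub> C))"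
    and asc_iso: "\<lbrakk>A \<in> Obj S; B \<in> Obj S; C \<in> Obj S\<rbrakk> \<Longrightarrow> iso_arr S (asc S A B C)"
    and asc_natural: "\<lbrakk>f \<in> hom_set S A A'; g \<in> hom_set S B B'; h \<in> hom_set S C C'\<rbrakk> \<Longrightarrow>
          asc S A' B' C' \<cdot>\<^bsub>S\<^esub> ((f \<diamondop>\<^bsub>S\<^esub> g) \<diamondop>\<^bsub>S\<^esub> h) = (f \<diamondop>\<^bsub>S\<^esub> (g \<diamondop>\<^bsub>S\<^esub> h)) \<cdot>\<^bsub>S\<^esub> asc S A B C"
    and pentagon: "\<lbrakk>A \<in> Obj S; B \<in> Obj S; C \<in> Obj S; D \<in> Obj S\<rbrakk> \<Longrightarrow>
          asc S A B (C \<box>\<^bsub>S\<^esub> D) \<cdot>\<^bsub>S\<^esub> asc S (A \<box>\<^bsub>S\<^esub> B) C D =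
          (Ide S A \<diamondop>\<^bsub>S\<^esub> asc S B C D) \<cdot>\<^bsub>S\<^esub> asc S A (B \<box>\<^bsub>S\<^esub> C) D \<cdot>\<^bsub>S\<^esub> (asc S A B C \<diamondop>\<^bsub>S\<^esub> Ide S D)"

locale semigroup_functor =
  S: semigroup_category K S + T: semigroup_category K T + lin_functor K S T F
  for K :: "('k,'x) ring_scheme" and S :: "('k,'o,'m,'y) sgcat_scheme"
    and T :: "('k,'p,'n,'z) sgcat_scheme" and F :: "('o,'m,'p,'n,'w) fctr_scheme" +
  fixes J :: "'o \<Rightarrow> 'o \<Rightarrow> 'n"
  assumes J_in_hom: "\<lbrakk>A \<in> Obj S; B \<in> Obj S\<rbrakk> \<Longrightarrow>
          J A B \<in> hom_set T (fobj F A \<box>\<^bsub>T\<^esub> fobj F B) (fobj F (A \<box>\<^bsub>S\<^esub> B))"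
    and J_iso: "\<lbrakk>A \<in> Obj S; B \<in> Obj S\<rbrakk> \<Longrightarrow> iso_arr T (J A B)"
    and J_natural: "\<lbrakk>f \<in> hom_set S A A'; g \<in> hom_set S B B'\<rbrakk> \<Longrightarrow>
          J A' B' \<cdot>\<^bsub>T\<^esub> (farr F f \<diamondop>\<^bsub>T\<^esub> farr F g) = farr F (f \<diamondop>\<^bsub>S\<^esub> g) \<cdot>\<^bsub>T\<^esub> J A B"
    and J_asc: "\<lbrakk>A \<in> Obj S; B \<in> Obj S; C \<in> Obj S\<rbrakk> \<Longrightarrow>
          farr F (asc S A B C) \<cdot>\<^bsub>T\<^esub> J (A \<box>\<^bsub>S\<^esub> B) C \<cdot>\<^bsub>T\<^esub> (J A B \<diamondop>\<^bsub>T\<^esub> Ide T (fobj F C)) =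
          J A (B \<box>\<^bsub>S\<^esub> C) \<cdot>\<^bsub>T\<^esub> (Ide T (fobj F A) \<diamondop>\<^bsub>T\<^esub> J B C) \<cdot>\<^bsub>T\<^esub> asc T (fobj F A) (fobj F B) (fobj F C)"

definition is_unit_object :: "('k,'o,'m,'y) sgcat_scheme \<Rightarrow> 'o \<Rightarrow> bool" where
  "is_unit_object S I \<longleftrightarrow> I \<in> Obj S \<and>
     (\<exists>l r.
       (\<forall>A\<in>Obj S. l A \<in> hom_set S (I \<box>\<^bsub>S\<^esub> A) A \<and> iso_arr S (l A)) \<and>
       (\<forall>A\<in>Obj S. r A \<in> hom_set S (A \<box>\<^bsub>S\<^esub> I) A \<and> iso_arr S (r A)) \<and>
       (\<forall>f\<in>Arr S. l (Cod S f) \<cdot>\<^bsub>S\<^esub> (Ide S I \<diamondop>\<^bsub>S\<^esub> f) = f \<cdot>\<^bsub>S\<^esub> l (Dom S f)) \<and>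
       (\<forall>f\<in>Arr S. r (Cod S f) \<cdot>\<^bsub>S\<^esub> (f \<diamondop>\<^bsub>S\<^esub> Ide S I) = f \<cdot>\<^bsub>S\<^esub> r (Dom S f)) \<and>
       (\<forall>A\<in>Obj S. \<forall>B\<in>Obj S. (Ide S A \<diamondop>\<^bsub>S\<^esub> l B) \<cdot>\<^bsub>S\<^esub> asc S A I B = r A \<diamondop>\<^bsub>S\<^esub> Ide S B))"

definition monoidal_category :: "('k,'x) ring_scheme \<Rightarrow> ('k,'o,'m,'y) sgcat_scheme \<Rightarrow> bool" where
  "monoidal_category K S \<longleftrightarrow> semigroup_category K S \<and> (\<exists>I. is_unit_object S I)"


section \<open>Module endofunctors of a semigroup category\<close>

text \<open>
  The structure map of a left module endofunctor \<open>\<Phi>\<close> is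
  \<open>mstr \<Phi> X M : \<Phi> (X \<box> M) \<rightarrow> X \<box> \<Phi> M\<close>, that of a right module endofunctor is
  \<open>mstr \<Phi> M X : \<Phi> (M \<box> X) \<rightarrow> \<Phi> M \<box> X\<close>.
\<close>

record ('o,'m) modfun = "('o,'m,'o,'m) fctr" +
  mstr :: "'o \<Rightarrow> 'o \<Rightarrow> 'm"

locale left_module_functor = S: semigroup_category K S + lin_functor K S S \<Phi>
  for K :: "('k,'x) ring_scheme" and S :: "('k,'o,'m,'y) sgcat_scheme"
    and \<Phi> :: "('o,'m) modfun" +
  assumes mstr_in_hom: "\<lbrakk>X \<in> Obj S; M \<in> Obj S\<rbrakk> \<Longrightarrow>
          mstr \<Phi> X M \<in> hom_set S (fobj \<Phi> (X \<box>\<^bsub>S\<^esub> M)) (X \<box>\<^bsub>S\<^esub> fobj \<Phi> M)"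
    and mstr_iso: "\<lbrakk>X \<in> Obj S; M \<in> Obj S\<rbrakk> \<Longrightarrow> iso_arr S (mstr \<Phi> X M)"
    and mstr_natural: "\<lbrakk>f \<in> hom_set S X X'; g \<in> hom_set S M M'\<rbrakk> \<Longrightarrow>
          mstr \<Phi> X' M' \<cdot>\<^bsub>S\<^esub> farr \<Phi> (f \<diamondop>\<^bsub>S\<^esub> g) = (f \<diamondop>\<^bsub>S\<^esub> farr \<Phi> g) \<cdot>\<^bsub>S\<^esub> mstr \<Phi> X M"
    and mstr_asc: "\<lbrakk>X \<in> Obj S; Y \<in> Obj S; M \<in> Obj S\<rbrakk> \<Longrightarrow>
          asc S X Y (fobj \<Phi> M) \<cdot>\<^bsub>S\<^esub> mstr \<Phi> (X \<box>\<^bsub>S\<^esub> Y) M =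
          (Ide S X \<diamondop>\<^bsub>S\<^esub> mstr \<Phi> Y M) \<cdot>\<^bsub>S\<^esub> mstr \<Phi> X (Y \<box>\<^bsub>S\<^esub> M) \<cdot>\<^bsub>S\<^esub> farr \<Phi> (asc S X Y M)"

locale right_module_functor = S: semigroup_category K S + lin_functor K S S \<Phi>
  for K :: "('k,'x) ring_scheme" and S :: "('k,'o,'m,'y) sgcat_scheme"
    and \<Phi> :: "('o,'m) modfun" +
  assumes mstr_in_hom: "\<lbrakk>M \<in> Obj S; X \<in> Obj S\<rbrakk> \<Longrightarrow>
          mstr \<Phi> M X \<in> hom_set S (fobj \<Phi> (M \<box>\<^bsub>S\<^esub> X)) (fobj \<Phi> M \<box>\<^bsub>S\<^esub> X)"
    and mstr_iso: "\<lbrakk>M \<in> Obj S; X \<in> Obj S\<rbrakk> \<Longrightarrow> iso_arr S (mstr \<Phi> M X)"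
    and mstr_natural: "\<lbrakk>g \<in> hom_set S M M'; f \<in> hom_set S X X'\<rbrakk> \<Longrightarrow>
          mstr \<Phi> M' X' \<cdot>\<^bsub>S\<^esub> farr \<Phi> (g \<diamondop>\<^bsub>S\<^esub> f) = (farr \<Phi> g \<diamondop>\<^bsub>S\<^esub> f) \<cdot>\<^bsub>S\<^esub> mstr \<Phi> M X"
    and mstr_asc: "\<lbrakk>M \<in> Obj S; X \<in> Obj S; Y \<in> Obj S\<rbrakk> \<Longrightarrow>
          asc S (fobj \<Phi> M) X Y \<cdot>\<^bsub>S\<^esub> (mstr \<Phi> M X \<diamondop>\<^bsub>S\<^esub> Ide S Y) \<cdot>\<^bsub>S\<^esub> mstr \<Phi> (M \<box>\<^bsub>S\<^esub> X) Y =
          mstr \<Phi> M (X \<box>\<^bsub>S\<^esub> Y) \<cdot>\<^bsub>S\<^esub> farr \<Phi> (asc S M X Y)"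

definition lmod_trans ::
  "('k,'o,'m,'y) sgcat_scheme \<Rightarrow> ('o,'m) modfun \<Rightarrow> ('o,'m) modfun \<Rightarrow> ('o \<Rightarrow> 'm) set" where
  "lmod_trans S \<Phi> \<Psi> =
     {t \<in> nat_trans S S \<Phi> \<Psi>. \<forall>X\<in>Obj S. \<forall>M\<in>Obj S.
        mstr \<Psi> X M \<cdot>\<^bsub>S\<^esub> t (X \<box>\<^bsub>S\<^esub> M) = (Ide S X \<diamondop>\<^bsub>S\<^esub> t M) \<cdot>\<^bsub>S\<^esub> mstr \<Phi> X M}"

definition rmod_trans ::
  "('k,'o,'m,'y) sgcat_scheme \<Rightarrow> ('o,'m) modfun \<Rightarrow> ('o,'m) modfun \<Rightarrow> ('o \<Rightarrow> 'm) set" where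
  "rmod_trans S \<Phi> \<Psi> =
     {t \<in> nat_trans S S \<Phi> \<Psi>. \<forall>M\<in>Obj S. \<forall>X\<in>Obj S.
        mstr \<Psi> M X \<cdot>\<^bsub>S\<^esub> t (M \<box>\<^bsub>S\<^esub> X) = (t M \<diamondop>\<^bsub>S\<^esub> Ide S X) \<cdot>\<^bsub>S\<^esub> mstr \<Phi> M X}"

definition lmod_cat ::
  "('k,'x) ring_scheme \<Rightarrow> ('k,'o,'m,'y) sgcat_scheme \<Rightarrow>
   ('k, ('o,'m) modfun, (('o,'m) modfun, 'o \<Rightarrow> 'm) marr) lcat" where
  "lmod_cat K S = trans_cat S S {\<Phi>. left_module_functor K S \<Phi>} (lmod_trans S)"

definition rmod_cat ::
  "('k,'x) ring_scheme \<Rightarrow> ('k,'o,'m,'y) sgcat_scheme \<Rightarrow>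
   ('k, ('o,'m) modfun, (('o,'m) modfun, 'o \<Rightarrow> 'm) marr) lcat" where
  "rmod_cat K S = trans_cat S S {\<Phi>. right_module_functor K S \<Phi>} (rmod_trans S)"

text \<open>The identity is a left and a right module functor, with the same structure maps.\<close>

definition id_modfun :: "('k,'o,'m,'y) sgcat_scheme \<Rightarrow> ('o,'m) modfun" where
  "id_modfun S = \<lparr>fobj = (\<lambda>A. A), farr = (\<lambda>f. f), mstr = (\<lambda>A B. Ide S (A \<box>\<^bsub>S\<^esub> B))\<rparr>"

definition lmod_comp ::
  "('k,'o,'m,'y) sgcat_scheme \<Rightarrow> ('o,'m) modfun \<Rightarrow> ('o,'m) modfun \<Rightarrow> ('o,'m) modfun" where
  "lmod_comp S \<Phi> \<Psi> =
     \<lparr>fobj = fobj \<Phi> \<circ> fobj \<Psi>, farr = farr \<Phi> \<circ> farr \<Psi>,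
      mstr = (\<lambda>X M. mstr \<Phi> X (fobj \<Psi> M) \<cdot>\<^bsub>S\<^esub> farr \<Phi> (mstr \<Psi> X M))\<rparr>"

definition rmod_comp ::
  "('k,'o,'m,'y) sgcat_scheme \<Rightarrow> ('o,'m) modfun \<Rightarrow> ('o,'m) modfun \<Rightarrow> ('o,'m) modfun" where
  "rmod_comp S \<Phi> \<Psi> =
     \<lparr>fobj = fobj \<Phi> \<circ> fobj \<Psi>, farr = farr \<Phi> \<circ> farr \<Psi>,
      mstr = (\<lambda>M X. mstr \<Phi> (fobj \<Psi> M) X \<cdot>\<^bsub>S\<^esub> farr \<Phi> (mstr \<Psi> M X))\<rparr>"

text \<open>\<open>rtens S F\<close> is \<open>- \<box> F\<close>, a left module functor; \<open>ltens S F\<close> is \<open>F \<box> -\<close>, a right one.\<close>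

definition rtens :: "('k,'o,'m,'y) sgcat_scheme \<Rightarrow> 'o \<Rightarrow> ('o,'m) modfun" where
  "rtens S F = \<lparr>fobj = (\<lambda>X. X \<box>\<^bsub>S\<^esub> F), farr = (\<lambda>f. f \<diamondop>\<^bsub>S\<^esub> Ide S F), mstr = (\<lambda>X M. asc S X M F)\<rparr>"

definition ltens :: "('k,'o,'m,'y) sgcat_scheme \<Rightarrow> 'o \<Rightarrow> ('o,'m) modfun" where
  "ltens S F = \<lparr>fobj = (\<lambda>X. F \<box>\<^bsub>S\<^esub> X), farr = (\<lambda>f. Ide S F \<diamondop>\<^bsub>S\<^esub> f),
     mstr = (\<lambda>M X. inv_arr S (asc S F M X))\<rparr>"

definition rtens_functor ::
  "('k,'o,'m,'y) sgcat_scheme \<Rightarrow> ('o, 'm, ('o,'m) modfun, (('o,'m) modfun, 'o \<Rightarrow> 'm) marr) fctr" where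
  "rtens_functor S = \<lparr>fobj = rtens S,
     farr = (\<lambda>h. MArr (rtens S (Dom S h)) (rtens S (Cod S h)) (\<lambda>X\<in>Obj S. Ide S X \<diamondop>\<^bsub>S\<^esub> h))\<rparr>"

definition ltens_functor ::
  "('k,'o,'m,'y) sgcat_scheme \<Rightarrow> ('o, 'm, ('o,'m) modfun, (('o,'m) modfun, 'o \<Rightarrow> 'm) marr) fctr" where
  "ltens_functor S = \<lparr>fobj = ltens S,
     farr = (\<lambda>h. MArr (ltens S (Dom S h)) (ltens S (Cod S h)) (\<lambda>X\<in>Obj S. h \<diamondop>\<^bsub>S\<^esub> Ide S X))\<rparr>"


section \<open>Adjunctions and rigidity\<close>

text \<open>In the adjunctions below the left adjoint comes first; \<open>\<eta>\<close> is the unit, \<open>\<epsilon>\<close> the counit.\<close>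

definition lmod_adjunction ::
  "('k,'x) ring_scheme \<Rightarrow> ('k,'o,'m,'y) sgcat_scheme \<Rightarrow> ('o,'m) modfun \<Rightarrow> ('o,'m) modfun \<Rightarrow>
   ('o \<Rightarrow> 'm) \<Rightarrow> ('o \<Rightarrow> 'm) \<Rightarrow> bool" where
  "lmod_adjunction K S L R \<eta> \<epsilon> \<longleftrightarrow>
     L \<in> Obj (lmod_cat K S) \<and> R \<in> Obj (lmod_cat K S) \<and>
     \<eta> \<in> lmod_trans S (id_modfun S) (lmod_comp S R L) \<and>
     \<epsilon> \<in> lmod_trans S (lmod_comp S L R) (id_modfun S) \<and>
     (\<forall>X\<in>Obj S. \<epsilon> (fobj L X) \<cdot>\<^bsub>S\<^esub> farr L (\<eta> X) = Ide S (fobj L X)) \<and>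
     (\<forall>X\<in>Obj S. farr R (\<epsilon> X) \<cdot>\<^bsub>S\<^esub> \<eta> (fobj R X) = Ide S (fobj R X))"

definition rmod_adjunction ::
  "('k,'x) ring_scheme \<Rightarrow> ('k,'o,'m,'y) sgcat_scheme \<Rightarrow> ('o,'m) modfun \<Rightarrow> ('o,'m) modfun \<Rightarrow>
   ('o \<Rightarrow> 'm) \<Rightarrow> ('o \<Rightarrow> 'm) \<Rightarrow> bool" where
  "rmod_adjunction K S L R \<eta> \<epsilon> \<longleftrightarrow>
     L \<in> Obj (rmod_cat K S) \<and> R \<in> Obj (rmod_cat K S) \<and>
     \<eta> \<in> rmod_trans S (id_modfun S) (rmod_comp S R L) \<and>
     \<epsilon> \<in> rmod_trans S (rmod_comp S L R) (id_modfun S) \<and>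
     (\<forall>X\<in>Obj S. \<epsilon> (fobj L X) \<cdot>\<^bsub>S\<^esub> farr L (\<eta> X) = Ide S (fobj L X)) \<and>
     (\<forall>X\<in>Obj S. farr R (\<epsilon> X) \<cdot>\<^bsub>S\<^esub> \<eta> (fobj R X) = Ide S (fobj R X))"

text \<open>
  Associators are inserted wherever composites would not typecheck without them; for example
  \<open>\<eta>l\<close> has codomain \<open>- \<box> (G \<box> F)\<close>, whereas the unit of the first adjunction has codomain
  \<open>(- \<box> G) \<box> F\<close>.
\<close>

definition sg_adjunction ::
  "('k,'x) ring_scheme \<Rightarrow> ('k,'o,'m,'y) sgcat_scheme \<Rightarrow> 'o \<Rightarrow> 'o \<Rightarrow>
   ('o \<Rightarrow> 'm) \<Rightarrow> ('o \<Rightarrow> 'm) \<Rightarrow> ('o \<Rightarrow> 'm) \<Rightarrow> ('o \<Rightarrow> 'm) \<Rightarrow> bool" where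
  "sg_adjunction K S F G \<eta>l \<eta>r \<epsilon>l \<epsilon>r \<longleftrightarrow>
     F \<in> Obj S \<and> G \<in> Obj S \<and>
     \<eta>l \<in> lmod_trans S (id_modfun S) (rtens S (G \<box>\<^bsub>S\<^esub> F)) \<and>
     \<epsilon>l \<in> lmod_trans S (rtens S (F \<box>\<^bsub>S\<^esub> G)) (id_modfun S) \<and>
     \<eta>r \<in> rmod_trans S (id_modfun S) (ltens S (G \<box>\<^bsub>S\<^esub> F)) \<and>
     \<epsilon>r \<in> rmod_trans S (ltens S (F \<box>\<^bsub>S\<^esub> G)) (id_modfun S) \<and>
     lmod_adjunction K S (rtens S G) (rtens S F)
       (\<lambda>X\<in>Obj S. inv_arr S (asc S X G F) \<cdot>\<^bsub>S\<^esub> \<eta>l X) (\<lambda>X\<in>Obj S. \<epsilon>l X \<cdot>\<^bsub>S\<^esub> asc S X F G) \<and>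
     rmod_adjunction K S (ltens S F) (ltens S G)
       (\<lambda>X\<in>Obj S. asc S G F X \<cdot>\<^bsub>S\<^esub> \<eta>r X) (\<lambda>X\<in>Obj S. \<epsilon>r X \<cdot>\<^bsub>S\<^esub> inv_arr S (asc S F G X)) \<and>
     \<epsilon>r F \<cdot>\<^bsub>S\<^esub> inv_arr S (asc S F G F) \<cdot>\<^bsub>S\<^esub> \<eta>l F = Ide S F \<and>
     \<epsilon>l G \<cdot>\<^bsub>S\<^esub> asc S G F G \<cdot>\<^bsub>S\<^esub> \<eta>r G = Ide S G \<and>
     (\<forall>H\<in>Obj S. \<forall>L\<in>Obj S.
        Ide S H \<diamondop>\<^bsub>S\<^esub> \<eta>r L = asc S H (G \<box>\<^bsub>S\<^esub> F) L \<cdot>\<^bsub>S\<^esub> (\<eta>l H \<diamondop>\<^bsub>S\<^esub> Ide S L)) \<and>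
     (\<forall>H\<in>Obj S. \<forall>L\<in>Obj S.
        (Ide S H \<diamondop>\<^bsub>S\<^esub> \<epsilon>r L) \<cdot>\<^bsub>S\<^esub> asc S H (F \<box>\<^bsub>S\<^esub> G) L = \<epsilon>l H \<diamondop>\<^bsub>S\<^esub> Ide S L)"

definition is_right_dual :: "('k,'x) ring_scheme \<Rightarrow> ('k,'o,'m,'y) sgcat_scheme \<Rightarrow> 'o \<Rightarrow> 'o \<Rightarrow> bool" where
  "is_right_dual K S F G \<longleftrightarrow> (\<exists>\<eta>l \<eta>r \<epsilon>l \<epsilon>r. sg_adjunction K S F G \<eta>l \<eta>r \<epsilon>l \<epsilon>r)"

definition rigid_object :: "('k,'x) ring_scheme \<Rightarrow> ('k,'o,'m,'y) sgcat_scheme \<Rightarrow> 'o \<Rightarrow> bool" where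
  "rigid_object K S F \<longleftrightarrow>
     F \<in> Obj S \<and> (\<exists>G. is_right_dual K S F G) \<and> (\<exists>G. is_right_dual K S G F)"

definition rigid :: "('k,'x) ring_scheme \<Rightarrow> ('k,'o,'m,'y) sgcat_scheme \<Rightarrow> bool" where
  "rigid K S \<longleftrightarrow> (\<forall>F\<in>Obj S. rigid_object K S F)"

definition rigid_part :: "('k,'x) ring_scheme \<Rightarrow> ('k,'o,'m,'y) sgcat_scheme \<Rightarrow> ('k,'o,'m) lcat" where
  "rigid_part K S = full_subcategory S {F. rigid_object K S F}"


section \<open>Presheaves\<close>

text \<open>
  \<open>vec_cat K\<close> is the category of the \<open>K\<close>-vector spaces whose carrier is a subset of the type \<open>'v\<close>,
  which plays the role of the universe of small sets.
\<close>

type_synonym ('k,'v) linmap = "(('k,'v) module, 'v \<Rightarrow> 'v) marr"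
type_synonym ('k,'o,'m,'v) psh = "('o, 'm, ('k,'v) module, ('k,'v) linmap) fctr"
type_synonym ('k,'o,'m,'v) pshmap = "(('k,'o,'m,'v) psh, 'o \<Rightarrow> ('k,'v) linmap) marr"

definition vec_cat :: "('k,'x) ring_scheme \<Rightarrow> ('k, ('k,'v) module, ('k,'v) linmap) lcat" where
  "vec_cat K =
     \<lparr>Obj = {V. module K V},
      Arr = {MArr V W h | V W h. module K V \<and> module K W \<and> h \<in> lin_maps K V W},
      Dom = src,
      Cod = tgt,
      Ide = (\<lambda>V. MArr V V (\<lambda>x\<in>carrier V. x)),
      Cmp = (\<lambda>g f. MArr (src f) (tgt g) (\<lambda>x\<in>carrier (src f). cpt g (cpt f x))),
      Hom = (\<lambda>V W.
        \<lparr>carrier = MArr V W ` lin_maps K V W,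
         mult = undefined,
         one = undefined,
         zero = MArr V W (\<lambda>x\<in>carrier V. \<zero>\<^bsub>W\<^esub>),
         add = (\<lambda>g h. MArr V W (\<lambda>x\<in>carrier V. cpt g x \<oplus>\<^bsub>W\<^esub> cpt h x)),
         smult = (\<lambda>c h. MArr V W (\<lambda>x\<in>carrier V. c \<odot>\<^bsub>W\<^esub> cpt h x))\<rparr>)\<rparr>"

definition presheaf_cat ::
  "('k,'x) ring_scheme \<Rightarrow> ('k,'o,'m,'y) lcat_scheme \<Rightarrow> ('k, ('k,'o,'m,'v) psh, ('k,'o,'m,'v) pshmap) lcat"
where
  "presheaf_cat K S = fun_cat K (op_cat S) (vec_cat K)"

text \<open>
  Spaces of arrows or of transformations do not literally have their carrier in \<open>'v\<close>. When they
  are small enough to be injected into \<open>'v\<close>, they are replaced by a copy along a fixed injection.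
\<close>

definition venc :: "('k,'a) module \<Rightarrow> 'a \<Rightarrow> 'v" where
  "venc V = (SOME e. inj_on e (carrier V))"

definition vdec :: "('k,'a) module \<Rightarrow> 'v \<Rightarrow> 'a" where
  "vdec V = inv_into (carrier V) (venc V)"

definition vcopy :: "('k,'a) module \<Rightarrow> ('k,'v) module" where
  "vcopy V =
     \<lparr>carrier = venc V ` carrier V,
      mult = undefined,
      one = undefined,
      zero = venc V \<zero>\<^bsub>V\<^esub>,
      add = (\<lambda>x y. venc V (vdec V x \<oplus>\<^bsub>V\<^esub> vdec V y)),
      smult = (\<lambda>c x. venc V (c \<odot>\<^bsub>V\<^esub> vdec V x))\<rparr>"

text \<open>The presheaf \<open>X \<mapsto> Hom D (\<Phi> X) d\<close> on \<open>C\<close>, for a functor \<open>\<Phi>\<close> from \<open>C\<close> to \<open>D\<close>.\<close>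

definition hom_psh ::
  "('k,'o,'m,'y) lcat_scheme \<Rightarrow> ('k,'p,'n,'z) lcat_scheme \<Rightarrow> ('o,'m,'p,'n) fctr \<Rightarrow> 'p \<Rightarrow>
   ('k,'o,'m,'v) psh" where
  "hom_psh C D \<Phi> d =
     \<lparr>fobj = (\<lambda>X. vcopy (Hom D (fobj \<Phi> X) d)),
      farr = (\<lambda>f.
        let V = Hom D (fobj \<Phi> (Cod C f)) d; W = Hom D (fobj \<Phi> (Dom C f)) d
        in MArr (vcopy V) (vcopy W)
             (\<lambda>x\<in>carrier (vcopy V). venc W (vdec V x \<cdot>\<^bsub>D\<^esub> farr \<Phi> f)))\<rparr>"

definition yoneda_psh :: "('k,'o,'m,'y) lcat_scheme \<Rightarrow> 'o \<Rightarrow> ('k,'o,'m,'v) psh" where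
  "yoneda_psh C A = hom_psh C C id_functor A"

definition yoneda ::
  "('k,'o,'m,'y) lcat_scheme \<Rightarrow> ('o, 'm, ('k,'o,'m,'v) psh, ('k,'o,'m,'v) pshmap) fctr" where
  "yoneda C =
     \<lparr>fobj = yoneda_psh C,
      farr = (\<lambda>h. MArr (yoneda_psh C (Dom C h)) (yoneda_psh C (Cod C h))
        (\<lambda>X\<in>Obj C.
          let V = Hom C X (Dom C h); W = Hom C X (Cod C h)
          in MArr (vcopy V) (vcopy W) (\<lambda>x\<in>carrier (vcopy V). venc W (h \<cdot>\<^bsub>C\<^esub> vdec V x))))\<rparr>"


section \<open>Day convolution\<close>

text \<open>
  A cowedge from \<open>(H, L) \<mapsto> Hom(X, H \<box> L) \<otimes> P(H) \<otimes> Q(L)\<close> to a vector space \<open>V\<close>: by the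
  universal property of the tensor product of vector spaces, its component at \<open>(H, L)\<close> is a
  trilinear map \<open>w H L\<close>. The coend is the universal cowedge.
\<close>

definition day_cowedge ::
  "('k,'x) ring_scheme \<Rightarrow> ('k,'o,'m,'y) sgcat_scheme \<Rightarrow> ('k,'o,'m,'v) psh \<Rightarrow> ('k,'o,'m,'v) psh \<Rightarrow> 'o \<Rightarrow>
   ('k,'v) module \<Rightarrow> ('o \<Rightarrow> 'o \<Rightarrow> 'm \<Rightarrow> 'v \<Rightarrow> 'v \<Rightarrow> 'v) \<Rightarrow> bool"
where
  "day_cowedge K S P Q X V w \<longleftrightarrow>
     module K V \<and>
     (\<forall>H\<in>Obj S. \<forall>L\<in>Obj S.
       (\<forall>p\<in>carrier (fobj P H). \<forall>q\<in>carrier (fobj Q L).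
          linear_on K (Hom S X (H \<box>\<^bsub>S\<^esub> L)) V (\<lambda>f. w H L f p q)) \<and>
       (\<forall>f\<in>hom_set S X (H \<box>\<^bsub>S\<^esub> L). \<forall>q\<in>carrier (fobj Q L).
          linear_on K (fobj P H) V (\<lambda>p. w H L f p q)) \<and>
       (\<forall>f\<in>hom_set S X (H \<box>\<^bsub>S\<^esub> L). \<forall>p\<in>carrier (fobj P H).
          linear_on K (fobj Q L) V (\<lambda>q. w H L f p q))) \<and>
     (\<forall>h\<in>Arr S. \<forall>l\<in>Arr S. \<forall>f\<in>hom_set S X (Dom S h \<box>\<^bsub>S\<^esub> Dom S l).
       \<forall>p\<in>carrier (fobj P (Cod S h)). \<forall>q\<in>carrier (fobj Q (Cod S l)).
         w (Cod S h) (Cod S l) ((h \<diamondop>\<^bsub>S\<^esub> l) \<cdot>\<^bsub>S\<^esub> f) p q =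
         w (Dom S h) (Dom S l) f (cpt (farr P h) p) (cpt (farr Q l) q))"

definition day_factors ::
  "('k,'x) ring_scheme \<Rightarrow> ('k,'o,'m,'y) sgcat_scheme \<Rightarrow> ('k,'o,'m,'v) psh \<Rightarrow> ('k,'o,'m,'v) psh \<Rightarrow> 'o \<Rightarrow>
   ('k,'v) module \<Rightarrow> ('o \<Rightarrow> 'o \<Rightarrow> 'm \<Rightarrow> 'v \<Rightarrow> 'v \<Rightarrow> 'v) \<Rightarrow>
   ('k,'v) module \<Rightarrow> ('o \<Rightarrow> 'o \<Rightarrow> 'm \<Rightarrow> 'v \<Rightarrow> 'v \<Rightarrow> 'v) \<Rightarrow> ('v \<Rightarrow> 'v) \<Rightarrow> bool"
where
  "day_factors K S P Q X V w V' w' h \<longleftrightarrow>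
     h \<in> lin_maps K V V' \<and>
     (\<forall>H\<in>Obj S. \<forall>L\<in>Obj S. \<forall>f\<in>hom_set S X (H \<box>\<^bsub>S\<^esub> L).
        \<forall>p\<in>carrier (fobj P H). \<forall>q\<in>carrier (fobj Q L). h (w H L f p q) = w' H L f p q)"

definition day_coend ::
  "('k,'x) ring_scheme \<Rightarrow> ('k,'o,'m,'y) sgcat_scheme \<Rightarrow> ('k,'o,'m,'v) psh \<Rightarrow> ('k,'o,'m,'v) psh \<Rightarrow> 'o \<Rightarrow>
   ('k,'v) module \<times> ('o \<Rightarrow> 'o \<Rightarrow> 'm \<Rightarrow> 'v \<Rightarrow> 'v \<Rightarrow> 'v)"
where
  "day_coend K S P Q X =
     (SOME (V, w). day_cowedge K S P Q X V w \<and>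
        (\<forall>V' w'. day_cowedge K S P Q X V' w' \<longrightarrow> (\<exists>!h. day_factors K S P Q X V w V' w' h)))"

definition day_space ::
  "('k,'x) ring_scheme \<Rightarrow> ('k,'o,'m,'y) sgcat_scheme \<Rightarrow> ('k,'o,'m,'v) psh \<Rightarrow> ('k,'o,'m,'v) psh \<Rightarrow> 'o \<Rightarrow>
   ('k,'v) module"
where
  "day_space K S P Q X = fst (day_coend K S P Q X)"
definition day_in ::
  "('k,'x) ring_scheme \<Rightarrow> ('k,'o,'m,'y) sgcat_scheme \<Rightarrow> ('k,'o,'m,'v) psh \<Rightarrow> ('k,'o,'m,'v) psh \<Rightarrow> 'o \<Rightarrow>
   'o \<Rightarrow> 'o \<Rightarrow> 'm \<Rightarrow> 'v \<Rightarrow> 'v \<Rightarrow> 'v"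
where
  "day_in K S P Q X = snd (day_coend K S P Q X)"

text \<open>The linear map out of the coend induced by a cowedge.\<close>

definition day_lift ::
  "('k,'x) ring_scheme \<Rightarrow> ('k,'o,'m,'y) sgcat_scheme \<Rightarrow> ('k,'o,'m,'v) psh \<Rightarrow> ('k,'o,'m,'v) psh \<Rightarrow> 'o \<Rightarrow>
   ('k,'v) module \<Rightarrow> ('o \<Rightarrow> 'o \<Rightarrow> 'm \<Rightarrow> 'v \<Rightarrow> 'v \<Rightarrow> 'v) \<Rightarrow> ('k,'v) linmap"
where
  "day_lift K S P Q X V' w' =
     MArr (day_space K S P Q X) V'
       (THE h. day_factors K S P Q X (day_space K S P Q X) (day_in K S P Q X) V' w' h)"

definition day_obj ::
  "('k,'x) ring_scheme \<Rightarrow> ('k,'o,'m,'y) sgcat_scheme \<Rightarrow> ('k,'o,'m,'v) psh \<Rightarrow> ('k,'o,'m,'v) psh \<Rightarrow>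
   ('k,'o,'m,'v) psh"
where
  "day_obj K S P Q =
     \<lparr>fobj = day_space K S P Q,
      farr = (\<lambda>g. day_lift K S P Q (Cod S g) (day_space K S P Q (Dom S g))
        (\<lambda>H L f. day_in K S P Q (Dom S g) H L (f \<cdot>\<^bsub>S\<^esub> g)))\<rparr>"

definition day_arr ::
  "('k,'x) ring_scheme \<Rightarrow> ('k,'o,'m,'y) sgcat_scheme \<Rightarrow> ('k,'o,'m,'v) pshmap \<Rightarrow> ('k,'o,'m,'v) pshmap \<Rightarrow>
   ('k,'o,'m,'v) pshmap"
where
  "day_arr K S s t =
     MArr (day_obj K S (src s) (src t)) (day_obj K S (tgt s) (tgt t))
       (\<lambda>X\<in>Obj S. day_lift K S (src s) (src t) X (day_space K S (tgt s) (tgt t) X)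
          (\<lambda>H L f p q. day_in K S (tgt s) (tgt t) X H L f (cpt (cpt s H) p) (cpt (cpt t L) q)))"

text \<open>
  The canonical associator sends the class of \<open>(f : X \<rightarrow> H \<box> L, u, r)\<close>, with \<open>u\<close> the class of
  \<open>(g : H \<rightarrow> A \<box> B, p, q)\<close>, to the class of
  \<open>(asc A B L \<cdot> (g \<diamondop> L) \<cdot> f : X \<rightarrow> A \<box> (B \<box> L), p, v)\<close>, with \<open>v\<close> the class of
  \<open>(id : B \<box> L \<rightarrow> B \<box> L, q, r)\<close>.
\<close>

definition day_asc ::
  "('k,'x) ring_scheme \<Rightarrow> ('k,'o,'m,'y) sgcat_scheme \<Rightarrow> ('k,'o,'m,'v) psh \<Rightarrow> ('k,'o,'m,'v) psh \<Rightarrow>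
   ('k,'o,'m,'v) psh \<Rightarrow> ('k,'o,'m,'v) pshmap"
where
  "day_asc K S P Q R =
     (let PQ = day_obj K S P Q; QR = day_obj K S Q R in
      MArr (day_obj K S PQ R) (day_obj K S P QR)
        (\<lambda>X\<in>Obj S. day_lift K S PQ R X (day_space K S P QR X)
          (\<lambda>H L f u r.
            cpt (day_lift K S P Q H (day_space K S P QR X)
              (\<lambda>A B g p q. day_in K S P QR X A (B \<box>\<^bsub>S\<^esub> L)
                 (asc S A B L \<cdot>\<^bsub>S\<^esub> (g \<diamondop>\<^bsub>S\<^esub> Ide S L) \<cdot>\<^bsub>S\<^esub> f) p
                 (day_in K S Q R (B \<box>\<^bsub>S\<^esub> L) B L (Ide S (B \<box>\<^bsub>S\<^esub> L)) q r))) u)))"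

definition day_cat ::
  "('k,'x) ring_scheme \<Rightarrow> ('k,'o,'m,'y) sgcat_scheme \<Rightarrow> ('k, ('k,'o,'m,'v) psh, ('k,'o,'m,'v) pshmap) sgcat"
where
  "day_cat K S = lcat.extend (presheaf_cat K S) (sgcat.fields (day_obj K S) (day_arr K S) (day_asc K S))"

text \<open>
  The canonical comparison from the convolution of the presheaves of \<open>F\<close> and \<open>G\<close> to the presheaf
  of \<open>F \<box> G\<close> sends the class of \<open>(f : X \<rightarrow> H \<box> L, a : H \<rightarrow> F, b : L \<rightarrow> G)\<close> to \<open>(a \<diamondop> b) \<cdot> f\<close>.
\<close>

definition yoneda_str ::
  "('k,'x) ring_scheme \<Rightarrow> ('k,'o,'m,'y) sgcat_scheme \<Rightarrow> 'o \<Rightarrow> 'o \<Rightarrow> ('k,'o,'m,'v) pshmap"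
where
  "yoneda_str K S F G =
     MArr (day_obj K S (yoneda_psh S F) (yoneda_psh S G)) (yoneda_psh S (F \<box>\<^bsub>S\<^esub> G))
       (\<lambda>X\<in>Obj S. day_lift K S (yoneda_psh S F) (yoneda_psh S G) X (fobj (yoneda_psh S (F \<box>\<^bsub>S\<^esub> G)) X)
          (\<lambda>H L f a b. venc (Hom S X (F \<box>\<^bsub>S\<^esub> G))
             ((vdec (Hom S H F) a \<diamondop>\<^bsub>S\<^esub> vdec (Hom S L G) b) \<cdot>\<^bsub>S\<^esub> f)))"

definition left_unit_psh ::
  "('k,'x) ring_scheme \<Rightarrow> ('k,'o,'m,'y) sgcat_scheme \<Rightarrow> ('k,'o,'m,'v) psh" where
  "left_unit_psh K S = hom_psh S (lmod_cat K S) (rtens_functor S) (id_modfun S)"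

definition right_unit_psh ::
  "('k,'x) ring_scheme \<Rightarrow> ('k,'o,'m,'y) sgcat_scheme \<Rightarrow> ('k,'o,'m,'v) psh" where
  "right_unit_psh K S = hom_psh S (rmod_cat K S) (ltens_functor S) (id_modfun S)"

end

theory Submission
  imports Defs
begin

text \<open>
  A dual pair \<open>(Z, Y)\<close> makes \<open>Y\<close> a retract of \<open>(Y \<box> Z) \<box> Y\<close>, so parallel arrows into \<open>Y\<close> that agree after
  tensoring with \<open>Y \<box> Z\<close> are equal. Over a rigid \<open>S\<close> each left module transformation \<open>t : - \<box> F \<rightarrow> Id\<close>
  therefore has a unique partner, a right module transformation \<open>s : F \<box> - \<rightarrow> Id\<close> with \<open>H \<box> s L = t H \<box> L\<close>,
  and conversely; this identifies the two candidate units.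

  The unitors are \<open>p \<otimes> t \<mapsto> P (t A) p\<close> and \<open>t \<otimes> p \<mapsto> P (s A) p\<close> for \<open>p\<close> in \<open>P A\<close>. Rigidity provides, for
  each \<open>X\<close>, a transformation \<open>\<epsilon> : - \<box> M \<rightarrow> Id\<close> whose component at \<open>X\<close> has a section \<open>h\<close>, and
  \<open>p \<mapsto> P h (p \<otimes> \<epsilon>)\<close> is then the inverse of the right unitor at \<open>X\<close>.

  Maps out of a Day convolution are determined by their values on the generators \<open>p \<otimes> q\<close>, and on
  generators each identity between such maps becomes the same identity in \<open>S\<close>. Finally, a presheaf
  map \<open>V \<rightarrow> 1\<close> induces a left and a right module transformation to the identity, and an element of
  \<open>T W\<close> turns transformations from the identity to \<open>- \<box> W\<close> and \<open>W \<box> -\<close> into transformations to \<open>- \<circledast> T\<close>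
  and \<open>T \<circledast> -\<close>; in this way a dual pair \<open>(F, G)\<close> in \<open>S\<close> yields one of the representable presheaves.
\<close>

section \<open>Linear maps and linear categories\<close>

text \<open>The obstacle is the missing unit object: the unit and counit of a dual pair cannot be
  arrows of \<open>S\<close>, only pairs of module transformations, one on each side, and passing
  from one side to the other costs rigidity. A second obstacle is size. The elements of the unit
  presheaf are whole transformations and those of a convolution are formal sums, yet all of them
  have to live in the one type \<open>'v\<close>. The smallness hypothesis provides the room: a
  power set can hold the graphs of transformations, and the summand of natural numbers makes
  \<open>'v\<close> infinite, so that pairs and lists of its elements can be coded in it again.
  Since the coends are picked by choice, a convolution is accessible only through its universal
  property. Each structure map is therefore first produced from its intended values on tensors and
  then identified with its definition. Many right-handed statements are obtained as left-handed ones
  over the semigroup category with reversed tensor product.\<close>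

lemma linear_on_closed: "linear_on K V W h \<Longrightarrow> x \<in> carrier V \<Longrightarrow> h x \<in> carrier W"
  by (auto simp: linear_on_def)

lemma linear_on_add: "linear_on K V W h \<Longrightarrow> x \<in> carrier V \<Longrightarrow> y \<in> carrier V \<Longrightarrow>
    h (x \<oplus>\<^bsub>V\<^esub> y) = h x \<oplus>\<^bsub>W\<^esub> h y"
  by (auto simp: linear_on_def)

lemma linear_on_smult: "linear_on K V W h \<Longrightarrow> c \<in> carrier K \<Longrightarrow> x \<in> carrier V \<Longrightarrow>
    h (c \<odot>\<^bsub>V\<^esub> x) = c \<odot>\<^bsub>W\<^esub> h x"
  by (auto simp: linear_on_def)

lemma linear_onI:
  assumes "\<And>x. x \<in> carrier V \<Longrightarrow> h x \<in> carrier W"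
    and "\<And>x y. x \<in> carrier V \<Longrightarrow> y \<in> carrier V \<Longrightarrow> h (x \<oplus>\<^bsub>V\<^esub> y) = h x \<oplus>\<^bsub>W\<^esub> h y"
    and "\<And>c x. c \<in> carrier K \<Longrightarrow> x \<in> carrier V \<Longrightarrow> h (c \<odot>\<^bsub>V\<^esub> x) = c \<odot>\<^bsub>W\<^esub> h x"
  shows "linear_on K V W h"
  using assms by (auto simp: linear_on_def)

lemma module_add_closed: "module K V \<Longrightarrow> x \<in> carrier V \<Longrightarrow> y \<in> carrier V \<Longrightarrow> x \<oplus>\<^bsub>V\<^esub> y \<in> carrier V"
  by (meson abelian_monoid.a_closed abelian_group.axioms(1) module.axioms(2))

lemma module_smult_closed: "module K V \<Longrightarrow> c \<in> carrier K \<Longrightarrow> x \<in> carrier V \<Longrightarrow> c \<odot>\<^bsub>V\<^esub> x \<in> carrier V"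
  by (rule module.smult_closed)

lemma module_zero_closed: "module K V \<Longrightarrow> \<zero>\<^bsub>V\<^esub> \<in> carrier V"
  by (meson abelian_monoid.zero_closed abelian_group.axioms(1) module.axioms(2))

text \<open>Maps of vector spaces matter on carriers only, and the carrier is closed under sums and
  multiples; so linearity passes between a map and its restriction, which is the form stored in
  arrows.\<close>

lemma linear_on_cong:
  assumes "module K V" "\<And>x. x \<in> carrier V \<Longrightarrow> h x = h' x" "linear_on K V W h'"
  shows "linear_on K V W h"
  using assms by (auto simp: linear_on_def module_add_closed module_smult_closed)

lemma linear_on_zero:
  assumes "module K V" "module K W" "linear_on K V W h"
  shows "h \<zero>\<^bsub>V\<^esub> = \<zero>\<^bsub>W\<^esub>"
proof -
  interpret V: module K V by fact
  interpret W: module K W by fact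
  \<comment> \<open>The definition of linearity has no clause for zero; zero is reached as its own
    multiple by the zero scalar.\<close>
  have "h (\<zero>\<^bsub>K\<^esub> \<odot>\<^bsub>V\<^esub> \<zero>\<^bsub>V\<^esub>) = \<zero>\<^bsub>K\<^esub> \<odot>\<^bsub>W\<^esub> h \<zero>\<^bsub>V\<^esub>"
    by (rule linear_on_smult[OF assms(3)]) auto
  then show ?thesis
    using linear_on_closed[OF assms(3) V.M.zero_closed] by simp
qed

lemma linear_on_comp:
  assumes "linear_on K U V g" "linear_on K V W h"
  shows "linear_on K U W (\<lambda>x. h (g x))"
  using assms unfolding linear_on_def by (auto simp: Pi_def)

lemma linear_on_sum:
  assumes "module K V" "module K W" "linear_on K V W g" "linear_on K V W h"
  shows "linear_on K V W (\<lambda>x. g x \<oplus>\<^bsub>W\<^esub> h x)"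
proof -
  interpret W: module K W by fact
  note c = linear_on_closed[OF assms(3)] linear_on_closed[OF assms(4)]
  show ?thesis
    by (rule linear_onI)
      (simp_all add: c W.M.a_ac W.smult_r_distr linear_on_add[OF assms(3)] linear_on_add[OF assms(4)]
        linear_on_smult[OF assms(3)] linear_on_smult[OF assms(4)])
qed

lemma linear_on_scale:
  assumes "module K V" "module K W" "linear_on K V W h" "c \<in> carrier K"
  shows "linear_on K V W (\<lambda>x. c \<odot>\<^bsub>W\<^esub> h x)"
proof -
  interpret W: module K W by fact
  note c = linear_on_closed[OF assms(3)]
  show ?thesis
    by (rule linear_onI)
      (simp_all add: c assms(4) W.smult_r_distr linear_on_add[OF assms(3)]
        linear_on_smult[OF assms(3)] W.smult_assoc1[symmetric] W.R.m_comm)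
qed

lemma linear_on_zero_map:
  assumes "module K W"
  shows "linear_on K V W (\<lambda>x. \<zero>\<^bsub>W\<^esub>)"
proof -
  interpret W: module K W by fact
  show ?thesis by (rule linear_onI) simp_all
qed

lemma linear_on_id: "linear_on K V V (\<lambda>x. x)"
  by (rule linear_onI) simp_all

text \<open>Additive inverses come for free from scalar multiplication by \<open>\<ominus>\<one>\<close>.\<close>

lemma module_by_scalars:
  assumes "cring K"
    and add: "\<And>x y. \<lbrakk>x \<in> carrier V; y \<in> carrier V\<rbrakk> \<Longrightarrow> x \<oplus>\<^bsub>V\<^esub> y \<in> carrier V"
    and zero: "\<zero>\<^bsub>V\<^esub> \<in> carrier V"
    and assoc: "\<And>x y z. \<lbrakk>x \<in> carrier V; y \<in> carrier V; z \<in> carrier V\<rbrakk> \<Longrightarrow>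
        (x \<oplus>\<^bsub>V\<^esub> y) \<oplus>\<^bsub>V\<^esub> z = x \<oplus>\<^bsub>V\<^esub> (y \<oplus>\<^bsub>V\<^esub> z)"
    and comm: "\<And>x y. \<lbrakk>x \<in> carrier V; y \<in> carrier V\<rbrakk> \<Longrightarrow> x \<oplus>\<^bsub>V\<^esub> y = y \<oplus>\<^bsub>V\<^esub> x"
    and l_zero: "\<And>x. x \<in> carrier V \<Longrightarrow> \<zero>\<^bsub>V\<^esub> \<oplus>\<^bsub>V\<^esub> x = x"
    and smult: "\<And>a x. \<lbrakk>a \<in> carrier K; x \<in> carrier V\<rbrakk> \<Longrightarrow> a \<odot>\<^bsub>V\<^esub> x \<in> carrier V"
    and l_distr: "\<And>a b x. \<lbrakk>a \<in> carrier K; b \<in> carrier K; x \<in> carrier V\<rbrakk> \<Longrightarrow>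
        (a \<oplus>\<^bsub>K\<^esub> b) \<odot>\<^bsub>V\<^esub> x = a \<odot>\<^bsub>V\<^esub> x \<oplus>\<^bsub>V\<^esub> b \<odot>\<^bsub>V\<^esub> x"
    and r_distr: "\<And>a x y. \<lbrakk>a \<in> carrier K; x \<in> carrier V; y \<in> carrier V\<rbrakk> \<Longrightarrow>
        a \<odot>\<^bsub>V\<^esub> (x \<oplus>\<^bsub>V\<^esub> y) = a \<odot>\<^bsub>V\<^esub> x \<oplus>\<^bsub>V\<^esub> a \<odot>\<^bsub>V\<^esub> y"
    and assoc1: "\<And>a b x. \<lbrakk>a \<in> carrier K; b \<in> carrier K; x \<in> carrier V\<rbrakk> \<Longrightarrow>
        (a \<otimes>\<^bsub>K\<^esub> b) \<odot>\<^bsub>V\<^esub> x = a \<odot>\<^bsub>V\<^esub> (b \<odot>\<^bsub>V\<^esub> x)"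
    and one: "\<And>x. x \<in> carrier V \<Longrightarrow> \<one>\<^bsub>K\<^esub> \<odot>\<^bsub>V\<^esub> x = x"
    and zero_smult: "\<And>x. x \<in> carrier V \<Longrightarrow> \<zero>\<^bsub>K\<^esub> \<odot>\<^bsub>V\<^esub> x = \<zero>\<^bsub>V\<^esub>"
  shows "module K V"
proof (rule moduleI)
  interpret K: cring K by fact
  show "abelian_group V"
  proof (rule abelian_groupI)
    fix x assume x: "x \<in> carrier V"
    have "(\<ominus>\<^bsub>K\<^esub> \<one>\<^bsub>K\<^esub>) \<odot>\<^bsub>V\<^esub> x \<oplus>\<^bsub>V\<^esub> \<one>\<^bsub>K\<^esub> \<odot>\<^bsub>V\<^esub> x = \<zero>\<^bsub>V\<^esub>"
      using l_distr[of "\<ominus>\<^bsub>K\<^esub> \<one>\<^bsub>K\<^esub>" "\<one>\<^bsub>K\<^esub>" x] x by (simp add: K.l_neg zero_smult)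
    then show "\<exists>y\<in>carrier V. y \<oplus>\<^bsub>V\<^esub> x = \<zero>\<^bsub>V\<^esub>"
      using x by (intro bexI[of _ "(\<ominus>\<^bsub>K\<^esub> \<one>\<^bsub>K\<^esub>) \<odot>\<^bsub>V\<^esub> x"]) (simp_all add: one smult)
  qed (auto simp: add zero assoc l_zero intro: comm)
qed (use assms in auto)

lemma lin_mapsD:
  assumes "h \<in> lin_maps K V W"
  shows "linear_on K V W h" "h \<in> extensional (carrier V)"
  using assms by (auto simp: lin_maps_def)

lemma restrict_lin_maps:
  "module K V \<Longrightarrow> linear_on K V W h \<Longrightarrow> restrict h (carrier V) \<in> lin_maps K V W"
  unfolding lin_maps_def by (auto intro: linear_on_cong)

section \<open>Arrow calculus and inverses in a linear category\<close>

notation (in lin_category) C (structure)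

context lin_category
begin

lemma cring_K: "cring K"
  by (rule is_cring)

lemma hom_setD:
  assumes "f \<in> hom_set C A B"
  shows "f \<in> Arr C" "Dom C f = A" "Cod C f = B"
  using assms by (auto simp: hom_set_def)

lemma Dom_Obj [simp]: "f \<in> Arr C \<Longrightarrow> Dom C f \<in> Obj C"
  and Cod_Obj [simp]: "f \<in> Arr C \<Longrightarrow> Cod C f \<in> Obj C"
  by (rule Dom_closed Cod_closed; assumption)+

lemma Ide_Arr [simp]:
  assumes "A \<in> Obj C"
  shows "Ide C A \<in> Arr C" "Dom C (Ide C A) = A" "Cod C (Ide C A) = A"
  using Ide_in_hom[OF assms] by (auto simp: hom_set_def)

text \<open>The typing of composites is not an axiom of its own: it is read off from the linearity
  of post-composition, whose values lie in the target hom-space.\<close>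

lemma Cmp_Arr [simp]:
  assumes "f \<in> Arr C" "g \<in> Arr C" "Dom C g = Cod C f"
  shows "g \<cdot> f \<in> Arr C" "Dom C (g \<cdot> f) = Dom C f" "Cod C (g \<cdot> f) = Cod C g"
proof -
  have "g \<in> hom_set C (Cod C f) (Cod C g)" "f \<in> hom_set C (Dom C f) (Cod C f)"
    using assms by (auto simp: hom_set_def)
  then have "g \<cdot> f \<in> hom_set C (Dom C f) (Cod C g)"
    using linear_on_closed[OF Cmp_linear_right[of "Dom C f" g "Cod C f" "Cod C g"], of f] assms
    by (simp add: Hom_carrier)
  then show "g \<cdot> f \<in> Arr C" "Dom C (g \<cdot> f) = Dom C f" "Cod C (g \<cdot> f) = Cod C g"
    by (auto simp: hom_set_def)
qed

lemma Ide_left [simp]: "f \<in> Arr C \<Longrightarrow> Cod C f = B \<Longrightarrow> Ide C B \<cdot> f = f"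
  using Cmp_Ide_left[of f "Dom C f" B] by (simp add: hom_set_def)

lemma Ide_right [simp]: "f \<in> Arr C \<Longrightarrow> Dom C f = A \<Longrightarrow> f \<cdot> Ide C A = f"
  using Cmp_Ide_right[of f A "Cod C f"] by (simp add: hom_set_def)

lemma Cmp_assoc_Arr [simp]:
  assumes "f \<in> Arr C" "g \<in> Arr C" "h \<in> Arr C" "Dom C g = Cod C f" "Dom C h = Cod C g"
  shows "(h \<cdot> g) \<cdot> f = h \<cdot> (g \<cdot> f)"
  by (rule Cmp_assoc[of f "Dom C f" "Cod C f" g "Cod C g" h "Cod C h"])
    (use assms in \<open>simp_all add: hom_set_def\<close>)

lemma Hom_Arr:
  assumes "A \<in> Obj C" "B \<in> Obj C" "f \<in> carrier (Hom C A B)"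
  shows "f \<in> Arr C" "Dom C f = A" "Cod C f = B"
  using assms Hom_carrier by (auto simp: hom_set_def)

lemma Hom_mem:
  assumes "f \<in> Arr C" "Dom C f = A" "Cod C f = B"
  shows "f \<in> carrier (Hom C A B)"
  using assms Hom_carrier[of A B] by (auto simp: hom_set_def)

lemma Cmp_lin_right:
  assumes "A \<in> Obj C" "g \<in> Arr C"
  shows "linear_on K (Hom C A (Dom C g)) (Hom C A (Cod C g)) (\<lambda>f. g \<cdot> f)"
  using assms by (intro Cmp_linear_right) (auto simp: hom_set_def)

lemma Cmp_lin_left:
  assumes "D \<in> Obj C" "f \<in> Arr C"
  shows "linear_on K (Hom C (Cod C f) D) (Hom C (Dom C f) D) (\<lambda>g. g \<cdot> f)"
  using assms by (intro Cmp_linear_left) (auto simp: hom_set_def)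

lemma Hom_add_Arr:
  assumes "f \<in> Arr C" "g \<in> Arr C" "Dom C f = A" "Cod C f = B" "Dom C g = A" "Cod C g = B"
  shows "f \<oplus>\<^bsub>Hom C A B\<^esub> g \<in> Arr C" "Dom C (f \<oplus>\<^bsub>Hom C A B\<^esub> g) = A" "Cod C (f \<oplus>\<^bsub>Hom C A B\<^esub> g) = B"
proof -
  have AB: "A \<in> Obj C" "B \<in> Obj C" using assms by auto
  have "f \<oplus>\<^bsub>Hom C A B\<^esub> g \<in> carrier (Hom C A B)"
    by (rule module_add_closed[OF Hom_module[OF AB]]) (use assms in \<open>auto intro: Hom_mem\<close>)
  from Hom_Arr[OF AB this] show "f \<oplus>\<^bsub>Hom C A B\<^esub> g \<in> Arr C" "Dom C (f \<oplus>\<^bsub>Hom C A B\<^esub> g) = A"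
    "Cod C (f \<oplus>\<^bsub>Hom C A B\<^esub> g) = B" .
qed

lemma Hom_smult_Arr:
  assumes "c \<in> carrier K" "f \<in> Arr C" "Dom C f = A" "Cod C f = B"
  shows "c \<odot>\<^bsub>Hom C A B\<^esub> f \<in> Arr C" "Dom C (c \<odot>\<^bsub>Hom C A B\<^esub> f) = A" "Cod C (c \<odot>\<^bsub>Hom C A B\<^esub> f) = B"
proof -
  have AB: "A \<in> Obj C" "B \<in> Obj C" using assms by auto
  have "c \<odot>\<^bsub>Hom C A B\<^esub> f \<in> carrier (Hom C A B)"
    by (rule module_smult_closed[OF Hom_module[OF AB]]) (use assms in \<open>auto intro: Hom_mem\<close>)
  from Hom_Arr[OF AB this] show "c \<odot>\<^bsub>Hom C A B\<^esub> f \<in> Arr C" "Dom C (c \<odot>\<^bsub>Hom C A B\<^esub> f) = A"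
    "Cod C (c \<odot>\<^bsub>Hom C A B\<^esub> f) = B" .
qed

lemma inverse_arrs_unique:
  assumes "inverse_arrs C f g" "inverse_arrs C f g'"
  shows "g = g'"
proof -
  note a = assms[unfolded inverse_arrs_def hom_set_def]
  have "g = g \<cdot> (f \<cdot> g')" using a by simp
  also have "\<dots> = (g \<cdot> f) \<cdot> g'" using a by (subst Cmp_assoc_Arr) auto
  also have "\<dots> = g'" using a by simp
  finally show ?thesis .
qed

lemma inv_arr_inverse: "iso_arr C f \<Longrightarrow> inverse_arrs C f (inv_arr C f)"
  unfolding inv_arr_def iso_arr_def by (metis inverse_arrs_unique theI)

lemma inv_arrI: "inverse_arrs C f g \<Longrightarrow> inv_arr C f = g"
  using inv_arr_inverse inverse_arrs_unique iso_arr_def by metis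

lemma inv_arr_Arr [simp]:
  assumes "iso_arr C f"
  shows "inv_arr C f \<in> Arr C" "Dom C (inv_arr C f) = Cod C f" "Cod C (inv_arr C f) = Dom C f"
    "inv_arr C f \<cdot> f = Ide C (Dom C f)" "f \<cdot> inv_arr C f = Ide C (Cod C f)"
  using inv_arr_inverse[OF assms] by (auto simp: inverse_arrs_def hom_set_def)

lemma iso_Arr: "iso_arr C f \<Longrightarrow> f \<in> Arr C"
  by (auto simp: iso_arr_def inverse_arrs_def)

text \<open>Composites are normalised to the right, so an arrow usually meets its inverse in front
  of a further arrow \<open>h\<close>; these are the cancellation laws for that position.\<close>

lemma inv_arr_assoc [simp]:
  assumes "iso_arr C f"
  shows "h \<in> Arr C \<Longrightarrow> Cod C h = Dom C f \<Longrightarrow> inv_arr C f \<cdot> f \<cdot> h = h"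
    and "h \<in> Arr C \<Longrightarrow> Cod C h = Cod C f \<Longrightarrow> f \<cdot> inv_arr C f \<cdot> h = h"
  using assms iso_Arr[OF assms]
  by (simp_all flip: Cmp_assoc_Arr)

lemma inverse_arrs_sym: "inverse_arrs C f g \<Longrightarrow> inverse_arrs C g f"
  by (auto simp: inverse_arrs_def hom_set_def)

lemma iso_inv_arr: "iso_arr C f \<Longrightarrow> iso_arr C (inv_arr C f)"
  unfolding iso_arr_def[of C "inv_arr C f"] using inv_arr_inverse inverse_arrs_sym by blast

lemma inv_inv_arr: "iso_arr C f \<Longrightarrow> inv_arr C (inv_arr C f) = f"
  using inv_arr_inverse inverse_arrs_sym inv_arrI by blast

lemma iso_Ide: "A \<in> Obj C \<Longrightarrow> iso_arr C (Ide C A)"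
  unfolding iso_arr_def inverse_arrs_def by (intro exI[of _ "Ide C A"]) (simp add: hom_set_def)

lemma inverse_arrs_Cmp:
  assumes "inverse_arrs C f f'" "inverse_arrs C g g'" "Dom C g = Cod C f"
  shows "inverse_arrs C (g \<cdot> f) (f' \<cdot> g')"
proof -
  have i: "iso_arr C f" "iso_arr C g" using assms by (auto simp: iso_arr_def)
  have e: "inv_arr C f = f'" "inv_arr C g = g'" using assms by (auto intro: inv_arrI)
  show ?thesis
    using i assms(3) by (simp add: e[symmetric] inverse_arrs_def hom_set_def iso_Arr)
qed

lemma iso_Cmp: "iso_arr C f \<Longrightarrow> iso_arr C g \<Longrightarrow> Dom C g = Cod C f \<Longrightarrow> iso_arr C (g \<cdot> f)"
  using inverse_arrs_Cmp unfolding iso_arr_def by blast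

lemma iso_cancel_left:
  assumes "iso_arr C f" "g \<in> Arr C" "h \<in> Arr C" "Cod C g = Dom C f" "Cod C h = Dom C f"
    "f \<cdot> g = f \<cdot> h"
  shows "g = h"
  using assms inv_arr_assoc(1) by metis

lemma iso_cancel_right:
  assumes "iso_arr C f" "g \<in> Arr C" "h \<in> Arr C" "Dom C g = Cod C f" "Dom C h = Cod C f"
    "g \<cdot> f = h \<cdot> f"
  shows "g = h"
proof -
  have "k = (k \<cdot> f) \<cdot> inv_arr C f" if "k \<in> Arr C" "Dom C k = Cod C f" for k
    using that assms(1) iso_Arr[OF assms(1)] by simp
  then show ?thesis using assms by metis
qed

text \<open>Reversing the arrows exchanges the two linearity axioms for composition.\<close>

lemma lin_category_op: "lin_category K (op_cat C)"
  by (rule lin_category.intro[OF field_axioms], rule lin_category_axioms.intro)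
    (auto simp: op_cat_def hom_set_def Hom_module Hom_carrier Cmp_lin_left Cmp_lin_right)

end

lemma op_cat_simps [simp]:
  "Obj (op_cat C) = Obj C" "Arr (op_cat C) = Arr C" "Dom (op_cat C) = Cod C" "Cod (op_cat C) = Dom C"
  "Ide (op_cat C) = Ide C" "Cmp (op_cat C) g f = Cmp C f g" "Hom (op_cat C) A B = Hom C B A"
  by (simp_all add: op_cat_def)

section \<open>The category of vector spaces\<close>

lemma vec_cat_simps [simp]:
  "Obj (vec_cat K) = {V. module K V}" "Dom (vec_cat K) = src" "Cod (vec_cat K) = tgt"
  "Ide (vec_cat K) V = MArr V V (\<lambda>x\<in>carrier V. x)"
  "Cmp (vec_cat K) g f = MArr (src f) (tgt g) (\<lambda>x\<in>carrier (src f). cpt g (cpt f x))"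
  "carrier (Hom (vec_cat K) V W) = MArr V W ` lin_maps K V W"
  "\<zero>\<^bsub>Hom (vec_cat K) V W\<^esub> = MArr V W (\<lambda>x\<in>carrier V. \<zero>\<^bsub>W\<^esub>)"
  "g \<oplus>\<^bsub>Hom (vec_cat K) V W\<^esub> h = MArr V W (\<lambda>x\<in>carrier V. cpt g x \<oplus>\<^bsub>W\<^esub> cpt h x)"
  "c \<odot>\<^bsub>Hom (vec_cat K) V W\<^esub> h = MArr V W (\<lambda>x\<in>carrier V. c \<odot>\<^bsub>W\<^esub> cpt h x)"
  by (simp_all add: vec_cat_def)

lemma vec_cat_Arr:
  "f \<in> Arr (vec_cat K) \<longleftrightarrow> module K (src f) \<and> module K (tgt f) \<and> cpt f \<in> lin_maps K (src f) (tgt f)"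
  unfolding vec_cat_def by (cases f) auto

lemma vec_hom_set:
  "f \<in> hom_set (vec_cat K) V W \<longleftrightarrow>
     module K V \<and> module K W \<and> f = MArr V W (cpt f) \<and> cpt f \<in> lin_maps K V W"
  unfolding hom_set_def by (cases f) (auto simp: vec_cat_Arr)

text \<open>The laws hold pointwise because they hold in \<open>W\<close>; arrows are extensional
  maps, so pointwise equality on \<open>carrier V\<close> is equality.\<close>

lemma module_vec_Hom:
  assumes "module K V" "module K W"
  shows "module K (Hom (vec_cat K) V W)"
proof (rule module_by_scalars)
  interpret W: module K W by fact
  show "cring K" by (rule W.R.is_cring)
  show "\<zero>\<^bsub>Hom (vec_cat K) V W\<^esub> \<in> carrier (Hom (vec_cat K) V W)"
    using assms by (auto intro!: imageI restrict_lin_maps linear_on_zero_map)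
  fix f assume "f \<in> carrier (Hom (vec_cat K) V W)"
  then obtain f' where f: "f = MArr V W f'" "f' \<in> lin_maps K V W" by auto
  note f' = lin_mapsD[OF f(2)] linear_on_closed[OF lin_mapsD(1)[OF f(2)]]
  show "\<zero>\<^bsub>Hom (vec_cat K) V W\<^esub> \<oplus>\<^bsub>Hom (vec_cat K) V W\<^esub> f = f"
    "\<one>\<^bsub>K\<^esub> \<odot>\<^bsub>Hom (vec_cat K) V W\<^esub> f = f"
    "\<zero>\<^bsub>K\<^esub> \<odot>\<^bsub>Hom (vec_cat K) V W\<^esub> f = \<zero>\<^bsub>Hom (vec_cat K) V W\<^esub>"
    using f f' by (auto intro!: ext simp: extensional_def restrict_def)
  fix a assume a: "a \<in> carrier K"
  show "a \<odot>\<^bsub>Hom (vec_cat K) V W\<^esub> f \<in> carrier (Hom (vec_cat K) V W)"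
    using f f' a assms by (auto intro!: imageI restrict_lin_maps linear_on_scale)
  fix b assume b: "b \<in> carrier K"
  show "(a \<oplus>\<^bsub>K\<^esub> b) \<odot>\<^bsub>Hom (vec_cat K) V W\<^esub> f =
      a \<odot>\<^bsub>Hom (vec_cat K) V W\<^esub> f \<oplus>\<^bsub>Hom (vec_cat K) V W\<^esub> b \<odot>\<^bsub>Hom (vec_cat K) V W\<^esub> f"
    "(a \<otimes>\<^bsub>K\<^esub> b) \<odot>\<^bsub>Hom (vec_cat K) V W\<^esub> f =
      a \<odot>\<^bsub>Hom (vec_cat K) V W\<^esub> (b \<odot>\<^bsub>Hom (vec_cat K) V W\<^esub> f)"
    using f f' a b by (auto intro!: ext simp: restrict_def W.smult_l_distr W.smult_assoc1)
next
  interpret W: module K W by fact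
  fix f g assume "f \<in> carrier (Hom (vec_cat K) V W)" "g \<in> carrier (Hom (vec_cat K) V W)"
  then obtain f' g' where f: "f = MArr V W f'" "f' \<in> lin_maps K V W"
      and g: "g = MArr V W g'" "g' \<in> lin_maps K V W" by auto
  note f' = lin_mapsD[OF f(2)] linear_on_closed[OF lin_mapsD(1)[OF f(2)]]
  note g' = lin_mapsD[OF g(2)] linear_on_closed[OF lin_mapsD(1)[OF g(2)]]
  show "f \<oplus>\<^bsub>Hom (vec_cat K) V W\<^esub> g \<in> carrier (Hom (vec_cat K) V W)"
    using f g f' g' assms by (auto intro!: imageI restrict_lin_maps linear_on_sum)
  show "f \<oplus>\<^bsub>Hom (vec_cat K) V W\<^esub> g = g \<oplus>\<^bsub>Hom (vec_cat K) V W\<^esub> f"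
    using f g f' g' by (auto intro!: ext simp: restrict_def W.M.a_comm)
  show "a \<odot>\<^bsub>Hom (vec_cat K) V W\<^esub> (f \<oplus>\<^bsub>Hom (vec_cat K) V W\<^esub> g) =
      a \<odot>\<^bsub>Hom (vec_cat K) V W\<^esub> f \<oplus>\<^bsub>Hom (vec_cat K) V W\<^esub> a \<odot>\<^bsub>Hom (vec_cat K) V W\<^esub> g"
    if "a \<in> carrier K" for a
    using that f g f' g' by (auto intro!: ext simp: restrict_def W.smult_r_distr)
  fix h assume "h \<in> carrier (Hom (vec_cat K) V W)"
  then obtain h' where h: "h = MArr V W h'" "h' \<in> lin_maps K V W" by auto
  note h' = lin_mapsD[OF h(2)] linear_on_closed[OF lin_mapsD(1)[OF h(2)]]
  show "f \<oplus>\<^bsub>Hom (vec_cat K) V W\<^esub> g \<oplus>\<^bsub>Hom (vec_cat K) V W\<^esub> h =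
      f \<oplus>\<^bsub>Hom (vec_cat K) V W\<^esub> (g \<oplus>\<^bsub>Hom (vec_cat K) V W\<^esub> h)"
    using f g f' g' h h' by (auto intro!: ext simp: restrict_def W.M.a_assoc)
qed

lemma vec_hom_linear:
  assumes "f \<in> hom_set (vec_cat K) V W"
  shows "module K V" "module K W" "src f = V" "tgt f = W" "linear_on K V W (cpt f)"
    "cpt f \<in> extensional (carrier V)" "\<And>x. x \<in> carrier V \<Longrightarrow> cpt f x \<in> carrier W"
proof -
  from assms have f: "module K V" "module K W" "src f = V" "tgt f = W" "cpt f \<in> lin_maps K V W"
    by (auto simp: hom_set_def vec_cat_Arr)
  note lf = lin_mapsD[OF f(5)]
  from f(1-4) lf show "module K V" "module K W" "src f = V" "tgt f = W" "linear_on K V W (cpt f)"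
    "cpt f \<in> extensional (carrier V)" by auto
  show "\<And>x. x \<in> carrier V \<Longrightarrow> cpt f x \<in> carrier W"
    by (rule linear_on_closed[OF lf(1)])
qed

lemma vec_Cmp_assoc:
  assumes "f \<in> hom_set (vec_cat K) V W" "g \<in> hom_set (vec_cat K) W U" "h \<in> hom_set (vec_cat K) U X"
  shows "(h \<cdot>\<^bsub>vec_cat K\<^esub> g) \<cdot>\<^bsub>vec_cat K\<^esub> f = h \<cdot>\<^bsub>vec_cat K\<^esub> g \<cdot>\<^bsub>vec_cat K\<^esub> f"
  using vec_hom_linear[OF assms(1)] vec_hom_linear[OF assms(2)] vec_hom_linear[OF assms(3)]
  by (simp cong: restrict_cong)

lemma restrict_eqI:
  assumes "t \<in> extensional A" "\<And>x. x \<in> A \<Longrightarrow> s x = t x"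
  shows "restrict s A = t"
  using assms by (auto simp: extensional_def restrict_def)

lemma lin_category_vec:
  fixes K :: "('k,'x) ring_scheme"
  assumes "field K"
  shows "lin_category K (vec_cat K :: ('k, ('k,'v) module, ('k,'v) linmap) lcat)"
proof -
  interpret field K by fact
  show ?thesis
  proof (rule lin_category.intro[OF assms], rule lin_category_axioms.intro)
    fix V W U X :: "('k,'v) module" and f g h :: "('k,'v) linmap"
    show "f \<in> Arr (vec_cat K) \<Longrightarrow> Dom (vec_cat K) f \<in> Obj (vec_cat K)"
      "f \<in> Arr (vec_cat K) \<Longrightarrow> Cod (vec_cat K) f \<in> Obj (vec_cat K)"
      by (auto simp: vec_cat_Arr)
    show "V \<in> Obj (vec_cat K) \<Longrightarrow> W \<in> Obj (vec_cat K) \<Longrightarrow> module K (Hom (vec_cat K) V W)"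
      by (simp add: module_vec_Hom)
    show "V \<in> Obj (vec_cat K) \<Longrightarrow> W \<in> Obj (vec_cat K) \<Longrightarrow>
        carrier (Hom (vec_cat K) V W) = hom_set (vec_cat K) V W"
      by (auto simp: vec_hom_set)
    show "V \<in> Obj (vec_cat K) \<Longrightarrow> Ide (vec_cat K) V \<in> hom_set (vec_cat K) V V"
      by (auto simp: vec_hom_set intro: restrict_lin_maps linear_on_id)
    have cmp: "restrict (\<lambda>x. cpt g (cpt f x)) (carrier V) \<in> lin_maps K V U"
      if "f \<in> hom_set (vec_cat K) V W" "g \<in> hom_set (vec_cat K) W U" for f g :: "('k,'v) linmap" and V W U
      using vec_hom_linear[OF that(1)] vec_hom_linear[OF that(2)]
      by (auto intro!: restrict_lin_maps intro: linear_on_comp)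
    show "linear_on K (Hom (vec_cat K) V W) (Hom (vec_cat K) V U) (\<lambda>f. g \<cdot>\<^bsub>vec_cat K\<^esub> f)"
      if "V \<in> Obj (vec_cat K)" "g \<in> hom_set (vec_cat K) W U"
    proof (rule linear_onI)
      fix x assume x: "x \<in> carrier (Hom (vec_cat K) V W)"
      then have x': "x \<in> hom_set (vec_cat K) V W"
        using that vec_hom_linear(1)[OF that(2)] by (auto simp: vec_hom_set)
      note xl = vec_hom_linear[OF x'] and gl = vec_hom_linear[OF that(2)]
      show "g \<cdot>\<^bsub>vec_cat K\<^esub> x \<in> carrier (Hom (vec_cat K) V U)"
        using cmp[OF x' that(2)] xl gl by auto
      fix c assume "c \<in> carrier K"
      then show "g \<cdot>\<^bsub>vec_cat K\<^esub> (c \<odot>\<^bsub>Hom (vec_cat K) V W\<^esub> x) = c \<odot>\<^bsub>Hom (vec_cat K) V U\<^esub> (g \<cdot>\<^bsub>vec_cat K\<^esub> x)"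
        using xl gl by (simp add: linear_on_smult[OF gl(5)] cong: restrict_cong)
    next
      fix x y assume xy: "x \<in> carrier (Hom (vec_cat K) V W)" "y \<in> carrier (Hom (vec_cat K) V W)"
      then have xy': "x \<in> hom_set (vec_cat K) V W" "y \<in> hom_set (vec_cat K) V W"
        using that vec_hom_linear(1)[OF that(2)] by (auto simp: vec_hom_set)
      note xl = vec_hom_linear[OF xy'(1)] vec_hom_linear[OF xy'(2)] and gl = vec_hom_linear[OF that(2)]
      show "g \<cdot>\<^bsub>vec_cat K\<^esub> (x \<oplus>\<^bsub>Hom (vec_cat K) V W\<^esub> y) =
          g \<cdot>\<^bsub>vec_cat K\<^esub> x \<oplus>\<^bsub>Hom (vec_cat K) V U\<^esub> (g \<cdot>\<^bsub>vec_cat K\<^esub> y)"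
        using xl gl by (simp add: linear_on_add[OF gl(5)] cong: restrict_cong)
    qed
    show "linear_on K (Hom (vec_cat K) W U) (Hom (vec_cat K) V U) (\<lambda>g. g \<cdot>\<^bsub>vec_cat K\<^esub> f)"
      if "f \<in> hom_set (vec_cat K) V W" "U \<in> Obj (vec_cat K)"
    proof (rule linear_onI)
      fix x assume x: "x \<in> carrier (Hom (vec_cat K) W U)"
      then have x': "x \<in> hom_set (vec_cat K) W U"
        using that vec_hom_linear(2)[OF that(1)] by (auto simp: vec_hom_set)
      note xl = vec_hom_linear[OF x'] and gl = vec_hom_linear[OF that(1)]
      show "x \<cdot>\<^bsub>vec_cat K\<^esub> f \<in> carrier (Hom (vec_cat K) V U)"
        using cmp[OF that(1) x'] xl gl by auto
      fix c assume "c \<in> carrier K"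
      then show "(c \<odot>\<^bsub>Hom (vec_cat K) W U\<^esub> x) \<cdot>\<^bsub>vec_cat K\<^esub> f = c \<odot>\<^bsub>Hom (vec_cat K) V U\<^esub> (x \<cdot>\<^bsub>vec_cat K\<^esub> f)"
        using xl gl by (simp cong: restrict_cong)
    next
      fix x y assume xy: "x \<in> carrier (Hom (vec_cat K) W U)" "y \<in> carrier (Hom (vec_cat K) W U)"
      then have xy': "x \<in> hom_set (vec_cat K) W U" "y \<in> hom_set (vec_cat K) W U"
        using that vec_hom_linear(2)[OF that(1)] by (auto simp: vec_hom_set)
      note xl = vec_hom_linear[OF xy'(1)] vec_hom_linear[OF xy'(2)] and gl = vec_hom_linear[OF that(1)]
      show "(x \<oplus>\<^bsub>Hom (vec_cat K) W U\<^esub> y) \<cdot>\<^bsub>vec_cat K\<^esub> f =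
          x \<cdot>\<^bsub>vec_cat K\<^esub> f \<oplus>\<^bsub>Hom (vec_cat K) V U\<^esub> (y \<cdot>\<^bsub>vec_cat K\<^esub> f)"
        using xl gl by (simp cong: restrict_cong)
    qed
    show "f \<cdot>\<^bsub>vec_cat K\<^esub> Ide (vec_cat K) V = f" "Ide (vec_cat K) W \<cdot>\<^bsub>vec_cat K\<^esub> f = f"
      if "f \<in> hom_set (vec_cat K) V W"
      using vec_hom_linear[OF that] by (cases f; auto intro!: restrict_eqI)+
    show "\<lbrakk>f \<in> hom_set (vec_cat K) V W; g \<in> hom_set (vec_cat K) W U; h \<in> hom_set (vec_cat K) U X\<rbrakk> \<Longrightarrow>
        (h \<cdot>\<^bsub>vec_cat K\<^esub> g) \<cdot>\<^bsub>vec_cat K\<^esub> f = h \<cdot>\<^bsub>vec_cat K\<^esub> g \<cdot>\<^bsub>vec_cat K\<^esub> f"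
      by (rule vec_Cmp_assoc)
  qed
qed

section \<open>Categories of transformations\<close>

lemma trans_cat_simps [simp]:
  "Obj (trans_cat C D Ob Tr) = Ob" "Dom (trans_cat C D Ob Tr) = src" "Cod (trans_cat C D Ob Tr) = tgt"
  "Ide (trans_cat C D Ob Tr) F = MArr F F (\<lambda>A\<in>Obj C. Ide D (fobj F A))"
  "Cmp (trans_cat C D Ob Tr) s t = MArr (src t) (tgt s) (\<lambda>A\<in>Obj C. cpt s A \<cdot>\<^bsub>D\<^esub> cpt t A)"
  "carrier (Hom (trans_cat C D Ob Tr) F G) = MArr F G ` Tr F G"
  "\<zero>\<^bsub>Hom (trans_cat C D Ob Tr) F G\<^esub> = MArr F G (\<lambda>A\<in>Obj C. \<zero>\<^bsub>Hom D (fobj F A) (fobj G A)\<^esub>)"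
  "s \<oplus>\<^bsub>Hom (trans_cat C D Ob Tr) F G\<^esub> t =
     MArr F G (\<lambda>A\<in>Obj C. cpt s A \<oplus>\<^bsub>Hom D (fobj F A) (fobj G A)\<^esub> cpt t A)"
  "c \<odot>\<^bsub>Hom (trans_cat C D Ob Tr) F G\<^esub> t =
     MArr F G (\<lambda>A\<in>Obj C. c \<odot>\<^bsub>Hom D (fobj F A) (fobj G A)\<^esub> cpt t A)"
  by (simp_all add: trans_cat_def)

lemma trans_cat_Arr:
  "f \<in> Arr (trans_cat C D Ob Tr) \<longleftrightarrow> src f \<in> Ob \<and> tgt f \<in> Ob \<and> cpt f \<in> Tr (src f) (tgt f)"
  unfolding trans_cat_def by (cases f) auto

text \<open>Collects the closure properties of a family \<open>Tr\<close> of transformations from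
  which a linear category results. Presheaf categories and the categories of left and of right
  module endofunctors are the instances, so the category laws are verified once for all
  three.\<close>

locale trans_category = D: lin_category K D
  for K :: "('k,'x) ring_scheme" and D :: "('k,'p,'n,'z) lcat_scheme" +
  fixes C :: "('k,'o,'m,'y) lcat_scheme" and Ob :: "('o,'m,'p,'n,'w) fctr_scheme set" and Tr
  assumes ob: "\<lbrakk>F \<in> Ob; A \<in> Obj C\<rbrakk> \<Longrightarrow> fobj F A \<in> Obj D"
    and ext: "\<lbrakk>F \<in> Ob; G \<in> Ob; t \<in> Tr F G\<rbrakk> \<Longrightarrow> t \<in> extensional (Obj C)"
    and hom: "\<lbrakk>F \<in> Ob; G \<in> Ob; t \<in> Tr F G; A \<in> Obj C\<rbrakk> \<Longrightarrow> t A \<in> hom_set D (fobj F A) (fobj G A)"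
    and ide: "F \<in> Ob \<Longrightarrow> (\<lambda>A\<in>Obj C. Ide D (fobj F A)) \<in> Tr F F"
    and cmp: "\<lbrakk>F \<in> Ob; G \<in> Ob; H \<in> Ob; s \<in> Tr F G; t \<in> Tr G H\<rbrakk> \<Longrightarrow> (\<lambda>A\<in>Obj C. t A \<cdot>\<^bsub>D\<^esub> s A) \<in> Tr F H"
    and zero: "\<lbrakk>F \<in> Ob; G \<in> Ob\<rbrakk> \<Longrightarrow> (\<lambda>A\<in>Obj C. \<zero>\<^bsub>Hom D (fobj F A) (fobj G A)\<^esub>) \<in> Tr F G"
    and add: "\<lbrakk>F \<in> Ob; G \<in> Ob; s \<in> Tr F G; t \<in> Tr F G\<rbrakk> \<Longrightarrow>
        (\<lambda>A\<in>Obj C. s A \<oplus>\<^bsub>Hom D (fobj F A) (fobj G A)\<^esub> t A) \<in> Tr F G"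
    and smult: "\<lbrakk>F \<in> Ob; G \<in> Ob; c \<in> carrier K; t \<in> Tr F G\<rbrakk> \<Longrightarrow>
        (\<lambda>A\<in>Obj C. c \<odot>\<^bsub>Hom D (fobj F A) (fobj G A)\<^esub> t A) \<in> Tr F G"
begin

lemma tr_Arr:
  assumes "F \<in> Ob" "G \<in> Ob" "t \<in> Tr F G" "A \<in> Obj C"
  shows "t A \<in> Arr D" "Dom D (t A) = fobj F A" "Cod D (t A) = fobj G A"
  using hom[OF assms] by (auto simp: hom_set_def)

lemma module_trans_Hom:
  assumes FG: "F \<in> Ob" "G \<in> Ob"
  shows "module K (Hom (trans_cat C D Ob Tr) F G)"
proof -
  let ?V = "Hom (trans_cat C D Ob Tr) F G"
  have m: "module K (Hom D (fobj F A) (fobj G A))" if "A \<in> Obj C" for A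
    using that FG by (intro D.Hom_module ob)
  have c: "t A \<in> carrier (Hom D (fobj F A) (fobj G A))" if "t \<in> Tr F G" "A \<in> Obj C" for t A
    using tr_Arr[OF FG that] by (auto intro: D.Hom_mem)
  note e = ext[OF FG]
  note ab = abelian_monoid.a_assoc[OF abelian_group.axioms(1)[OF module.axioms(2)[OF m]]]
    abelian_monoid.a_comm[OF abelian_group.axioms(1)[OF module.axioms(2)[OF m]]]
    abelian_monoid.l_zero[OF abelian_group.axioms(1)[OF module.axioms(2)[OF m]]]
  show ?thesis
    by (rule module_by_scalars)
      (auto simp: D.is_cring FG zero add smult add[unfolded restrict_def] smult[unfolded restrict_def] c e ab module.smult_l_distr[OF m]
        module.smult_r_distr[OF m] module.smult_assoc1[OF m] module.smult_one[OF m]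
        module.smult_l_null[OF m] intro!: imageI restrict_eqI)
qed

text \<open>Every law is the law of \<open>D\<close> at each component; extensionality excludes
  differences off \<open>Obj C\<close>.\<close>

lemma lin_category_trans: "lin_category K (trans_cat C D Ob Tr)"
proof (rule lin_category.intro[OF D.field_axioms], rule lin_category_axioms.intro)
  let ?T = "trans_cat C D Ob Tr"
  fix F G H E and f g h
  have e: "cpt f \<in> extensional (Obj C)" if "f \<in> Arr ?T" for f
    using ext[of "src f" "tgt f" "cpt f"] that by (simp add: trans_cat_Arr)
  have c: "cpt f A \<in> Arr D" "Dom D (cpt f A) = fobj (src f) A" "Cod D (cpt f A) = fobj (tgt f) A"
     if "f \<in> Arr ?T" "A \<in> Obj C" for f A
    using tr_Arr[of "src f" "tgt f" "cpt f" A] that by (auto simp: trans_cat_Arr)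
  show "f \<in> Arr ?T \<Longrightarrow> Dom ?T f \<in> Obj ?T" "f \<in> Arr ?T \<Longrightarrow> Cod ?T f \<in> Obj ?T"
    by (auto simp: trans_cat_Arr)
  show "F \<in> Obj ?T \<Longrightarrow> G \<in> Obj ?T \<Longrightarrow> module K (Hom ?T F G)"
    by (simp add: module_trans_Hom)
  show carT: "F \<in> Obj ?T \<Longrightarrow> G \<in> Obj ?T \<Longrightarrow> carrier (Hom ?T F G) = hom_set ?T F G" for F G
    by (auto simp: hom_set_def trans_cat_Arr image_iff) (metis marr.collapse)
  show "F \<in> Obj ?T \<Longrightarrow> Ide ?T F \<in> hom_set ?T F F"
    by (simp add: hom_set_def trans_cat_Arr ide)
  show "f \<in> hom_set ?T F G \<Longrightarrow> f \<cdot>\<^bsub>?T\<^esub> Ide ?T F = f" "f \<in> hom_set ?T F G \<Longrightarrow> Ide ?T G \<cdot>\<^bsub>?T\<^esub> f = f"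
    using e[of f] c[of f] by (cases f; auto intro!: restrict_eqI simp: hom_set_def)+
  show "\<lbrakk>f \<in> hom_set ?T F G; g \<in> hom_set ?T G H; h \<in> hom_set ?T H E\<rbrakk> \<Longrightarrow>
      (h \<cdot>\<^bsub>?T\<^esub> g) \<cdot>\<^bsub>?T\<^esub> f = h \<cdot>\<^bsub>?T\<^esub> g \<cdot>\<^bsub>?T\<^esub> f"
    by (auto intro!: restrict_eqI simp: hom_set_def c)
  have cl: "f \<in> hom_set ?T F G \<Longrightarrow> g \<in> hom_set ?T G H \<Longrightarrow> g \<cdot>\<^bsub>?T\<^esub> f \<in> hom_set ?T F H" for f g F G H
    by (auto simp: hom_set_def trans_cat_Arr cmp)
  have obT: "f \<in> hom_set ?T F G \<Longrightarrow> F \<in> Ob \<and> G \<in> Ob" for f F G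
    by (auto simp: hom_set_def trans_cat_Arr)
  have cc: "f \<in> hom_set ?T F G \<Longrightarrow> A \<in> Obj C \<Longrightarrow> cpt f A \<in> carrier (Hom D (fobj F A) (fobj G A))" for f F G A
    using c[of f A] by (auto simp: hom_set_def intro: D.Hom_mem)
  show "linear_on K (Hom ?T F G) (Hom ?T F H) (\<lambda>f. g \<cdot>\<^bsub>?T\<^esub> f)"
    if F: "F \<in> Obj ?T" and g: "g \<in> hom_set ?T G H"
  proof (rule linear_onI)
    have gl: "linear_on K (Hom D (fobj F A) (fobj G A)) (Hom D (fobj F A) (fobj H A)) (\<lambda>f. cpt g A \<cdot>\<^bsub>D\<^esub> f)"
      if "A \<in> Obj C" for A
      using D.Cmp_lin_right[of "fobj F A" "cpt g A"] ob[of F A] c[of g A] g F that by (auto simp: hom_set_def)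
    note gs = linear_on_add[OF gl] linear_on_smult[OF gl]
    have gd: "src g = G" "tgt g = H" using g by (auto simp: hom_set_def)
    note obT[OF g]
    then have car: "x \<in> hom_set ?T F G" if "x \<in> carrier (Hom ?T F G)" for x
      using carT[of F G] F that by simp
    have hs: "src x = F \<and> tgt x = G" if "x \<in> carrier (Hom ?T F G)" for x
      using car[OF that] by (simp add: hom_set_def)
    show "g \<cdot>\<^bsub>?T\<^esub> x \<in> carrier (Hom ?T F H)" if "x \<in> carrier (Hom ?T F G)" for x
      using cl[OF car[OF that] g] F obT[OF g] carT[of F H]
      by (simp del: trans_cat_simps(4-))
    show "g \<cdot>\<^bsub>?T\<^esub> (x \<oplus>\<^bsub>Hom ?T F G\<^esub> y) = g \<cdot>\<^bsub>?T\<^esub> x \<oplus>\<^bsub>Hom ?T F H\<^esub> g \<cdot>\<^bsub>?T\<^esub> y"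
      if "x \<in> carrier (Hom ?T F G)" "y \<in> carrier (Hom ?T F G)" for x y
      using cc[OF car[OF that(1)]] cc[OF car[OF that(2)]] hs[OF that(1)] hs[OF that(2)] by (simp add: gd gs cong: restrict_cong)
    show "g \<cdot>\<^bsub>?T\<^esub> (a \<odot>\<^bsub>Hom ?T F G\<^esub> x) = a \<odot>\<^bsub>Hom ?T F H\<^esub> (g \<cdot>\<^bsub>?T\<^esub> x)"
      if "a \<in> carrier K" "x \<in> carrier (Hom ?T F G)" for a x
      using cc[OF car[OF that(2)]] hs[OF that(2)] that(1) by (simp add: gd gs cong: restrict_cong)
  qed
  show "linear_on K (Hom ?T G H) (Hom ?T F H) (\<lambda>g. g \<cdot>\<^bsub>?T\<^esub> f)"
    if f: "f \<in> hom_set ?T F G" and H: "H \<in> Obj ?T"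
  proof (rule linear_onI)
    have gl: "linear_on K (Hom D (fobj G A) (fobj H A)) (Hom D (fobj F A) (fobj H A)) (\<lambda>g. g \<cdot>\<^bsub>D\<^esub> cpt f A)"
      if "A \<in> Obj C" for A
      using D.Cmp_lin_left[of "fobj H A" "cpt f A"] ob[of H A] c[of f A] f H that by (auto simp: hom_set_def)
    note gs = linear_on_add[OF gl] linear_on_smult[OF gl]
    have gd: "src f = F" "tgt f = G" using f by (auto simp: hom_set_def)
    note obT[OF f]
    then have car: "x \<in> hom_set ?T G H" if "x \<in> carrier (Hom ?T G H)" for x
      using carT[of G H] H that by simp
    have hs: "src x = G \<and> tgt x = H" if "x \<in> carrier (Hom ?T G H)" for x
      using car[OF that] by (simp add: hom_set_def)
    show "x \<cdot>\<^bsub>?T\<^esub> f \<in> carrier (Hom ?T F H)" if "x \<in> carrier (Hom ?T G H)" for x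
      using cl[OF f car[OF that]] H obT[OF f] carT[of F H]
      by (simp del: trans_cat_simps(4-))
    show "(x \<oplus>\<^bsub>Hom ?T G H\<^esub> y) \<cdot>\<^bsub>?T\<^esub> f = x \<cdot>\<^bsub>?T\<^esub> f \<oplus>\<^bsub>Hom ?T F H\<^esub> y \<cdot>\<^bsub>?T\<^esub> f"
      if "x \<in> carrier (Hom ?T G H)" "y \<in> carrier (Hom ?T G H)" for x y
      using cc[OF car[OF that(1)]] cc[OF car[OF that(2)]] hs[OF that(1)] hs[OF that(2)] by (simp add: gd gs cong: restrict_cong)
    show "(a \<odot>\<^bsub>Hom ?T G H\<^esub> x) \<cdot>\<^bsub>?T\<^esub> f = a \<odot>\<^bsub>Hom ?T F H\<^esub> (x \<cdot>\<^bsub>?T\<^esub> f)"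
      if "a \<in> carrier K" "x \<in> carrier (Hom ?T G H)" for a x
      using cc[OF car[OF that(2)]] hs[OF that(2)] that(1) by (simp add: gd gs cong: restrict_cong)
  qed
qed

end

section \<open>Natural transformations and module functors\<close>

lemma nat_transD:
  assumes "t \<in> nat_trans C D F G"
  shows "t \<in> extensional (Obj C)"
    and "A \<in> Obj C \<Longrightarrow> t A \<in> Arr D" "A \<in> Obj C \<Longrightarrow> Dom D (t A) = fobj F A"
    and "A \<in> Obj C \<Longrightarrow> Cod D (t A) = fobj G A"
    and "f \<in> Arr C \<Longrightarrow> t (Cod C f) \<cdot>\<^bsub>D\<^esub> farr F f = farr G f \<cdot>\<^bsub>D\<^esub> t (Dom C f)"
  using assms by (auto simp: nat_trans_def hom_set_def)

context lin_functor
begin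

lemma fobj_Obj [simp]: "A \<in> Obj C \<Longrightarrow> fobj F A \<in> Obj D"
  by (rule fobj_closed)

lemma farr_Arr [simp]:
  assumes "f \<in> Arr C"
  shows "farr F f \<in> Arr D" "Dom D (farr F f) = fobj F (Dom C f)" "Cod D (farr F f) = fobj F (Cod C f)"
proof -
  have o: "Dom C f \<in> Obj C" "Cod C f \<in> Obj C" using assms by simp_all
  have "farr F f \<in> carrier (Hom D (fobj F (Dom C f)) (fobj F (Cod C f)))"
    by (rule linear_on_closed[OF farr_linear[OF o]]) (simp add: assms C.Hom_mem)
  from D.Hom_Arr[OF _ _ this] o show "farr F f \<in> Arr D" "Dom D (farr F f) = fobj F (Dom C f)"
    "Cod D (farr F f) = fobj F (Cod C f)" by simp_all
qed

lemma farr_Cmp_Arr: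
  "f \<in> Arr C \<Longrightarrow> g \<in> Arr C \<Longrightarrow> Dom C g = Cod C f \<Longrightarrow> farr F (g \<cdot>\<^bsub>C\<^esub> f) = farr F g \<cdot>\<^bsub>D\<^esub> farr F f"
  by (rule farr_Cmp) (auto simp: hom_set_def)

end

lemma nat_trans_Ide:
  assumes "lin_functor K C D F"
  shows "(\<lambda>A\<in>Obj C. Ide D (fobj F A)) \<in> nat_trans C D F F"
proof -
  interpret F: lin_functor K C D F by fact
  show ?thesis by (auto simp: nat_trans_def hom_set_def)
qed

lemma nat_trans_Cmp:
  assumes "lin_functor K C D F" "lin_functor K C D G" "lin_functor K C D H"
    and s: "s \<in> nat_trans C D F G" and t: "t \<in> nat_trans C D G H"
  shows "(\<lambda>A\<in>Obj C. t A \<cdot>\<^bsub>D\<^esub> s A) \<in> nat_trans C D F H"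
proof -
  interpret F: lin_functor K C D F by fact
  interpret G: lin_functor K C D G by fact
  interpret H: lin_functor K C D H by fact
  note s' = nat_transD[OF s] and t' = nat_transD[OF t]
  have "(t (Cod C f) \<cdot>\<^bsub>D\<^esub> s (Cod C f)) \<cdot>\<^bsub>D\<^esub> farr F f = farr H f \<cdot>\<^bsub>D\<^esub> t (Dom C f) \<cdot>\<^bsub>D\<^esub> s (Dom C f)"
    if "f \<in> Arr C" for f
  proof -
    have "(t (Cod C f) \<cdot>\<^bsub>D\<^esub> s (Cod C f)) \<cdot>\<^bsub>D\<^esub> farr F f = t (Cod C f) \<cdot>\<^bsub>D\<^esub> (farr G f \<cdot>\<^bsub>D\<^esub> s (Dom C f))"
      using that by (simp add: s' t')
    also have "\<dots> = (t (Cod C f) \<cdot>\<^bsub>D\<^esub> farr G f) \<cdot>\<^bsub>D\<^esub> s (Dom C f)"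
      using that by (simp add: s' t' del: t'(5))
    also have "\<dots> = farr H f \<cdot>\<^bsub>D\<^esub> t (Dom C f) \<cdot>\<^bsub>D\<^esub> s (Dom C f)"
      using that by (simp add: t'(5)) (simp add: s' t')
    finally show ?thesis .
  qed
  then show ?thesis
    by (auto simp: nat_trans_def hom_set_def s' t')
qed

text \<open>Composition is linear in each argument, so both sides of the naturality square are
  zero.\<close>

lemma nat_trans_zero:
  assumes "lin_functor K C D F" "lin_functor K C D G"
  shows "(\<lambda>A\<in>Obj C. \<zero>\<^bsub>Hom D (fobj F A) (fobj G A)\<^esub>) \<in> nat_trans C D F G"
proof -
  interpret F: lin_functor K C D F by fact
  interpret G: lin_functor K C D G by fact
  have z: "\<zero>\<^bsub>Hom D A B\<^esub> \<in> hom_set D A B" if "A \<in> Obj D" "B \<in> Obj D" for A B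
    using module_zero_closed[OF F.D.Hom_module[OF that]] F.D.Hom_carrier[OF that] by simp
  have "\<zero>\<^bsub>Hom D (fobj F (Cod C f)) (fobj G (Cod C f))\<^esub> \<cdot>\<^bsub>D\<^esub> farr F f =
      farr G f \<cdot>\<^bsub>D\<^esub> \<zero>\<^bsub>Hom D (fobj F (Dom C f)) (fobj G (Dom C f))\<^esub>" if f: "f \<in> Arr C" for f
    using linear_on_zero[OF _ _ F.D.Cmp_lin_left[of "fobj G (Cod C f)" "farr F f"]]
      linear_on_zero[OF _ _ F.D.Cmp_lin_right[of "fobj F (Dom C f)" "farr G f"]] f
    by (simp add: F.D.Hom_module)
  then show ?thesis using z by (auto simp: nat_trans_def)
qed

lemma nat_trans_add:
  assumes "lin_functor K C D F" "lin_functor K C D G"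
    and s: "s \<in> nat_trans C D F G" and t: "t \<in> nat_trans C D F G"
  shows "(\<lambda>A\<in>Obj C. s A \<oplus>\<^bsub>Hom D (fobj F A) (fobj G A)\<^esub> t A) \<in> nat_trans C D F G"
proof -
  interpret F: lin_functor K C D F by fact
  interpret G: lin_functor K C D G by fact
  note s' = nat_transD[OF s] and t' = nat_transD[OF t]
  have "(s (Cod C f) \<oplus>\<^bsub>Hom D (fobj F (Cod C f)) (fobj G (Cod C f))\<^esub> t (Cod C f)) \<cdot>\<^bsub>D\<^esub> farr F f =
      farr G f \<cdot>\<^bsub>D\<^esub> (s (Dom C f) \<oplus>\<^bsub>Hom D (fobj F (Dom C f)) (fobj G (Dom C f))\<^esub> t (Dom C f))"
    if f: "f \<in> Arr C" for f
    using linear_on_add[OF F.D.Cmp_lin_left[of "fobj G (Cod C f)" "farr F f"], of "s (Cod C f)" "t (Cod C f)"]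
      linear_on_add[OF F.D.Cmp_lin_right[of "fobj F (Dom C f)" "farr G f"], of "s (Dom C f)" "t (Dom C f)"] f
    by (simp add: s' t' F.D.Hom_mem)
  then show ?thesis by (auto simp: nat_trans_def hom_set_def s' t' F.D.Hom_add_Arr)
qed

lemma nat_trans_smult:
  assumes "lin_functor K C D F" "lin_functor K C D G" and c: "c \<in> carrier K" and t: "t \<in> nat_trans C D F G"
  shows "(\<lambda>A\<in>Obj C. c \<odot>\<^bsub>Hom D (fobj F A) (fobj G A)\<^esub> t A) \<in> nat_trans C D F G"
proof -
  interpret F: lin_functor K C D F by fact
  interpret G: lin_functor K C D G by fact
  note t' = nat_transD[OF t]
  have "(c \<odot>\<^bsub>Hom D (fobj F (Cod C f)) (fobj G (Cod C f))\<^esub> t (Cod C f)) \<cdot>\<^bsub>D\<^esub> farr F f =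
      farr G f \<cdot>\<^bsub>D\<^esub> (c \<odot>\<^bsub>Hom D (fobj F (Dom C f)) (fobj G (Dom C f))\<^esub> t (Dom C f))"
    if f: "f \<in> Arr C" for f
    using linear_on_smult[OF F.D.Cmp_lin_left[of "fobj G (Cod C f)" "farr F f"] c, of "t (Cod C f)"]
      linear_on_smult[OF F.D.Cmp_lin_right[of "fobj F (Dom C f)" "farr G f"] c, of "t (Dom C f)"] f
    by (simp add: t' F.D.Hom_mem)
  then show ?thesis by (auto simp: nat_trans_def hom_set_def t' c F.D.Hom_smult_Arr)
qed

lemma lin_category_fun_cat:
  fixes C :: "('k,'o,'m,'y) lcat_scheme" and D :: "('k,'p,'n,'z) lcat_scheme"
  assumes C: "lin_category K C" and D: "lin_category K D"
  shows "lin_category K (fun_cat K C D)"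
proof -
  interpret trans_category K D C "{F. lin_functor K C D F}" "nat_trans C D"
  proof (rule trans_category.intro[OF D], rule trans_category_axioms.intro, unfold mem_Collect_eq, goal_cases)
    case 1 then show ?case by (rule lin_functor.fobj_closed)
  next
    case 2 then show ?case by (simp add: nat_trans_def)
  next
    case 3 then show ?case by (simp add: nat_trans_def)
  next
    case 4 then show ?case by (rule nat_trans_Ide)
  next
    case 5 then show ?case by (rule nat_trans_Cmp)
  next
    case 6 then show ?case by (rule nat_trans_zero)
  next
    case 7 then show ?case by (rule nat_trans_add)
  next
    case 8 then show ?case by (rule nat_trans_smult)
  qed
  show ?thesis unfolding fun_cat_def by (rule lin_category_trans)
qed

section \<open>Tensor products of arrows and the associator\<close>

notation (in semigroup_category) S (structure)

context semigroup_category
begin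

lemma tobj_Obj [simp]: "A \<in> Obj S \<Longrightarrow> B \<in> Obj S \<Longrightarrow> A \<box> B \<in> Obj S"
  by (rule tobj_closed)

text \<open>As for composition, the typing comes out of the linearity axioms: a linear map takes its
  values in the target hom-space.\<close>

lemma tarr_Arr [simp]:
  assumes "f \<in> Arr S" "g \<in> Arr S"
  shows "f \<diamondop> g \<in> Arr S" "Dom S (f \<diamondop> g) = Dom S f \<box> Dom S g"
    "Cod S (f \<diamondop> g) = Cod S f \<box> Cod S g"
proof -
  have f: "f \<in> hom_set S (Dom S f) (Cod S f)" using assms by (simp add: hom_set_def)
  have o: "Dom S f \<in> Obj S" "Cod S f \<in> Obj S" "Dom S g \<in> Obj S" "Cod S g \<in> Obj S" using assms by simp_all
  have "f \<diamondop> g \<in> carrier (Hom S (Dom S f \<box> Dom S g) (Cod S f \<box> Cod S g))"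
    by (rule linear_on_closed[OF tarr_linear_right[OF f o(3,4)]]) (simp add: assms Hom_mem)
  from Hom_Arr[OF _ _ this] o show "f \<diamondop> g \<in> Arr S" "Dom S (f \<diamondop> g) = Dom S f \<box> Dom S g"
    "Cod S (f \<diamondop> g) = Cod S f \<box> Cod S g" by simp_all
qed

lemma tarr_Ide_Obj [simp]: "A \<in> Obj S \<Longrightarrow> B \<in> Obj S \<Longrightarrow> Ide S A \<diamondop> Ide S B = Ide S (A \<box> B)"
  by (rule tarr_Ide)

lemma tarr_Cmp_Arr:
  assumes "f \<in> Arr S" "f' \<in> Arr S" "g \<in> Arr S" "g' \<in> Arr S" "Dom S f' = Cod S f" "Dom S g' = Cod S g"
  shows "(f' \<diamondop> g') \<cdot> (f \<diamondop> g) = (f' \<cdot> f) \<diamondop> (g' \<cdot> g)"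
  by (rule tarr_Cmp[symmetric]) (use assms in \<open>auto simp: hom_set_def\<close>)

text \<open>The interchange law in front of a tail \<open>h\<close>. Together with its plain form it
  fuses adjacent tensors of arrows anywhere in a composite associated to the right.\<close>

lemma tarr_Cmp_assoc:
  assumes "f \<in> Arr S" "f' \<in> Arr S" "g \<in> Arr S" "g' \<in> Arr S" "Dom S f' = Cod S f" "Dom S g' = Cod S g"
    "h \<in> Arr S" "Cod S h = Dom S f \<box> Dom S g"
  shows "(f' \<diamondop> g') \<cdot> (f \<diamondop> g) \<cdot> h = ((f' \<cdot> f) \<diamondop> (g' \<cdot> g)) \<cdot> h"
  using assms by (simp flip: tarr_Cmp_Arr)

lemmas merge = tarr_Cmp_Arr tarr_Cmp_assoc

lemma asc_Arr [simp]:
  assumes "A \<in> Obj S" "B \<in> Obj S" "C \<in> Obj S"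
  shows "asc S A B C \<in> Arr S" "Dom S (asc S A B C) = (A \<box> B) \<box> C"
    "Cod S (asc S A B C) = A \<box> (B \<box> C)" "iso_arr S (asc S A B C)"
  using asc_in_hom[OF assms] asc_iso[OF assms] by (auto simp: hom_set_def)

lemma asc_nat:
  assumes "f \<in> Arr S" "g \<in> Arr S" "h \<in> Arr S" "Dom S f = A" "Cod S f = A'" "Dom S g = B" "Cod S g = B'"
    "Dom S h = C" "Cod S h = C'"
  shows "asc S A' B' C' \<cdot> ((f \<diamondop> g) \<diamondop> h) = (f \<diamondop> (g \<diamondop> h)) \<cdot> asc S A B C"
  by (rule asc_natural) (use assms in \<open>auto simp: hom_set_def\<close>)

text \<open>Applies an equation between short composites inside a longer one, where associativity to
  the right hides its left-hand side.\<close>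

lemma Cmp_eq_assoc:
  assumes "a \<cdot> b = c" "a \<in> Arr S" "b \<in> Arr S" "Dom S a = Cod S b" "x \<in> Arr S" "Cod S x = Dom S b"
  shows "a \<cdot> b \<cdot> x = c \<cdot> x"
  using assms by auto

text \<open>Naturality of the associator, conjugated with its inverses at both ends.\<close>

lemma inv_asc_nat:
  assumes "f \<in> Arr S" "g \<in> Arr S" "h \<in> Arr S" "Dom S f = A" "Cod S f = A'" "Dom S g = B" "Cod S g = B'"
    "Dom S h = C" "Cod S h = C'"
  shows "inv_arr S (asc S A' B' C') \<cdot> (f \<diamondop> (g \<diamondop> h)) = ((f \<diamondop> g) \<diamondop> h) \<cdot> inv_arr S (asc S A B C)"
proof -
  have o: "A \<in> Obj S" "B \<in> Obj S" "C \<in> Obj S" "A' \<in> Obj S" "B' \<in> Obj S" "C' \<in> Obj S" using assms by auto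
  have "inv_arr S (asc S A' B' C') \<cdot> (f \<diamondop> (g \<diamondop> h)) =
     inv_arr S (asc S A' B' C') \<cdot> ((f \<diamondop> (g \<diamondop> h)) \<cdot> asc S A B C) \<cdot> inv_arr S (asc S A B C)"
    using assms o by simp
  also have "\<dots> = ((f \<diamondop> g) \<diamondop> h) \<cdot> inv_arr S (asc S A B C)"
    unfolding asc_nat[OF assms, symmetric] using assms o by simp
  finally show ?thesis .
qed

lemma iso_tarr:
  assumes "iso_arr S f" "iso_arr S g"
  shows "iso_arr S (f \<diamondop> g)" "inv_arr S (f \<diamondop> g) = inv_arr S f \<diamondop> inv_arr S g"
proof -
  have "inverse_arrs S (f \<diamondop> g) (inv_arr S f \<diamondop> inv_arr S g)"
    using assms by (simp add: inverse_arrs_def hom_set_def iso_Arr merge)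
  then show "iso_arr S (f \<diamondop> g)" "inv_arr S (f \<diamondop> g) = inv_arr S f \<diamondop> inv_arr S g"
    by (auto simp: iso_arr_def inv_arrI)
qed

lemma inv_arr_Cmp:
  "iso_arr S f \<Longrightarrow> iso_arr S g \<Longrightarrow> Dom S g = Cod S f \<Longrightarrow> inv_arr S (g \<cdot> f) = inv_arr S f \<cdot> inv_arr S g"
  by (intro inv_arrI inverse_arrs_Cmp inv_arr_inverse)

lemma inv_arr_Ide: "A \<in> Obj S \<Longrightarrow> inv_arr S (Ide S A) = Ide S A"
  by (rule inv_arrI) (simp add: inverse_arrs_def hom_set_def)

text \<open>Both sides of the pentagon are invertible, and this compares their inverses. With the
  four objects in opposite order it is the pentagon of \<open>reverse_sg\<close>.\<close>

lemma inv_pentagon: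
  assumes "A \<in> Obj S" "B \<in> Obj S" "C \<in> Obj S" "D \<in> Obj S"
  shows "inv_arr S (asc S (A \<box> B) C D) \<cdot> inv_arr S (asc S A B (C \<box> D)) =
    (inv_arr S (asc S A B C) \<diamondop> Ide S D) \<cdot> inv_arr S (asc S A (B \<box> C) D) \<cdot>
      (Ide S A \<diamondop> inv_arr S (asc S B C D))"
  using arg_cong[OF pentagon[OF assms], of "inv_arr S"] assms
  by (simp add: inv_arr_Cmp iso_tarr iso_Ide iso_Cmp inv_arr_Ide)

end

text \<open>The same category with the tensor factors exchanged. The rebracketing then goes the
  other way, hence the inverse associator with reversed arguments. Left module structures over it
  are right module structures over \<open>S\<close>, which turns left-handed proofs into
  right-handed ones.\<close>

definition reverse_sg :: "('k,'o,'m,'y) sgcat_scheme \<Rightarrow> ('k,'o,'m) sgcat" where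
  "reverse_sg S = \<lparr>Obj = Obj S, Arr = Arr S, Dom = Dom S, Cod = Cod S, Ide = Ide S, Cmp = Cmp S, Hom = Hom S,
     tobj = (\<lambda>A B. B \<box>\<^bsub>S\<^esub> A), tarr = (\<lambda>f g. g \<diamondop>\<^bsub>S\<^esub> f), asc = (\<lambda>A B C. inv_arr S (asc S C B A))\<rparr>"

lemma reverse_sg_simps [simp]:
  "Obj (reverse_sg S) = Obj S" "Arr (reverse_sg S) = Arr S" "Dom (reverse_sg S) = Dom S"
  "Cod (reverse_sg S) = Cod S" "Ide (reverse_sg S) = Ide S" "Cmp (reverse_sg S) = Cmp S"
  "Hom (reverse_sg S) = Hom S" "A \<box>\<^bsub>reverse_sg S\<^esub> B = B \<box>\<^bsub>S\<^esub> A" "f \<diamondop>\<^bsub>reverse_sg S\<^esub> g = g \<diamondop>\<^bsub>S\<^esub> f"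
  "asc (reverse_sg S) A B C = inv_arr S (asc S C B A)"
  by (simp_all add: reverse_sg_def)

lemma reverse_sg_derived [simp]:
  "hom_set (reverse_sg S) = hom_set S" "inverse_arrs (reverse_sg S) = inverse_arrs S"
  "iso_arr (reverse_sg S) = iso_arr S" "inv_arr (reverse_sg S) = inv_arr S"
  by (simp_all add: fun_eq_iff hom_set_def inverse_arrs_def iso_arr_def inv_arr_def)

lemma (in semigroup_category) reverse: "semigroup_category K (reverse_sg S)"
proof (rule semigroup_category.intro)
  show "lin_category K (reverse_sg S)"
    by (rule lin_category.intro[OF field_axioms], rule lin_category_axioms.intro)
      (auto simp: Hom_module Hom_carrier Ide_in_hom Cmp_linear_right Cmp_linear_left Cmp_assoc hom_set_def
        intro: Cmp_lin_left Cmp_lin_right)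
  show "semigroup_category_axioms K (reverse_sg S)"
  proof (rule semigroup_category_axioms.intro, goal_cases)
    case (2 f A A' B B') then show ?case by (simp add: tarr_linear_left)
  next
    case (3 A A' g B B') then show ?case by (simp add: tarr_linear_right)
  next
    case (5 f A A' f' A'' g B B' g' B'') then show ?case by (simp add: hom_set_def tarr_Cmp_Arr)
  next
    case (8 f A A' g B B' h C C') then show ?case by (auto simp: hom_set_def inv_asc_nat)
  next
    case (9 A B C D) then show ?case by (simp add: inv_pentagon)
  qed (auto simp: hom_set_def iso_inv_arr)
qed

text \<open>The structure map of a left module functor takes the acting object first, that of a
  right module functor takes it last; reversing the tensor product therefore swaps the
  arguments.\<close>

definition swap_mf :: "('o,'m) modfun \<Rightarrow> ('o,'m) modfun" where
  "swap_mf \<Phi> = \<lparr>fobj = fobj \<Phi>, farr = farr \<Phi>, mstr = (\<lambda>X M. mstr \<Phi> M X)\<rparr>"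

lemma swap_mf_simps [simp]:
  "fobj (swap_mf \<Phi>) = fobj \<Phi>" "farr (swap_mf \<Phi>) = farr \<Phi>" "mstr (swap_mf \<Phi>) X M = mstr \<Phi> M X"
  by (simp_all add: swap_mf_def)

lemma rtens_simps [simp]:
  "fobj (rtens S F) = (\<lambda>X. X \<box>\<^bsub>S\<^esub> F)" "farr (rtens S F) = (\<lambda>f. f \<diamondop>\<^bsub>S\<^esub> Ide S F)" "mstr (rtens S F) X M = asc S X M F"
  by (simp_all add: rtens_def)

lemma ltens_simps [simp]:
  "fobj (ltens S F) = (\<lambda>X. F \<box>\<^bsub>S\<^esub> X)" "farr (ltens S F) = (\<lambda>f. Ide S F \<diamondop>\<^bsub>S\<^esub> f)"
  "mstr (ltens S F) M X = inv_arr S (asc S F M X)"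
  by (simp_all add: ltens_def)

lemma id_modfun_simps [simp]:
  "fobj (id_modfun S) = (\<lambda>X. X)" "farr (id_modfun S) = (\<lambda>f. f)" "mstr (id_modfun S) X M = Ide S (X \<box>\<^bsub>S\<^esub> M)"
  by (simp_all add: id_modfun_def)

lemma lmod_comp_simps [simp]:
  "fobj (lmod_comp S \<Phi> \<Psi>) X = fobj \<Phi> (fobj \<Psi> X)" "farr (lmod_comp S \<Phi> \<Psi>) f = farr \<Phi> (farr \<Psi> f)"
  "mstr (lmod_comp S \<Phi> \<Psi>) X M = mstr \<Phi> X (fobj \<Psi> M) \<cdot>\<^bsub>S\<^esub> farr \<Phi> (mstr \<Psi> X M)"
  by (simp_all add: lmod_comp_def)

lemma rmod_comp_simps [simp]:
  "fobj (rmod_comp S \<Phi> \<Psi>) X = fobj \<Phi> (fobj \<Psi> X)" "farr (rmod_comp S \<Phi> \<Psi>) f = farr \<Phi> (farr \<Psi> f)"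
  "mstr (rmod_comp S \<Phi> \<Psi>) M X = mstr \<Phi> (fobj \<Psi> M) X \<cdot>\<^bsub>S\<^esub> farr \<Phi> (mstr \<Psi> M X)"
  by (simp_all add: rmod_comp_def)

text \<open>Equalities of records, without conditions on objects: the structure maps of
  \<open>ltens\<close> are defined by the very inverse associators that \<open>reverse_sg\<close>
  uses.\<close>

lemma swap_mf_eqs:
  "swap_mf (ltens S F) = rtens (reverse_sg S) F" "swap_mf (id_modfun S) = id_modfun (reverse_sg S)"
  "swap_mf (rmod_comp S \<Phi> \<Psi>) = lmod_comp (reverse_sg S) (swap_mf \<Phi>) (swap_mf \<Psi>)"
  by (simp_all add: swap_mf_def rtens_def ltens_def id_modfun_def lmod_comp_def rmod_comp_def fun_eq_iff o_def)

lemma rmod_trans_reverse: "rmod_trans S \<Phi> \<Psi> = lmod_trans (reverse_sg S) (swap_mf \<Phi>) (swap_mf \<Psi>)"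
  unfolding rmod_trans_def lmod_trans_def nat_trans_def by auto

lemma lmod_transD:
  assumes "t \<in> lmod_trans S \<Phi> \<Psi>"
  shows "t \<in> nat_trans S S \<Phi> \<Psi>"
    "\<lbrakk>X \<in> Obj S; M \<in> Obj S\<rbrakk> \<Longrightarrow> mstr \<Psi> X M \<cdot>\<^bsub>S\<^esub> t (X \<box>\<^bsub>S\<^esub> M) = (Ide S X \<diamondop>\<^bsub>S\<^esub> t M) \<cdot>\<^bsub>S\<^esub> mstr \<Phi> X M"
  using assms by (auto simp: lmod_trans_def)

section \<open>Module endofunctors and module transformations\<close>

context semigroup_category
begin

lemma tarr_lin_right:
  assumes "f \<in> Arr S" "B \<in> Obj S" "B' \<in> Obj S" "Dom S f = A" "Cod S f = A'"
  shows "linear_on K (Hom S B B') (Hom S (A \<box> B) (A' \<box> B')) (\<lambda>g. f \<diamondop> g)"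
  by (rule tarr_linear_right) (use assms in \<open>auto simp: hom_set_def\<close>)

lemma tarr_lin_left:
  assumes "g \<in> Arr S" "A \<in> Obj S" "A' \<in> Obj S" "Dom S g = B" "Cod S g = B'"
  shows "linear_on K (Hom S A A') (Hom S (A \<box> B) (A' \<box> B')) (\<lambda>f. f \<diamondop> g)"
  by (rule tarr_linear_left) (use assms in \<open>auto simp: hom_set_def\<close>)

lemma lin_functor_id: "lin_functor K S S (id_modfun S)"
  by (intro lin_functor.intro lin_functor_axioms.intro lin_category_axioms) (simp_all add: linear_on_id)

lemma lin_functor_rtens: "F \<in> Obj S \<Longrightarrow> lin_functor K S S (rtens S F)"
  by (intro lin_functor.intro lin_functor_axioms.intro lin_category_axioms)
    (auto simp: hom_set_def tarr_lin_left merge)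

lemma lin_functor_ltens: "F \<in> Obj S \<Longrightarrow> lin_functor K S S (ltens S F)"
  by (intro lin_functor.intro lin_functor_axioms.intro lin_category_axioms)
    (auto simp: hom_set_def tarr_lin_right merge)

text \<open>With the associator as structure map, coherence is the pentagon and naturality is that
  of the associator.\<close>

lemma left_module_functor_rtens:
  assumes "F \<in> Obj S"
  shows "left_module_functor K S (rtens S F)"
proof -
  show ?thesis
    by (intro left_module_functor.intro left_module_functor_axioms.intro semigroup_category_axioms lin_functor_rtens)
      (use assms in \<open>auto simp: hom_set_def pentagon asc_nat\<close>)
qed

lemma left_module_functor_id: "left_module_functor K S (id_modfun S)"
  by (intro left_module_functor.intro left_module_functor_axioms.intro semigroup_category_axioms lin_functor_id)
    (auto simp: hom_set_def iso_Ide)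
lemma right_module_functor_ltens:
  assumes "F \<in> Obj S"
  shows "right_module_functor K S (ltens S F)"
proof -
  have "asc S (F \<box> M) X Y \<cdot> (inv_arr S (asc S F M X) \<diamondop> Ide S Y) \<cdot> inv_arr S (asc S F (M \<box> X) Y) =
    inv_arr S (asc S F M (X \<box> Y)) \<cdot> (Ide S F \<diamondop> asc S M X Y)"
    if "M \<in> Obj S" "X \<in> Obj S" "Y \<in> Obj S" for M X Y
  proof -
    let ?i = "Ide S F \<diamondop> inv_arr S (asc S M X Y)"
    \<comment> \<open>Inserting \<open>?i\<close> together with its inverse on the right exposes the
      right-hand side of the inverse pentagon; what it is replaced by then cancels against the
      leading associator.\<close>
    have "asc S (F \<box> M) X Y \<cdot> (inv_arr S (asc S F M X) \<diamondop> Ide S Y) \<cdot> inv_arr S (asc S F (M \<box> X) Y) =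
      asc S (F \<box> M) X Y \<cdot> ((inv_arr S (asc S F M X) \<diamondop> Ide S Y) \<cdot> inv_arr S (asc S F (M \<box> X) Y)
        \<cdot> ?i) \<cdot> (Ide S F \<diamondop> asc S M X Y)"
      using that assms by (simp add: merge)
    also have "\<dots> = inv_arr S (asc S F M (X \<box> Y)) \<cdot> (Ide S F \<diamondop> asc S M X Y)"
      using that assms by (simp flip: inv_pentagon)
    finally show ?thesis .
  qed
  then show ?thesis
    by (intro right_module_functor.intro right_module_functor_axioms.intro semigroup_category_axioms lin_functor_ltens)
      (use assms in \<open>auto simp: hom_set_def inv_asc_nat iso_inv_arr\<close>)
qed

lemma right_module_functor_id: "right_module_functor K S (id_modfun S)"
  by (intro right_module_functor.intro right_module_functor_axioms.intro semigroup_category_axioms lin_functor_id)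
    (auto simp: hom_set_def iso_Ide)
end

lemma lin_functor_swap:
  assumes "semigroup_category K S" "lin_functor K S S \<Phi>"
  shows "lin_functor K (reverse_sg S) (reverse_sg S) (swap_mf \<Phi>)"
proof -
  interpret lin_functor K S S \<Phi> by fact
  interpret R: semigroup_category K "reverse_sg S" by (rule semigroup_category.reverse) fact
  show ?thesis
    by (intro lin_functor.intro lin_functor_axioms.intro R.lin_category_axioms)
      (auto simp: farr_linear farr_Ide hom_set_def farr_Cmp_Arr)
qed

context semigroup_category
begin

text \<open>The module condition on \<open>t\<close> says that two linear maps, one applied to \<open>t (X \<box> M)\<close> and the
  other to \<open>t M\<close>, agree; hence it is stable under linear combinations.\<close>

lemma lmod_condition_linear:
  assumes "lin_functor K S S \<Phi>" "lin_functor K S S \<Psi>"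
    and "\<And>X M. X \<in> Obj S \<Longrightarrow> M \<in> Obj S \<Longrightarrow> mstr \<Phi> X M \<in> hom_set S (fobj \<Phi> (X \<box> M)) (X \<box> fobj \<Phi> M)"
    and "\<And>X M. X \<in> Obj S \<Longrightarrow> M \<in> Obj S \<Longrightarrow> mstr \<Psi> X M \<in> hom_set S (fobj \<Psi> (X \<box> M)) (X \<box> fobj \<Psi> M)"
    and X: "X \<in> Obj S" and M: "M \<in> Obj S"
  shows "linear_on K (Hom S (fobj \<Phi> (X \<box> M)) (fobj \<Psi> (X \<box> M)))
      (Hom S (fobj \<Phi> (X \<box> M)) (X \<box> fobj \<Psi> M)) (\<lambda>u. mstr \<Psi> X M \<cdot> u)"
    and "linear_on K (Hom S (fobj \<Phi> M) (fobj \<Psi> M))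
      (Hom S (fobj \<Phi> (X \<box> M)) (X \<box> fobj \<Psi> M)) (\<lambda>u. (Ide S X \<diamondop> u) \<cdot> mstr \<Phi> X M)"
proof -
  interpret F: lin_functor K S S \<Phi> by fact
  interpret G: lin_functor K S S \<Psi> by fact
  note F = hom_setD[OF assms(3)[OF X M]] and G = hom_setD[OF assms(4)[OF X M]]
  show "linear_on K (Hom S (fobj \<Phi> (X \<box> M)) (fobj \<Psi> (X \<box> M)))
      (Hom S (fobj \<Phi> (X \<box> M)) (X \<box> fobj \<Psi> M)) (\<lambda>u. mstr \<Psi> X M \<cdot> u)"
    using Cmp_lin_right[of "fobj \<Phi> (X \<box> M)" "mstr \<Psi> X M"] F G X M by simp
  show "linear_on K (Hom S (fobj \<Phi> M) (fobj \<Psi> M))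
      (Hom S (fobj \<Phi> (X \<box> M)) (X \<box> fobj \<Psi> M)) (\<lambda>u. (Ide S X \<diamondop> u) \<cdot> mstr \<Phi> X M)"
    by (rule linear_on_comp[OF tarr_lin_right[of "Ide S X" "fobj \<Phi> M" "fobj \<Psi> M" X X]])
      (use Cmp_lin_left[of "X \<box> fobj \<Psi> M" "mstr \<Phi> X M"] F G X M in simp_all)
qed

text \<open>Phrased for linear functors with typed structure maps, so that it applies directly to
  the swaps of right module functors over \<open>reverse_sg\<close>.\<close>

lemma lmod_trans_closed:
  assumes F: "lin_functor K S S \<Phi>" and G: "lin_functor K S S \<Psi>"
    and mF: "\<And>X M. X \<in> Obj S \<Longrightarrow> M \<in> Obj S \<Longrightarrow> mstr \<Phi> X M \<in> hom_set S (fobj \<Phi> (X \<box> M)) (X \<box> fobj \<Phi> M)"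
    and mG: "\<And>X M. X \<in> Obj S \<Longrightarrow> M \<in> Obj S \<Longrightarrow> mstr \<Psi> X M \<in> hom_set S (fobj \<Psi> (X \<box> M)) (X \<box> fobj \<Psi> M)"
  shows "(\<lambda>A\<in>Obj S. Ide S (fobj \<Phi> A)) \<in> lmod_trans S \<Phi> \<Phi>"
    and "(\<lambda>A\<in>Obj S. \<zero>\<^bsub>Hom S (fobj \<Phi> A) (fobj \<Psi> A)\<^esub>) \<in> lmod_trans S \<Phi> \<Psi>"
    and "s \<in> lmod_trans S \<Phi> \<Psi> \<Longrightarrow> t \<in> lmod_trans S \<Phi> \<Psi> \<Longrightarrow>
       (\<lambda>A\<in>Obj S. s A \<oplus>\<^bsub>Hom S (fobj \<Phi> A) (fobj \<Psi> A)\<^esub> t A) \<in> lmod_trans S \<Phi> \<Psi>"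
    and "c \<in> carrier K \<Longrightarrow> t \<in> lmod_trans S \<Phi> \<Psi> \<Longrightarrow>
       (\<lambda>A\<in>Obj S. c \<odot>\<^bsub>Hom S (fobj \<Phi> A) (fobj \<Psi> A)\<^esub> t A) \<in> lmod_trans S \<Phi> \<Psi>"
proof -
  interpret F: lin_functor K S S \<Phi> by fact
  interpret G: lin_functor K S S \<Psi> by fact
  note lin = lmod_condition_linear[OF F G mF mG]
  have m: "module K (Hom S (fobj \<Phi> A) (fobj \<Psi> B))" if "A \<in> Obj S" "B \<in> Obj S" for A B
    using that by (simp add: Hom_module)
  have cod: "module K (Hom S (fobj \<Phi> (X \<box> M)) (X \<box> fobj \<Psi> M))" if "X \<in> Obj S" "M \<in> Obj S" for X M
    using that by (simp add: Hom_module)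
  have car: "t A \<in> carrier (Hom S (fobj \<Phi> A) (fobj \<Psi> A))" if "t \<in> lmod_trans S \<Phi> \<Psi>" "A \<in> Obj S" for t A
    using nat_transD[OF lmod_transD(1)[OF that(1)]] that(2) by (auto intro: Hom_mem)
  show "(\<lambda>A\<in>Obj S. Ide S (fobj \<Phi> A)) \<in> lmod_trans S \<Phi> \<Phi>"
    using nat_trans_Ide[OF F] hom_setD[OF mF] by (simp add: lmod_trans_def)
  show "(\<lambda>A\<in>Obj S. \<zero>\<^bsub>Hom S (fobj \<Phi> A) (fobj \<Psi> A)\<^esub>) \<in> lmod_trans S \<Phi> \<Psi>"
    using nat_trans_zero[OF F G] linear_on_zero[OF m cod lin(1)] linear_on_zero[OF m cod lin(2)]
    by (simp add: lmod_trans_def)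
  show "(\<lambda>A\<in>Obj S. s A \<oplus>\<^bsub>Hom S (fobj \<Phi> A) (fobj \<Psi> A)\<^esub> t A) \<in> lmod_trans S \<Phi> \<Psi>"
    if "s \<in> lmod_trans S \<Phi> \<Psi>" "t \<in> lmod_trans S \<Phi> \<Psi>"
    using that nat_trans_add[OF F G lmod_transD(1)[OF that(1)] lmod_transD(1)[OF that(2)]]
    by (simp add: lmod_trans_def[of S \<Phi> \<Psi>] linear_on_add[OF lin(1)] linear_on_add[OF lin(2)] car lmod_transD(2))
  show "(\<lambda>A\<in>Obj S. c \<odot>\<^bsub>Hom S (fobj \<Phi> A) (fobj \<Psi> A)\<^esub> t A) \<in> lmod_trans S \<Phi> \<Psi>"
    if "c \<in> carrier K" "t \<in> lmod_trans S \<Phi> \<Psi>"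
    using that nat_trans_smult[OF F G that(1) lmod_transD(1)[OF that(2)]]
    by (simp add: lmod_trans_def[of S \<Phi> \<Psi>] linear_on_smult[OF lin(1)] linear_on_smult[OF lin(2)] car lmod_transD(2))
qed

lemma lmod_trans_Cmp:
  assumes F: "lin_functor K S S \<Phi>" and G: "lin_functor K S S \<Psi>" and H: "lin_functor K S S \<Theta>"
    and mF: "\<And>X M. X \<in> Obj S \<Longrightarrow> M \<in> Obj S \<Longrightarrow> mstr \<Phi> X M \<in> hom_set S (fobj \<Phi> (X \<box> M)) (X \<box> fobj \<Phi> M)"
    and mG: "\<And>X M. X \<in> Obj S \<Longrightarrow> M \<in> Obj S \<Longrightarrow> mstr \<Psi> X M \<in> hom_set S (fobj \<Psi> (X \<box> M)) (X \<box> fobj \<Psi> M)"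
    and mH: "\<And>X M. X \<in> Obj S \<Longrightarrow> M \<in> Obj S \<Longrightarrow> mstr \<Theta> X M \<in> hom_set S (fobj \<Theta> (X \<box> M)) (X \<box> fobj \<Theta> M)"
    and s: "s \<in> lmod_trans S \<Phi> \<Psi>" and t: "t \<in> lmod_trans S \<Psi> \<Theta>"
  shows "(\<lambda>A\<in>Obj S. t A \<cdot> s A) \<in> lmod_trans S \<Phi> \<Theta>"
proof -
  interpret F: lin_functor K S S \<Phi> by fact
  interpret G: lin_functor K S S \<Psi> by fact
  interpret H: lin_functor K S S \<Theta> by fact
  note s' = nat_transD[OF lmod_transD(1)[OF s]] and t' = nat_transD[OF lmod_transD(1)[OF t]]
  have "mstr \<Theta> X M \<cdot> t (X \<box> M) \<cdot> s (X \<box> M) = (Ide S X \<diamondop> (t M \<cdot> s M)) \<cdot> mstr \<Phi> X M"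
    if XM: "X \<in> Obj S" "M \<in> Obj S" for X M
  proof -
    note F = hom_setD[OF mF[OF XM]] and G = hom_setD[OF mG[OF XM]] and H = hom_setD[OF mH[OF XM]]
    have "mstr \<Theta> X M \<cdot> t (X \<box> M) \<cdot> s (X \<box> M) =
        (Ide S X \<diamondop> t M) \<cdot> mstr \<Psi> X M \<cdot> s (X \<box> M)"
      using Cmp_eq_assoc[OF lmod_transD(2)[OF t XM], of "s (X \<box> M)"] XM
      by (simp add: s' t' F G H)
    also have "\<dots> = (Ide S X \<diamondop> (t M \<cdot> s M)) \<cdot> mstr \<Phi> X M"
      using XM by (simp add: lmod_transD(2)[OF s XM]) (simp add: merge s' t' F)
    finally show ?thesis .
  qed
  then show ?thesis
    using nat_trans_Cmp[OF F G H lmod_transD(1)[OF s] lmod_transD(1)[OF t]]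
    by (simp add: lmod_trans_def)
qed

lemma lmod_trans_category: "trans_category K S S {\<Phi>. left_module_functor K S \<Phi>} (lmod_trans S)"
proof (rule trans_category.intro[OF lin_category_axioms], rule trans_category_axioms.intro,
    unfold mem_Collect_eq, goal_cases)
  note l = left_module_functor.axioms(2) and m = left_module_functor.mstr_in_hom
  case 1 then show ?case by (rule lin_functor.fobj_closed[OF l])
next
  case 2 then show ?case by (simp add: lmod_trans_def nat_trans_def)
next
  case 3 then show ?case by (simp add: lmod_trans_def nat_trans_def)
next
  note l = left_module_functor.axioms(2) and m = left_module_functor.mstr_in_hom
  case 4 then show ?case by (intro lmod_trans_closed l m)
next
  note l = left_module_functor.axioms(2) and m = left_module_functor.mstr_in_hom
  case (5 F G H s t) then show ?case
    by (intro lmod_trans_Cmp[OF l l l, of F G H]) (auto intro: m)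
next
  note l = left_module_functor.axioms(2) and m = left_module_functor.mstr_in_hom
  case 6 then show ?case by (intro lmod_trans_closed l m)
next
  note l = left_module_functor.axioms(2) and m = left_module_functor.mstr_in_hom
  case 7 then show ?case by (intro lmod_trans_closed l m)
next
  note l = left_module_functor.axioms(2) and m = left_module_functor.mstr_in_hom
  case 8 then show ?case by (intro lmod_trans_closed l m)
qed

lemma lin_category_lmod: "lin_category K (lmod_cat K S)"
  unfolding lmod_cat_def by (rule trans_category.lin_category_trans[OF lmod_trans_category])

text \<open>The closure properties are those of left module transformations over
  \<open>reverse_sg\<close>, read through \<open>rmod_trans_reverse\<close>.\<close>

lemma rmod_trans_category: "trans_category K S S {\<Phi>. right_module_functor K S \<Phi>} (rmod_trans S)"
proof -
  interpret R: semigroup_category K "reverse_sg S" by (rule reverse)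
  have l: "right_module_functor K S \<Phi> \<Longrightarrow> lin_functor K (reverse_sg S) (reverse_sg S) (swap_mf \<Phi>)" for \<Phi>
    by (intro lin_functor_swap semigroup_category_axioms right_module_functor.axioms(2))
  have m: "right_module_functor K S \<Phi> \<Longrightarrow> X \<in> Obj (reverse_sg S) \<Longrightarrow> M \<in> Obj (reverse_sg S) \<Longrightarrow>
     mstr (swap_mf \<Phi>) X M \<in> hom_set (reverse_sg S) (fobj (swap_mf \<Phi>) (X \<box>\<^bsub>reverse_sg S\<^esub> M))
       (X \<box>\<^bsub>reverse_sg S\<^esub> fobj (swap_mf \<Phi>) M)" for \<Phi> X M
    using right_module_functor.mstr_in_hom[of K S \<Phi> M X] by simp
  note cl = R.lmod_trans_closed[of "swap_mf _" "swap_mf _", OF l l m m, simplified]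
  show ?thesis
  proof (rule trans_category.intro[OF lin_category_axioms], rule trans_category_axioms.intro,
    unfold mem_Collect_eq, goal_cases)
    case (1 F A) then show ?case using lin_functor.fobj_closed[OF l[of F]] by simp
  next
    case 2 then show ?case by (simp add: rmod_trans_def nat_trans_def)
  next
    case 3 then show ?case by (simp add: rmod_trans_def nat_trans_def)
  next
    case 4 then show ?case unfolding rmod_trans_reverse by (intro cl(1))
  next
    case (5 F G H s t) then show ?case
      unfolding rmod_trans_reverse
      by (intro R.lmod_trans_Cmp[OF l l l m m m, simplified, of F G H])
  next
    case 6 then show ?case unfolding rmod_trans_reverse by (intro cl(2))
  next
    case 7 then show ?case unfolding rmod_trans_reverse by (intro cl(3))
  next
    case 8 then show ?case unfolding rmod_trans_reverse by (intro cl(4))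
  qed
qed

lemma lin_category_rmod: "lin_category K (rmod_cat K S)"
  unfolding rmod_cat_def by (rule trans_category.lin_category_trans[OF rmod_trans_category])

text \<open>The inverse associator identifies \<open>- \<box> (G \<box> F)\<close> with
  \<open>(- \<box> G) \<box> F\<close>; the pentagon makes this identification compatible with the
  module structures.\<close>

lemma lmod_trans_unit_comp:
  assumes F: "F \<in> Obj S" and G: "G \<in> Obj S" and \<eta>: "\<eta> \<in> lmod_trans S (id_modfun S) (rtens S (G \<box> F))"
  shows "(\<lambda>X\<in>Obj S. inv_arr S (asc S X G F) \<cdot> \<eta> X) \<in>
    lmod_trans S (id_modfun S) (lmod_comp S (rtens S F) (rtens S G))"
proof -
  note n = nat_transD[OF lmod_transD(1)[OF \<eta>], simplified] and m = lmod_transD(2)[OF \<eta>, simplified]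
  have nat: "inv_arr S (asc S (Cod S f) G F) \<cdot> \<eta> (Cod S f) \<cdot> f =
      ((f \<diamondop> Ide S G) \<diamondop> Ide S F) \<cdot> inv_arr S (asc S (Dom S f) G F) \<cdot> \<eta> (Dom S f)"
    if f: "f \<in> Arr S" for f
  proof -
    have "inv_arr S (asc S (Cod S f) G F) \<cdot> \<eta> (Cod S f) \<cdot> f =
        (inv_arr S (asc S (Cod S f) G F) \<cdot> (f \<diamondop> (Ide S G \<diamondop> Ide S F))) \<cdot> \<eta> (Dom S f)"
      using f F G by (simp add: n)
    also have "\<dots> = ((f \<diamondop> Ide S G) \<diamondop> Ide S F) \<cdot> inv_arr S (asc S (Dom S f) G F) \<cdot> \<eta> (Dom S f)"
      using f F G by (subst inv_asc_nat) (auto simp: n)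
    finally show ?thesis .
  qed
  have mod: "(asc S X (M \<box> G) F \<cdot> (asc S X M G \<diamondop> Ide S F)) \<cdot> inv_arr S (asc S (X \<box> M) G F) \<cdot> \<eta> (X \<box> M) =
      (Ide S X \<diamondop> (inv_arr S (asc S M G F) \<cdot> \<eta> M)) \<cdot> Ide S (X \<box> M)"
    if X: "X \<in> Obj S" and M: "M \<in> Obj S" for X M
  \<comment> \<open>Comparing after the invertible arrow
    \<open>Ide S X \<diamondop> asc S M G F\<close> produces the full right-hand side of the
    pentagon, which can then be replaced by two associators.\<close>
  proof (rule iso_cancel_left[of "Ide S X \<diamondop> asc S M G F"])
    show "iso_arr S (Ide S X \<diamondop> asc S M G F)" using X M F G by (simp add: iso_tarr iso_Ide)
    have "(Ide S X \<diamondop> asc S M G F) \<cdot> (asc S X (M \<box> G) F \<cdot> (asc S X M G \<diamondop> Ide S F)) \<cdot>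
        inv_arr S (asc S (X \<box> M) G F) \<cdot> \<eta> (X \<box> M) =
      ((Ide S X \<diamondop> asc S M G F) \<cdot> asc S X (M \<box> G) F \<cdot> (asc S X M G \<diamondop> Ide S F)) \<cdot>
        inv_arr S (asc S (X \<box> M) G F) \<cdot> \<eta> (X \<box> M)"
      using X M F G by (simp add: n)
    also have "\<dots> = asc S X M (G \<box> F) \<cdot> \<eta> (X \<box> M)"
      unfolding pentagon[OF X M G F, symmetric] using X M F G by (simp add: n)
    also have "\<dots> = (Ide S X \<diamondop> asc S M G F) \<cdot> (Ide S X \<diamondop> (inv_arr S (asc S M G F) \<cdot> \<eta> M)) \<cdot> Ide S (X \<box> M)"
      using X M F G by (simp add: m n merge)
    finally show "(Ide S X \<diamondop> asc S M G F) \<cdot> (asc S X (M \<box> G) F \<cdot> (asc S X M G \<diamondop> Ide S F)) \<cdot>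
        inv_arr S (asc S (X \<box> M) G F) \<cdot> \<eta> (X \<box> M) =
        (Ide S X \<diamondop> asc S M G F) \<cdot> (Ide S X \<diamondop> (inv_arr S (asc S M G F) \<cdot> \<eta> M)) \<cdot> Ide S (X \<box> M)" .
  qed (use X M F G in \<open>simp_all add: n\<close>)
  show ?thesis
    unfolding lmod_trans_def nat_trans_def using F G nat mod by (simp add: hom_set_def n)
qed

text \<open>Precomposition with the associator turns a transformation out of
  \<open>- \<box> (F \<box> G)\<close> into one out of \<open>(- \<box> F) \<box> G\<close>; the
  module condition follows by expanding \<open>\<epsilon>\<close> at a product and applying the
  pentagon.\<close>

lemma lmod_trans_counit_comp:
  assumes F: "F \<in> Obj S" and G: "G \<in> Obj S" and \<epsilon>: "\<epsilon> \<in> lmod_trans S (rtens S (F \<box> G)) (id_modfun S)"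
  shows "(\<lambda>X\<in>Obj S. \<epsilon> X \<cdot> asc S X F G) \<in>
    lmod_trans S (lmod_comp S (rtens S G) (rtens S F)) (id_modfun S)"
proof -
  note n = nat_transD[OF lmod_transD(1)[OF \<epsilon>], simplified] and m = lmod_transD(2)[OF \<epsilon>, simplified]
  have nat: "\<epsilon> (Cod S f) \<cdot> asc S (Cod S f) F G \<cdot> ((f \<diamondop> Ide S F) \<diamondop> Ide S G) =
      f \<cdot> \<epsilon> (Dom S f) \<cdot> asc S (Dom S f) F G" if f: "f \<in> Arr S" for f
  proof -
    have "\<epsilon> (Cod S f) \<cdot> asc S (Cod S f) F G \<cdot> ((f \<diamondop> Ide S F) \<diamondop> Ide S G) =
        (\<epsilon> (Cod S f) \<cdot> (f \<diamondop> Ide S (F \<box> G))) \<cdot> asc S (Dom S f) F G"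
      using f F G by (subst asc_nat) (auto simp: n simp del: n(5))
    also have "\<dots> = f \<cdot> \<epsilon> (Dom S f) \<cdot> asc S (Dom S f) F G"
      using f F G by (simp add: n)
    finally show ?thesis .
  qed
  have mod: "\<epsilon> (X \<box> M) \<cdot> asc S (X \<box> M) F G =
      (Ide S X \<diamondop> (\<epsilon> M \<cdot> asc S M F G)) \<cdot> asc S X (M \<box> F) G \<cdot> (asc S X M F \<diamondop> Ide S G)"
    if X: "X \<in> Obj S" and M: "M \<in> Obj S" for X M
  proof -
    have "\<epsilon> (X \<box> M) = (Ide S X \<diamondop> \<epsilon> M) \<cdot> asc S X M (F \<box> G)"
      using m[OF X M] X M F G by (simp add: n)
    then show ?thesis using X M F G by (simp add: n pentagon merge)
  qed
  show ?thesis
    unfolding lmod_trans_def nat_trans_def using F G nat mod by (simp add: hom_set_def n)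
qed

text \<open>The left-handed version over \<open>reverse_sg\<close> with \<open>F\<close> and
  \<open>G\<close> exchanged; the associator appears there as a double inverse.\<close>

lemma rmod_trans_unit_comp:
  assumes F: "F \<in> Obj S" and G: "G \<in> Obj S" and \<eta>: "\<eta> \<in> rmod_trans S (id_modfun S) (ltens S (G \<box> F))"
  shows "(\<lambda>X\<in>Obj S. asc S G F X \<cdot> \<eta> X) \<in> rmod_trans S (id_modfun S) (rmod_comp S (ltens S G) (ltens S F))"
proof -
  interpret R: semigroup_category K "reverse_sg S" by (rule reverse)
  have "(\<lambda>X\<in>Obj S. inv_arr S (inv_arr S (asc S G F X)) \<cdot> \<eta> X) \<in>
      rmod_trans S (id_modfun S) (rmod_comp S (ltens S G) (ltens S F))"
    using R.lmod_trans_unit_comp[of G F \<eta>] assms by (simp add: rmod_trans_reverse swap_mf_eqs)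
  then show ?thesis using F G by (simp add: inv_inv_arr cong: restrict_cong)
qed

lemma rmod_trans_counit_comp:
  assumes F: "F \<in> Obj S" and G: "G \<in> Obj S" and \<epsilon>: "\<epsilon> \<in> rmod_trans S (ltens S (F \<box> G)) (id_modfun S)"
  shows "(\<lambda>X\<in>Obj S. \<epsilon> X \<cdot> inv_arr S (asc S F G X)) \<in>
    rmod_trans S (rmod_comp S (ltens S F) (ltens S G)) (id_modfun S)"
proof -
  interpret R: semigroup_category K "reverse_sg S" by (rule reverse)
  show ?thesis
    using R.lmod_trans_counit_comp[of G F \<epsilon>] assms by (simp add: rmod_trans_reverse swap_mf_eqs)
qed

text \<open>It suffices to check the equations between components: the unit and counit of the two
  adjunctions are automatically module transformations.\<close>

lemma sg_adjunctionI:
  assumes F: "F \<in> Obj S" and G: "G \<in> Obj S"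
    and \<eta>l: "\<eta>l \<in> lmod_trans S (id_modfun S) (rtens S (G \<box> F))"
    and \<epsilon>l: "\<epsilon>l \<in> lmod_trans S (rtens S (F \<box> G)) (id_modfun S)"
    and \<eta>r: "\<eta>r \<in> rmod_trans S (id_modfun S) (ltens S (G \<box> F))"
    and \<epsilon>r: "\<epsilon>r \<in> rmod_trans S (ltens S (F \<box> G)) (id_modfun S)"
    and "\<And>X. X \<in> Obj S \<Longrightarrow> (\<epsilon>l (X \<box> G) \<cdot> asc S (X \<box> G) F G) \<cdot>
           ((inv_arr S (asc S X G F) \<cdot> \<eta>l X) \<diamondop> Ide S G) = Ide S (X \<box> G)"
    and "\<And>X. X \<in> Obj S \<Longrightarrow> ((\<epsilon>l X \<cdot> asc S X F G) \<diamondop> Ide S F) \<cdot>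
           inv_arr S (asc S (X \<box> F) G F) \<cdot> \<eta>l (X \<box> F) = Ide S (X \<box> F)"
    and "\<And>X. X \<in> Obj S \<Longrightarrow> (\<epsilon>r (F \<box> X) \<cdot> inv_arr S (asc S F G (F \<box> X))) \<cdot>
           (Ide S F \<diamondop> (asc S G F X \<cdot> \<eta>r X)) = Ide S (F \<box> X)"
    and "\<And>X. X \<in> Obj S \<Longrightarrow> (Ide S G \<diamondop> (\<epsilon>r X \<cdot> inv_arr S (asc S F G X))) \<cdot>
           asc S G F (G \<box> X) \<cdot> \<eta>r (G \<box> X) = Ide S (G \<box> X)"
    and "\<epsilon>r F \<cdot> inv_arr S (asc S F G F) \<cdot> \<eta>l F = Ide S F"
    and "\<epsilon>l G \<cdot> asc S G F G \<cdot> \<eta>r G = Ide S G"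
    and "\<And>H L. H \<in> Obj S \<Longrightarrow> L \<in> Obj S \<Longrightarrow>
           Ide S H \<diamondop> \<eta>r L = asc S H (G \<box> F) L \<cdot> (\<eta>l H \<diamondop> Ide S L)"
    and "\<And>H L. H \<in> Obj S \<Longrightarrow> L \<in> Obj S \<Longrightarrow>
           (Ide S H \<diamondop> \<epsilon>r L) \<cdot> asc S H (F \<box> G) L = \<epsilon>l H \<diamondop> Ide S L"
  shows "sg_adjunction K S F G \<eta>l \<eta>r \<epsilon>l \<epsilon>r"
  unfolding sg_adjunction_def lmod_adjunction_def rmod_adjunction_def lmod_cat_def rmod_cat_def
  using assms left_module_functor_rtens right_module_functor_ltens
    lmod_trans_unit_comp[OF F G \<eta>l] lmod_trans_counit_comp[OF F G \<epsilon>l]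
    rmod_trans_unit_comp[OF F G \<eta>r] rmod_trans_counit_comp[OF F G \<epsilon>r]
  by (simp cong: restrict_cong)

end

section \<open>Balanced pairs of module transformations\<close>

text \<open>The transformations that form the values at \<open>F\<close> of the two presheaves
  claimed to be the unit.\<close>

abbreviation lunit :: "('k,'o,'m,'y) sgcat_scheme \<Rightarrow> 'o \<Rightarrow> ('o \<Rightarrow> 'm) set" where
  "lunit S F \<equiv> lmod_trans S (rtens S F) (id_modfun S)"

abbreviation runit :: "('k,'o,'m,'y) sgcat_scheme \<Rightarrow> 'o \<Rightarrow> ('o \<Rightarrow> 'm) set" where
  "runit S F \<equiv> rmod_trans S (ltens S F) (id_modfun S)"

text \<open>The counit half of condition (IV) in the notion of adjunction, isolated from any dual
  pair and with the associator written out.\<close>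

definition balanced :: "('k,'o,'m,'y) sgcat_scheme \<Rightarrow> 'o \<Rightarrow> ('o \<Rightarrow> 'm) \<Rightarrow> ('o \<Rightarrow> 'm) \<Rightarrow> bool" where
  "balanced S F t s \<longleftrightarrow>
     (\<forall>H\<in>Obj S. \<forall>L\<in>Obj S. (Ide S H \<diamondop>\<^bsub>S\<^esub> s L) \<cdot>\<^bsub>S\<^esub> asc S H F L = t H \<diamondop>\<^bsub>S\<^esub> Ide S L)"

text \<open>The part of a dual pair \<open>(Z, Y)\<close>, with \<open>W = Y \<box> Z\<close>, needed to cancel an object on the left.\<close>

definition left_cancel ::
  "('k,'o,'m,'y) sgcat_scheme \<Rightarrow> 'o \<Rightarrow> 'o \<Rightarrow> ('o \<Rightarrow> 'm) \<Rightarrow> ('o \<Rightarrow> 'm) \<Rightarrow> 'm \<Rightarrow> bool" where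
  "left_cancel S Y W \<eta>l \<eta>r e \<longleftrightarrow> W \<in> Obj S \<and> e \<in> hom_set S (W \<box>\<^bsub>S\<^esub> Y) Y \<and>
     (\<forall>H\<in>Obj S. \<eta>l H \<in> hom_set S H (H \<box>\<^bsub>S\<^esub> W)) \<and>
     (\<forall>H\<in>Obj S. \<eta>r H \<in> hom_set S H (W \<box>\<^bsub>S\<^esub> H)) \<and>
     (\<forall>f\<in>Arr S. \<eta>l (Cod S f) \<cdot>\<^bsub>S\<^esub> f = (f \<diamondop>\<^bsub>S\<^esub> Ide S W) \<cdot>\<^bsub>S\<^esub> \<eta>l (Dom S f)) \<and>
     (\<forall>f\<in>Arr S. \<eta>r (Cod S f) \<cdot>\<^bsub>S\<^esub> f = (Ide S W \<diamondop>\<^bsub>S\<^esub> f) \<cdot>\<^bsub>S\<^esub> \<eta>r (Dom S f)) \<and>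
     (\<forall>H\<in>Obj S. \<forall>L\<in>Obj S. Ide S H \<diamondop>\<^bsub>S\<^esub> \<eta>r L = asc S H W L \<cdot>\<^bsub>S\<^esub> (\<eta>l H \<diamondop>\<^bsub>S\<^esub> Ide S L)) \<and>
     e \<cdot>\<^bsub>S\<^esub> \<eta>r Y = Ide S Y"

lemma runit_reverse: "runit S F = lunit (reverse_sg S) F"
  by (simp add: rmod_trans_reverse swap_mf_eqs)

context semigroup_category
begin

lemma lunitD:
  assumes "t \<in> lunit S F" "F \<in> Obj S"
  shows "t \<in> extensional (Obj S)"
    and "X \<in> Obj S \<Longrightarrow> t X \<in> Arr S" "X \<in> Obj S \<Longrightarrow> Dom S (t X) = X \<box> F" "X \<in> Obj S \<Longrightarrow> Cod S (t X) = X"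
    and "f \<in> Arr S \<Longrightarrow> t (Cod S f) \<cdot> (f \<diamondop> Ide S F) = f \<cdot> t (Dom S f)"
    and "X \<in> Obj S \<Longrightarrow> M \<in> Obj S \<Longrightarrow> t (X \<box> M) = (Ide S X \<diamondop> t M) \<cdot> asc S X M F"
proof -
  note n = nat_transD[OF lmod_transD(1)[OF assms(1)], simplified]
  show "t \<in> extensional (Obj S)" "X \<in> Obj S \<Longrightarrow> t X \<in> Arr S" "X \<in> Obj S \<Longrightarrow> Dom S (t X) = X \<box> F"
    "X \<in> Obj S \<Longrightarrow> Cod S (t X) = X"
    "f \<in> Arr S \<Longrightarrow> t (Cod S f) \<cdot> (f \<diamondop> Ide S F) = f \<cdot> t (Dom S f)"
    by (simp_all add: n)
  show "t (X \<box> M) = (Ide S X \<diamondop> t M) \<cdot> asc S X M F" if "X \<in> Obj S" "M \<in> Obj S"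
    using lmod_transD(2)[OF assms(1) that] that by (simp add: n)
qed

lemma lunitI:
  assumes "F \<in> Obj S" "t \<in> extensional (Obj S)"
    and t: "\<And>X. X \<in> Obj S \<Longrightarrow> t X \<in> Arr S" "\<And>X. X \<in> Obj S \<Longrightarrow> Dom S (t X) = X \<box> F"
      "\<And>X. X \<in> Obj S \<Longrightarrow> Cod S (t X) = X"
    and "\<And>f. f \<in> Arr S \<Longrightarrow> t (Cod S f) \<cdot> (f \<diamondop> Ide S F) = f \<cdot> t (Dom S f)"
    and "\<And>X M. X \<in> Obj S \<Longrightarrow> M \<in> Obj S \<Longrightarrow> t (X \<box> M) = (Ide S X \<diamondop> t M) \<cdot> asc S X M F"
  shows "t \<in> lunit S F"
proof -
  have "Ide S (X \<box> M) \<cdot> t (X \<box> M) = (Ide S X \<diamondop> t M) \<cdot> asc S X M F"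
    if "X \<in> Obj S" "M \<in> Obj S" for X M
    using assms(7)[OF that] t that by (metis Ide_left tobj_Obj)
  then show ?thesis
    using assms by (simp add: lmod_trans_def nat_trans_def hom_set_def)
qed

lemma runitD:
  assumes "s \<in> runit S F" "F \<in> Obj S"
  shows "s \<in> extensional (Obj S)"
    and "X \<in> Obj S \<Longrightarrow> s X \<in> Arr S" "X \<in> Obj S \<Longrightarrow> Dom S (s X) = F \<box> X" "X \<in> Obj S \<Longrightarrow> Cod S (s X) = X"
    and "f \<in> Arr S \<Longrightarrow> s (Cod S f) \<cdot> (Ide S F \<diamondop> f) = f \<cdot> s (Dom S f)"
    and "X \<in> Obj S \<Longrightarrow> M \<in> Obj S \<Longrightarrow> s (M \<box> X) = (s M \<diamondop> Ide S X) \<cdot> inv_arr S (asc S F M X)"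
  using semigroup_category.lunitD[OF reverse, of s F] assms by (simp_all add: runit_reverse)

lemma runitI:
  assumes "F \<in> Obj S" "s \<in> extensional (Obj S)"
    and "\<And>X. X \<in> Obj S \<Longrightarrow> s X \<in> Arr S" "\<And>X. X \<in> Obj S \<Longrightarrow> Dom S (s X) = F \<box> X"
      "\<And>X. X \<in> Obj S \<Longrightarrow> Cod S (s X) = X"
    and "\<And>f. f \<in> Arr S \<Longrightarrow> s (Cod S f) \<cdot> (Ide S F \<diamondop> f) = f \<cdot> s (Dom S f)"
    and "\<And>X M. X \<in> Obj S \<Longrightarrow> M \<in> Obj S \<Longrightarrow> s (M \<box> X) = (s M \<diamondop> Ide S X) \<cdot> inv_arr S (asc S F M X)"
  shows "s \<in> runit S F"
  unfolding runit_reverse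
  by (rule semigroup_category.lunitI[OF reverse]) (use assms in simp_all)

lemma balancedD:
  "balanced S F t s \<Longrightarrow> H \<in> Obj S \<Longrightarrow> L \<in> Obj S \<Longrightarrow>
     (Ide S H \<diamondop> s L) \<cdot> asc S H F L = t H \<diamondop> Ide S L"
  by (simp add: balanced_def)

text \<open>Reversal exchanges \<open>t\<close> and \<open>s\<close> and replaces the associator by
  its inverse, which moves across the equation because it is invertible.\<close>

lemma balanced_reverse:
  assumes "F \<in> Obj S" "s \<in> runit S F" "t \<in> lunit S F"
  shows "balanced (reverse_sg S) F s t \<longleftrightarrow> balanced S F t s"
proof -
  note s = runitD[OF assms(2,1)] and t = lunitD[OF assms(3,1)]
  have "(t H \<diamondop> Ide S L) \<cdot> inv_arr S (asc S H F L) = Ide S H \<diamondop> s L \<longleftrightarrow>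
      (Ide S H \<diamondop> s L) \<cdot> asc S H F L = t H \<diamondop> Ide S L" (is "?a = ?b \<longleftrightarrow> ?c = ?d")
    if "H \<in> Obj S" "L \<in> Obj S" for H L
  proof
    assume "?a = ?b"
    then have "?c = ?a \<cdot> asc S H F L" by simp
    then show "?c = ?d" using that assms(1) by (simp add: t)
  next
    assume "?c = ?d"
    then have "?a = ?c \<cdot> inv_arr S (asc S H F L)" by simp
    then show "?a = ?b" using that assms(1) by (simp add: s)
  qed
  then show ?thesis by (auto simp: balanced_def)
qed

text \<open>In contrast to \<open>runit_reverse\<close>, the functors themselves need not coincide:
  over \<open>reverse_sg\<close> the structure maps of \<open>ltens\<close> are double inverses of
  associators, known to equal the associators only on objects.\<close>

lemma lunit_reverse: "F \<in> Obj S \<Longrightarrow> runit (reverse_sg S) F = lunit S F"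
  by (auto simp: rmod_trans_def lmod_trans_def nat_trans_def inv_inv_arr)

lemma balanced_inv:
  assumes "balanced S F t s" "F \<in> Obj S" "s \<in> runit S F" "t \<in> lunit S F" "H \<in> Obj S" "L \<in> Obj S"
  shows "Ide S H \<diamondop> s L = (t H \<diamondop> Ide S L) \<cdot> inv_arr S (asc S H F L)"
  using assms by (simp flip: balancedD[OF assms(1,5,6)] add: runitD[OF assms(3,2)])

lemma left_cancelD:
  assumes "left_cancel S Y W \<eta>l \<eta>r e"
  shows "W \<in> Obj S" "e \<in> Arr S" "Dom S e = W \<box> Y" "Cod S e = Y"
    "H \<in> Obj S \<Longrightarrow> \<eta>l H \<in> Arr S" "H \<in> Obj S \<Longrightarrow> Dom S (\<eta>l H) = H" "H \<in> Obj S \<Longrightarrow> Cod S (\<eta>l H) = H \<box> W"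
    "H \<in> Obj S \<Longrightarrow> \<eta>r H \<in> Arr S" "H \<in> Obj S \<Longrightarrow> Dom S (\<eta>r H) = H" "H \<in> Obj S \<Longrightarrow> Cod S (\<eta>r H) = W \<box> H"
    "f \<in> Arr S \<Longrightarrow> \<eta>l (Cod S f) \<cdot> f = (f \<diamondop> Ide S W) \<cdot> \<eta>l (Dom S f)"
    "f \<in> Arr S \<Longrightarrow> \<eta>r (Cod S f) \<cdot> f = (Ide S W \<diamondop> f) \<cdot> \<eta>r (Dom S f)"
    "H \<in> Obj S \<Longrightarrow> L \<in> Obj S \<Longrightarrow> Ide S H \<diamondop> \<eta>r L = asc S H W L \<cdot> (\<eta>l H \<diamondop> Ide S L)"
    "e \<cdot> \<eta>r Y = Ide S Y"
  using assms by (auto simp: left_cancel_def hom_set_def)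

text \<open>Naturality of \<open>\<eta>r\<close> and the retraction \<open>e\<close> recover an
  arrow \<open>h\<close> into \<open>Y\<close> from \<open>W \<box> h\<close> by
  \<open>h = e \<cdot> (W \<box> h) \<cdot> \<eta>r X\<close>.\<close>

lemma left_cancel_faithful:
  assumes "left_cancel S Y W \<eta>l \<eta>r e"
    and f: "f \<in> Arr S" "Dom S f = X" "Cod S f = Y" and g: "g \<in> Arr S" "Dom S g = X" "Cod S g = Y"
    and eq: "\<And>H. H \<in> Obj S \<Longrightarrow> Ide S H \<diamondop> f = Ide S H \<diamondop> g"
  shows "f = g"
proof -
  note c = left_cancelD[OF assms(1)]
  have Y: "Y \<in> Obj S" and X: "X \<in> Obj S" using f by auto
  have *: "h = e \<cdot> (Ide S W \<diamondop> h) \<cdot> \<eta>r X" if h: "h \<in> Arr S" "Dom S h = X" "Cod S h = Y" for h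
  proof -
    have "h = (e \<cdot> \<eta>r Y) \<cdot> h" using h Y by (simp only: c(14) Ide_left)
    also have "\<dots> = e \<cdot> \<eta>r Y \<cdot> h" using h Y by (simp add: c(1-10))
    also have "\<eta>r Y \<cdot> h = (Ide S W \<diamondop> h) \<cdot> \<eta>r X" using c(12)[OF h(1)] h by simp
    finally show ?thesis .
  qed
  show ?thesis
    using *[OF f] *[OF g] eq[OF c(1)] by simp
qed

text \<open>The arrow \<open>s = e \<cdot> (t \<^sub>W \<box> Y) \<cdot> \<eta>r\<close>, associators omitted, satisfies \<open>H \<box> s = t \<^sub>H \<box> Y\<close>.\<close>

lemma partner_component:
  assumes "left_cancel S Y W \<eta>l \<eta>r e" and F: "F \<in> Obj S" and Y: "Y \<in> Obj S" and t: "t \<in> lunit S F"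
  shows "\<exists>s. s \<in> Arr S \<and> Dom S s = F \<box> Y \<and> Cod S s = Y \<and>
    (\<forall>H\<in>Obj S. (Ide S H \<diamondop> s) \<cdot> asc S H F Y = t H \<diamondop> Ide S Y)"
proof (intro exI conjI ballI)
  note c = left_cancelD[OF assms(1)] and t' = lunitD[OF t F]
  let ?s = "e \<cdot> (t W \<diamondop> Ide S Y) \<cdot> inv_arr S (asc S W F Y) \<cdot> \<eta>r (F \<box> Y)"
  show "?s \<in> Arr S" "Dom S ?s = F \<box> Y" "Cod S ?s = Y"
    using F Y by (simp_all add: c(1-10) t')
  fix H assume H: "H \<in> Obj S"
  note ty = c(1-10) t'(2-4) F Y H
  let ?I = "Ide S H"
  have pent: "(?I \<diamondop> inv_arr S (asc S W F Y)) \<cdot> asc S H W (F \<box> Y) \<cdot> asc S (H \<box> W) F Y =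
      asc S H (W \<box> F) Y \<cdot> (asc S H W F \<diamondop> Ide S Y)"
    using ty by (simp add: pentagon merge)
  have "(?I \<diamondop> ?s) \<cdot> asc S H F Y = (?I \<diamondop> e) \<cdot> (?I \<diamondop> (t W \<diamondop> Ide S Y)) \<cdot>
      (?I \<diamondop> inv_arr S (asc S W F Y)) \<cdot> (?I \<diamondop> \<eta>r (F \<box> Y)) \<cdot> asc S H F Y"
    using ty by (simp add: merge)
  \<comment> \<open>The relation between the two units replaces insertion of \<open>W\<close> to the
    left of \<open>F \<box> Y\<close> by insertion to the right of \<open>H\<close>, where
    \<open>t\<close> can be applied to \<open>H \<box> W\<close>.\<close>
  also have "(?I \<diamondop> \<eta>r (F \<box> Y)) \<cdot> asc S H F Y =
      asc S H W (F \<box> Y) \<cdot> (\<eta>l H \<diamondop> (Ide S F \<diamondop> Ide S Y)) \<cdot> asc S H F Y"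
    using ty by (simp add: c(13))
  also have "(\<eta>l H \<diamondop> (Ide S F \<diamondop> Ide S Y)) \<cdot> asc S H F Y =
      asc S (H \<box> W) F Y \<cdot> ((\<eta>l H \<diamondop> Ide S F) \<diamondop> Ide S Y)"
    by (rule asc_nat[symmetric]) (use ty in simp_all)
  also have "(?I \<diamondop> inv_arr S (asc S W F Y)) \<cdot> asc S H W (F \<box> Y) \<cdot> asc S (H \<box> W) F Y \<cdot>
      ((\<eta>l H \<diamondop> Ide S F) \<diamondop> Ide S Y) =
      asc S H (W \<box> F) Y \<cdot> ((asc S H W F \<cdot> (\<eta>l H \<diamondop> Ide S F)) \<diamondop> Ide S Y)"
    using arg_cong[OF pent, of "\<lambda>x. x \<cdot> ((\<eta>l H \<diamondop> Ide S F) \<diamondop> Ide S Y)"] ty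
    by (simp add: merge)
  also have "(?I \<diamondop> (t W \<diamondop> Ide S Y)) \<cdot> asc S H (W \<box> F) Y \<cdot>
      ((asc S H W F \<cdot> (\<eta>l H \<diamondop> Ide S F)) \<diamondop> Ide S Y) =
      (asc S H W Y \<cdot> ((?I \<diamondop> t W) \<diamondop> Ide S Y)) \<cdot>
      ((asc S H W F \<cdot> (\<eta>l H \<diamondop> Ide S F)) \<diamondop> Ide S Y)"
    by (subst asc_nat[of ?I "t W" "Ide S Y" H H "W \<box> F" W Y Y]) (use ty in simp_all)
  also have "\<dots> = asc S H W Y \<cdot> ((((?I \<diamondop> t W) \<cdot> asc S H W F) \<cdot> (\<eta>l H \<diamondop> Ide S F)) \<diamondop> Ide S Y)"
    using ty by (simp add: merge)
  also have "(?I \<diamondop> t W) \<cdot> asc S H W F = t (H \<box> W)"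
    using t'(6) ty by simp
  \<comment> \<open>Naturality of \<open>t\<close> along \<open>\<eta>l H\<close> puts
    \<open>t H\<close> first. The inserted \<open>W\<close> then stands next to \<open>Y\<close> and
    is removed by going back to \<open>\<eta>r Y\<close> and applying \<open>e\<close>.\<close>
  also have "t (H \<box> W) \<cdot> (\<eta>l H \<diamondop> Ide S F) = \<eta>l H \<cdot> t H"
    using t'(5)[of "\<eta>l H"] ty by simp
  also have "(?I \<diamondop> e) \<cdot> asc S H W Y \<cdot> ((\<eta>l H \<cdot> t H) \<diamondop> Ide S Y) =
      (?I \<diamondop> e) \<cdot> (asc S H W Y \<cdot> (\<eta>l H \<diamondop> Ide S Y)) \<cdot> (t H \<diamondop> Ide S Y)"
    using ty by (simp add: merge)
  also have "asc S H W Y \<cdot> (\<eta>l H \<diamondop> Ide S Y) = ?I \<diamondop> \<eta>r Y"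
    using c(13) ty by simp
  also have "(?I \<diamondop> e) \<cdot> (?I \<diamondop> \<eta>r Y) \<cdot> (t H \<diamondop> Ide S Y) = t H \<diamondop> Ide S Y"
    using ty by (simp add: merge c(14))
  finally show "(?I \<diamondop> ?s) \<cdot> asc S H F Y = t H \<diamondop> Ide S Y" .
qed

text \<open>The components are chosen object by object. Tensoring with all \<open>H\<close> on the
  left is faithful and turns \<open>s\<close> into \<open>t H \<box> -\<close>, so naturality and
  the module condition of \<open>s\<close> reduce to facts about the tensor product alone.\<close>

lemma partner_exists:
  assumes lc: "\<And>Y. Y \<in> Obj S \<Longrightarrow> \<exists>W \<eta>l \<eta>r e. left_cancel S Y W \<eta>l \<eta>r e"
    and F: "F \<in> Obj S" and t: "t \<in> lunit S F"
  shows "\<exists>s\<in>runit S F. balanced S F t s"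
proof -
  note t' = lunitD[OF t F]
  have "\<forall>Y\<in>Obj S. \<exists>s. s \<in> Arr S \<and> Dom S s = F \<box> Y \<and> Cod S s = Y \<and>
    (\<forall>H\<in>Obj S. (Ide S H \<diamondop> s) \<cdot> asc S H F Y = t H \<diamondop> Ide S Y)"
    using partner_component[OF _ F _ t] lc by blast
  from bchoice[OF this] obtain s0 where s0: "\<And>Y. Y \<in> Obj S \<Longrightarrow> s0 Y \<in> Arr S"
    "\<And>Y. Y \<in> Obj S \<Longrightarrow> Dom S (s0 Y) = F \<box> Y" "\<And>Y. Y \<in> Obj S \<Longrightarrow> Cod S (s0 Y) = Y"
    "\<And>Y H. Y \<in> Obj S \<Longrightarrow> H \<in> Obj S \<Longrightarrow> (Ide S H \<diamondop> s0 Y) \<cdot> asc S H F Y = t H \<diamondop> Ide S Y"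
    by blast
  have w: "Ide S H \<diamondop> s0 Y = (t H \<diamondop> Ide S Y) \<cdot> inv_arr S (asc S H F Y)"
    if "Y \<in> Obj S" "H \<in> Obj S" for Y H
    using that F by (simp flip: s0(4) add: s0(1-3))
  \<comment> \<open>The cancelling data may depend on the common codomain, so they are chosen for
    each pair of arrows separately.\<close>
  have faithful: "f = g" if "f \<in> Arr S" "g \<in> Arr S" "Dom S f = Dom S g" "Cod S f = Cod S g"
    "\<And>H. H \<in> Obj S \<Longrightarrow> Ide S H \<diamondop> f = Ide S H \<diamondop> g" for f g
  proof -
    from lc[OF Cod_Obj[OF that(1)]] obtain W \<eta>l \<eta>r e where "left_cancel S (Cod S f) W \<eta>l \<eta>r e" by blast
    then show ?thesis
      by (rule left_cancel_faithful[OF _ that(1) refl refl that(2)]) (use that in simp_all)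
  qed
  have "restrict s0 (Obj S) \<in> runit S F"
  proof (rule runitI)
    fix f assume f: "f \<in> Arr S"
    have "s0 (Cod S f) \<cdot> (Ide S F \<diamondop> f) = f \<cdot> s0 (Dom S f)"
    proof (rule faithful)
      fix H assume H: "H \<in> Obj S"
      have "Ide S H \<diamondop> (s0 (Cod S f) \<cdot> (Ide S F \<diamondop> f)) =
          (Ide S H \<diamondop> s0 (Cod S f)) \<cdot> (Ide S H \<diamondop> (Ide S F \<diamondop> f))"
        using f F H by (simp add: merge s0)
      also have "\<dots> = (t H \<diamondop> Ide S (Cod S f)) \<cdot> inv_arr S (asc S H F (Cod S f)) \<cdot> (Ide S H \<diamondop> (Ide S F \<diamondop> f))"
        using f F H by (simp add: w t')
      also have "inv_arr S (asc S H F (Cod S f)) \<cdot> (Ide S H \<diamondop> (Ide S F \<diamondop> f)) =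
          ((Ide S H \<diamondop> Ide S F) \<diamondop> f) \<cdot> inv_arr S (asc S H F (Dom S f))"
        by (rule inv_asc_nat) (use f F H in simp_all)
      also have "(t H \<diamondop> Ide S (Cod S f)) \<cdot> \<dots> = (Ide S H \<diamondop> f) \<cdot> (t H \<diamondop> Ide S (Dom S f)) \<cdot> inv_arr S (asc S H F (Dom S f))"
        using f F H by (simp add: merge t')
      also have "\<dots> = (Ide S H \<diamondop> f) \<cdot> (Ide S H \<diamondop> s0 (Dom S f))"
        using f F H by (simp add: w)
      also have "\<dots> = Ide S H \<diamondop> (f \<cdot> s0 (Dom S f))"
        using f F H by (simp add: merge s0)
      finally show "Ide S H \<diamondop> (s0 (Cod S f) \<cdot> (Ide S F \<diamondop> f)) = Ide S H \<diamondop> (f \<cdot> s0 (Dom S f))" .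
    qed (use f F in \<open>simp_all add: s0\<close>)
    then show "restrict s0 (Obj S) (Cod S f) \<cdot> (Ide S F \<diamondop> f) = f \<cdot> restrict s0 (Obj S) (Dom S f)"
      using f by simp
  next
    fix X M assume X: "X \<in> Obj S" and M: "M \<in> Obj S"
    \<comment> \<open>After tensoring with \<open>H\<close>, both sides are \<open>t H\<close>
      tensored with \<open>M\<close> and \<open>X\<close> in two bracketings, and the inverse
      pentagon relates these.\<close>
    have "s0 (M \<box> X) = (s0 M \<diamondop> Ide S X) \<cdot> inv_arr S (asc S F M X)"
    proof (rule faithful)
      fix H assume H: "H \<in> Obj S"
      note ty = H X M F s0(1-3) t'(2-4)
      have "(Ide S H \<diamondop> s0 (M \<box> X)) = (t H \<diamondop> (Ide S M \<diamondop> Ide S X)) \<cdot> inv_arr S (asc S H F (M \<box> X))"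
        using w ty by simp
      also have "\<dots> = (asc S H M X \<cdot> inv_arr S (asc S H M X)) \<cdot> (t H \<diamondop> (Ide S M \<diamondop> Ide S X)) \<cdot> inv_arr S (asc S H F (M \<box> X))"
        using ty by simp
      also have "\<dots> = asc S H M X \<cdot> (inv_arr S (asc S H M X) \<cdot> (t H \<diamondop> (Ide S M \<diamondop> Ide S X))) \<cdot> inv_arr S (asc S H F (M \<box> X))"
        using ty by simp
      also have "inv_arr S (asc S H M X) \<cdot> (t H \<diamondop> (Ide S M \<diamondop> Ide S X)) =
          ((t H \<diamondop> Ide S M) \<diamondop> Ide S X) \<cdot> inv_arr S (asc S (H \<box> F) M X)"
        by (rule inv_asc_nat) (use ty in simp_all)
      also have "asc S H M X \<cdot> (((t H \<diamondop> Ide S M) \<diamondop> Ide S X) \<cdot> inv_arr S (asc S (H \<box> F) M X)) \<cdot> inv_arr S (asc S H F (M \<box> X)) =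
          asc S H M X \<cdot> ((t H \<diamondop> Ide S M) \<diamondop> Ide S X) \<cdot>
            inv_arr S (asc S (H \<box> F) M X) \<cdot> inv_arr S (asc S H F (M \<box> X))"
        using ty by simp
      also have "\<dots> = asc S H M X \<cdot> (((t H \<diamondop> Ide S M) \<cdot> inv_arr S (asc S H F M)) \<diamondop> Ide S X) \<cdot>
          inv_arr S (asc S H (F \<box> M) X) \<cdot> (Ide S H \<diamondop> inv_arr S (asc S F M X))"
        using ty by (simp add: inv_pentagon merge)
      also have "\<dots> = (asc S H M X \<cdot> ((Ide S H \<diamondop> s0 M) \<diamondop> Ide S X)) \<cdot>
          inv_arr S (asc S H (F \<box> M) X) \<cdot> (Ide S H \<diamondop> inv_arr S (asc S F M X))"
        using ty by (simp add: w)
      also have "asc S H M X \<cdot> ((Ide S H \<diamondop> s0 M) \<diamondop> Ide S X) =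
          (Ide S H \<diamondop> (s0 M \<diamondop> Ide S X)) \<cdot> asc S H (F \<box> M) X"
        by (rule asc_nat) (use ty in simp_all)
      also have "((Ide S H \<diamondop> (s0 M \<diamondop> Ide S X)) \<cdot> asc S H (F \<box> M) X) \<cdot>
          inv_arr S (asc S H (F \<box> M) X) \<cdot> (Ide S H \<diamondop> inv_arr S (asc S F M X)) =
          Ide S H \<diamondop> ((s0 M \<diamondop> Ide S X) \<cdot> inv_arr S (asc S F M X))"
        using ty by (simp add: merge)
      finally show "Ide S H \<diamondop> s0 (M \<box> X) = Ide S H \<diamondop> ((s0 M \<diamondop> Ide S X) \<cdot> inv_arr S (asc S F M X))" .
    qed (use X M F in \<open>simp_all add: s0\<close>)
    then show "restrict s0 (Obj S) (M \<box> X) =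
        (restrict s0 (Obj S) M \<diamondop> Ide S X) \<cdot> inv_arr S (asc S F M X)"
      using X M by simp
  qed (use F in \<open>simp_all add: s0\<close>)
  moreover have "balanced S F t (restrict s0 (Obj S))"
    by (simp add: balanced_def s0)
  ultimately show ?thesis by blast
qed

text \<open>Balance prescribes \<open>H \<box> s Y\<close> for every \<open>H\<close>, and an arrow
  into \<open>Y\<close> is determined by these tensors.\<close>

lemma balanced_unique:
  assumes lc: "\<And>Y. Y \<in> Obj S \<Longrightarrow> \<exists>W \<eta>l \<eta>r e. left_cancel S Y W \<eta>l \<eta>r e"
    and F: "F \<in> Obj S" and t: "t \<in> lunit S F"
    and s: "s \<in> runit S F" "balanced S F t s" and s': "s' \<in> runit S F" "balanced S F t s'"
  shows "s = s'"
proof (rule extensionalityI)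
  note d = runitD[OF s(1) F] and d' = runitD[OF s'(1) F]
  show "s \<in> extensional (Obj S)" "s' \<in> extensional (Obj S)" by (rule d(1) d'(1))+
  fix Y assume Y: "Y \<in> Obj S"
  from lc[OF Y] obtain W \<eta>l \<eta>r e where c: "left_cancel S Y W \<eta>l \<eta>r e" by blast
  show "s Y = s' Y"
    by (rule left_cancel_faithful[OF c, of _ "F \<box> Y"])
      (use Y in \<open>simp_all add: d d' balanced_inv[OF s(2) F s(1) t] balanced_inv[OF s'(2) F s'(1) t]\<close>)
qed

text \<open>Up to an associator both sides are the naturality square of \<open>u\<close> at the
  arrow \<open>t A\<close>. It says that restricting \<open>u\<close> along \<open>s M\<close>
  equals restricting \<open>t\<close> along \<open>u L\<close>, an exchange on which the inverses of
  the unitors rest.\<close>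

lemma balanced_commute_left:
  assumes "balanced S L t s" "L \<in> Obj S" "M \<in> Obj S" "t \<in> lunit S L" "s \<in> runit S L" "u \<in> lunit S M" "A \<in> Obj S"
  shows "u A \<cdot> (Ide S A \<diamondop> s M) = t A \<cdot> (Ide S A \<diamondop> u L)"
proof (rule iso_cancel_right)
  note t = lunitD[OF assms(4,2)] and s = runitD[OF assms(5,2)] and u = lunitD[OF assms(6,3)]
  note o = assms(2,3,7)
  show "iso_arr S (asc S A L M)" using o by simp
  have "(u A \<cdot> (Ide S A \<diamondop> s M)) \<cdot> asc S A L M = u A \<cdot> (t A \<diamondop> Ide S M)"
    using o by (simp add: s u flip: balancedD[OF assms(1)])
  also have "\<dots> = t A \<cdot> (Ide S A \<diamondop> u L) \<cdot> asc S A L M"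
    using u(5)[of "t A"] u(6)[of A L] o by (simp add: t)
  also have "\<dots> = (t A \<cdot> (Ide S A \<diamondop> u L)) \<cdot> asc S A L M" using o by (simp add: t u)
  finally show "(u A \<cdot> (Ide S A \<diamondop> s M)) \<cdot> asc S A L M = (t A \<cdot> (Ide S A \<diamondop> u L)) \<cdot> asc S A L M" .
qed (use assms lunitD[OF assms(4,2)] runitD[OF assms(5,2)] lunitD[OF assms(6,3)] in \<open>simp_all del: Cmp_assoc_Arr\<close>)

text \<open>The same exchange with the roles of the two transformations interchanged, so that the
  balanced one is now \<open>u\<close>.\<close>

lemma balanced_commute_right:
  assumes "balanced S M u e" "L \<in> Obj S" "M \<in> Obj S" "t \<in> lunit S L" "e \<in> runit S M" "u \<in> lunit S M" "A \<in> Obj S"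
  shows "u A \<cdot> (Ide S A \<diamondop> t M) = t A \<cdot> (Ide S A \<diamondop> e L)"
  using balanced_commute_left[OF assms(1,3,2,6,5,4,7)] by simp

end

section \<open>Dual pairs and cancellation in a rigid semigroup category\<close>

lemma (in semigroup_category) sg_adjunctionD:
  assumes "sg_adjunction K S F G \<eta>l \<eta>r \<epsilon>l \<epsilon>r"
  shows "F \<in> Obj S" "G \<in> Obj S"
    "\<eta>l \<in> lmod_trans S (id_modfun S) (rtens S (G \<box> F))"
    "\<epsilon>l \<in> lunit S (F \<box> G)" "\<eta>r \<in> rmod_trans S (id_modfun S) (ltens S (G \<box> F))" "\<epsilon>r \<in> runit S (F \<box> G)"
    "X \<in> Obj S \<Longrightarrow> (\<epsilon>l (X \<box> G) \<cdot> asc S (X \<box> G) F G) \<cdot>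
           ((inv_arr S (asc S X G F) \<cdot> \<eta>l X) \<diamondop> Ide S G) = Ide S (X \<box> G)"
    "X \<in> Obj S \<Longrightarrow> ((\<epsilon>l X \<cdot> asc S X F G) \<diamondop> Ide S F) \<cdot>
           inv_arr S (asc S (X \<box> F) G F) \<cdot> \<eta>l (X \<box> F) = Ide S (X \<box> F)"
    "X \<in> Obj S \<Longrightarrow> (\<epsilon>r (F \<box> X) \<cdot> inv_arr S (asc S F G (F \<box> X))) \<cdot>
           (Ide S F \<diamondop> (asc S G F X \<cdot> \<eta>r X)) = Ide S (F \<box> X)"
    "X \<in> Obj S \<Longrightarrow> (Ide S G \<diamondop> (\<epsilon>r X \<cdot> inv_arr S (asc S F G X))) \<cdot>
           asc S G F (G \<box> X) \<cdot> \<eta>r (G \<box> X) = Ide S (G \<box> X)"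
    "\<epsilon>r F \<cdot> inv_arr S (asc S F G F) \<cdot> \<eta>l F = Ide S F"
    "\<epsilon>l G \<cdot> asc S G F G \<cdot> \<eta>r G = Ide S G"
    "H \<in> Obj S \<Longrightarrow> L \<in> Obj S \<Longrightarrow>
           Ide S H \<diamondop> \<eta>r L = asc S H (G \<box> F) L \<cdot> (\<eta>l H \<diamondop> Ide S L)"
    "balanced S (F \<box> G) \<epsilon>l \<epsilon>r"
  using assms by (auto simp: sg_adjunction_def lmod_adjunction_def rmod_adjunction_def balanced_def)

lemma (in semigroup_category) \<eta>lD:
  assumes "\<eta> \<in> lmod_trans S (id_modfun S) (rtens S W)" "W \<in> Obj S"
  shows "X \<in> Obj S \<Longrightarrow> \<eta> X \<in> Arr S" "X \<in> Obj S \<Longrightarrow> Dom S (\<eta> X) = X" "X \<in> Obj S \<Longrightarrow> Cod S (\<eta> X) = X \<box> W"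
    "f \<in> Arr S \<Longrightarrow> \<eta> (Cod S f) \<cdot> f = (f \<diamondop> Ide S W) \<cdot> \<eta> (Dom S f)"
    "X \<in> Obj S \<Longrightarrow> M \<in> Obj S \<Longrightarrow> asc S X M W \<cdot> \<eta> (X \<box> M) = Ide S X \<diamondop> \<eta> M"
proof -
  note n = nat_transD[OF lmod_transD(1)[OF assms(1)], simplified]
  show "X \<in> Obj S \<Longrightarrow> \<eta> X \<in> Arr S" "X \<in> Obj S \<Longrightarrow> Dom S (\<eta> X) = X" "X \<in> Obj S \<Longrightarrow> Cod S (\<eta> X) = X \<box> W"
    "f \<in> Arr S \<Longrightarrow> \<eta> (Cod S f) \<cdot> f = (f \<diamondop> Ide S W) \<cdot> \<eta> (Dom S f)"
    by (simp_all add: n)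
  show "asc S X M W \<cdot> \<eta> (X \<box> M) = Ide S X \<diamondop> \<eta> M" if "X \<in> Obj S" "M \<in> Obj S"
    using lmod_transD(2)[OF assms(1) that] that assms(2) by (simp add: n)
qed

lemma (in semigroup_category) \<eta>rD:
  assumes "\<eta> \<in> rmod_trans S (id_modfun S) (ltens S W)" "W \<in> Obj S"
  shows "X \<in> Obj S \<Longrightarrow> \<eta> X \<in> Arr S" "X \<in> Obj S \<Longrightarrow> Dom S (\<eta> X) = X" "X \<in> Obj S \<Longrightarrow> Cod S (\<eta> X) = W \<box> X"
    "f \<in> Arr S \<Longrightarrow> \<eta> (Cod S f) \<cdot> f = (Ide S W \<diamondop> f) \<cdot> \<eta> (Dom S f)"
    "X \<in> Obj S \<Longrightarrow> M \<in> Obj S \<Longrightarrow> inv_arr S (asc S W M X) \<cdot> \<eta> (M \<box> X) = \<eta> M \<diamondop> Ide S X"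
  using semigroup_category.\<eta>lD[OF reverse, of \<eta> W] assms by (simp_all add: rmod_trans_reverse swap_mf_eqs)

locale rigid_sg = semigroup_category K S for K :: "('k,'x) ring_scheme" and S :: "('k,'o,'m,'y) sgcat_scheme" +
  assumes rigid: "rigid K S"
begin

lemma duals:
  assumes "F \<in> Obj S"
  shows "\<exists>G \<eta>l \<eta>r \<epsilon>l \<epsilon>r. sg_adjunction K S F G \<eta>l \<eta>r \<epsilon>l \<epsilon>r"
    "\<exists>G \<eta>l \<eta>r \<epsilon>l \<epsilon>r. sg_adjunction K S G F \<eta>l \<eta>r \<epsilon>l \<epsilon>r"
  using rigid assms by (auto simp: rigid_def rigid_object_def is_right_dual_def)

text \<open>A left dual \<open>Z\<close> of \<open>Y\<close> gives \<open>W = Y \<box> Z\<close>;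
  the retraction onto \<open>Y\<close> is the second equation of condition (III).\<close>

lemma left_cancel_exists:
  assumes "Y \<in> Obj S"
  shows "\<exists>W \<eta>l \<eta>r e. left_cancel S Y W \<eta>l \<eta>r e"
proof -
  obtain Z \<eta>l \<eta>r \<epsilon>l \<epsilon>r where a: "sg_adjunction K S Z Y \<eta>l \<eta>r \<epsilon>l \<epsilon>r" using duals[OF assms] by blast
  note d = sg_adjunctionD[OF a]
  have o: "Y \<box> Z \<in> Obj S" "Z \<box> Y \<in> Obj S" using d by simp_all
  note l = \<eta>lD[OF d(3) o(1)] and r = \<eta>rD[OF d(5) o(1)] and e = lunitD[OF d(4) o(2)]
  have "left_cancel S Y (Y \<box> Z) \<eta>l \<eta>r (\<epsilon>l Y \<cdot> asc S Y Z Y)"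
    using d(1,2,12,13) by (simp add: left_cancel_def hom_set_def l r e)
  then show ?thesis by blast
qed

text \<open>A right dual \<open>Z\<close> of \<open>Y\<close> gives \<open>W = Z \<box> Y\<close>.
  The retraction is the first equation of condition (III), and the two units change places because
  the tensor product is reversed.\<close>

lemma right_cancel_exists:
  assumes "Y \<in> Obj S"
  shows "\<exists>W \<eta>l \<eta>r e. left_cancel (reverse_sg S) Y W \<eta>l \<eta>r e"
proof -
  obtain Z \<eta>l \<eta>r \<epsilon>l \<epsilon>r where a: "sg_adjunction K S Y Z \<eta>l \<eta>r \<epsilon>l \<epsilon>r" using duals[OF assms] by blast
  note d = sg_adjunctionD[OF a]
  have o: "Y \<box> Z \<in> Obj S" "Z \<box> Y \<in> Obj S" using d by simp_all
  note l = \<eta>lD[OF d(3) o(2)] and r = \<eta>rD[OF d(5) o(2)] and e = runitD[OF d(6) o(1)]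
  have "\<eta>l L \<diamondop> Ide S H = inv_arr S (asc S L (Z \<box> Y) H) \<cdot> (Ide S L \<diamondop> \<eta>r H)"
    if "H \<in> Obj S" "L \<in> Obj S" for H L
    using that o by (simp add: d(13) l r)
  then have "left_cancel (reverse_sg S) Y (Z \<box> Y) \<eta>r \<eta>l (\<epsilon>r Y \<cdot> inv_arr S (asc S Y Z Y))"
    using d(1,2,11) by (simp add: left_cancel_def hom_set_def l r e)
  then show ?thesis by blast
qed

lemma right_partner:
  assumes "F \<in> Obj S" "t \<in> lunit S F"
  shows "\<exists>!s. s \<in> runit S F \<and> balanced S F t s"
  using partner_exists[OF left_cancel_exists assms] balanced_unique[OF left_cancel_exists assms] by blast

text \<open>The construction of partners is applied over \<open>reverse_sg\<close>, where
  \<open>s\<close> counts as a left module transformation; cancellation on the other side comes from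
  the right duals.\<close>

lemma left_partner:
  assumes F: "F \<in> Obj S" and s: "s \<in> runit S F"
  shows "\<exists>!t. t \<in> lunit S F \<and> balanced S F t s"
proof -
  interpret R: semigroup_category K "reverse_sg S" by (rule reverse)
  have rev: "t \<in> runit (reverse_sg S) F \<and> balanced (reverse_sg S) F s t \<longleftrightarrow> t \<in> lunit S F \<and> balanced S F t s" for t
    using balanced_reverse[OF F s] by (auto simp: lunit_reverse[OF F])
  have "F \<in> Obj (reverse_sg S)" "s \<in> lunit (reverse_sg S) F" using F s by (simp_all add: runit_reverse)
  from R.partner_exists[OF _ this] R.balanced_unique[OF _ this] right_cancel_exists
  have "\<exists>!t. t \<in> runit (reverse_sg S) F \<and> balanced (reverse_sg S) F s t"
    by (metis reverse_sg_simps(1))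
  then show ?thesis unfolding rev .
qed

end

section \<open>Presheaves\<close>

text \<open>The first argument only fixes the target type \<open>'v\<close>, which does not occur in
  the type of the space.\<close>

definition fits :: "'v itself \<Rightarrow> ('k,'a) module \<Rightarrow> bool" where
  "fits _ V \<longleftrightarrow> (\<exists>e::'a \<Rightarrow> 'v. inj_on e (carrier V))"

lemma venc_inj:
  assumes "fits TYPE('v) V"
  shows "inj_on (venc V :: 'a \<Rightarrow> 'v) (carrier (V :: ('k,'a) module))"
  using assms unfolding fits_def venc_def by (rule someI_ex)

lemma vdec_venc [simp]:
  assumes "fits TYPE('v) V" "x \<in> carrier V"
  shows "vdec V (venc V x :: 'v) = x"
  unfolding vdec_def by (rule inv_into_f_f[OF venc_inj[OF assms(1)] assms(2)])

lemma carrier_vcopy: "carrier (vcopy V) = venc V ` carrier V"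
  by (simp add: vcopy_def)

lemma venc_closed: "x \<in> carrier V \<Longrightarrow> venc V x \<in> carrier (vcopy V)"
  by (simp add: carrier_vcopy)

lemma vcopyE:
  assumes "y \<in> carrier (vcopy V)"
  obtains x where "x \<in> carrier V" "y = venc V x"
  using assms by (auto simp: carrier_vcopy)

lemma vcopy_ops:
  assumes "fits TYPE('v) V"
  shows "\<zero>\<^bsub>vcopy V\<^esub> = (venc V \<zero>\<^bsub>V\<^esub> :: 'v)"
    and "x \<in> carrier V \<Longrightarrow> y \<in> carrier V \<Longrightarrow> (venc V x :: 'v) \<oplus>\<^bsub>vcopy V\<^esub> venc V y = venc V (x \<oplus>\<^bsub>V\<^esub> y)"
    and "x \<in> carrier V \<Longrightarrow> c \<odot>\<^bsub>vcopy V\<^esub> (venc V x :: 'v) = venc V (c \<odot>\<^bsub>V\<^esub> x)"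
  using assms by (simp_all add: vcopy_def)

lemma module_vcopy:
  fixes V :: "('k,'a) module"
  assumes fit: "fits TYPE('v) V" and V: "module K V"
  shows "module K (vcopy V :: ('k,'v) module)"
proof -
  interpret V: module K V by fact
  show ?thesis
    by (rule module_by_scalars)
      (auto elim!: vcopyE simp: V.R.is_cring vcopy_ops[OF fit] venc_closed V.M.a_ac
        V.smult_l_distr V.smult_r_distr V.smult_assoc1)
qed

text \<open>The operations of the copy are defined by transport along the encoding, which makes the
  encoding linear.\<close>

lemma linear_venc:
  assumes "fits TYPE('v) V"
  shows "linear_on K V (vcopy V :: ('k,'v) module) (venc V)"
  by (rule linear_onI) (simp_all add: vcopy_ops[OF assms] venc_closed)

lemma linear_vdec:
  assumes "fits TYPE('v) V" "module K V"
  shows "linear_on K (vcopy V :: ('k,'v) module) V (vdec V)"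
proof -
  interpret V: module K V by fact
  show ?thesis
    by (rule linear_onI) (auto elim!: vcopyE simp: vcopy_ops[OF assms(1)] assms(1))
qed

section \<open>Presheaves and their maps in terms of elements\<close>

abbreviation psh :: "('k,'x) ring_scheme \<Rightarrow> ('k,'o,'m,'y) lcat_scheme \<Rightarrow> ('k,'o,'m,'v) psh \<Rightarrow> bool" where
  "psh K C P \<equiv> lin_functor K (op_cat C) (vec_cat K) P"

abbreviation act :: "('k,'o,'m,'v) psh \<Rightarrow> 'm \<Rightarrow> 'v \<Rightarrow> 'v" where
  "act P h \<equiv> cpt (farr P h)"

abbreviation ap :: "('k,'o,'m,'v) pshmap \<Rightarrow> 'o \<Rightarrow> 'v \<Rightarrow> 'v" where
  "ap s X \<equiv> cpt (cpt s X)"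

lemma presheaf_cat_simps [simp]:
  "Obj (presheaf_cat K C) = {P. psh K C P}" "Dom (presheaf_cat K C) = src" "Cod (presheaf_cat K C) = tgt"
  by (simp_all add: presheaf_cat_def fun_cat_def)

context lin_category
begin

lemma lin_category_presheaf: "lin_category K (presheaf_cat K C)"
  unfolding presheaf_cat_def
  by (rule lin_category_fun_cat[OF lin_category_op lin_category_vec[OF field_axioms]])

text \<open>Functoriality translated to elements. The last clause, linearity in the arrow for a
  fixed element \<open>p\<close>, is what makes \<open>f \<mapsto> act P f p\<close> a linear map
  out of a representable presheaf.\<close>

lemma pshD:
  fixes P :: "('k,'o,'m,'v) psh"
  assumes "psh K C P"
  shows "A \<in> Obj C \<Longrightarrow> module K (fobj P A)"
    and "h \<in> Arr C \<Longrightarrow> farr P h = MArr (fobj P (Cod C h)) (fobj P (Dom C h)) (act P h)"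
    and "h \<in> Arr C \<Longrightarrow> linear_on K (fobj P (Cod C h)) (fobj P (Dom C h)) (act P h)"
    and "h \<in> Arr C \<Longrightarrow> act P h \<in> extensional (carrier (fobj P (Cod C h)))"
    and "h \<in> Arr C \<Longrightarrow> B = Cod C h \<Longrightarrow> p \<in> carrier (fobj P B) \<Longrightarrow> act P h p \<in> carrier (fobj P (Dom C h))"
    and "A \<in> Obj C \<Longrightarrow> p \<in> carrier (fobj P A) \<Longrightarrow> act P (Ide C A) p = p"
    and "f \<in> Arr C \<Longrightarrow> g \<in> Arr C \<Longrightarrow> Dom C g = Cod C f \<Longrightarrow> p \<in> carrier (fobj P (Cod C g)) \<Longrightarrow>
          act P (g \<cdot> f) p = act P f (act P g p)"
    and "A \<in> Obj C \<Longrightarrow> B \<in> Obj C \<Longrightarrow> p \<in> carrier (fobj P B) \<Longrightarrow>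
          linear_on K (Hom C A B) (fobj P A) (\<lambda>h. act P h p)"
proof -
  interpret P: lin_functor K "op_cat C" "vec_cat K" P by fact
  show m: "module K (fobj P A)" if "A \<in> Obj C" for A
    using P.fobj_closed[of A] that by simp
  have hs: "farr P h \<in> hom_set (vec_cat K) (fobj P (Cod C h)) (fobj P (Dom C h))" if "h \<in> Arr C" for h
    using P.farr_Arr[of h] that by (simp add: hom_set_def)
  show "h \<in> Arr C \<Longrightarrow> farr P h = MArr (fobj P (Cod C h)) (fobj P (Dom C h)) (act P h)" for h
    using hs[of h] by (simp add: vec_hom_set)
  show "h \<in> Arr C \<Longrightarrow> linear_on K (fobj P (Cod C h)) (fobj P (Dom C h)) (act P h)"
    "h \<in> Arr C \<Longrightarrow> act P h \<in> extensional (carrier (fobj P (Cod C h)))"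
    using vec_hom_linear(5,6)[OF hs] by auto
  show cl: "act P h p \<in> carrier (fobj P (Dom C h))"
    if "h \<in> Arr C" "B = Cod C h" "p \<in> carrier (fobj P B)" for h B p
    using vec_hom_linear(7)[OF hs[OF that(1)]] that by simp
  show "A \<in> Obj C \<Longrightarrow> p \<in> carrier (fobj P A) \<Longrightarrow> act P (Ide C A) p = p"
    using P.farr_Ide[of A] by simp
  show "act P (g \<cdot> f) p = act P f (act P g p)"
    if "f \<in> Arr C" "g \<in> Arr C" "Dom C g = Cod C f" "p \<in> carrier (fobj P (Cod C g))"
    using P.farr_Cmp_Arr[of g f] vec_hom_linear(3)[OF hs[OF that(2)]] that by simp
  show "linear_on K (Hom C A B) (fobj P A) (\<lambda>h. act P h p)"
    if "A \<in> Obj C" "B \<in> Obj C" "p \<in> carrier (fobj P B)"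
  proof (rule linear_onI)
    have lin: "linear_on K (Hom C A B) (Hom (vec_cat K) (fobj P B) (fobj P A)) (farr P)"
      using P.farr_linear[of B A] that by simp
    fix x assume x: "x \<in> carrier (Hom C A B)"
    note x' = Hom_Arr[OF that(1,2) x]
    show "act P x p \<in> carrier (fobj P A)" using cl[of x B p] x' that by simp
    show "act P (x \<oplus>\<^bsub>Hom C A B\<^esub> y) p = act P x p \<oplus>\<^bsub>fobj P A\<^esub> act P y p" if "y \<in> carrier (Hom C A B)" for y
      using linear_on_add[OF lin x that] \<open>p \<in> carrier (fobj P B)\<close> by simp
    show "act P (c \<odot>\<^bsub>Hom C A B\<^esub> x) p = c \<odot>\<^bsub>fobj P A\<^esub> act P x p" if "c \<in> carrier K" for c
      using linear_on_smult[OF lin that x] \<open>p \<in> carrier (fobj P B)\<close> by simp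
  qed
qed

lemma pshI:
  fixes P :: "('k,'o,'m,'v) psh"
  assumes m: "\<And>A. A \<in> Obj C \<Longrightarrow> module K (fobj P A)"
    and f: "\<And>h. h \<in> Arr C \<Longrightarrow> farr P h = MArr (fobj P (Cod C h)) (fobj P (Dom C h)) (act P h)"
    and l: "\<And>h. h \<in> Arr C \<Longrightarrow> linear_on K (fobj P (Cod C h)) (fobj P (Dom C h)) (act P h)"
    and e: "\<And>h. h \<in> Arr C \<Longrightarrow> act P h \<in> extensional (carrier (fobj P (Cod C h)))"
    and i: "\<And>A p. A \<in> Obj C \<Longrightarrow> p \<in> carrier (fobj P A) \<Longrightarrow> act P (Ide C A) p = p"
    and c: "\<And>f g p. f \<in> Arr C \<Longrightarrow> g \<in> Arr C \<Longrightarrow> Dom C g = Cod C f \<Longrightarrow> p \<in> carrier (fobj P (Cod C g)) \<Longrightarrow>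
          act P (g \<cdot> f) p = act P f (act P g p)"
    and ll: "\<And>A B p. A \<in> Obj C \<Longrightarrow> B \<in> Obj C \<Longrightarrow> p \<in> carrier (fobj P B) \<Longrightarrow>
          linear_on K (Hom C A B) (fobj P A) (\<lambda>h. act P h p)"
  shows "psh K C P"
proof (intro lin_functor.intro lin_category_op lin_category_vec field_axioms lin_functor_axioms.intro)
  show "A \<in> Obj (op_cat C) \<Longrightarrow> fobj P A \<in> Obj (vec_cat K)" for A by (simp add: m)
  have fr: "farr P h = MArr (fobj P (Cod C h)) (fobj P (Dom C h)) (\<lambda>p\<in>carrier (fobj P (Cod C h)). act P h p)"
    if "h \<in> Arr C" for h
    by (simp only: extensional_restrict[OF e[OF that]]) (rule f[OF that])
  have cl: "farr P h \<in> MArr (fobj P (Cod C h)) (fobj P (Dom C h)) ` lin_maps K (fobj P (Cod C h)) (fobj P (Dom C h))"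
    if "h \<in> Arr C" for h
    using f[OF that] l[OF that] e[OF that] by (auto simp: lin_maps_def)
  show "linear_on K (Hom (op_cat C) B A) (Hom (vec_cat K) (fobj P B) (fobj P A)) (farr P)"
    if o: "B \<in> Obj (op_cat C)" "A \<in> Obj (op_cat C)" for A B
  proof (rule linear_onI)
    have o: "A \<in> Obj C" "B \<in> Obj C" using o by simp_all
    fix x assume "x \<in> carrier (Hom (op_cat C) B A)"
    then have x: "x \<in> carrier (Hom C A B)" by simp
    note x' = Hom_Arr[OF o x]
    show "farr P x \<in> carrier (Hom (vec_cat K) (fobj P B) (fobj P A))"
      using cl[OF x'(1)] x' by simp
    have fh: "farr P z = MArr (fobj P B) (fobj P A) (\<lambda>p\<in>carrier (fobj P B). act P z p)"
      if "z \<in> carrier (Hom C A B)" for z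
      by (subst fr) (use Hom_Arr[OF o that] in simp_all)
    show "farr P (x \<oplus>\<^bsub>Hom (op_cat C) B A\<^esub> y) = farr P x \<oplus>\<^bsub>Hom (vec_cat K) (fobj P B) (fobj P A)\<^esub> farr P y"
      if "y \<in> carrier (Hom (op_cat C) B A)" for y
    proof -
      have y: "y \<in> carrier (Hom C A B)" using that by simp
      have "farr P (x \<oplus>\<^bsub>Hom C A B\<^esub> y) = MArr (fobj P B) (fobj P A) (\<lambda>p\<in>carrier (fobj P B). act P (x \<oplus>\<^bsub>Hom C A B\<^esub> y) p)"
        by (rule fh[OF module_add_closed[OF Hom_module[OF o] x y]])
      also have "\<dots> = farr P x \<oplus>\<^bsub>Hom (vec_cat K) (fobj P B) (fobj P A)\<^esub> farr P y"
        using linear_on_add[OF ll[OF o] x y] by (simp cong: restrict_cong)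
      finally show ?thesis by simp
    qed
    show "farr P (c \<odot>\<^bsub>Hom (op_cat C) B A\<^esub> x) = c \<odot>\<^bsub>Hom (vec_cat K) (fobj P B) (fobj P A)\<^esub> farr P x"
      if c: "c \<in> carrier K" for c
    proof -
      have "farr P (c \<odot>\<^bsub>Hom C A B\<^esub> x) = MArr (fobj P B) (fobj P A) (\<lambda>p\<in>carrier (fobj P B). act P (c \<odot>\<^bsub>Hom C A B\<^esub> x) p)"
        by (rule fh[OF module_smult_closed[OF Hom_module[OF o] c x]])
      also have "\<dots> = c \<odot>\<^bsub>Hom (vec_cat K) (fobj P B) (fobj P A)\<^esub> farr P x"
        using linear_on_smult[OF ll[OF o] c x] by (simp cong: restrict_cong)
      finally show ?thesis by simp
    qed
  qed
  show "farr P (Ide (op_cat C) A) = Ide (vec_cat K) (fobj P A)" if "A \<in> Obj (op_cat C)" for A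
  proof -
    have A: "A \<in> Obj C" using that by simp
    show ?thesis unfolding op_cat_simps
      by (subst fr) (use A i[OF A] in \<open>simp_all cong: restrict_cong\<close>)
  qed
  show "farr P (g \<cdot>\<^bsub>op_cat C\<^esub> h) = farr P g \<cdot>\<^bsub>vec_cat K\<^esub> farr P h"
    if "h \<in> hom_set (op_cat C) A B" "g \<in> hom_set (op_cat C) B E" for g h A B E
  proof -
    from that have a: "h \<in> Arr C" "g \<in> Arr C" "Cod C g = Dom C h" by (auto simp: hom_set_def)
    have "farr P (h \<cdot> g) = MArr (fobj P (Cod C h)) (fobj P (Dom C g))
        (\<lambda>p\<in>carrier (fobj P (Cod C h)). act P (h \<cdot> g) p)"
      by (subst fr) (use a in simp_all)
    moreover have "src (farr P h) = fobj P (Cod C h)" "tgt (farr P g) = fobj P (Dom C g)"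
      by (subst f[OF a(1)], simp, subst f[OF a(2)], simp)
    ultimately show ?thesis using a c[OF a(2,1)] by (simp cong: restrict_cong)
  qed
qed

lemma psh_arrD:
  fixes s :: "('k,'o,'m,'v) pshmap"
  assumes "s \<in> Arr (presheaf_cat K C)"
  shows "psh K C (src s)" "psh K C (tgt s)"
    and "cpt s \<in> extensional (Obj C)"
    and "X \<in> Obj C \<Longrightarrow> cpt s X = MArr (fobj (src s) X) (fobj (tgt s) X) (ap s X)"
    and "X \<in> Obj C \<Longrightarrow> linear_on K (fobj (src s) X) (fobj (tgt s) X) (ap s X)"
    and "X \<in> Obj C \<Longrightarrow> ap s X \<in> extensional (carrier (fobj (src s) X))"
    and "X \<in> Obj C \<Longrightarrow> p \<in> carrier (fobj (src s) X) \<Longrightarrow> ap s X p \<in> carrier (fobj (tgt s) X)"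
    and "h \<in> Arr C \<Longrightarrow> p \<in> carrier (fobj (src s) (Cod C h)) \<Longrightarrow>
          ap s (Dom C h) (act (src s) h p) = act (tgt s) h (ap s (Cod C h) p)"
proof -
  have t: "psh K C (src s)" "psh K C (tgt s)" "cpt s \<in> nat_trans (op_cat C) (vec_cat K) (src s) (tgt s)"
    using assms by (simp_all add: presheaf_cat_def fun_cat_def trans_cat_Arr)
  have v: "cpt s X \<in> hom_set (vec_cat K) (fobj (src s) X) (fobj (tgt s) X)" if "X \<in> Obj C" for X
    using t(3) that by (auto simp: nat_trans_def)
  show "psh K C (src s)" "psh K C (tgt s)" "cpt s \<in> extensional (Obj C)"
    using t by (simp_all add: nat_trans_def)
  show "cpt s X = MArr (fobj (src s) X) (fobj (tgt s) X) (ap s X)" if "X \<in> Obj C"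
    using v[OF that] by (simp add: vec_hom_set)
  show "linear_on K (fobj (src s) X) (fobj (tgt s) X) (ap s X)" "ap s X \<in> extensional (carrier (fobj (src s) X))"
    if "X \<in> Obj C" using vec_hom_linear[OF v[OF that]] by simp_all
  show "ap s X p \<in> carrier (fobj (tgt s) X)" if "X \<in> Obj C" "p \<in> carrier (fobj (src s) X)"
    using vec_hom_linear(7)[OF v[OF that(1)] that(2)] .
  show "ap s (Dom C h) (act (src s) h p) = act (tgt s) h (ap s (Cod C h) p)"
    if h: "h \<in> Arr C" and p: "p \<in> carrier (fobj (src s) (Cod C h))"
  proof -
    have "cpt s (Dom C h) \<cdot>\<^bsub>vec_cat K\<^esub> farr (src s) h = farr (tgt s) h \<cdot>\<^bsub>vec_cat K\<^esub> cpt s (Cod C h)"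
      using nat_transD(5)[OF t(3), of h] h by (simp del: vec_cat_simps)
    from arg_cong[OF this, of "\<lambda>u. cpt u p"] p h show ?thesis
      using arg_cong[OF pshD(2)[OF t(1) h], of src] vec_hom_linear(3)[OF v[of "Cod C h"]] by simp
  qed
qed

definition mk_psh :: "('k,'o,'m,'v) psh \<Rightarrow> ('k,'o,'m,'v) psh \<Rightarrow> ('o \<Rightarrow> 'v \<Rightarrow> 'v) \<Rightarrow> ('k,'o,'m,'v) pshmap" where
  "mk_psh P Q \<phi> = MArr P Q (\<lambda>X\<in>Obj C. MArr (fobj P X) (fobj Q X) (\<lambda>p\<in>carrier (fobj P X). \<phi> X p))"

lemma mk_psh_simps [simp]:
  "src (mk_psh P Q \<phi>) = P" "tgt (mk_psh P Q \<phi>) = Q"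
  "X \<in> Obj C \<Longrightarrow> p \<in> carrier (fobj P X) \<Longrightarrow> ap (mk_psh P Q \<phi>) X p = \<phi> X p"
  by (simp_all add: mk_psh_def)

lemma psh_arrI:
  fixes P Q :: "('k,'o,'m,'v) psh"
  assumes P: "psh K C P" and Q: "psh K C Q"
    and t: "t \<in> extensional (Obj C)" "\<And>X. X \<in> Obj C \<Longrightarrow> t X = MArr (fobj P X) (fobj Q X) (cpt (t X))"
      "\<And>X. X \<in> Obj C \<Longrightarrow> cpt (t X) \<in> extensional (carrier (fobj P X))"
      "\<And>X. X \<in> Obj C \<Longrightarrow> linear_on K (fobj P X) (fobj Q X) (cpt (t X))"
    and n: "\<And>h p. h \<in> Arr C \<Longrightarrow> p \<in> carrier (fobj P (Cod C h)) \<Longrightarrow>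
          cpt (t (Dom C h)) (act P h p) = act Q h (cpt (t (Cod C h)) p)"
  shows "MArr P Q t \<in> Arr (presheaf_cat K C)"
proof -
  have "t (Dom C h) \<cdot>\<^bsub>vec_cat K\<^esub> farr P h = farr Q h \<cdot>\<^bsub>vec_cat K\<^esub> t (Cod C h)" if h: "h \<in> Arr C" for h
  proof -
    have o: "Dom C h \<in> Obj C" "Cod C h \<in> Obj C" using h by simp_all
    show ?thesis
      using arg_cong[OF t(2)[OF o(1)], of tgt] arg_cong[OF t(2)[OF o(2)], of src]
        arg_cong[OF pshD(2)[OF P h], of src] arg_cong[OF pshD(2)[OF Q h], of tgt] n[OF h]
      by (simp cong: restrict_cong)
  qed
  moreover have "t X \<in> hom_set (vec_cat K) (fobj P X) (fobj Q X)" if "X \<in> Obj C" for X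
    using t(2-4)[OF that] pshD(1)[OF P that] pshD(1)[OF Q that] by (auto simp: vec_hom_set lin_maps_def)
  ultimately show ?thesis
    using P Q t(1) by (simp add: presheaf_cat_def fun_cat_def trans_cat_Arr nat_trans_def del: vec_cat_simps)
qed

lemma mk_psh_arr:
  fixes P Q :: "('k,'o,'m,'v) psh"
  assumes P: "psh K C P" and Q: "psh K C Q"
    and l: "\<And>X. X \<in> Obj C \<Longrightarrow> linear_on K (fobj P X) (fobj Q X) (\<phi> X)"
    and n: "\<And>h p. h \<in> Arr C \<Longrightarrow> p \<in> carrier (fobj P (Cod C h)) \<Longrightarrow>
          \<phi> (Dom C h) (act P h p) = act Q h (\<phi> (Cod C h) p)"
  shows "mk_psh P Q \<phi> \<in> Arr (presheaf_cat K C)"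
  unfolding mk_psh_def
proof (rule psh_arrI[OF P Q], goal_cases)
  case (4 X) then show ?case by (simp add: linear_on_cong[OF pshD(1)[OF P] _ l])
next
  case (5 h p) then show ?case using n pshD(5)[OF P] by simp
qed simp_all

lemma psh_arr_eqI:
  assumes "s \<in> Arr (presheaf_cat K C)" "s' \<in> Arr (presheaf_cat K C)" "src s = src s'" "tgt s = tgt s'"
    and "\<And>X p. X \<in> Obj C \<Longrightarrow> p \<in> carrier (fobj (src s) X) \<Longrightarrow> ap s X p = ap s' X p"
  shows "s = s'"
proof (rule marr.expand, intro conjI)
  show "cpt s = cpt s'"
  proof (rule extensionalityI[OF psh_arrD(3)[OF assms(1)] psh_arrD(3)[OF assms(2)]])
    fix X assume X: "X \<in> Obj C"
    have "ap s X = ap s' X"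
      by (rule extensionalityI[OF psh_arrD(6)[OF assms(1) X]])
        (use psh_arrD(6)[OF assms(2) X] assms(3,5) X in auto)
    then show "cpt s X = cpt s' X"
      using psh_arrD(4)[OF assms(1) X] psh_arrD(4)[OF assms(2) X] assms(3,4) by simp
  qed
qed (use assms in auto)

lemma ap_Cmp [simp]:
  assumes "s \<in> Arr (presheaf_cat K C)" "X \<in> Obj C" "p \<in> carrier (fobj (src s) X)"
  shows "ap (s' \<cdot>\<^bsub>presheaf_cat K C\<^esub> s) X p = ap s' X (ap s X p)"
  using assms arg_cong[OF psh_arrD(4)[OF assms(1,2)], of src]
  by (simp add: presheaf_cat_def fun_cat_def)

lemma src_Cmp [simp]: "src (s' \<cdot>\<^bsub>presheaf_cat K C\<^esub> s) = src s" "tgt (s' \<cdot>\<^bsub>presheaf_cat K C\<^esub> s) = tgt s'"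
  by (simp_all add: presheaf_cat_def fun_cat_def)

lemma ap_Ide [simp]:
  "X \<in> Obj C \<Longrightarrow> p \<in> carrier (fobj P X) \<Longrightarrow> ap (Ide (presheaf_cat K C) P) X p = p"
  "src (Ide (presheaf_cat K C) P) = P" "tgt (Ide (presheaf_cat K C) P) = P"
  by (simp_all add: presheaf_cat_def fun_cat_def)

lemma ap_add [simp]:
  assumes "X \<in> Obj C" "p \<in> carrier (fobj P X)"
  shows "ap (s \<oplus>\<^bsub>Hom (presheaf_cat K C) P Q\<^esub> t) X p = ap s X p \<oplus>\<^bsub>fobj Q X\<^esub> ap t X p"
    and "ap (c \<odot>\<^bsub>Hom (presheaf_cat K C) P Q\<^esub> s) X p = c \<odot>\<^bsub>fobj Q X\<^esub> ap s X p"
  using assms by (simp_all add: presheaf_cat_def fun_cat_def)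

lemma psh_inverseI:
  assumes s: "s \<in> Arr (presheaf_cat K C)" and s': "s' \<in> Arr (presheaf_cat K C)"
    and "src s' = tgt s" "tgt s' = src s"
    and "\<And>X p. X \<in> Obj C \<Longrightarrow> p \<in> carrier (fobj (src s) X) \<Longrightarrow> ap s' X (ap s X p) = p"
    and "\<And>X p. X \<in> Obj C \<Longrightarrow> p \<in> carrier (fobj (tgt s) X) \<Longrightarrow> ap s X (ap s' X p) = p"
  shows "inverse_arrs (presheaf_cat K C) s s'"
proof -
  interpret PS: lin_category K "presheaf_cat K C" by (rule lin_category_presheaf)
  have c: "s' \<cdot>\<^bsub>presheaf_cat K C\<^esub> s \<in> Arr (presheaf_cat K C)" "s \<cdot>\<^bsub>presheaf_cat K C\<^esub> s' \<in> Arr (presheaf_cat K C)"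
    using PS.Cmp_Arr(1)[OF s s'] PS.Cmp_Arr(1)[OF s' s] assms(3,4) by simp_all
  have i: "Ide (presheaf_cat K C) (src s) \<in> Arr (presheaf_cat K C)" "Ide (presheaf_cat K C) (tgt s) \<in> Arr (presheaf_cat K C)"
    using PS.Ide_Arr(1)[of "src s"] PS.Ide_Arr(1)[of "tgt s"] psh_arrD(1,2)[OF s] by simp_all
  have "s' \<cdot>\<^bsub>presheaf_cat K C\<^esub> s = Ide (presheaf_cat K C) (src s)"
    by (rule psh_arr_eqI[OF c(1) i(1)]) (use assms in simp_all)
  moreover have "s \<cdot>\<^bsub>presheaf_cat K C\<^esub> s' = Ide (presheaf_cat K C) (tgt s)"
    by (rule psh_arr_eqI[OF c(2) i(2)]) (use assms in simp_all)
  ultimately show ?thesis using assms by (simp add: inverse_arrs_def hom_set_def)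
qed

end

lemma hom_psh_simps:
  "fobj (hom_psh C D \<Phi> d) X = vcopy (Hom D (fobj \<Phi> X) d)"
  "farr (hom_psh C D \<Phi> d) f = MArr (vcopy (Hom D (fobj \<Phi> (Cod C f)) d)) (vcopy (Hom D (fobj \<Phi> (Dom C f)) d))
     (\<lambda>x\<in>carrier (vcopy (Hom D (fobj \<Phi> (Cod C f)) d)).
        venc (Hom D (fobj \<Phi> (Dom C f)) d) (vdec (Hom D (fobj \<Phi> (Cod C f)) d) x \<cdot>\<^bsub>D\<^esub> farr \<Phi> f))"
  by (simp_all add: hom_psh_def Let_def)

lemma act_hom_psh:
  assumes "fits TYPE('v) (Hom D (fobj \<Phi> (Cod C f)) d)" "x \<in> carrier (Hom D (fobj \<Phi> (Cod C f)) d)"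
  shows "act (hom_psh C D \<Phi> d) f (venc (Hom D (fobj \<Phi> (Cod C f)) d) x :: 'v) =
    venc (Hom D (fobj \<Phi> (Dom C f)) d) (x \<cdot>\<^bsub>D\<^esub> farr \<Phi> f)"
  using assms by (simp add: hom_psh_simps venc_closed)

text \<open>The laws are those of precomposition in \<open>D\<close>; encoding and decoding are
  linear and cancel against each other, so they survive the passage to copies inside
  \<open>'v\<close>.\<close>

lemma psh_hom_psh:
  fixes \<Phi> :: "('o,'m,'p,'n) fctr" and D :: "('k,'p,'n,'z) lcat_scheme" and C :: "('k,'o,'m,'y) lcat_scheme"
  assumes "lin_functor K C D \<Phi>" and d: "d \<in> Obj D"
    and fit: "\<And>X. X \<in> Obj C \<Longrightarrow> fits TYPE('v) (Hom D (fobj \<Phi> X) d)"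
  shows "psh K C (hom_psh C D \<Phi> d :: ('k,'o,'m,'v) psh)"
proof -
  interpret F: lin_functor K C D \<Phi> by fact
  let ?P = "hom_psh C D \<Phi> d :: ('k,'o,'m,'v) psh"
  let ?H = "\<lambda>X. Hom D (fobj \<Phi> X) d"
  have m: "module K (?H X)" if "X \<in> Obj C" for X
    by (rule F.D.Hom_module) (use that d in simp_all)
  have el: "x \<cdot>\<^bsub>D\<^esub> farr \<Phi> h \<in> carrier (?H (Dom C h))" if "h \<in> Arr C" "x \<in> carrier (?H (Cod C h))" for h x
    using F.D.Hom_Arr[OF _ d that(2)] that(1) by (simp add: F.D.Hom_mem)
  have lin: "linear_on K (?H (Cod C h)) (?H (Dom C h)) (\<lambda>x. x \<cdot>\<^bsub>D\<^esub> farr \<Phi> h)" if "h \<in> Arr C" for h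
    using F.D.Cmp_lin_left[OF d, of "farr \<Phi> h"] that by simp
  have actv: "act ?P h (venc (?H (Cod C h)) x) = venc (?H (Dom C h)) (x \<cdot>\<^bsub>D\<^esub> farr \<Phi> h)"
    if "h \<in> Arr C" "x \<in> carrier (?H (Cod C h))" for h x
    using act_hom_psh[of D \<Phi> C h d x] that fit[of "Cod C h"] by simp
  show ?thesis
  proof (rule F.C.pshI)
    fix A assume A: "A \<in> Obj C"
    show "module K (fobj ?P A)"
      unfolding hom_psh_simps by (rule module_vcopy[OF fit[OF A] m[OF A]])
    fix p assume "p \<in> carrier (fobj ?P A)"
    then obtain x where x: "x \<in> carrier (?H A)" "p = venc (?H A) x" by (auto simp: hom_psh_simps elim: vcopyE)
    show "act ?P (Ide C A) p = p"
      using actv[of "Ide C A" x] F.D.Hom_Arr[OF _ d x(1)] A x by (simp add: F.farr_Ide)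
  next
    fix h assume h: "h \<in> Arr C"
    show "farr ?P h = MArr (fobj ?P (Cod C h)) (fobj ?P (Dom C h)) (act ?P h)"
      "act ?P h \<in> extensional (carrier (fobj ?P (Cod C h)))"
      by (simp_all add: hom_psh_simps)
    show "linear_on K (fobj ?P (Cod C h)) (fobj ?P (Dom C h)) (act ?P h)"
    proof (rule linear_on_cong)
      show "module K (fobj ?P (Cod C h))"
        unfolding hom_psh_simps by (rule module_vcopy) (use h fit m in simp_all)
      show "act ?P h x = venc (?H (Dom C h)) (vdec (?H (Cod C h)) x \<cdot>\<^bsub>D\<^esub> farr \<Phi> h)"
        if "x \<in> carrier (fobj ?P (Cod C h))" for x
        using that by (simp add: hom_psh_simps)
      show "linear_on K (fobj ?P (Cod C h)) (fobj ?P (Dom C h))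
          (\<lambda>x. venc (?H (Dom C h)) (vdec (?H (Cod C h)) x \<cdot>\<^bsub>D\<^esub> farr \<Phi> h))"
        unfolding hom_psh_simps
        by (rule linear_on_comp[OF linear_on_comp[OF linear_vdec lin[OF h]] linear_venc])
          (use h fit m in simp_all)
    qed
  next
    fix f g p assume a: "f \<in> Arr C" "g \<in> Arr C" "Dom C g = Cod C f" "p \<in> carrier (fobj ?P (Cod C g))"
    then obtain x where x: "x \<in> carrier (?H (Cod C g))" "p = venc (?H (Cod C g)) x"
      by (auto simp: hom_psh_simps elim: vcopyE)
    have "x \<cdot>\<^bsub>D\<^esub> farr \<Phi> g \<in> carrier (?H (Cod C f))" using el[OF a(2) x(1)] a by simp
    then show "act ?P (g \<cdot>\<^bsub>C\<^esub> f) p = act ?P f (act ?P g p)"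
      using actv[of "g \<cdot>\<^bsub>C\<^esub> f" x] actv[OF a(2) x(1)] actv[OF a(1), of "x \<cdot>\<^bsub>D\<^esub> farr \<Phi> g"]
        F.D.Hom_Arr[OF _ d x(1)] a x(1) by (simp add: x(2) F.farr_Cmp_Arr)
  next
    fix A B p assume o: "A \<in> Obj C" "B \<in> Obj C" and "p \<in> carrier (fobj ?P B)"
    then obtain x where x: "x \<in> carrier (?H B)" "p = venc (?H B) x" by (auto simp: hom_psh_simps elim: vcopyE)
    have xA: "x \<in> Arr D" "Dom D x = fobj \<Phi> B" "Cod D x = d" using F.D.Hom_Arr[OF _ d x(1)] o by simp_all
    show "linear_on K (Hom C A B) (fobj ?P A) (\<lambda>h. act ?P h p)"
    proof (rule linear_on_cong[OF F.C.Hom_module[OF o]])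
      show "act ?P h p = venc (?H A) (x \<cdot>\<^bsub>D\<^esub> farr \<Phi> h)" if "h \<in> carrier (Hom C A B)" for h
        using actv[of h x] F.C.Hom_Arr[OF o that] x by simp
      show "linear_on K (Hom C A B) (fobj ?P A) (\<lambda>h. venc (?H A) (x \<cdot>\<^bsub>D\<^esub> farr \<Phi> h))"
        unfolding hom_psh_simps
        by (rule linear_on_comp[OF linear_on_comp[OF F.farr_linear[OF o]] linear_venc[OF fit[OF o(1)]]])
          (use F.D.Cmp_lin_right[of "fobj \<Phi> A" x] xA o in simp)
    qed
  qed
qed

section \<open>Existence of the coends\<close>

lemma inj_pair_infinite:
  assumes "infinite (A :: 'a set)"
  shows "\<exists>g. inj_on g (A \<times> A) \<and> g ` (A \<times> A) \<subseteq> A"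
proof -
  have "A \<times> A \<approx> A"
    unfolding eqpoll_iff_card_of_ordIso by (rule card_of_Times_same_infinite[OF assms])
  then show ?thesis unfolding eqpoll_def bij_betw_def by blast
qed

lemma inj_lists_infinite:
  assumes "infinite (UNIV :: 'v set)" and f: "inj_on (f :: 'a \<Rightarrow> 'v) A"
  shows "\<exists>enc :: 'a list \<Rightarrow> 'v. inj_on enc (lists A)"
proof -
  obtain g :: "'v \<times> 'v \<Rightarrow> 'v" where g: "inj g"
    using inj_pair_infinite[OF assms(1)] by auto
  obtain c0 c1 :: 'v where c: "c0 \<noteq> c1"
    using assms(1) by (metis (full_types) UNIV_eq_I finite.emptyI finite.insertI insertI1)
  \<comment> \<open>The distinct constants \<open>c0\<close> and \<open>c1\<close> tag the end of a
    list and a proper cell, so that codes of lists of different lengths cannot collide.\<close>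
  define enc where "enc = (\<lambda>xs. foldr (\<lambda>x a. g (c1, g (f x, a))) xs (g (c0, c0)))"
  have "xs = ys" if "xs \<in> lists A" "ys \<in> lists A" "enc xs = enc ys" for xs ys
    using that
  proof (induction xs arbitrary: ys)
    case Nil
    then show ?case using g c by (cases ys) (auto simp: enc_def inj_eq)
  next
    case (Cons x xs)
    then obtain y ys' where ys: "ys = y # ys'" using g c by (cases ys) (auto simp: enc_def inj_eq)
    then have "f x = f y" "enc xs = enc ys'" using Cons.prems(2) g by (auto simp: enc_def inj_eq)
    moreover have "x \<in> A" "y \<in> A" "ys' \<in> lists A" using Cons.hyps(1) Cons.prems(1) ys by simp_all
    ultimately show ?case using Cons.IH inj_onD[OF f] ys by blast
  qed
  then show ?thesis unfolding inj_on_def by blast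
qed

text \<open>Singletons code objects and arrows, larger subsets code transformations, and the natural
  numbers make the universe infinite.\<close>

locale small_sg = semigroup_category K S
  for K :: "('k,'x) ring_scheme" and S :: "('k,'o,'m,'y) sgcat_scheme" +
  fixes emb :: "(nat + 'k + 'o + 'm) set \<Rightarrow> 'v"
  assumes emb: "inj_on emb (Pow ((UNIV :: nat set) <+> carrier K <+> Obj S <+> Arr S))"
begin

lemma emb_eq:
  assumes "x \<in> (UNIV :: nat set) <+> carrier K <+> Obj S <+> Arr S" "y \<in> (UNIV :: nat set) <+> carrier K <+> Obj S <+> Arr S"
  shows "emb {x} = emb {y} \<longleftrightarrow> x = y"
  using inj_on_eq_iff[OF emb, of "{x}" "{y}"] assms by simp

lemma infinite_v: "infinite (UNIV :: 'v set)"
proof -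
  have "inj (\<lambda>n. emb {Inl n})"
    by (rule injI) (simp add: emb_eq InlI)
  then show ?thesis using finite_imageD by (metis infinite_UNIV_nat rev_finite_subset subset_UNIV)
qed

lemma emb_eqs:
  "A \<in> Obj S \<Longrightarrow> B \<in> Obj S \<Longrightarrow> emb {Inr (Inr (Inl A))} = emb {Inr (Inr (Inl B))} \<longleftrightarrow> A = B"
  "f \<in> Arr S \<Longrightarrow> g \<in> Arr S \<Longrightarrow> emb {Inr (Inr (Inr f))} = emb {Inr (Inr (Inr g))} \<longleftrightarrow> f = g"
  by (simp_all add: emb_eq InlI InrI)

lemma fits_Hom:
  assumes "A \<in> Obj S" "B \<in> Obj S"
  shows "fits TYPE('v) (Hom S A B)"
proof -
  have "inj_on (\<lambda>f. emb {Inr (Inr (Inr f))}) (carrier (Hom S A B))"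
    using Hom_Arr(1)[OF assms] by (intro inj_onI) (simp add: emb_eqs)
  then show ?thesis unfolding fits_def by blast
qed

text \<open>A transformation is determined by its graph, a set of pairs over \<open>?U\<close>. As
  \<open>?U\<close> is infinite, pairs can be coded by elements, so the graph becomes a subset of
  \<open>?U\<close>, which \<open>emb\<close> encodes. This is where the power set in the smallness
  hypothesis enters.\<close>

lemma fits_trans:
  assumes tr: "\<And>t. t \<in> T \<Longrightarrow> t \<in> extensional (Obj S) \<and> (\<forall>A\<in>Obj S. t A \<in> Arr S)"
  shows "\<exists>e :: ('z, 'o \<Rightarrow> 'm) marr \<Rightarrow> 'v. inj_on e (MArr F G ` T)"
proof -
  let ?U = "(UNIV :: nat set) <+> carrier K <+> Obj S <+> Arr S"
  have "infinite (Inl ` (UNIV :: nat set) :: (nat + 'k + 'o + 'm) set)"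
    by (simp add: finite_image_iff)
  then have "infinite ?U" by (rule infinite_super[rotated]) auto
  then obtain g where g: "inj_on g (?U \<times> ?U)" "g ` (?U \<times> ?U) \<subseteq> ?U" using inj_pair_infinite by blast
  define gr :: "('o \<Rightarrow> 'm) \<Rightarrow> ((nat + 'k + 'o + 'm) \<times> (nat + 'k + 'o + 'm)) set" where "gr t = (\<lambda>A. (Inr (Inr (Inl A)), Inr (Inr (Inr (t A))))) ` Obj S" for t
  have gr: "gr t \<subseteq> ?U \<times> ?U" if "t \<in> T" for t using tr[OF that] by (auto simp: gr_def)
  have "inj_on (\<lambda>s. emb (g ` gr (cpt s))) (MArr F G ` T)"
  proof (rule inj_onI)
    fix s s' assume "s \<in> MArr F G ` T" "s' \<in> MArr F G ` T" and e: "emb (g ` gr (cpt s)) = emb (g ` gr (cpt s'))"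
    then obtain t t' where t: "t \<in> T" "t' \<in> T" and s: "s = MArr F G t" "s' = MArr F G t'" by auto
    have e: "emb (g ` gr t) = emb (g ` gr t')" using e s by simp
    have "g ` gr t = g ` gr t'"
      by (rule inj_onD[OF emb e]) (use gr[OF t(1)] gr[OF t(2)] g(2) in blast)+
    then have "gr t = gr t'" using inj_on_image_eq_iff[OF g(1) gr[OF t(1)] gr[OF t(2)]] by simp
    have "t A = t' A" if "A \<in> Obj S" for A
    proof -
      have "(Inr (Inr (Inl A)), Inr (Inr (Inr (t A)))) \<in> gr t" using that by (auto simp: gr_def)
      then show ?thesis unfolding \<open>gr t = gr t'\<close> by (auto simp: gr_def)
    qed
    then show "s = s'" unfolding s using tr[OF t(1)] tr[OF t(2)] by (auto intro: extensionalityI)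
  qed
  then show ?thesis by blast
qed

section \<open>Cowedges and the construction of the universal one\<close>

definition gen_ok :: "('k,'o,'m,'v) psh \<Rightarrow> ('k,'o,'m,'v) psh \<Rightarrow> 'o \<Rightarrow> 'o \<Rightarrow> 'o \<Rightarrow> 'm \<Rightarrow> 'v \<Rightarrow> 'v \<Rightarrow> bool" where
  "gen_ok P Q X H L f p q \<longleftrightarrow> X \<in> Obj S \<and> H \<in> Obj S \<and> L \<in> Obj S \<and> f \<in> Arr S \<and> Dom S f = X \<and> Cod S f = H \<box> L \<and>
     p \<in> carrier (fobj P H) \<and> q \<in> carrier (fobj Q L)"

lemma day_cowedgeD:
  assumes "day_cowedge K S P Q X V w"
  shows "module K V"
    and "\<lbrakk>H \<in> Obj S; L \<in> Obj S; p \<in> carrier (fobj P H); q \<in> carrier (fobj Q L)\<rbrakk> \<Longrightarrow>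
      linear_on K (Hom S X (H \<box> L)) V (\<lambda>f. w H L f p q)"
    and "\<lbrakk>H \<in> Obj S; L \<in> Obj S; f \<in> Arr S; Dom S f = X; Cod S f = H \<box> L; q \<in> carrier (fobj Q L)\<rbrakk> \<Longrightarrow>
      linear_on K (fobj P H) V (\<lambda>p. w H L f p q)"
    and "\<lbrakk>H \<in> Obj S; L \<in> Obj S; f \<in> Arr S; Dom S f = X; Cod S f = H \<box> L; p \<in> carrier (fobj P H)\<rbrakk> \<Longrightarrow>
      linear_on K (fobj Q L) V (\<lambda>q. w H L f p q)"
    and "\<lbrakk>h \<in> Arr S; l \<in> Arr S; f \<in> Arr S; Dom S f = X; Cod S f = Dom S h \<box> Dom S l;
      p \<in> carrier (fobj P (Cod S h)); q \<in> carrier (fobj Q (Cod S l))\<rbrakk> \<Longrightarrow>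
      w (Cod S h) (Cod S l) ((h \<diamondop> l) \<cdot> f) p q = w (Dom S h) (Dom S l) f (act P h p) (act Q l q)"
    and "gen_ok P Q X H L f p q \<Longrightarrow> w H L f p q \<in> carrier V"
proof -
  note d = assms[unfolded day_cowedge_def hom_set_def]
  show "module K V" using d by blast
  show l: "\<lbrakk>H \<in> Obj S; L \<in> Obj S; p \<in> carrier (fobj P H); q \<in> carrier (fobj Q L)\<rbrakk> \<Longrightarrow>
      linear_on K (Hom S X (H \<box> L)) V (\<lambda>f. w H L f p q)" for H L p q using d by blast
  show "\<lbrakk>H \<in> Obj S; L \<in> Obj S; f \<in> Arr S; Dom S f = X; Cod S f = H \<box> L; q \<in> carrier (fobj Q L)\<rbrakk> \<Longrightarrow>
      linear_on K (fobj P H) V (\<lambda>p. w H L f p q)"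
    "\<lbrakk>H \<in> Obj S; L \<in> Obj S; f \<in> Arr S; Dom S f = X; Cod S f = H \<box> L; p \<in> carrier (fobj P H)\<rbrakk> \<Longrightarrow>
      linear_on K (fobj Q L) V (\<lambda>q. w H L f p q)" using d by blast+
  show "\<lbrakk>h \<in> Arr S; l \<in> Arr S; f \<in> Arr S; Dom S f = X; Cod S f = Dom S h \<box> Dom S l;
      p \<in> carrier (fobj P (Cod S h)); q \<in> carrier (fobj Q (Cod S l))\<rbrakk> \<Longrightarrow>
      w (Cod S h) (Cod S l) ((h \<diamondop> l) \<cdot> f) p q = w (Dom S h) (Dom S l) f (act P h p) (act Q l q)"
    using d by blast
  show "w H L f p q \<in> carrier V" if "gen_ok P Q X H L f p q"
    by (rule linear_on_closed[OF l]) (use that in \<open>auto simp: gen_ok_def intro: Hom_mem\<close>)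
qed

lemma day_cowedgeI:
  assumes "module K V" "X \<in> Obj S"
    and "\<And>H L p q. \<lbrakk>H \<in> Obj S; L \<in> Obj S; p \<in> carrier (fobj P H); q \<in> carrier (fobj Q L)\<rbrakk> \<Longrightarrow>
      linear_on K (Hom S X (H \<box> L)) V (\<lambda>f. w H L f p q)"
    and "\<And>H L f q. \<lbrakk>H \<in> Obj S; L \<in> Obj S; f \<in> Arr S; Dom S f = X; Cod S f = H \<box> L; q \<in> carrier (fobj Q L)\<rbrakk> \<Longrightarrow>
      linear_on K (fobj P H) V (\<lambda>p. w H L f p q)"
    and "\<And>H L f p. \<lbrakk>H \<in> Obj S; L \<in> Obj S; f \<in> Arr S; Dom S f = X; Cod S f = H \<box> L; p \<in> carrier (fobj P H)\<rbrakk> \<Longrightarrow>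
      linear_on K (fobj Q L) V (\<lambda>q. w H L f p q)"
    and "\<And>h l f p q. \<lbrakk>h \<in> Arr S; l \<in> Arr S; f \<in> Arr S; Dom S f = X; Cod S f = Dom S h \<box> Dom S l;
      p \<in> carrier (fobj P (Cod S h)); q \<in> carrier (fobj Q (Cod S l))\<rbrakk> \<Longrightarrow>
      w (Cod S h) (Cod S l) ((h \<diamondop> l) \<cdot> f) p q = w (Dom S h) (Dom S l) f (act P h p) (act Q l q)"
  shows "day_cowedge K S P Q X V w"
  unfolding day_cowedge_def hom_set_def using assms(1,3-) by auto

text \<open>
  An element of the coend is a formal sum of generators, that is a list; scalars are absorbed by
  the arrow component. Two lists are identified when all cowedges agree on them, which makes
  universality immediate, and a class is stored in \<open>'v\<close> through a code of a representative.
\<close>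

theorem coend_exists:
  fixes P Q :: "('k,'o,'m,'v) psh"
  assumes P: "psh K S P" and Q: "psh K S Q" and X: "X \<in> Obj S"
  shows "\<exists>V w. day_cowedge K S P Q X V w \<and>
    (\<forall>V' w'. day_cowedge K S P Q X V' w' \<longrightarrow> (\<exists>!h. day_factors K S P Q X V w V' w' h))"
proof -
  define valid where "valid = {(H,L,f,p,q). gen_ok P Q X H L f p q}"
  define lsum :: "('k,'v) module \<Rightarrow> ('o \<Rightarrow> 'o \<Rightarrow> 'm \<Rightarrow> 'v \<Rightarrow> 'v \<Rightarrow> 'v) \<Rightarrow> ('o \<times> 'o \<times> 'm \<times> 'v \<times> 'v) list \<Rightarrow> 'v"
    where "lsum V w xs = foldr (\<lambda>(H,L,f,p,q) a. w H L f p q \<oplus>\<^bsub>V\<^esub> a) xs \<zero>\<^bsub>V\<^esub>" for V w xs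
  define scale :: "'k \<Rightarrow> ('o \<times> 'o \<times> 'm \<times> 'v \<times> 'v) list \<Rightarrow> ('o \<times> 'o \<times> 'm \<times> 'v \<times> 'v) list"
    where "scale c = map (\<lambda>(H,L,f,p,q). (H,L,c \<odot>\<^bsub>Hom S X (H \<box> L)\<^esub> f,p,q))" for c
  \<comment> \<open>The spaces \<open>V\<close> range over those carried by \<open>'v\<close>, which
    are exactly the targets of the universal property to be proved.\<close>
  define eqv where "eqv xs ys \<longleftrightarrow> (\<forall>V w. day_cowedge K S P Q X V w \<longrightarrow> lsum V w xs = lsum V w ys)" for xs ys
  obtain g :: "'v \<times> 'v \<Rightarrow> 'v" where g: "inj g" using inj_pair_infinite[OF infinite_v] by auto
  \<comment> \<open>The components \<open>p\<close> and \<open>q\<close> lie in \<open>'v\<close>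
    already; the two objects and the arrow enter through their singletons, and \<open>g\<close>
    pairs the five codes into one.\<close>
  define code where "code = (\<lambda>(H,L,f,p,q). g (emb {Inr (Inr (Inl H))}, g (emb {Inr (Inr (Inl L))},
    g (emb {Inr (Inr (Inr f))}, g (p, q)))))"
  have "inj_on code valid"
    by (rule inj_onI)
      (auto simp: code_def valid_def gen_ok_def inj_eq[OF g] emb_eqs)
  then obtain enc :: "('o \<times> 'o \<times> 'm \<times> 'v \<times> 'v) list \<Rightarrow> 'v" where enc: "inj_on enc (lists valid)"
    using inj_lists_infinite[OF infinite_v] by blast
  \<comment> \<open>Equivalent lists make the predicate under the choice operator the same, so the
    chosen representative depends only on the class.\<close>
  define cl where "cl xs = enc (SOME ys. ys \<in> lists valid \<and> eqv ys xs)" for xs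
  define dec where "dec a = (SOME xs. xs \<in> lists valid \<and> cl xs = a)" for a
  define V :: "('k,'v) module" where "V = \<lparr>carrier = cl ` lists valid, mult = undefined, one = undefined, zero = cl [],
     add = (\<lambda>a b. cl (dec a @ dec b)), smult = (\<lambda>c a. cl (scale c (dec a)))\<rparr>"
  define w where "w H L f p q = cl [(H,L,f,p,q)]" for H L f p q
  have eqv_refl: "eqv xs xs" for xs by (simp add: eqv_def)
  have cl_iff: "cl xs = cl ys \<longleftrightarrow> eqv xs ys" if "xs \<in> lists valid" "ys \<in> lists valid" for xs ys
  proof
    assume e: "cl xs = cl ys"
    have rx: "(SOME z. z \<in> lists valid \<and> eqv z xs) \<in> lists valid \<and> eqv (SOME z. z \<in> lists valid \<and> eqv z xs) xs"
      by (rule someI[of _ xs]) (use that eqv_refl in simp)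
    have ry: "(SOME z. z \<in> lists valid \<and> eqv z ys) \<in> lists valid \<and> eqv (SOME z. z \<in> lists valid \<and> eqv z ys) ys"
      by (rule someI[of _ ys]) (use that eqv_refl in simp)
    have "(SOME z. z \<in> lists valid \<and> eqv z xs) = (SOME z. z \<in> lists valid \<and> eqv z ys)"
      by (rule inj_onD[OF enc]) (use e rx ry in \<open>auto simp: cl_def\<close>)
    then show "eqv xs ys" using rx ry by (auto simp: eqv_def)
  next
    assume "eqv xs ys"
    then have "(\<lambda>z. z \<in> lists valid \<and> eqv z xs) = (\<lambda>z. z \<in> lists valid \<and> eqv z ys)"
      by (auto simp: eqv_def fun_eq_iff)
    then show "cl xs = cl ys" by (simp add: cl_def)
  qed
  have dec: "dec (cl xs) \<in> lists valid \<and> eqv (dec (cl xs)) xs" if "xs \<in> lists valid" for xs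
  proof -
    have "dec (cl xs) \<in> lists valid \<and> cl (dec (cl xs)) = cl xs"
      unfolding dec_def by (rule someI[of _ xs]) (use that in simp)
    then show ?thesis using cl_iff that by blast
  qed
  have lsum_simps: "lsum V' w' [] = \<zero>\<^bsub>V'\<^esub>"
    "lsum V' w' ((H,L,f,p,q) # xs) = w' H L f p q \<oplus>\<^bsub>V'\<^esub> lsum V' w' xs" for V' w' H L f p q xs
    by (simp_all add: lsum_def)
  have lsum_closed: "lsum V' w' xs \<in> carrier V'" if c: "day_cowedge K S P Q X V' w'" and "xs \<in> lists valid" for V' w' xs
    using that(2)
  proof (induction xs)
    case Nil then show ?case by (simp add: lsum_simps module_zero_closed[OF day_cowedgeD(1)[OF c]])
  next
    case (Cons x xs) then show ?case
      by (cases x) (auto simp: lsum_simps valid_def intro!: module_add_closed[OF day_cowedgeD(1)[OF c]] day_cowedgeD(6)[OF c])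
  qed
  have lsum_append: "lsum V' w' (xs @ ys) = lsum V' w' xs \<oplus>\<^bsub>V'\<^esub> lsum V' w' ys"
    if c: "day_cowedge K S P Q X V' w'" and "xs \<in> lists valid" and ys: "ys \<in> lists valid" for V' w' xs ys
    using that(2)
  proof (induction xs)
    interpret V': module K V' by (rule day_cowedgeD(1)[OF c])
    case Nil then show ?case using lsum_closed[OF c ys] by (simp add: lsum_simps)
  next
    interpret V': module K V' by (rule day_cowedgeD(1)[OF c])
    case (Cons x xs) then show ?case using lsum_closed[OF c ys] lsum_closed[OF c Cons.hyps(2)]
      by (cases x) (auto simp: lsum_simps valid_def V'.M.a_assoc day_cowedgeD(6)[OF c])
  qed
  have Hm: "module K (Hom S X (H \<box> L))" if "H \<in> Obj S" "L \<in> Obj S" for H L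
    using that X by (simp add: Hom_module)
  have scale_valid: "scale c xs \<in> lists valid" if "c \<in> carrier K" "xs \<in> lists valid" for c xs
    using that(2)
  proof (induction xs)
    case (Cons x xs) then show ?case using that(1)
      by (cases x) (auto simp: scale_def valid_def gen_ok_def Hom_smult_Arr)
  qed (simp add: scale_def)
  have lsum_scale: "lsum V' w' (scale c xs) = c \<odot>\<^bsub>V'\<^esub> lsum V' w' xs"
    if k: "day_cowedge K S P Q X V' w'" and c: "c \<in> carrier K" and "xs \<in> lists valid" for V' w' c xs
    using that(3)
  proof (induction xs)
    interpret V': module K V' by (rule day_cowedgeD(1)[OF k])
    case Nil then show ?case using c by (simp add: lsum_simps scale_def)
  next
    interpret V': module K V' by (rule day_cowedgeD(1)[OF k])
    case (Cons x xs)
    obtain H L f p q where x: "x = (H,L,f,p,q)" by (cases x) auto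
    then have ok: "gen_ok P Q X H L f p q" using Cons.hyps(1) by (simp add: valid_def)
    have "w' H L (c \<odot>\<^bsub>Hom S X (H \<box> L)\<^esub> f) p q = c \<odot>\<^bsub>V'\<^esub> w' H L f p q"
      by (rule linear_on_smult[OF day_cowedgeD(2)[OF k] c]) (use ok in \<open>auto simp: gen_ok_def intro: Hom_mem\<close>)
    then show ?case
      using Cons c lsum_closed[OF k Cons.hyps(2)] day_cowedgeD(6)[OF k ok]
      by (simp add: x lsum_simps scale_def V'.smult_r_distr)
  qed
  \<comment> \<open>Addition in \<open>V\<close> concatenates decoded representatives; it does not
    depend on the choice because every \<open>lsum\<close> is additive under concatenation.\<close>
  have add_cl: "cl xs \<oplus>\<^bsub>V\<^esub> cl ys = cl (xs @ ys)" if "xs \<in> lists valid" "ys \<in> lists valid" for xs ys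
    using that dec[OF that(1)] dec[OF that(2)]
    by (auto simp: V_def cl_iff eqv_def lsum_append simp del: lists_eq_set)
  have smult_cl: "c \<odot>\<^bsub>V\<^esub> cl xs = cl (scale c xs)" if "c \<in> carrier K" "xs \<in> lists valid" for c xs
    using that dec[OF that(2)] by (auto simp: V_def cl_iff eqv_def lsum_scale scale_valid simp del: lists_eq_set)
  have carV: "carrier V = cl ` lists valid" and zeroV: "\<zero>\<^bsub>V\<^esub> = cl []" by (simp_all add: V_def)
  \<comment> \<open>Two classes are equal once every cowedge sums their lists to the same vector, so
    each law is inherited from the modules that are targets of cowedges.\<close>
  have modV: "module K V"
  proof (rule module_by_scalars[OF cring_K], goal_cases)
    note ml = module.smult_one[OF day_cowedgeD(1)] module.smult_l_null[OF day_cowedgeD(1)]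
      module.smult_l_distr[OF day_cowedgeD(1)] module.smult_r_distr[OF day_cowedgeD(1)]
      module.smult_assoc1[OF day_cowedgeD(1)]
      abelian_monoid.a_comm[OF abelian_group.axioms(1)[OF module.axioms(2)[OF day_cowedgeD(1)]]]
      abelian_monoid.l_zero[OF abelian_group.axioms(1)[OF module.axioms(2)[OF day_cowedgeD(1)]]]
    note ls = lsum_scale lsum_append lsum_closed lsum_simps(1)
    have E: "\<exists>xs. a = cl xs \<and> xs \<in> lists valid" if "a \<in> carrier V" for a using that by (auto simp: carV simp del: lists_eq_set)
    have cc: "cl xs \<in> carrier V" if "xs \<in> lists valid" for xs using that by (simp add: carV del: lists_eq_set)
    have ap: "xs \<in> lists valid \<Longrightarrow> ys \<in> lists valid \<Longrightarrow> xs @ ys \<in> lists valid" for xs ys by simp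
    have K1: "\<one>\<^bsub>K\<^esub> \<in> carrier K" "\<zero>\<^bsub>K\<^esub> \<in> carrier K"
      "a \<in> carrier K \<Longrightarrow> b \<in> carrier K \<Longrightarrow> a \<oplus>\<^bsub>K\<^esub> b \<in> carrier K"
      "a \<in> carrier K \<Longrightarrow> b \<in> carrier K \<Longrightarrow> a \<otimes>\<^bsub>K\<^esub> b \<in> carrier K" for a b by simp_all
    have nil: "[] \<in> lists valid" by simp
    note ops = add_cl smult_cl scale_valid ap nil K1 zeroV
    {
      case (1 x y) from E[OF 1(1)] E[OF 1(2)] show ?case by (elim exE conjE) (simp add: ops cc del: lists_eq_set)
    next
      case 2 show ?case by (simp add: ops cc del: lists_eq_set)
    next
      case (3 x y z) from E[OF 3(1)] E[OF 3(2)] E[OF 3(3)] show ?case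
        by (elim exE conjE) (simp add: ops del: lists_eq_set)
    next
      case (4 x y) from E[OF 4(1)] E[OF 4(2)] show ?case
        by (elim exE conjE) (simp add: ops cl_iff eqv_def ls ml(6) del: lists_eq_set)
    next
      case (5 x) from E[OF 5] show ?case
        by (elim exE conjE) (simp add: ops cl_iff eqv_def ls ml(7) del: lists_eq_set)
    next
      case (6 c x) from E[OF 6(2)] show ?case using 6(1) by (elim exE conjE) (simp add: ops cc del: lists_eq_set)
    next
      case (7 c d x) from E[OF 7(3)] show ?case using 7(1,2)
        by (elim exE conjE) (simp add: ops cl_iff eqv_def ls ml(3) del: lists_eq_set)
    next
      case (8 c x y) from E[OF 8(2)] E[OF 8(3)] show ?case using 8(1)
        by (elim exE conjE) (simp add: ops cl_iff eqv_def ls ml(4) del: lists_eq_set)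
    next
      case (9 c d x) from E[OF 9(3)] show ?case using 9(1,2)
        by (elim exE conjE) (simp add: ops cl_iff eqv_def ls ml(5) del: lists_eq_set)
    next
      case (10 x) from E[OF 10] show ?case
        by (elim exE conjE) (simp add: ops cl_iff eqv_def ls ml(1) del: lists_eq_set)
    next
      case (11 x) from E[OF 11] show ?case
        by (elim exE conjE) (simp add: ops cl_iff eqv_def ls ml(2) del: lists_eq_set)
    }
  qed
  have sing: "[(H,L,f,p,q)] \<in> lists valid" if "gen_ok P Q X H L f p q" for H L f p q
    using that by (simp add: valid_def)
  have lsum_sing: "lsum V' w' [(H,L,f,p,q)] = w' H L f p q"
    if "day_cowedge K S P Q X V' w'" "gen_ok P Q X H L f p q" for V' w' H L f p q
  proof -
    interpret V': module K V' by (rule day_cowedgeD(1)[OF that(1)])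
    show ?thesis using day_cowedgeD(6)[OF that] by (simp add: lsum_simps)
  qed
  \<comment> \<open>A linear relation between generators holds in \<open>V\<close> as soon as every
    cowedge satisfies it. With \<open>smult_eq\<close> this yields the trilinearity of
    \<open>w\<close>.\<close>
  have add_eq: "cl [x] = cl [y] \<oplus>\<^bsub>V\<^esub> cl [z]"
    if "x \<in> valid" "y \<in> valid" "z \<in> valid"
      "\<And>V' w'. day_cowedge K S P Q X V' w' \<Longrightarrow> lsum V' w' [x] = lsum V' w' [y] \<oplus>\<^bsub>V'\<^esub> lsum V' w' [z]" for x y z
  proof -
    have v: "[x] \<in> lists valid" "[y] \<in> lists valid" "[z] \<in> lists valid" "[y] @ [z] \<in> lists valid" using that by auto
    have "eqv [x] ([y] @ [z])" unfolding eqv_def using that(4) lsum_append v by metis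
    then show ?thesis using v by (simp only: add_cl cl_iff)
  qed
  have smult_eq: "cl [x] = c \<odot>\<^bsub>V\<^esub> cl [y]"
    if "c \<in> carrier K" "x \<in> valid" "y \<in> valid"
      "\<And>V' w'. day_cowedge K S P Q X V' w' \<Longrightarrow> lsum V' w' [x] = c \<odot>\<^bsub>V'\<^esub> lsum V' w' [y]" for x y c
  proof -
    have v: "[x] \<in> lists valid" "[y] \<in> lists valid" using that by auto
    have "eqv [x] (scale c [y])" unfolding eqv_def using that(4) lsum_scale[OF _ that(1) v(2)] by metis
    then show ?thesis using v scale_valid[OF that(1) v(2)] that(1) by (simp only: smult_cl cl_iff)
  qed
  have cow: "day_cowedge K S P Q X V w"
  proof (rule day_cowedgeI[OF modV X])
    fix H L p q assume HL: "H \<in> Obj S" "L \<in> Obj S" and p: "p \<in> carrier (fobj P H)" and q: "q \<in> carrier (fobj Q L)"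
    have Ob: "H \<box> L \<in> Obj S" using HL by simp
    have ok: "gen_ok P Q X H L f p q" if "f \<in> carrier (Hom S X (H \<box> L))" for f
      using Hom_Arr[OF X Ob that] HL p q X by (simp add: gen_ok_def)
    show "linear_on K (Hom S X (H \<box> L)) V (\<lambda>f. w H L f p q)"
    proof (rule linear_onI)
      fix f assume f: "f \<in> carrier (Hom S X (H \<box> L))"
      show "w H L f p q \<in> carrier V" unfolding w_def carV using sing[OF ok[OF f]] by (rule imageI)
      show "w H L (c \<odot>\<^bsub>Hom S X (H \<box> L)\<^esub> f) p q = c \<odot>\<^bsub>V\<^esub> w H L f p q" if c: "c \<in> carrier K" for c
        unfolding w_def
        by (rule smult_eq[OF c])
          (use ok[OF f] ok[OF module_smult_closed[OF Hm[OF HL] c f]]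
            linear_on_smult[OF day_cowedgeD(2)[OF _ HL p q] c f] in \<open>auto simp: lsum_sing valid_def\<close>)
      show "w H L (f \<oplus>\<^bsub>Hom S X (H \<box> L)\<^esub> f') p q = w H L f p q \<oplus>\<^bsub>V\<^esub> w H L f' p q"
        if f': "f' \<in> carrier (Hom S X (H \<box> L))" for f'
        unfolding w_def
        by (rule add_eq)
          (use ok[OF f] ok[OF f'] ok[OF module_add_closed[OF Hm[OF HL] f f']]
            linear_on_add[OF day_cowedgeD(2)[OF _ HL p q] f f'] in \<open>auto simp: lsum_sing valid_def\<close>)
    qed
  next
    fix H L f q assume a: "H \<in> Obj S" "L \<in> Obj S" "f \<in> Arr S" "Dom S f = X" "Cod S f = H \<box> L" "q \<in> carrier (fobj Q L)"
    note m = pshD(1)[OF P a(1)]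
    have ok: "gen_ok P Q X H L f p q" if "p \<in> carrier (fobj P H)" for p
      using a that X by (simp add: gen_ok_def)
    show "linear_on K (fobj P H) V (\<lambda>p. w H L f p q)"
    proof (rule linear_onI)
      fix p assume p: "p \<in> carrier (fobj P H)"
      show "w H L f p q \<in> carrier V" unfolding w_def carV using sing[OF ok[OF p]] by (rule imageI)
      show "w H L f (c \<odot>\<^bsub>fobj P H\<^esub> p) q = c \<odot>\<^bsub>V\<^esub> w H L f p q" if c: "c \<in> carrier K" for c
        unfolding w_def
        by (rule smult_eq[OF c])
          (use ok[OF p] ok[OF module_smult_closed[OF m c p]]
            linear_on_smult[OF day_cowedgeD(3)[OF _ a] c p] in \<open>auto simp: lsum_sing valid_def\<close>)
      show "w H L f (p \<oplus>\<^bsub>fobj P H\<^esub> p') q = w H L f p q \<oplus>\<^bsub>V\<^esub> w H L f p' q" if p': "p' \<in> carrier (fobj P H)" for p'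
        unfolding w_def
        by (rule add_eq)
          (use ok[OF p] ok[OF p'] ok[OF module_add_closed[OF m p p']]
            linear_on_add[OF day_cowedgeD(3)[OF _ a] p p'] in \<open>auto simp: lsum_sing valid_def\<close>)
    qed
  next
    fix H L f p assume a: "H \<in> Obj S" "L \<in> Obj S" "f \<in> Arr S" "Dom S f = X" "Cod S f = H \<box> L" "p \<in> carrier (fobj P H)"
    note m = pshD(1)[OF Q a(2)]
    have ok: "gen_ok P Q X H L f p q" if "q \<in> carrier (fobj Q L)" for q
      using a that X by (simp add: gen_ok_def)
    show "linear_on K (fobj Q L) V (\<lambda>q. w H L f p q)"
    proof (rule linear_onI)
      fix q assume q: "q \<in> carrier (fobj Q L)"
      show "w H L f p q \<in> carrier V" unfolding w_def carV using sing[OF ok[OF q]] by (rule imageI)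
      show "w H L f p (c \<odot>\<^bsub>fobj Q L\<^esub> q) = c \<odot>\<^bsub>V\<^esub> w H L f p q" if c: "c \<in> carrier K" for c
        unfolding w_def
        by (rule smult_eq[OF c])
          (use ok[OF q] ok[OF module_smult_closed[OF m c q]]
            linear_on_smult[OF day_cowedgeD(4)[OF _ a] c q] in \<open>auto simp: lsum_sing valid_def\<close>)
      show "w H L f p (q \<oplus>\<^bsub>fobj Q L\<^esub> q') = w H L f p q \<oplus>\<^bsub>V\<^esub> w H L f p q'" if q': "q' \<in> carrier (fobj Q L)" for q'
        unfolding w_def
        by (rule add_eq)
          (use ok[OF q] ok[OF q'] ok[OF module_add_closed[OF m q q']]
            linear_on_add[OF day_cowedgeD(4)[OF _ a] q q'] in \<open>auto simp: lsum_sing valid_def\<close>)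
    qed
  next
    fix h l f p q assume a: "h \<in> Arr S" "l \<in> Arr S" "f \<in> Arr S" "Dom S f = X" "Cod S f = Dom S h \<box> Dom S l"
      "p \<in> carrier (fobj P (Cod S h))" "q \<in> carrier (fobj Q (Cod S l))"
    have ok: "gen_ok P Q X (Cod S h) (Cod S l) ((h \<diamondop> l) \<cdot> f) p q"
      "gen_ok P Q X (Dom S h) (Dom S l) f (act P h p) (act Q l q)"
      using a X pshD(5)[OF P a(1) refl a(6)] pshD(5)[OF Q a(2) refl a(7)] by (simp_all add: gen_ok_def)
    show "w (Cod S h) (Cod S l) ((h \<diamondop> l) \<cdot> f) p q = w (Dom S h) (Dom S l) f (act P h p) (act Q l q)"
      unfolding w_def cl_iff[OF sing[OF ok(1)] sing[OF ok(2)]] eqv_def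
      using lsum_sing ok day_cowedgeD(5)[OF _ a] by simp
  qed
  have cl_Cons: "cl ((H,L,f,p,q) # xs) = w H L f p q \<oplus>\<^bsub>V\<^esub> cl xs"
    if "gen_ok P Q X H L f p q" "xs \<in> lists valid" for H L f p q xs
    using add_cl[OF sing[OF that(1)] that(2)] by (simp add: w_def)
  have univ: "\<exists>!h. day_factors K S P Q X V w V' w' h" if c: "day_cowedge K S P Q X V' w'" for V' w'
  proof (rule ex1I)
    \<comment> \<open>The mediating map is evaluation of formal sums by the given cowedge; it is
      well defined by the choice of \<open>eqv\<close>.\<close>
    let ?h = "\<lambda>a\<in>carrier V. lsum V' w' (dec a)"
    have h: "?h (cl xs) = lsum V' w' xs" if "xs \<in> lists valid" for xs
      using that dec[OF that] c by (simp add: carV eqv_def del: lists_eq_set)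
    have lin: "linear_on K V V' ?h"
    proof (rule linear_onI)
      fix x assume "x \<in> carrier V"
      then obtain xs where x: "x = cl xs" "xs \<in> lists valid" by (auto simp: carV simp del: lists_eq_set)
      show "?h x \<in> carrier V'" unfolding x(1) h[OF x(2)] by (rule lsum_closed[OF c x(2)])
      show "?h (a \<odot>\<^bsub>V\<^esub> x) = a \<odot>\<^bsub>V'\<^esub> ?h x" if "a \<in> carrier K" for a
        unfolding x(1) smult_cl[OF that x(2)] h[OF scale_valid[OF that x(2)]] h[OF x(2)]
        by (rule lsum_scale[OF c that x(2)])
      fix y assume "y \<in> carrier V"
      then obtain ys where y: "y = cl ys" "ys \<in> lists valid" by (auto simp: carV simp del: lists_eq_set)
      have "xs @ ys \<in> lists valid" using x y by simp
      then show "?h (x \<oplus>\<^bsub>V\<^esub> y) = ?h x \<oplus>\<^bsub>V'\<^esub> ?h y"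
        unfolding x(1) y(1) add_cl[OF x(2) y(2)] using h x(2) y(2) lsum_append[OF c x(2) y(2)] by metis
    qed
    show "day_factors K S P Q X V w V' w' ?h"
      unfolding day_factors_def
    proof (intro conjI ballI)
      show "?h \<in> lin_maps K V V'" using lin by (simp add: lin_maps_def)
      fix H L f p q assume "H \<in> Obj S" "L \<in> Obj S" "f \<in> hom_set S X (H \<box> L)" "p \<in> carrier (fobj P H)" "q \<in> carrier (fobj Q L)"
      then have ok: "gen_ok P Q X H L f p q" using X by (simp add: gen_ok_def hom_set_def)
      show "?h (w H L f p q) = w' H L f p q"
        unfolding w_def h[OF sing[OF ok]] by (rule lsum_sing[OF c ok])
    qed
    fix k assume k: "day_factors K S P Q X V w V' w' k"
    then have kl: "linear_on K V V' k" "k \<in> extensional (carrier V)"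
      and kw: "\<And>H L f p q. gen_ok P Q X H L f p q \<Longrightarrow> k (w H L f p q) = w' H L f p q"
      by (auto simp: day_factors_def lin_maps_def gen_ok_def hom_set_def)
    \<comment> \<open>Every element is a sum of generators, so a linear map with prescribed values
      on generators is fixed by induction on the list.\<close>
    have kc: "k (cl xs) = lsum V' w' xs" if "xs \<in> lists valid" for xs
      using that
    proof (induction xs)
      case Nil
      then show ?case using linear_on_zero[OF modV day_cowedgeD(1)[OF c] kl(1)] by (simp add: zeroV lsum_simps)
    next
      case (Cons x xs)
      obtain H L f p q where x: "x = (H,L,f,p,q)" by (cases x) auto
      then have ok: "gen_ok P Q X H L f p q" using Cons.hyps(1) by (simp add: valid_def)
      have "k (cl (x # xs)) = k (w H L f p q) \<oplus>\<^bsub>V'\<^esub> k (cl xs)"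
        unfolding x cl_Cons[OF ok Cons.hyps(2)]
        by (rule linear_on_add[OF kl(1)]) (use Cons.hyps day_cowedgeD(6)[OF cow ok] in \<open>auto simp: carV\<close>)
      then show ?case using Cons.IH kw[OF ok] by (simp add: x lsum_simps)
    qed
    show "k = ?h"
    proof (rule extensionalityI[OF kl(2)])
      fix x assume "x \<in> carrier V"
      then obtain xs where x: "x = cl xs" "xs \<in> lists valid" by (auto simp: carV simp del: lists_eq_set)
      show "k x = ?h x" unfolding x(1) h[OF x(2)] by (rule kc[OF x(2)])
    qed simp
  qed
  show ?thesis using cow univ by blast
qed

end

section \<open>Day convolution\<close>

lemma fobj_day [simp]: "fobj (day_obj K S P Q) X = day_space K S P Q X"
  by (simp add: day_obj_def)

context small_sg
begin

abbreviation day :: "('k,'o,'m,'v) psh \<Rightarrow> ('k,'o,'m,'v) psh \<Rightarrow> ('k,'o,'m,'v) psh" (infixr "\<circledast>" 80) where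
  "P \<circledast> Q \<equiv> day_obj K S P Q"

abbreviation PC :: "('k, ('k,'o,'m,'v) psh, ('k,'o,'m,'v) pshmap) lcat" where
  "PC \<equiv> presheaf_cat K S"

abbreviation DC :: "('k, ('k,'o,'m,'v) psh, ('k,'o,'m,'v) pshmap) sgcat" where
  "DC \<equiv> day_cat K S"

lemma coend:
  fixes P Q :: "('k,'o,'m,'v) psh"
  assumes "psh K S P" "psh K S Q" "X \<in> Obj S"
  shows "day_cowedge K S P Q X (day_space K S P Q X) (day_in K S P Q X)"
    and "day_cowedge K S P Q X V' w' \<Longrightarrow>
      \<exists>!h. day_factors K S P Q X (day_space K S P Q X) (day_in K S P Q X) V' w' h"
proof -
  have "case day_coend K S P Q X of (V, w) \<Rightarrow> day_cowedge K S P Q X V w \<and>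
        (\<forall>V' w'. day_cowedge K S P Q X V' w' \<longrightarrow> (\<exists>!h. day_factors K S P Q X V w V' w' h))"
    unfolding day_coend_def by (rule someI_ex) (use coend_exists[OF assms] in auto)
  then show "day_cowedge K S P Q X (day_space K S P Q X) (day_in K S P Q X)"
    "day_cowedge K S P Q X V' w' \<Longrightarrow>
      \<exists>!h. day_factors K S P Q X (day_space K S P Q X) (day_in K S P Q X) V' w' h"
    by (auto simp: day_space_def day_in_def case_prod_unfold)
qed

lemmas cow = day_cowedgeD[OF coend(1)]

lemma module_day: "psh K S P \<Longrightarrow> psh K S Q \<Longrightarrow> X \<in> Obj S \<Longrightarrow> module K (day_space K S P Q X :: ('k,'v) module)"
  by (rule cow(1))

lemma day_in_closed:
  fixes P Q :: "('k,'o,'m,'v) psh"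
  assumes "psh K S P" "psh K S Q" "H \<in> Obj S" "L \<in> Obj S" "f \<in> Arr S" "Dom S f = X" "Cod S f = H \<box> L"
    "p \<in> carrier (fobj P H)" "q \<in> carrier (fobj Q L)"
  shows "day_in K S P Q X H L f p q \<in> carrier (day_space K S P Q X)"
  by (rule cow(6)) (use assms in \<open>auto simp: gen_ok_def\<close>)

lemma day_liftD:
  fixes P Q :: "('k,'o,'m,'v) psh"
  assumes "psh K S P" "psh K S Q" "X \<in> Obj S" "day_cowedge K S P Q X V' w'"
  defines "h \<equiv> day_lift K S P Q X V' w'"
  shows "h = MArr (day_space K S P Q X) V' (cpt h)" "src h = day_space K S P Q X" "tgt h = V'"
    and "linear_on K (day_space K S P Q X) V' (cpt h)" "cpt h \<in> extensional (carrier (day_space K S P Q X))"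
    and "\<lbrakk>H \<in> Obj S; L \<in> Obj S; f \<in> Arr S; Dom S f = X; Cod S f = H \<box> L;
      p \<in> carrier (fobj P H); q \<in> carrier (fobj Q L)\<rbrakk> \<Longrightarrow>
      cpt h (day_in K S P Q X H L f p q) = w' H L f p q"
proof -
  have "day_factors K S P Q X (day_space K S P Q X) (day_in K S P Q X) V' w' (cpt h)"
    unfolding h_def day_lift_def using theI'[OF coend(2)[OF assms(1-4)]] by simp
  then show "linear_on K (day_space K S P Q X) V' (cpt h)" "cpt h \<in> extensional (carrier (day_space K S P Q X))"
    "\<lbrakk>H \<in> Obj S; L \<in> Obj S; f \<in> Arr S; Dom S f = X; Cod S f = H \<box> L;
      p \<in> carrier (fobj P H); q \<in> carrier (fobj Q L)\<rbrakk> \<Longrightarrow>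
      cpt h (day_in K S P Q X H L f p q) = w' H L f p q"
    by (simp_all add: day_factors_def lin_maps_def hom_set_def)
  show "h = MArr (day_space K S P Q X) V' (cpt h)" "src h = day_space K S P Q X" "tgt h = V'"
    by (simp_all add: h_def day_lift_def)
qed

lemma day_cowedge_comp:
  fixes P Q :: "('k,'o,'m,'v) psh"
  assumes "day_cowedge K S P Q X V w" "X \<in> Obj S" "linear_on K V V' g" "module K V'"
  shows "day_cowedge K S P Q X V' (\<lambda>H L f p q. g (w H L f p q))"
  by (rule day_cowedgeI)
    (use assms in \<open>auto intro: linear_on_comp[OF _ assms(3)] day_cowedgeD[OF assms(1)] simp: day_cowedgeD(5)[OF assms(1)]\<close>)

text \<open>After restriction to the carrier both maps factor the cowedge induced by
  \<open>g\<close>, so the uniqueness half of the universal property identifies them. All later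
  equality proofs on convolutions go back to this.\<close>

lemma day_in_ext:
  fixes P Q :: "('k,'o,'m,'v) psh" and V :: "('k,'v) module"
  assumes PQ: "psh K S P" "psh K S Q" and X: "X \<in> Obj S"
    and g: "linear_on K (day_space K S P Q X) V g" and g': "linear_on K (day_space K S P Q X) V g'" and V: "module K V"
    and eq: "\<And>H L f p q. \<lbrakk>H \<in> Obj S; L \<in> Obj S; f \<in> Arr S; Dom S f = X; Cod S f = H \<box> L;
      p \<in> carrier (fobj P H); q \<in> carrier (fobj Q L)\<rbrakk> \<Longrightarrow>
      g (day_in K S P Q X H L f p q) = g' (day_in K S P Q X H L f p q)"
    and u: "u \<in> carrier (day_space K S P Q X)"
  shows "g u = g' u"
proof -
  let ?V = "day_space K S P Q X"
  have "restrict g (carrier ?V) = restrict g' (carrier ?V)"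
  proof (rule ex1E[OF coend(2)[OF PQ X day_cowedge_comp[OF coend(1)[OF PQ X] X g V]]], rule trans)
    fix h assume *: "\<forall>h'. day_factors K S P Q X ?V (day_in K S P Q X) V (\<lambda>H L f p q. g (day_in K S P Q X H L f p q)) h' \<longrightarrow> h' = h"
    note m = module_day[OF PQ X]
    have c: "day_in K S P Q X H L f p q \<in> carrier ?V"
      if "H \<in> Obj S" "L \<in> Obj S" "f \<in> hom_set S X (H \<box> L)" "p \<in> carrier (fobj P H)" "q \<in> carrier (fobj Q L)" for H L f p q
      using that by (intro day_in_closed[OF PQ]) (auto simp: hom_set_def)
    show "restrict g (carrier ?V) = h"
      by (rule *[rule_format]) (simp add: day_factors_def restrict_lin_maps[OF m g] c)
    show "h = restrict g' (carrier ?V)"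
      by (rule *[rule_format, symmetric])
        (simp add: day_factors_def restrict_lin_maps[OF m g'] c, simp add: hom_set_def eq)
  qed
  from fun_cong[OF this, of u] u show ?thesis by simp
qed

text \<open>For fixed parameters, both sides of the additivity and homogeneity equations are linear
  in \<open>u\<close>, so linearity in \<open>z\<close> may be tested on generators.\<close>

lemma day_family_linear:
  fixes P Q :: "('k,'o,'m,'v) psh" and V :: "('k,'v) module"
  assumes PQ: "psh K S P" "psh K S Q" and X: "X \<in> Obj S" and Z: "module K Z" and V: "module K V"
    and l: "\<And>z. z \<in> carrier Z \<Longrightarrow> linear_on K (day_space K S P Q X) V (\<phi> z)"
    and g: "\<And>H L f p q. \<lbrakk>H \<in> Obj S; L \<in> Obj S; f \<in> Arr S; Dom S f = X; Cod S f = H \<box> L;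
      p \<in> carrier (fobj P H); q \<in> carrier (fobj Q L)\<rbrakk> \<Longrightarrow>
      linear_on K Z V (\<lambda>z. \<phi> z (day_in K S P Q X H L f p q))"
    and u: "u \<in> carrier (day_space K S P Q X)"
  shows "linear_on K Z V (\<lambda>z. \<phi> z u)"
proof (rule linear_onI)
  note m = module_day[OF PQ X]
  fix z assume z: "z \<in> carrier Z"
  show "\<phi> z u \<in> carrier V" by (rule linear_on_closed[OF l[OF z] u])
  show "\<phi> (c \<odot>\<^bsub>Z\<^esub> z) u = c \<odot>\<^bsub>V\<^esub> \<phi> z u" if c: "c \<in> carrier K" for c
    by (rule day_in_ext[OF PQ X l[OF module_smult_closed[OF Z c z]] linear_on_scale[OF m V l[OF z] c] V _ u])
      (rule linear_on_smult[OF g c z])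
  show "\<phi> (z \<oplus>\<^bsub>Z\<^esub> z') u = \<phi> z u \<oplus>\<^bsub>V\<^esub> \<phi> z' u" if z': "z' \<in> carrier Z" for z'
    by (rule day_in_ext[OF PQ X l[OF module_add_closed[OF Z z z']] linear_on_sum[OF m V l[OF z] l[OF z']] V _ u])
      (rule linear_on_add[OF g z z'])
qed

lemma day_in_dinat:
  fixes P Q :: "('k,'o,'m,'v) psh"
  assumes "psh K S P" "psh K S Q" "h \<in> Arr S" "l \<in> Arr S" "f \<in> Arr S" "Dom S f = X" "Dom S h = A" "Dom S l = B"
    "Cod S f = A \<box> B" "Cod S h = A'" "Cod S l = B'" "p \<in> carrier (fobj P A')" "q \<in> carrier (fobj Q B')"
  shows "day_in K S P Q X A B f (act P h p) (act Q l q) = day_in K S P Q X A' B' ((h \<diamondop> l) \<cdot> f) p q"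
  using cow(5)[OF assms(1,2) _ assms(3-6), of p q] assms by auto

lemma Ide_psh_arr: "psh K S P \<Longrightarrow> Ide PC P \<in> Arr PC"
  using lin_category.Ide_Arr(1)[OF lin_category_presheaf, of P] by simp

lemma day_act_cowedge:
  fixes P Q :: "('k,'o,'m,'v) psh"
  assumes P: "psh K S P" and Q: "psh K S Q" and g: "g \<in> Arr S"
  shows "day_cowedge K S P Q (Cod S g) (day_space K S P Q (Dom S g)) (\<lambda>H L f. day_in K S P Q (Dom S g) H L (f \<cdot> g))"
proof (rule day_cowedgeI)
  note cw = cow[OF P Q Dom_Obj[OF g]]
  show "module K (day_space K S P Q (Dom S g))" by (rule cw(1))
  show "Cod S g \<in> Obj S" using g by simp
  fix H L assume HL: "H \<in> Obj S" "L \<in> Obj S"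
  show "linear_on K (Hom S (Cod S g) (H \<box> L)) (day_space K S P Q (Dom S g)) (\<lambda>f. day_in K S P Q (Dom S g) H L (f \<cdot> g) p q)"
    if "p \<in> carrier (fobj P H)" "q \<in> carrier (fobj Q L)" for p q
    by (rule linear_on_comp[OF Cmp_lin_left cw(2)]) (use HL g that in simp_all)
  fix f assume f: "f \<in> Arr S" "Dom S f = Cod S g" "Cod S f = H \<box> L"
  show "linear_on K (fobj P H) (day_space K S P Q (Dom S g)) (\<lambda>p. day_in K S P Q (Dom S g) H L (f \<cdot> g) p q)"
    if "q \<in> carrier (fobj Q L)" for q
    by (rule cw(3)) (use HL g f that in simp_all)
  show "linear_on K (fobj Q L) (day_space K S P Q (Dom S g)) (\<lambda>q. day_in K S P Q (Dom S g) H L (f \<cdot> g) p q)"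
    if "p \<in> carrier (fobj P H)" for p
    by (rule cw(4)) (use HL g f that in simp_all)
next
  fix h l f p q assume a: "h \<in> Arr S" "l \<in> Arr S" "f \<in> Arr S" "Dom S f = Cod S g" "Cod S f = Dom S h \<box> Dom S l"
    "p \<in> carrier (fobj P (Cod S h))" "q \<in> carrier (fobj Q (Cod S l))"
  show "day_in K S P Q (Dom S g) (Cod S h) (Cod S l) (((h \<diamondop> l) \<cdot> f) \<cdot> g) p q =
      day_in K S P Q (Dom S g) (Dom S h) (Dom S l) (f \<cdot> g) (act P h p) (act Q l q)"
    using day_in_dinat[OF P Q a(1,2), of "f \<cdot> g" "Dom S g"] a g by simp
qed

lemma act_day:
  fixes P Q :: "('k,'o,'m,'v) psh"
  assumes P: "psh K S P" and Q: "psh K S Q" and g: "g \<in> Arr S"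
    and "H \<in> Obj S" "L \<in> Obj S" "f \<in> Arr S" "Dom S f = X" "X = Cod S g" "Cod S f = H \<box> L"
    "p \<in> carrier (fobj P H)" "q \<in> carrier (fobj Q L)"
  shows "act (P \<circledast> Q) g (day_in K S P Q X H L f p q) = day_in K S P Q (Dom S g) H L (f \<cdot> g) p q"
  using day_liftD(6)[OF P Q Cod_Obj[OF g] day_act_cowedge[OF P Q g], of H L f p q] assms
  by (simp add: day_obj_def)

text \<open>Each functor law compares maps that are linear on a coend, so it suffices to check
  generators, where an arrow acts by precomposition on \<open>f\<close>.\<close>

lemma psh_day [simp]:
  fixes P Q :: "('k,'o,'m,'v) psh"
  assumes P: "psh K S P" and Q: "psh K S Q"
  shows "psh K S (P \<circledast> Q)"
proof (rule pshI)
  fix A assume A: "A \<in> Obj S"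
  show m: "module K (fobj (P \<circledast> Q) A)" using module_day[OF P Q A] by simp
next
  fix h assume h: "h \<in> Arr S"
  have e: "farr (P \<circledast> Q) h = day_lift K S P Q (Cod S h) (day_space K S P Q (Dom S h))
      (\<lambda>H L f. day_in K S P Q (Dom S h) H L (f \<cdot> h))" by (simp add: day_obj_def)
  note d = day_liftD[OF P Q Cod_Obj[OF h] day_act_cowedge[OF P Q h]]
  show "farr (P \<circledast> Q) h = MArr (fobj (P \<circledast> Q) (Cod S h)) (fobj (P \<circledast> Q) (Dom S h)) (act (P \<circledast> Q) h)"
    unfolding e fobj_day by (rule d(1))
  show lin: "linear_on K (fobj (P \<circledast> Q) (Cod S h)) (fobj (P \<circledast> Q) (Dom S h)) (act (P \<circledast> Q) h)"
    unfolding e fobj_day by (rule d(4))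
  show "act (P \<circledast> Q) h \<in> extensional (carrier (fobj (P \<circledast> Q) (Cod S h)))"
    unfolding e fobj_day by (rule d(5))
next
  have lin: "linear_on K (day_space K S P Q (Cod S h)) (day_space K S P Q (Dom S h)) (act (P \<circledast> Q) h)"
    if "h \<in> Arr S" for h
    using day_liftD(4)[OF P Q Cod_Obj[OF that] day_act_cowedge[OF P Q that]] by (simp add: day_obj_def)
  show "act (P \<circledast> Q) (Ide S A) p = p" if A: "A \<in> Obj S" and p: "p \<in> carrier (fobj (P \<circledast> Q) A)" for A p
    by (rule day_in_ext[OF P Q A _ linear_on_id module_day[OF P Q A]])
      (use lin[of "Ide S A"] A p in \<open>simp_all add: act_day[OF P Q]\<close>)
  show "act (P \<circledast> Q) (g \<cdot> f) p = act (P \<circledast> Q) f (act (P \<circledast> Q) g p)"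
    if a: "f \<in> Arr S" "g \<in> Arr S" "Dom S g = Cod S f" "p \<in> carrier (fobj (P \<circledast> Q) (Cod S g))" for f g p
    by (rule day_in_ext[OF P Q Cod_Obj[OF a(2)] _ linear_on_comp[OF lin[OF a(2)]] module_day[OF P Q Dom_Obj[OF a(1)]]])
      (use lin[of "g \<cdot> f"] lin[of f] a in \<open>simp_all add: act_day[OF P Q]\<close>)
  show "linear_on K (Hom S A B) (fobj (P \<circledast> Q) A) (\<lambda>h. act (P \<circledast> Q) h p)"
    if A: "A \<in> Obj S" and B: "B \<in> Obj S" and p: "p \<in> carrier (fobj (P \<circledast> Q) B)" for A B p
    unfolding fobj_day
  proof (rule day_family_linear[OF P Q B Hom_module[OF A B] module_day[OF P Q A]])
    show "linear_on K (day_space K S P Q B) (day_space K S P Q A) (act (P \<circledast> Q) z)" if "z \<in> carrier (Hom S A B)" for z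
      using lin[of z] Hom_Arr[OF A B that] by simp
    show "linear_on K (Hom S A B) (day_space K S P Q A) (\<lambda>z. act (P \<circledast> Q) z (day_in K S P Q B H L f p q))"
      if a: "H \<in> Obj S" "L \<in> Obj S" "f \<in> Arr S" "Dom S f = B" "Cod S f = H \<box> L" "p \<in> carrier (fobj P H)" "q \<in> carrier (fobj Q L)" for H L f p q
    proof (rule linear_on_cong[OF Hom_module[OF A B]])
      show "act (P \<circledast> Q) z (day_in K S P Q B H L f p q) = day_in K S P Q A H L (f \<cdot> z) p q"
        if "z \<in> carrier (Hom S A B)" for z
        using Hom_Arr[OF A B that] a by (simp add: act_day[OF P Q])
      show "linear_on K (Hom S A B) (day_space K S P Q A) (\<lambda>z. day_in K S P Q A H L (f \<cdot> z) p q)"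
        by (rule linear_on_comp[OF _ cow(2)[OF P Q A a(1,2,6,7)]])
          (use Cmp_lin_right[OF A a(3)] a in simp)
    qed
    show "p \<in> carrier (day_space K S P Q B)" using p by simp
  qed
qed

text \<open>The generator \<open>p \<otimes> q\<close>, carried by an identity arrow. A general
  generator is its restriction along \<open>f\<close>, so the tensors generate the convolution as a
  presheaf.\<close>

definition tens :: "('k,'o,'m,'v) psh \<Rightarrow> ('k,'o,'m,'v) psh \<Rightarrow> 'o \<Rightarrow> 'o \<Rightarrow> 'v \<Rightarrow> 'v \<Rightarrow> 'v" where
  "tens P Q A B p q = day_in K S P Q (A \<box> B) A B (Ide S (A \<box> B)) p q"

lemma tens_closed [simp]:
  assumes "psh K S P" "psh K S Q" "A \<in> Obj S" "B \<in> Obj S" "p \<in> carrier (fobj P A)" "q \<in> carrier (fobj Q B)"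
  shows "tens P Q A B p q \<in> carrier (day_space K S P Q (A \<box> B))"
  unfolding tens_def by (rule day_in_closed) (use assms in simp_all)

lemma day_in_tens:
  assumes "psh K S P" "psh K S Q" "H \<in> Obj S" "L \<in> Obj S" "f \<in> Arr S" "Dom S f = X" "Cod S f = H \<box> L"
    "p \<in> carrier (fobj P H)" "q \<in> carrier (fobj Q L)"
  shows "day_in K S P Q X H L f p q = act (P \<circledast> Q) f (tens P Q H L p q)"
  unfolding tens_def using assms by (simp add: act_day)

lemma linear_tens:
  assumes "psh K S P" "psh K S Q" "A \<in> Obj S" "B \<in> Obj S"
  shows "q \<in> carrier (fobj Q B) \<Longrightarrow> linear_on K (fobj P A) (day_space K S P Q (A \<box> B)) (\<lambda>p. tens P Q A B p q)"
    and "p \<in> carrier (fobj P A) \<Longrightarrow> linear_on K (fobj Q B) (day_space K S P Q (A \<box> B)) (\<lambda>q. tens P Q A B p q)"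
  unfolding tens_def using assms by (auto intro: cow(3,4))

lemma act_tens:
  assumes "psh K S P" "psh K S Q" "h \<in> Arr S" "l \<in> Arr S" "Cod S h = A'" "Cod S l = B'"
    "p \<in> carrier (fobj P A')" "q \<in> carrier (fobj Q B')"
  shows "act (P \<circledast> Q) (h \<diamondop> l) (tens P Q A' B' p q) = tens P Q (Dom S h) (Dom S l) (act P h p) (act Q l q)"
  unfolding tens_def using assms day_in_dinat[OF assms(1-4), of "Ide S (Dom S h \<box> Dom S l)"]
  by (auto simp: act_day)

text \<open>Naturality moves the arrow \<open>f\<close> of a generator out of the map, which leaves
  only the values on tensors.\<close>

lemma day_ext:
  fixes P Q :: "('k,'o,'m,'v) psh"
  assumes P: "psh K S P" and Q: "psh K S Q" and s: "s \<in> Arr PC" and s': "s' \<in> Arr PC"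
    and "src s = P \<circledast> Q" "src s' = P \<circledast> Q" "tgt s = tgt s'"
    and eq: "\<And>A B p q. \<lbrakk>A \<in> Obj S; B \<in> Obj S; p \<in> carrier (fobj P A); q \<in> carrier (fobj Q B)\<rbrakk> \<Longrightarrow>
      ap s (A \<box> B) (tens P Q A B p q) = ap s' (A \<box> B) (tens P Q A B p q)"
  shows "s = s'"
proof (rule psh_arr_eqI[OF s s'])
  note d = psh_arrD[OF s] and d' = psh_arrD[OF s']
  fix X p assume X: "X \<in> Obj S" and p: "p \<in> carrier (fobj (src s) X)"
  show "ap s X p = ap s' X p"
  proof (rule day_in_ext[OF P Q X, where g = "ap s X" and g' = "ap s' X" and V = "fobj (tgt s) X"])
    show "module K (fobj (tgt s) X)" by (rule pshD(1)[OF d(2) X])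
    show "linear_on K (day_space K S P Q X) (fobj (tgt s) X) (ap s X)"
      "linear_on K (day_space K S P Q X) (fobj (tgt s) X) (ap s' X)"
      using d(5)[OF X] d'(5)[OF X] assms(5-7) by simp_all
    show "p \<in> carrier (day_space K S P Q X)" using p assms(5) by simp
    fix H L f p q
    assume a: "H \<in> Obj S" "L \<in> Obj S" "f \<in> Arr S" "Dom S f = X" "Cod S f = H \<box> L" "p \<in> carrier (fobj P H)" "q \<in> carrier (fobj Q L)"
    have "tens P Q H L p q \<in> carrier (day_space K S P Q (H \<box> L))" using a P Q by simp
    then show "ap s X (day_in K S P Q X H L f p q) = ap s' X (day_in K S P Q X H L f p q)"
      using d(8)[OF a(3)] d'(8)[OF a(3)] a eq[OF a(1,2,6,7)] assms(5-7) by (simp add: day_in_tens[OF P Q])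
  qed
qed (use assms in simp_all)

text \<open>The first reduction leaves an arbitrary \<open>u\<close> in the left factor. Both maps
  are linear in \<open>u\<close>, so it may be taken to be a generator, and its arrow is again moved
  out by naturality.\<close>

lemma day_ext_left:
  fixes P Q R :: "('k,'o,'m,'v) psh"
  assumes P: "psh K S P" and Q: "psh K S Q" and R: "psh K S R"
    and s: "s \<in> Arr PC" and s': "s' \<in> Arr PC"
    and src: "src s = (P \<circledast> Q) \<circledast> R" "src s' = (P \<circledast> Q) \<circledast> R" "tgt s = tgt s'"
    and eq: "\<And>A B C p q r. \<lbrakk>A \<in> Obj S; B \<in> Obj S; C \<in> Obj S; p \<in> carrier (fobj P A); q \<in> carrier (fobj Q B); r \<in> carrier (fobj R C)\<rbrakk> \<Longrightarrow>
      ap s ((A \<box> B) \<box> C) (tens (P \<circledast> Q) R (A \<box> B) C (tens P Q A B p q) r) =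
      ap s' ((A \<box> B) \<box> C) (tens (P \<circledast> Q) R (A \<box> B) C (tens P Q A B p q) r)"
  shows "s = s'"
proof (rule day_ext[OF psh_day[OF P Q] R s s' src])
  note d = psh_arrD[OF s] and d' = psh_arrD[OF s'] and PQ = psh_day[OF P Q]
  fix H C u r assume H: "H \<in> Obj S" and C: "C \<in> Obj S" and u: "u \<in> carrier (fobj (P \<circledast> Q) H)" and r: "r \<in> carrier (fobj R C)"
  have HC: "H \<box> C \<in> Obj S" using H C by simp
  note lt = linear_tens(1)[OF PQ R H C r, unfolded fobj_day]
  show "ap s (H \<box> C) (tens (P \<circledast> Q) R H C u r) = ap s' (H \<box> C) (tens (P \<circledast> Q) R H C u r)"
  proof (rule day_in_ext[OF P Q H linear_on_comp[OF lt] linear_on_comp[OF lt] pshD(1)[OF d(2) HC]])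
    show "linear_on K (day_space K S (P \<circledast> Q) R (H \<box> C)) (fobj (tgt s) (H \<box> C)) (ap s (H \<box> C))"
      "linear_on K (day_space K S (P \<circledast> Q) R (H \<box> C)) (fobj (tgt s) (H \<box> C)) (ap s' (H \<box> C))"
      using d(5)[OF HC] d'(5)[OF HC] src by simp_all
    show "u \<in> carrier (day_space K S P Q H)" using u by simp
    fix A B f p q
    assume a: "A \<in> Obj S" "B \<in> Obj S" "f \<in> Arr S" "Dom S f = H" "Cod S f = A \<box> B" "p \<in> carrier (fobj P A)" "q \<in> carrier (fobj Q B)"
    let ?t = "tens (P \<circledast> Q) R (A \<box> B) C (tens P Q A B p q) r"
    have t: "?t \<in> carrier (day_space K S (P \<circledast> Q) R ((A \<box> B) \<box> C))" using a C r P Q R by simp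
    have e: "tens (P \<circledast> Q) R H C (day_in K S P Q H A B f p q) r = act ((P \<circledast> Q) \<circledast> R) (f \<diamondop> Ide S C) ?t"
      using a C r P Q R pshD(6)[OF R C r] by (subst act_tens) (simp_all add: day_in_tens)
    show "ap s (H \<box> C) (tens (P \<circledast> Q) R H C (day_in K S P Q H A B f p q) r) =
        ap s' (H \<box> C) (tens (P \<circledast> Q) R H C (day_in K S P Q H A B f p q) r)"
      unfolding e using d(8)[of "f \<diamondop> Ide S C" ?t] d'(8)[of "f \<diamondop> Ide S C" ?t] a C t src eq[OF a(1,2) C a(6,7) r] by simp
  qed
qed

text \<open>As for the other bracketing, with the inner reduction performed in the second
  factor.\<close>

lemma day_ext_right:
  fixes P Q R :: "('k,'o,'m,'v) psh"
  assumes P: "psh K S P" and Q: "psh K S Q" and R: "psh K S R"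
    and s: "s \<in> Arr PC" and s': "s' \<in> Arr PC"
    and src: "src s = P \<circledast> (Q \<circledast> R)" "src s' = P \<circledast> (Q \<circledast> R)" "tgt s = tgt s'"
    and eq: "\<And>A B C p q r. \<lbrakk>A \<in> Obj S; B \<in> Obj S; C \<in> Obj S; p \<in> carrier (fobj P A); q \<in> carrier (fobj Q B); r \<in> carrier (fobj R C)\<rbrakk> \<Longrightarrow>
      ap s (A \<box> (B \<box> C)) (tens P (Q \<circledast> R) A (B \<box> C) p (tens Q R B C q r)) =
      ap s' (A \<box> (B \<box> C)) (tens P (Q \<circledast> R) A (B \<box> C) p (tens Q R B C q r))"
  shows "s = s'"
proof (rule day_ext[OF P psh_day[OF Q R] s s' src])
  note d = psh_arrD[OF s] and d' = psh_arrD[OF s'] and QR = psh_day[OF Q R]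
  fix A H p u assume A: "A \<in> Obj S" and H: "H \<in> Obj S" and u: "u \<in> carrier (fobj (Q \<circledast> R) H)" and p: "p \<in> carrier (fobj P A)"
  have AH: "A \<box> H \<in> Obj S" using H A by simp
  note lt = linear_tens(2)[OF P QR A H p, unfolded fobj_day]
  show "ap s (A \<box> H) (tens P (Q \<circledast> R) A H p u) = ap s' (A \<box> H) (tens P (Q \<circledast> R) A H p u)"
  proof (rule day_in_ext[OF Q R H linear_on_comp[OF lt] linear_on_comp[OF lt] pshD(1)[OF d(2) AH]])
    show "linear_on K (day_space K S P (Q \<circledast> R) (A \<box> H)) (fobj (tgt s) (A \<box> H)) (ap s (A \<box> H))"
      "linear_on K (day_space K S P (Q \<circledast> R) (A \<box> H)) (fobj (tgt s) (A \<box> H)) (ap s' (A \<box> H))"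
      using d(5)[OF AH] d'(5)[OF AH] src by simp_all
    show "u \<in> carrier (day_space K S Q R H)" using u by simp
    fix B C f q r
    assume a: "B \<in> Obj S" "C \<in> Obj S" "f \<in> Arr S" "Dom S f = H" "Cod S f = B \<box> C" "q \<in> carrier (fobj Q B)" "r \<in> carrier (fobj R C)"
    let ?t = "tens P (Q \<circledast> R) A (B \<box> C) p (tens Q R B C q r)"
    have t: "?t \<in> carrier (day_space K S P (Q \<circledast> R) (A \<box> (B \<box> C)))" using a A p P Q R by simp
    have e: "tens P (Q \<circledast> R) A H p (day_in K S Q R H B C f q r) = act (P \<circledast> (Q \<circledast> R)) (Ide S A \<diamondop> f) ?t"
      using a A p P Q R pshD(6)[OF P A p] by (subst act_tens) (simp_all add: day_in_tens)
    show "ap s (A \<box> H) (tens P (Q \<circledast> R) A H p (day_in K S Q R H B C f q r)) =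
        ap s' (A \<box> H) (tens P (Q \<circledast> R) A H p (day_in K S Q R H B C f q r))"
      unfolding e using d(8)[of "Ide S A \<diamondop> f" ?t] d'(8)[of "Ide S A \<diamondop> f" ?t] a A t src eq[OF A a(1,2) p a(6,7)] by simp
  qed
qed

text \<open>The universal property in its working form: bilinear natural families on tensors extend
  to presheaf maps. The cowedge at \<open>X\<close> sends \<open>(f, p, q)\<close> to
  \<open>act T f (\<theta> p q)\<close>, and its dinaturality is the naturality of
  \<open>\<theta>\<close> in both variables.\<close>

lemma tens_lift:
  assumes P: "psh K S P" and Q: "psh K S Q" and T: "psh K S T"
    and l1: "\<And>A B q. A \<in> Obj S \<Longrightarrow> B \<in> Obj S \<Longrightarrow> q \<in> carrier (fobj Q B) \<Longrightarrow> linear_on K (fobj P A) (fobj T (A \<box> B)) (\<lambda>p. \<theta> A B p q)"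
    and l2: "\<And>A B p. A \<in> Obj S \<Longrightarrow> B \<in> Obj S \<Longrightarrow> p \<in> carrier (fobj P A) \<Longrightarrow> linear_on K (fobj Q B) (fobj T (A \<box> B)) (\<lambda>q. \<theta> A B p q)"
    and dn: "\<And>h l p q. \<lbrakk>h \<in> Arr S; l \<in> Arr S; p \<in> carrier (fobj P (Cod S h)); q \<in> carrier (fobj Q (Cod S l))\<rbrakk> \<Longrightarrow>
      act T (h \<diamondop> l) (\<theta> (Cod S h) (Cod S l) p q) = \<theta> (Dom S h) (Dom S l) (act P h p) (act Q l q)"
  shows "\<exists>s. s \<in> Arr PC \<and> src s = P \<circledast> Q \<and> tgt s = T \<and>
    (\<forall>A\<in>Obj S. \<forall>B\<in>Obj S. \<forall>p\<in>carrier (fobj P A). \<forall>q\<in>carrier (fobj Q B). ap s (A \<box> B) (tens P Q A B p q) = \<theta> A B p q)"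
proof -
  let ?w = "\<lambda>X H L f p q. act T f (\<theta> H L p q)"
  have t: "\<theta> A B p q \<in> carrier (fobj T (A \<box> B))" if "A \<in> Obj S" "B \<in> Obj S" "p \<in> carrier (fobj P A)" "q \<in> carrier (fobj Q B)" for A B p q
    using linear_on_closed[OF l1] that by blast
  have c: "day_cowedge K S P Q X (fobj T X) (?w X)" if X: "X \<in> Obj S" for X
  proof (rule day_cowedgeI[OF pshD(1)[OF T X] X])
    show "linear_on K (Hom S X (H \<box> L)) (fobj T X) (\<lambda>f. act T f (\<theta> H L p q))"
      if "H \<in> Obj S" "L \<in> Obj S" "p \<in> carrier (fobj P H)" "q \<in> carrier (fobj Q L)" for H L p q
      by (rule pshD(8)[OF T X]) (use that t in simp_all)
    fix H L f assume a: "H \<in> Obj S" "L \<in> Obj S" "f \<in> Arr S" "Dom S f = X" "Cod S f = H \<box> L"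
    have la: "linear_on K (fobj T (H \<box> L)) (fobj T X) (act T f)" using pshD(3)[OF T a(3)] a by simp
    show "linear_on K (fobj P H) (fobj T X) (\<lambda>p. act T f (\<theta> H L p q))" if "q \<in> carrier (fobj Q L)" for q
      by (rule linear_on_comp[OF l1[OF a(1,2) that] la])
    show "linear_on K (fobj Q L) (fobj T X) (\<lambda>q. act T f (\<theta> H L p q))" if "p \<in> carrier (fobj P H)" for p
      by (rule linear_on_comp[OF l2[OF a(1,2) that] la])
  next
    fix h l f p q
    assume a: "h \<in> Arr S" "l \<in> Arr S" "f \<in> Arr S" "Dom S f = X" "Cod S f = Dom S h \<box> Dom S l"
      "p \<in> carrier (fobj P (Cod S h))" "q \<in> carrier (fobj Q (Cod S l))"
    then show "act T ((h \<diamondop> l) \<cdot> f) (\<theta> (Cod S h) (Cod S l) p q) = act T f (\<theta> (Dom S h) (Dom S l) (act P h p) (act Q l q))"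
      using t by (simp add: pshD(7)[OF T] flip: dn)
  qed
  note d = day_liftD[OF P Q _ c]
  define g where "g X = cpt (day_lift K S P Q X (fobj T X) (?w X))" for X
  have g: "linear_on K (day_space K S P Q X) (fobj T X) (g X)" if "X \<in> Obj S" for X
    unfolding g_def by (rule d(4)[OF that that])
  have gv: "g X (day_in K S P Q X H L f p q) = ?w X H L f p q"
    if "H \<in> Obj S" "L \<in> Obj S" "f \<in> Arr S" "Dom S f = X" "Cod S f = H \<box> L" "p \<in> carrier (fobj P H)" "q \<in> carrier (fobj Q L)"
    for X H L f p q
    unfolding g_def by (rule d(6)) (use that in auto)
  have "mk_psh (P \<circledast> Q) T g \<in> Arr PC"
  proof (rule mk_psh_arr[OF psh_day[OF P Q] T])
    fix h u assume h: "h \<in> Arr S" and u: "u \<in> carrier (fobj (P \<circledast> Q) (Cod S h))"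
    then have o: "Dom S h \<in> Obj S" "Cod S h \<in> Obj S" by simp_all
    have ld: "linear_on K (day_space K S P Q (Cod S h)) (day_space K S P Q (Dom S h)) (act (P \<circledast> Q) h)"
      using pshD(3)[OF psh_day[OF P Q] h] by simp
    show "g (Dom S h) (act (P \<circledast> Q) h u) = act T h (g (Cod S h) u)"
      by (rule day_in_ext[OF P Q o(2) linear_on_comp[OF ld g[OF o(1)]] linear_on_comp[OF g[OF o(2)] pshD(3)[OF T h]] pshD(1)[OF T o(1)]])
        (use h u P Q t in \<open>simp_all add: act_day gv pshD(7)[OF T]\<close>)
  qed (simp add: g)
  moreover have "g (A \<box> B) (tens P Q A B p q) = \<theta> A B p q"
    if a: "A \<in> Obj S" "B \<in> Obj S" "p \<in> carrier (fobj P A)" "q \<in> carrier (fobj Q B)" for A B p q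
    unfolding tens_def using a t by (simp add: gv pshD(6)[OF T])
  ultimately show ?thesis using P Q by (intro exI[of _ "mk_psh (P \<circledast> Q) T g"]) simp
qed

text \<open>A lift depends only on the values of its family at well-typed arguments. If these come
  from a linear map, uniqueness identifies the lift with that map.\<close>

lemma day_lift_eq:
  fixes P Q :: "('k,'o,'m,'v) psh" and V :: "('k,'v) module"
  assumes PQ: "psh K S P" "psh K S Q" and X: "X \<in> Obj S" and V: "module K V" and g: "linear_on K (day_space K S P Q X) V g"
    and eq: "\<And>H L f p q. \<lbrakk>H \<in> Obj S; L \<in> Obj S; f \<in> Arr S; Dom S f = X; Cod S f = H \<box> L;
      p \<in> carrier (fobj P H); q \<in> carrier (fobj Q L)\<rbrakk> \<Longrightarrow> w H L f p q = g (day_in K S P Q X H L f p q)"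
  shows "day_lift K S P Q X V w = MArr (day_space K S P Q X) V (restrict g (carrier (day_space K S P Q X)))"
proof -
  let ?w = "\<lambda>H L f p q. g (day_in K S P Q X H L f p q)"
  note c = day_cowedge_comp[OF coend(1)[OF PQ X] X g V]
  have w: "day_factors K S P Q X (day_space K S P Q X) (day_in K S P Q X) V w =
      day_factors K S P Q X (day_space K S P Q X) (day_in K S P Q X) V ?w"
    by (auto simp: fun_eq_iff day_factors_def hom_set_def eq)
  define F where "F = day_factors K S P Q X (day_space K S P Q X) (day_in K S P Q X) V ?w"
  have "\<exists>!h. F h" unfolding F_def by (rule coend(2)[OF PQ X c])
  moreover have "F (restrict g (carrier (day_space K S P Q X)))"
    by (simp add: F_def day_factors_def restrict_lin_maps[OF module_day[OF PQ X] g] day_in_closed[OF PQ] hom_set_def)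
  ultimately have "(THE h. F h) = restrict g (carrier (day_space K S P Q X))" by (intro the1_equality)
  then show ?thesis by (simp add: day_lift_def w F_def)
qed

text \<open>Bridges definitions and universal property: a map built by \<open>tens_lift\<close> has
  the lifts occurring in the definitions as its components. The defining families need not be shown
  to be cowedges separately.\<close>

lemma day_lift_psh_arr:
  fixes P Q :: "('k,'o,'m,'v) psh"
  assumes P: "psh K S P" and Q: "psh K S Q" and s: "s \<in> Arr PC" "src s = P \<circledast> Q" and X: "X \<in> Obj S" "V = fobj (tgt s) X"
    and eq: "\<And>H L f p q. \<lbrakk>H \<in> Obj S; L \<in> Obj S; f \<in> Arr S; Dom S f = X; Cod S f = H \<box> L;
      p \<in> carrier (fobj P H); q \<in> carrier (fobj Q L)\<rbrakk> \<Longrightarrow> w H L f p q = act (tgt s) f (ap s (H \<box> L) (tens P Q H L p q))"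
  shows "day_lift K S P Q X V w = cpt s X"
proof -
  note d = psh_arrD[OF s(1)]
  have "day_lift K S P Q X V w = MArr (day_space K S P Q X) V (restrict (ap s X) (carrier (day_space K S P Q X)))"
  proof (rule day_lift_eq[OF P Q X(1)])
    fix H L f p q assume a: "H \<in> Obj S" "L \<in> Obj S" "f \<in> Arr S" "Dom S f = X" "Cod S f = H \<box> L" "p \<in> carrier (fobj P H)" "q \<in> carrier (fobj Q L)"
    show "w H L f p q = ap s X (day_in K S P Q X H L f p q)"
      using a P Q s d(8)[OF a(3), of "tens P Q H L p q"] by (simp add: eq[OF a] day_in_tens)
  qed (use d(2,5) s X in \<open>auto intro: pshD(1)\<close>)
  also have "restrict (ap s X) (carrier (day_space K S P Q X)) = ap s X"
    using d(6)[OF X(1)] s by (simp add: extensional_restrict)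
  finally show ?thesis using d(4)[OF X(1)] s X by simp
qed

end

section \<open>The convolution of maps and lifting out of triple convolutions\<close>

lemma day_cat_simps [simp]:
  "Obj (day_cat K S) = {P. psh K S P}" "Arr (day_cat K S) = Arr (presheaf_cat K S)" "Dom (day_cat K S) = src"
  "Cod (day_cat K S) = tgt" "Ide (day_cat K S) = Ide (presheaf_cat K S)" "Cmp (day_cat K S) = Cmp (presheaf_cat K S)"
  "Hom (day_cat K S) = Hom (presheaf_cat K S)"
  "P \<box>\<^bsub>day_cat K S\<^esub> Q = day_obj K S P Q" "s \<diamondop>\<^bsub>day_cat K S\<^esub> t = day_arr K S s t" "asc (day_cat K S) P Q R = day_asc K S P Q R"
  using presheaf_cat_simps[of K S]
  by (simp_all add: day_cat_def lcat.extend_def sgcat.fields_def)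

lemma day_cat_derived [simp]:
  "hom_set (day_cat K S) = hom_set (presheaf_cat K S)" "inverse_arrs (day_cat K S) = inverse_arrs (presheaf_cat K S)"
  "iso_arr (day_cat K S) = iso_arr (presheaf_cat K S)" "inv_arr (day_cat K S) = inv_arr (presheaf_cat K S)"
  by (simp_all add: fun_eq_iff hom_set_def inverse_arrs_def iso_arr_def inv_arr_def)

context small_sg
begin

text \<open>A map with the desired values on tensors exists by \<open>tens_lift\<close>; comparing
  components shows that it is the one defined by \<open>day_arr\<close>.\<close>

lemma day_arrD:
  fixes s t :: "('k,'o,'m,'v) pshmap"
  assumes s: "s \<in> Arr PC" and t: "t \<in> Arr PC"
  shows "day_arr K S s t \<in> Arr PC" "src (day_arr K S s t) = src s \<circledast> src t"
    "tgt (day_arr K S s t) = tgt s \<circledast> tgt t"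
    and "\<lbrakk>A \<in> Obj S; B \<in> Obj S; p \<in> carrier (fobj (src s) A); q \<in> carrier (fobj (src t) B)\<rbrakk> \<Longrightarrow>
      ap (day_arr K S s t) (A \<box> B) (tens (src s) (src t) A B p q) = tens (tgt s) (tgt t) A B (ap s A p) (ap t B q)"
proof -
  note s' = psh_arrD[OF s] and t' = psh_arrD[OF t]
  obtain r where r: "r \<in> Arr PC" "src r = src s \<circledast> src t" "tgt r = tgt s \<circledast> tgt t"
    and v: "\<And>A B p q. A \<in> Obj S \<Longrightarrow> B \<in> Obj S \<Longrightarrow> p \<in> carrier (fobj (src s) A) \<Longrightarrow> q \<in> carrier (fobj (src t) B) \<Longrightarrow>
      ap r (A \<box> B) (tens (src s) (src t) A B p q) = tens (tgt s) (tgt t) A B (ap s A p) (ap t B q)"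
  proof (rule exE[OF tens_lift[where \<theta> = "\<lambda>A B p q. tens (tgt s) (tgt t) A B (ap s A p) (ap t B q)", OF s'(1) t'(1) psh_day[OF s'(2) t'(2)]]])
    fix A B assume a: "A \<in> Obj S" "B \<in> Obj S"
    show "linear_on K (fobj (src s) A) (fobj (tgt s \<circledast> tgt t) (A \<box> B)) (\<lambda>p. tens (tgt s) (tgt t) A B (ap s A p) (ap t B q))"
      if "q \<in> carrier (fobj (src t) B)" for q
      using linear_on_comp[OF s'(5)[OF a(1)] linear_tens(1)[OF s'(2) t'(2) a t'(7)[OF a(2) that]]] by simp
    show "linear_on K (fobj (src t) B) (fobj (tgt s \<circledast> tgt t) (A \<box> B)) (\<lambda>q. tens (tgt s) (tgt t) A B (ap s A p) (ap t B q))"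
      if "p \<in> carrier (fobj (src s) A)" for p
      using linear_on_comp[OF t'(5)[OF a(2)] linear_tens(2)[OF s'(2) t'(2) a s'(7)[OF a(1) that]]] by simp
  qed (use s' t' in \<open>auto simp: act_tens\<close>)
  have "day_arr K S s t = MArr (src s \<circledast> src t) (tgt s \<circledast> tgt t) (\<lambda>X\<in>Obj S. cpt r X)"
    unfolding day_arr_def marr.inject
  proof (intro conjI refl restrict_ext)
    fix X assume "X \<in> Obj S"
    then show "day_lift K S (src s) (src t) X (day_space K S (tgt s) (tgt t) X)
        (\<lambda>H L f p q. day_in K S (tgt s) (tgt t) X H L f (ap s H p) (ap t L q)) = cpt r X"
      by (intro day_lift_psh_arr) (use r s' t' in \<open>simp_all add: v day_in_tens\<close>)
  qed
  also have "\<dots> = r" using psh_arrD(3)[OF r(1)] r by (cases r) (simp add: extensional_restrict)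
  finally show "day_arr K S s t \<in> Arr PC" "src (day_arr K S s t) = src s \<circledast> src t" "tgt (day_arr K S s t) = tgt s \<circledast> tgt t"
    "\<lbrakk>A \<in> Obj S; B \<in> Obj S; p \<in> carrier (fobj (src s) A); q \<in> carrier (fobj (src t) B)\<rbrakk> \<Longrightarrow>
      ap (day_arr K S s t) (A \<box> B) (tens (src s) (src t) A B p q) = tens (tgt s) (tgt t) A B (ap s A p) (ap t B q)"
    using r v by simp_all
qed

text \<open>
  Maps out of a triple convolution are obtained by lifting twice, first into a presheaf of the
  form \<open>T (- \<box> C)\<close> or \<open>T (A \<box> -)\<close>.
\<close>

definition shift :: "('m \<Rightarrow> 'm) \<Rightarrow> ('o \<Rightarrow> 'o) \<Rightarrow> ('k,'o,'m,'v) psh \<Rightarrow> ('k,'o,'m,'v) psh" where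
  "shift g f T = \<lparr>fobj = (\<lambda>X. fobj T (f X)), farr = (\<lambda>h. farr T (g h))\<rparr>"

lemma shift_simps [simp]: "fobj (shift g f T) X = fobj T (f X)" "farr (shift g f T) h = farr T (g h)"
  by (simp_all add: shift_def)

lemma psh_shift:
  fixes T :: "('k,'o,'m,'v) psh"
  assumes T: "psh K S T" and C: "C \<in> Obj S"
  shows "psh K S (shift (\<lambda>h. h \<diamondop> Ide S C) (\<lambda>X. X \<box> C) T)" "psh K S (shift (\<lambda>h. Ide S C \<diamondop> h) (\<lambda>X. C \<box> X) T)"
proof -
  note d = pshD[OF T]
  show "psh K S (shift (\<lambda>h. h \<diamondop> Ide S C) (\<lambda>X. X \<box> C) T)"
  proof (rule pshI, unfold shift_simps, goal_cases)
    case (2 h) then show ?case using d(2)[of "h \<diamondop> Ide S C"] C by simp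
  next
    case (3 h) then show ?case using d(3)[of "h \<diamondop> Ide S C"] C by simp
  next
    case (4 h) then show ?case using d(4)[of "h \<diamondop> Ide S C"] C by simp
  next
    case (6 f g p) then show ?case using d(7)[of "f \<diamondop> Ide S C" "g \<diamondop> Ide S C" p] C by (simp add: merge)
  next
    case (7 A B p) then show ?case by (intro linear_on_comp[OF tarr_lin_left d(8)]) (use C in simp_all)
  qed (use C d in simp_all)
  show "psh K S (shift (\<lambda>h. Ide S C \<diamondop> h) (\<lambda>X. C \<box> X) T)"
  proof (rule pshI, unfold shift_simps, goal_cases)
    case (2 h) then show ?case using d(2)[of "Ide S C \<diamondop> h"] C by simp
  next
    case (3 h) then show ?case using d(3)[of "Ide S C \<diamondop> h"] C by simp
  next
    case (4 h) then show ?case using d(4)[of "Ide S C \<diamondop> h"] C by simp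
  next
    case (6 f g p) then show ?case using d(7)[of "Ide S C \<diamondop> f" "Ide S C \<diamondop> g" p] C by (simp add: merge)
  next
    case (7 A B p) then show ?case by (intro linear_on_comp[OF tarr_lin_right d(8)]) (use C in simp_all)
  qed (use C d in simp_all)
qed

text \<open>For a fixed \<open>r\<close> the family lifts over the inner convolution to a map into
  \<open>T (- \<box> C)\<close>; these maps are then lifted over the outer one. The second lift
  needs linearity and naturality in \<open>r\<close>, which are tested on generators of the inner
  convolution.\<close>

lemma triple_left:
  fixes P Q R T :: "('k,'o,'m,'v) psh"
  assumes P: "psh K S P" and Q: "psh K S Q" and R: "psh K S R" and T: "psh K S T"
    and l1: "\<And>A B C q r. \<lbrakk>A \<in> Obj S; B \<in> Obj S; C \<in> Obj S; q \<in> carrier (fobj Q B); r \<in> carrier (fobj R C)\<rbrakk> \<Longrightarrow>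
      linear_on K (fobj P A) (fobj T ((A \<box> B) \<box> C)) (\<lambda>p. \<theta> A B C p q r)"
    and l2: "\<And>A B C p r. \<lbrakk>A \<in> Obj S; B \<in> Obj S; C \<in> Obj S; p \<in> carrier (fobj P A); r \<in> carrier (fobj R C)\<rbrakk> \<Longrightarrow>
      linear_on K (fobj Q B) (fobj T ((A \<box> B) \<box> C)) (\<lambda>q. \<theta> A B C p q r)"
    and l3: "\<And>A B C p q. \<lbrakk>A \<in> Obj S; B \<in> Obj S; C \<in> Obj S; p \<in> carrier (fobj P A); q \<in> carrier (fobj Q B)\<rbrakk> \<Longrightarrow>
      linear_on K (fobj R C) (fobj T ((A \<box> B) \<box> C)) (\<lambda>r. \<theta> A B C p q r)"
    and dn: "\<And>h l k p q r. \<lbrakk>h \<in> Arr S; l \<in> Arr S; k \<in> Arr S; p \<in> carrier (fobj P (Cod S h)); q \<in> carrier (fobj Q (Cod S l));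
       r \<in> carrier (fobj R (Cod S k))\<rbrakk> \<Longrightarrow>
      act T ((h \<diamondop> l) \<diamondop> k) (\<theta> (Cod S h) (Cod S l) (Cod S k) p q r) =
        \<theta> (Dom S h) (Dom S l) (Dom S k) (act P h p) (act Q l q) (act R k r)"
  shows "\<exists>s. s \<in> Arr PC \<and> src s = (P \<circledast> Q) \<circledast> R \<and> tgt s = T \<and>
    (\<forall>A\<in>Obj S. \<forall>B\<in>Obj S. \<forall>C\<in>Obj S. \<forall>p\<in>carrier (fobj P A). \<forall>q\<in>carrier (fobj Q B). \<forall>r\<in>carrier (fobj R C).
      ap s ((A \<box> B) \<box> C) (tens (P \<circledast> Q) R (A \<box> B) C (tens P Q A B p q) r) = \<theta> A B C p q r)"
proof -
  note PQ = psh_day[OF P Q]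
  have \<theta>: "\<theta> A B C p q r \<in> carrier (fobj T ((A \<box> B) \<box> C))"
    if "A \<in> Obj S" "B \<in> Obj S" "C \<in> Obj S" "p \<in> carrier (fobj P A)" "q \<in> carrier (fobj Q B)" "r \<in> carrier (fobj R C)" for A B C p q r
    by (rule linear_on_closed[OF l1]) (use that in simp_all)
  let ?T = "\<lambda>C. shift (\<lambda>h. h \<diamondop> Ide S C) (\<lambda>X. X \<box> C) T"
  have ex: "\<exists>s. s \<in> Arr PC \<and> src s = P \<circledast> Q \<and> tgt s = ?T C \<and>
      (\<forall>A\<in>Obj S. \<forall>B\<in>Obj S. \<forall>p\<in>carrier (fobj P A). \<forall>q\<in>carrier (fobj Q B). ap s (A \<box> B) (tens P Q A B p q) = \<theta> A B C p q r)"
    if C: "C \<in> Obj S" and r: "r \<in> carrier (fobj R C)" for C r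
  proof (rule tens_lift[OF P Q psh_shift(1)[OF T C]])
    fix h l p q assume a: "h \<in> Arr S" "l \<in> Arr S" "p \<in> carrier (fobj P (Cod S h))" "q \<in> carrier (fobj Q (Cod S l))"
    show "act (?T C) (h \<diamondop> l) (\<theta> (Cod S h) (Cod S l) C p q r) = \<theta> (Dom S h) (Dom S l) C (act P h p) (act Q l q) r"
      using dn[of h l "Ide S C" p q r] a C r by (simp add: pshD(6)[OF R])
  qed (use C r in \<open>simp_all add: l1 l2\<close>)
  \<comment> \<open>The chosen map is pinned down by its values on tensors, which is how its
    dependence on \<open>r\<close> can be controlled later.\<close>
  define \<sigma> where "\<sigma> C r = (SOME s. s \<in> Arr PC \<and> src s = P \<circledast> Q \<and> tgt s = ?T C \<and>
      (\<forall>A\<in>Obj S. \<forall>B\<in>Obj S. \<forall>p\<in>carrier (fobj P A). \<forall>q\<in>carrier (fobj Q B). ap s (A \<box> B) (tens P Q A B p q) = \<theta> A B C p q r))" for C r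
  have s: "\<sigma> C r \<in> Arr PC" "src (\<sigma> C r) = P \<circledast> Q" "tgt (\<sigma> C r) = ?T C"
    and v: "\<lbrakk>A \<in> Obj S; B \<in> Obj S; p \<in> carrier (fobj P A); q \<in> carrier (fobj Q B)\<rbrakk> \<Longrightarrow> ap (\<sigma> C r) (A \<box> B) (tens P Q A B p q) = \<theta> A B C p q r"
    if "C \<in> Obj S" "r \<in> carrier (fobj R C)" for A B C p q r
    using someI_ex[OF ex[OF that]] unfolding \<sigma>_def[symmetric] by auto
  have ls: "linear_on K (day_space K S P Q H) (fobj T (H \<box> C)) (ap (\<sigma> C r) H)"
    if "H \<in> Obj S" "C \<in> Obj S" "r \<in> carrier (fobj R C)" for H C r
    using psh_arrD(5)[OF s(1)[OF that(2,3)] that(1)] s that by simp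
  have nat: "ap (\<sigma> C r) (Dom S h) (act (P \<circledast> Q) h u) = act T (h \<diamondop> Ide S C) (ap (\<sigma> C r) (Cod S h) u)"
    if "h \<in> Arr S" "C \<in> Obj S" "r \<in> carrier (fobj R C)" "u \<in> carrier (day_space K S P Q (Cod S h))" for h C r u
    using psh_arrD(8)[OF s(1)[OF that(2,3)] that(1)] s that by simp
  have vg: "ap (\<sigma> C r) H (day_in K S P Q H A B f p q) = act T (f \<diamondop> Ide S C) (\<theta> A B C p q r)"
    if a: "H \<in> Obj S" "A \<in> Obj S" "B \<in> Obj S" "C \<in> Obj S" "f \<in> Arr S" "Dom S f = H" "Cod S f = A \<box> B"
      "p \<in> carrier (fobj P A)" "q \<in> carrier (fobj Q B)" "r \<in> carrier (fobj R C)" for H A B C f p q r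
    using nat[OF a(5,4,10), of "tens P Q A B p q"] a P Q by (simp add: v day_in_tens)
  have "\<exists>s. s \<in> Arr PC \<and> src s = (P \<circledast> Q) \<circledast> R \<and> tgt s = T \<and>
      (\<forall>H\<in>Obj S. \<forall>C\<in>Obj S. \<forall>u\<in>carrier (fobj (P \<circledast> Q) H). \<forall>r\<in>carrier (fobj R C).
        ap s (H \<box> C) (tens (P \<circledast> Q) R H C u r) = ap (\<sigma> C r) H u)"
  proof (rule tens_lift[OF PQ R T])
    fix H C assume HC: "H \<in> Obj S" "C \<in> Obj S"
    show "linear_on K (fobj (P \<circledast> Q) H) (fobj T (H \<box> C)) (\<lambda>u. ap (\<sigma> C r) H u)" if "r \<in> carrier (fobj R C)" for r
      using ls HC that by simp
    fix u assume u: "u \<in> carrier (fobj (P \<circledast> Q) H)"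
    show "linear_on K (fobj R C) (fobj T (H \<box> C)) (\<lambda>r. ap (\<sigma> C r) H u)"
    proof (rule day_family_linear[OF P Q HC(1) pshD(1)[OF R HC(2)] pshD(1)[OF T], where \<phi> = "\<lambda>r. ap (\<sigma> C r) H"])
      fix A B f p q assume a: "A \<in> Obj S" "B \<in> Obj S" "f \<in> Arr S" "Dom S f = H" "Cod S f = A \<box> B" "p \<in> carrier (fobj P A)" "q \<in> carrier (fobj Q B)"
      show "linear_on K (fobj R C) (fobj T (H \<box> C)) (\<lambda>r. ap (\<sigma> C r) H (day_in K S P Q H A B f p q))"
      proof (rule linear_on_cong[OF pshD(1)[OF R HC(2)] vg])
        show "linear_on K (fobj R C) (fobj T (H \<box> C)) (\<lambda>r. act T (f \<diamondop> Ide S C) (\<theta> A B C p q r))"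
          by (rule linear_on_comp[OF l3]) (use a HC pshD(3)[OF T, of "f \<diamondop> Ide S C"] in simp_all)
      qed (use a HC in simp_all)
    qed (use HC u ls in simp_all)
  next
    fix h k u r assume a: "h \<in> Arr S" "k \<in> Arr S" "u \<in> carrier (fobj (P \<circledast> Q) (Cod S h))" "r \<in> carrier (fobj R (Cod S k))"
    have o: "Cod S h \<in> Obj S" "Dom S k \<in> Obj S" using a by simp_all
    note rk = pshD(5)[OF R a(2) refl a(4)]
    let ?h = "h \<diamondop> k" and ?k = "h \<diamondop> Ide S (Dom S k)"
    have lT: "linear_on K (fobj T (Cod S h \<box> Cod S k)) (fobj T (Dom S h \<box> Dom S k)) (act T ?h)"
      "linear_on K (fobj T (Cod S h \<box> Dom S k)) (fobj T (Dom S h \<box> Dom S k)) (act T ?k)"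
      using pshD(3)[OF T, of ?h] pshD(3)[OF T, of ?k] a by simp_all
    \<comment> \<open>Naturality in \<open>h\<close> is already that of the map
      \<open>\<sigma>\<close>. What remains is the passage along \<open>k\<close>, which changes
      both the parameter and the shift of \<open>T\<close>.\<close>
    have "act T ?h (ap (\<sigma> (Cod S k) r) (Cod S h) u) = act T ?k (ap (\<sigma> (Dom S k) (act R k r)) (Cod S h) u)"
    proof (rule day_in_ext[OF P Q o(1) linear_on_comp[OF ls lT(1)] linear_on_comp[OF ls lT(2)] pshD(1)[OF T]])
      fix A B f p q
      assume b: "A \<in> Obj S" "B \<in> Obj S" "f \<in> Arr S" "Dom S f = Cod S h" "Cod S f = A \<box> B" "p \<in> carrier (fobj P A)" "q \<in> carrier (fobj Q B)"
      have "\<theta> A B (Dom S k) p q (act R k r) = act T (Ide S (A \<box> B) \<diamondop> k) (\<theta> A B (Cod S k) p q r)"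
        using dn[of "Ide S A" "Ide S B" k p q r] a b by (simp add: pshD(6)[OF P] pshD(6)[OF Q])
      then show "act T ?h (ap (\<sigma> (Cod S k) r) (Cod S h) (day_in K S P Q (Cod S h) A B f p q)) =
          act T ?k (ap (\<sigma> (Dom S k) (act R k r)) (Cod S h) (day_in K S P Q (Cod S h) A B f p q))"
        using a b rk \<theta>[OF b(1,2) _ b(6,7) a(4)] by (simp add: vg merge flip: pshD(7)[OF T])
    qed (use a rk in simp_all)
    then show "act T ?h (ap (\<sigma> (Cod S k) r) (Cod S h) u) = ap (\<sigma> (Dom S k) (act R k r)) (Dom S h) (act (P \<circledast> Q) h u)"
      using nat[OF a(1) o(2) rk] a by simp
  qed
  then obtain s where "s \<in> Arr PC" "src s = (P \<circledast> Q) \<circledast> R" "tgt s = T"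
    "\<And>H C u r. H \<in> Obj S \<Longrightarrow> C \<in> Obj S \<Longrightarrow> u \<in> carrier (fobj (P \<circledast> Q) H) \<Longrightarrow> r \<in> carrier (fobj R C) \<Longrightarrow>
        ap s (H \<box> C) (tens (P \<circledast> Q) R H C u r) = ap (\<sigma> C r) H u" by blast
  then show ?thesis using v P Q by (intro exI[of _ s]) simp
qed


text \<open>The mirror image: the element \<open>p\<close> is fixed first, and the inner lift goes
  into \<open>T (A \<box> -)\<close>.\<close>

lemma triple_right:
  fixes P Q R T :: "('k,'o,'m,'v) psh"
  assumes P: "psh K S P" and Q: "psh K S Q" and R: "psh K S R" and T: "psh K S T"
    and l1: "\<And>A B C q r. \<lbrakk>A \<in> Obj S; B \<in> Obj S; C \<in> Obj S; q \<in> carrier (fobj Q B); r \<in> carrier (fobj R C)\<rbrakk> \<Longrightarrow>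
      linear_on K (fobj P A) (fobj T (A \<box> (B \<box> C))) (\<lambda>p. \<theta> A B C p q r)"
    and l2: "\<And>A B C p r. \<lbrakk>A \<in> Obj S; B \<in> Obj S; C \<in> Obj S; p \<in> carrier (fobj P A); r \<in> carrier (fobj R C)\<rbrakk> \<Longrightarrow>
      linear_on K (fobj Q B) (fobj T (A \<box> (B \<box> C))) (\<lambda>q. \<theta> A B C p q r)"
    and l3: "\<And>A B C p q. \<lbrakk>A \<in> Obj S; B \<in> Obj S; C \<in> Obj S; p \<in> carrier (fobj P A); q \<in> carrier (fobj Q B)\<rbrakk> \<Longrightarrow>
      linear_on K (fobj R C) (fobj T (A \<box> (B \<box> C))) (\<lambda>r. \<theta> A B C p q r)"
    and dn: "\<And>h l k p q r. \<lbrakk>h \<in> Arr S; l \<in> Arr S; k \<in> Arr S; p \<in> carrier (fobj P (Cod S h)); q \<in> carrier (fobj Q (Cod S l));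
       r \<in> carrier (fobj R (Cod S k))\<rbrakk> \<Longrightarrow>
      act T (h \<diamondop> (l \<diamondop> k)) (\<theta> (Cod S h) (Cod S l) (Cod S k) p q r) =
        \<theta> (Dom S h) (Dom S l) (Dom S k) (act P h p) (act Q l q) (act R k r)"
  shows "\<exists>s. s \<in> Arr PC \<and> src s = P \<circledast> (Q \<circledast> R) \<and> tgt s = T \<and>
    (\<forall>A\<in>Obj S. \<forall>B\<in>Obj S. \<forall>C\<in>Obj S. \<forall>p\<in>carrier (fobj P A). \<forall>q\<in>carrier (fobj Q B). \<forall>r\<in>carrier (fobj R C).
      ap s (A \<box> (B \<box> C)) (tens P (Q \<circledast> R) A (B \<box> C) p (tens Q R B C q r)) = \<theta> A B C p q r)"
proof -
  note QR = psh_day[OF Q R]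
  have \<theta>: "\<theta> A B C p q r \<in> carrier (fobj T (A \<box> (B \<box> C)))"
    if "A \<in> Obj S" "B \<in> Obj S" "C \<in> Obj S" "p \<in> carrier (fobj P A)" "q \<in> carrier (fobj Q B)" "r \<in> carrier (fobj R C)" for A B C p q r
    by (rule linear_on_closed[OF l1]) (use that in simp_all)
  let ?T = "\<lambda>A. shift (\<lambda>h. Ide S A \<diamondop> h) (\<lambda>X. A \<box> X) T"
  have ex: "\<exists>s. s \<in> Arr PC \<and> src s = Q \<circledast> R \<and> tgt s = ?T A \<and>
      (\<forall>B\<in>Obj S. \<forall>C\<in>Obj S. \<forall>q\<in>carrier (fobj Q B). \<forall>r\<in>carrier (fobj R C). ap s (B \<box> C) (tens Q R B C q r) = \<theta> A B C p q r)"
    if A: "A \<in> Obj S" and p: "p \<in> carrier (fobj P A)" for A p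
  proof (rule tens_lift[OF Q R psh_shift(2)[OF T A]])
    fix l k q r assume a: "l \<in> Arr S" "k \<in> Arr S" "q \<in> carrier (fobj Q (Cod S l))" "r \<in> carrier (fobj R (Cod S k))"
    show "act (?T A) (l \<diamondop> k) (\<theta> A (Cod S l) (Cod S k) p q r) = \<theta> A (Dom S l) (Dom S k) p (act Q l q) (act R k r)"
      using dn[of "Ide S A" l k p q r] a A p by (simp add: pshD(6)[OF P])
  qed (use A p in \<open>simp_all add: l2 l3\<close>)
  define \<sigma> where "\<sigma> A p = (SOME s. s \<in> Arr PC \<and> src s = Q \<circledast> R \<and> tgt s = ?T A \<and>
      (\<forall>B\<in>Obj S. \<forall>C\<in>Obj S. \<forall>q\<in>carrier (fobj Q B). \<forall>r\<in>carrier (fobj R C). ap s (B \<box> C) (tens Q R B C q r) = \<theta> A B C p q r))" for A p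
  have s: "\<sigma> A p \<in> Arr PC" "src (\<sigma> A p) = Q \<circledast> R" "tgt (\<sigma> A p) = ?T A"
    and v: "\<lbrakk>B \<in> Obj S; C \<in> Obj S; q \<in> carrier (fobj Q B); r \<in> carrier (fobj R C)\<rbrakk> \<Longrightarrow> ap (\<sigma> A p) (B \<box> C) (tens Q R B C q r) = \<theta> A B C p q r"
    if "A \<in> Obj S" "p \<in> carrier (fobj P A)" for A B C p q r
    using someI_ex[OF ex[OF that]] unfolding \<sigma>_def[symmetric] by auto
  have ls: "linear_on K (day_space K S Q R H) (fobj T (A \<box> H)) (ap (\<sigma> A p) H)"
    if "H \<in> Obj S" "A \<in> Obj S" "p \<in> carrier (fobj P A)" for H A p
    using psh_arrD(5)[OF s(1)[OF that(2,3)] that(1)] s that by simp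
  have nat: "ap (\<sigma> A p) (Dom S h) (act (Q \<circledast> R) h u) = act T (Ide S A \<diamondop> h) (ap (\<sigma> A p) (Cod S h) u)"
    if "h \<in> Arr S" "A \<in> Obj S" "p \<in> carrier (fobj P A)" "u \<in> carrier (day_space K S Q R (Cod S h))" for h A p u
    using psh_arrD(8)[OF s(1)[OF that(2,3)] that(1)] s that by simp
  have vg: "ap (\<sigma> A p) H (day_in K S Q R H B C f q r) = act T (Ide S A \<diamondop> f) (\<theta> A B C p q r)"
    if a: "H \<in> Obj S" "A \<in> Obj S" "B \<in> Obj S" "C \<in> Obj S" "f \<in> Arr S" "Dom S f = H" "Cod S f = B \<box> C"
      "p \<in> carrier (fobj P A)" "q \<in> carrier (fobj Q B)" "r \<in> carrier (fobj R C)" for H A B C f p q r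
    using nat[OF a(5,2,8), of "tens Q R B C q r"] a Q R by (simp add: v day_in_tens)
  have "\<exists>s. s \<in> Arr PC \<and> src s = P \<circledast> (Q \<circledast> R) \<and> tgt s = T \<and>
      (\<forall>A\<in>Obj S. \<forall>H\<in>Obj S. \<forall>p\<in>carrier (fobj P A). \<forall>u\<in>carrier (fobj (Q \<circledast> R) H).
        ap s (A \<box> H) (tens P (Q \<circledast> R) A H p u) = ap (\<sigma> A p) H u)"
  proof (rule tens_lift[OF P QR T])
    fix A H assume AH: "A \<in> Obj S" "H \<in> Obj S"
    show "linear_on K (fobj (Q \<circledast> R) H) (fobj T (A \<box> H)) (\<lambda>u. ap (\<sigma> A p) H u)" if "p \<in> carrier (fobj P A)" for p
      using ls AH that by simp
    fix u assume u: "u \<in> carrier (fobj (Q \<circledast> R) H)"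
    show "linear_on K (fobj P A) (fobj T (A \<box> H)) (\<lambda>p. ap (\<sigma> A p) H u)"
    proof (rule day_family_linear[OF Q R AH(2) pshD(1)[OF P AH(1)] pshD(1)[OF T], where \<phi> = "\<lambda>p. ap (\<sigma> A p) H"])
      fix B C f q r assume a: "B \<in> Obj S" "C \<in> Obj S" "f \<in> Arr S" "Dom S f = H" "Cod S f = B \<box> C" "q \<in> carrier (fobj Q B)" "r \<in> carrier (fobj R C)"
      show "linear_on K (fobj P A) (fobj T (A \<box> H)) (\<lambda>p. ap (\<sigma> A p) H (day_in K S Q R H B C f q r))"
      proof (rule linear_on_cong[OF pshD(1)[OF P AH(1)] vg])
        show "linear_on K (fobj P A) (fobj T (A \<box> H)) (\<lambda>p. act T (Ide S A \<diamondop> f) (\<theta> A B C p q r))"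
          by (rule linear_on_comp[OF l1]) (use a AH pshD(3)[OF T, of "Ide S A \<diamondop> f"] in simp_all)
      qed (use a AH in simp_all)
    qed (use AH u ls in simp_all)
  next
    fix h k p u assume a: "h \<in> Arr S" "k \<in> Arr S" "p \<in> carrier (fobj P (Cod S h))" "u \<in> carrier (fobj (Q \<circledast> R) (Cod S k))"
    have o: "Cod S k \<in> Obj S" "Dom S h \<in> Obj S" using a by simp_all
    note ph = pshD(5)[OF P a(1) refl a(3)]
    let ?h = "h \<diamondop> k" and ?k = "Ide S (Dom S h) \<diamondop> k"
    have lT: "linear_on K (fobj T (Cod S h \<box> Cod S k)) (fobj T (Dom S h \<box> Dom S k)) (act T ?h)"
      "linear_on K (fobj T (Dom S h \<box> Cod S k)) (fobj T (Dom S h \<box> Dom S k)) (act T ?k)"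
      using pshD(3)[OF T, of ?h] pshD(3)[OF T, of ?k] a by simp_all
    have "act T ?h (ap (\<sigma> (Cod S h) p) (Cod S k) u) = act T ?k (ap (\<sigma> (Dom S h) (act P h p)) (Cod S k) u)"
    proof (rule day_in_ext[OF Q R o(1) linear_on_comp[OF ls lT(1)] linear_on_comp[OF ls lT(2)] pshD(1)[OF T]])
      fix B C f q r
      assume b: "B \<in> Obj S" "C \<in> Obj S" "f \<in> Arr S" "Dom S f = Cod S k" "Cod S f = B \<box> C" "q \<in> carrier (fobj Q B)" "r \<in> carrier (fobj R C)"
      have "\<theta> (Dom S h) B C (act P h p) q r = act T (h \<diamondop> Ide S (B \<box> C)) (\<theta> (Cod S h) B C p q r)"
        using dn[of h "Ide S B" "Ide S C" p q r] a b by (simp add: pshD(6)[OF Q] pshD(6)[OF R])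
      then show "act T ?h (ap (\<sigma> (Cod S h) p) (Cod S k) (day_in K S Q R (Cod S k) B C f q r)) =
          act T ?k (ap (\<sigma> (Dom S h) (act P h p)) (Cod S k) (day_in K S Q R (Cod S k) B C f q r))"
        using a b ph \<theta>[OF _ b(1,2) a(3) b(6,7)] by (simp add: vg merge flip: pshD(7)[OF T])
    qed (use a ph in simp_all)
    then show "act T ?h (ap (\<sigma> (Cod S h) p) (Cod S k) u) = ap (\<sigma> (Dom S h) (act P h p)) (Dom S k) (act (Q \<circledast> R) k u)"
      using nat[OF a(2) o(2) ph] a by simp
  qed
  then obtain s where "s \<in> Arr PC" "src s = P \<circledast> (Q \<circledast> R)" "tgt s = T"
    "\<And>A H p u. A \<in> Obj S \<Longrightarrow> H \<in> Obj S \<Longrightarrow> p \<in> carrier (fobj P A) \<Longrightarrow> u \<in> carrier (fobj (Q \<circledast> R) H) \<Longrightarrow>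
        ap s (A \<box> H) (tens P (Q \<circledast> R) A H p u) = ap (\<sigma> A p) H u" by blast
  then show ?thesis using v Q R by (intro exI[of _ s]) simp
qed

end

section \<open>Calculation with tensors, the associator and the pentagon\<close>

context small_sg
begin

lemma act_closed:
  fixes P :: "('k,'o,'m,'v) psh"
  assumes "psh K S P" "h \<in> Arr S" "Dom S h = X" "p \<in> carrier (fobj P (Cod S h))"
  shows "act P h p \<in> carrier (fobj P X)"
  using pshD(5)[OF assms(1,2) refl assms(4)] assms(3) by simp

text \<open>The rule \<open>fobj_day\<close> rewrites values of a convolution to
  \<open>day_space\<close>, a form that the general rule no longer matches. The other
  \<open>_day\<close> variants have the same purpose.\<close>

lemma act_closed_day:
  fixes P Q :: "('k,'o,'m,'v) psh"
  assumes "psh K S P" "psh K S Q" "h \<in> Arr S" "Dom S h = X" "p \<in> carrier (day_space K S P Q (Cod S h))"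
  shows "act (P \<circledast> Q) h p \<in> carrier (day_space K S P Q X)"
  using act_closed[OF psh_day[OF assms(1,2)] assms(3,4)] assms(5) by simp

lemma ap_closed:
  assumes "s \<in> Arr PC" "X \<in> Obj S" "tgt s = Q" "p \<in> carrier (fobj (src s) X)"
  shows "ap s X p \<in> carrier (fobj Q X)"
  using psh_arrD(7)[OF assms(1,2,4)] assms(3) by simp

lemma ap_closed_day:
  assumes "s \<in> Arr PC" "X \<in> Obj S" "tgt s = P \<circledast> Q" "p \<in> carrier (fobj (src s) X)"
  shows "ap s X p \<in> carrier (day_space K S P Q X)"
  using ap_closed[OF assms] by simp

lemma act_act:
  fixes P :: "('k,'o,'m,'v) psh"
  assumes "psh K S P" "f \<in> Arr S" "g \<in> Arr S" "Dom S g = Cod S f" "p \<in> carrier (fobj P (Cod S g))"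
  shows "act P f (act P g p) = act P (g \<cdot> f) p"
  using pshD(7)[OF assms] by simp

lemma act_act_day:
  fixes P Q :: "('k,'o,'m,'v) psh"
  assumes "psh K S P" "psh K S Q" "f \<in> Arr S" "g \<in> Arr S" "Dom S g = Cod S f" "p \<in> carrier (day_space K S P Q (Cod S g))"
  shows "act (P \<circledast> Q) f (act (P \<circledast> Q) g p) = act (P \<circledast> Q) (g \<cdot> f) p"
  using act_act[OF psh_day[OF assms(1,2)] assms(3-5)] assms(6) by simp

lemma act_Ide: "psh K S P \<Longrightarrow> A \<in> Obj S \<Longrightarrow> p \<in> carrier (fobj P A) \<Longrightarrow> act P (Ide S A) p = p"
  by (rule pshD(6))

lemma act_Ide_day:
  fixes P Q :: "('k,'o,'m,'v) psh"
  assumes "psh K S P" "psh K S Q" "A \<in> Obj S" "p \<in> carrier (day_space K S P Q A)"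
  shows "act (P \<circledast> Q) (Ide S A) p = p"
  using pshD(6)[OF psh_day[OF assms(1,2)] assms(3)] assms(4) by simp

lemma ap_act:
  assumes "s \<in> Arr PC" "src s = P" "h \<in> Arr S" "Dom S h = X" "p \<in> carrier (fobj P (Cod S h))"
  shows "ap s X (act P h p) = act (tgt s) h (ap s (Cod S h) p)"
  using psh_arrD(8)[OF assms(1,3)] assms by simp

lemma ap_act_day:
  assumes "s \<in> Arr PC" "src s = P \<circledast> Q" "h \<in> Arr S" "Dom S h = X" "p \<in> carrier (day_space K S P Q (Cod S h))"
  shows "ap s X (act (P \<circledast> Q) h p) = act (tgt s) h (ap s (Cod S h) p)"
  using ap_act[OF assms(1-4)] assms(5) by simp

lemma tens_act_left:
  fixes P Q :: "('k,'o,'m,'v) psh"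
  assumes "psh K S P" "psh K S Q" "h \<in> Arr S" "Dom S h = A" "B \<in> Obj S" "p \<in> carrier (fobj P (Cod S h))" "q \<in> carrier (fobj Q B)"
  shows "tens P Q A B (act P h p) q = act (P \<circledast> Q) (h \<diamondop> Ide S B) (tens P Q (Cod S h) B p q)"
  using act_tens[OF assms(1-3), of "Ide S B" "Cod S h" B p q] assms by (simp add: act_Ide)

lemma tens_act_right:
  fixes P Q :: "('k,'o,'m,'v) psh"
  assumes "psh K S P" "psh K S Q" "h \<in> Arr S" "Dom S h = B" "A \<in> Obj S" "q \<in> carrier (fobj Q (Cod S h))" "p \<in> carrier (fobj P A)"
  shows "tens P Q A B p (act Q h q) = act (P \<circledast> Q) (Ide S A \<diamondop> h) (tens P Q A (Cod S h) p q)"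
  using act_tens[OF assms(1,2) _ assms(3), of "Ide S A" A "Cod S h" p q] assms by (simp add: act_Ide)

lemma tens_act_left_day:
  fixes P P' Q :: "('k,'o,'m,'v) psh"
  assumes "psh K S P" "psh K S P'" "psh K S Q" "h \<in> Arr S" "Dom S h = A" "B \<in> Obj S" "p \<in> carrier (day_space K S P P' (Cod S h))" "q \<in> carrier (fobj Q B)"
  shows "tens (P \<circledast> P') Q A B (act (P \<circledast> P') h p) q =
    act ((P \<circledast> P') \<circledast> Q) (h \<diamondop> Ide S B) (tens (P \<circledast> P') Q (Cod S h) B p q)"
  using tens_act_left[OF psh_day[OF assms(1,2)] assms(3-6) _ assms(8)] assms(7) by simp

lemma tens_act_right_day:
  fixes P Q Q' :: "('k,'o,'m,'v) psh"
  assumes "psh K S P" "psh K S Q" "psh K S Q'" "h \<in> Arr S" "Dom S h = B" "A \<in> Obj S" "q \<in> carrier (day_space K S Q Q' (Cod S h))" "p \<in> carrier (fobj P A)"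
  shows "tens P (Q \<circledast> Q') A B p (act (Q \<circledast> Q') h q) =
    act (P \<circledast> (Q \<circledast> Q')) (Ide S A \<diamondop> h) (tens P (Q \<circledast> Q') A (Cod S h) p q)"
  using tens_act_right[OF assms(1) psh_day[OF assms(2,3)] assms(4-6) _ assms(8)] assms(7) by simp

lemma ap_day_arr:
  assumes "s \<in> Arr PC" "t \<in> Arr PC" "src s = P" "src t = Q"
    "A \<in> Obj S" "B \<in> Obj S" "p \<in> carrier (fobj P A)" "q \<in> carrier (fobj Q B)"
  shows "ap (day_arr K S s t) (A \<box> B) (tens P Q A B p q) = tens (tgt s) (tgt t) A B (ap s A p) (ap t B q)"
  using day_arrD(4)[OF assms(1,2,5,6)] assms by auto

text \<open>Brings a composite on elements to normal form: actions are pulled out of tensors and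
  maps and fused into the action of one arrow of \<open>S\<close>. An identity of presheaf maps
  becomes an identity of arrows.\<close>

lemmas act_norm = act_closed act_closed_day ap_closed ap_closed_day act_act act_act_day act_Ide act_Ide_day ap_act ap_act_day
  tens_act_left tens_act_right tens_act_left_day tens_act_right_day ap_day_arr

text \<open>The values on triple tensors form a natural family because the associator of
  \<open>S\<close> is natural, so \<open>triple_left\<close> gives a map; the work left is to match
  it with the nested lifts of the definition.\<close>

lemma day_ascD:
  fixes P Q R :: "('k,'o,'m,'v) psh"
  assumes P: "psh K S P" and Q: "psh K S Q" and R: "psh K S R"
  shows "day_asc K S P Q R \<in> Arr PC" "src (day_asc K S P Q R) = (P \<circledast> Q) \<circledast> R"
    "tgt (day_asc K S P Q R) = P \<circledast> (Q \<circledast> R)"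
    and "\<lbrakk>A \<in> Obj S; B \<in> Obj S; C \<in> Obj S; p \<in> carrier (fobj P A); q \<in> carrier (fobj Q B); r \<in> carrier (fobj R C)\<rbrakk> \<Longrightarrow>
      ap (day_asc K S P Q R) ((A \<box> B) \<box> C) (tens (P \<circledast> Q) R (A \<box> B) C (tens P Q A B p q) r) =
      act (P \<circledast> (Q \<circledast> R)) (asc S A B C) (tens P (Q \<circledast> R) A (B \<box> C) p (tens Q R B C q r))"
proof -
  let ?QR = "Q \<circledast> R" and ?PQ = "P \<circledast> Q"
  let ?T = "P \<circledast> ?QR"
  note QR = psh_day[OF Q R] and T = psh_day[OF P psh_day[OF Q R]]
  define \<theta> where "\<theta> A B C p q r = act ?T (asc S A B C) (tens P ?QR A (B \<box> C) p (tens Q R B C q r))" for A B C p q r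
  have la: "linear_on K (day_space K S P ?QR (A \<box> (B \<box> C))) (fobj ?T ((A \<box> B) \<box> C)) (act ?T (asc S A B C))"
    if "A \<in> Obj S" "B \<in> Obj S" "C \<in> Obj S" for A B C
    using pshD(3)[OF T, of "asc S A B C"] that by simp
  have l1: "linear_on K (fobj P A) (fobj ?T ((A \<box> B) \<box> C)) (\<lambda>p. \<theta> A B C p q r)"
    if "A \<in> Obj S" "B \<in> Obj S" "C \<in> Obj S" "q \<in> carrier (fobj Q B)" "r \<in> carrier (fobj R C)" for A B C q r
    unfolding \<theta>_def by (rule linear_on_comp[OF linear_tens(1)[OF P QR] la]) (use that Q R in simp_all)
  have l2: "linear_on K (fobj Q B) (fobj ?T ((A \<box> B) \<box> C)) (\<lambda>q. \<theta> A B C p q r)"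
    if a: "A \<in> Obj S" "B \<in> Obj S" "C \<in> Obj S" "p \<in> carrier (fobj P A)" "r \<in> carrier (fobj R C)" for A B C p r
    unfolding \<theta>_def
    by (rule linear_on_comp[OF linear_on_comp[OF linear_tens(1)[OF Q R a(2,3,5)] linear_tens(2)[OF P QR a(1) _ a(4), unfolded fobj_day]] la])
      (use a in simp_all)
  have l3: "linear_on K (fobj R C) (fobj ?T ((A \<box> B) \<box> C)) (\<lambda>r. \<theta> A B C p q r)"
    if a: "A \<in> Obj S" "B \<in> Obj S" "C \<in> Obj S" "p \<in> carrier (fobj P A)" "q \<in> carrier (fobj Q B)" for A B C p q
    unfolding \<theta>_def
    by (rule linear_on_comp[OF linear_on_comp[OF linear_tens(2)[OF Q R a(2,3,5)] linear_tens(2)[OF P QR a(1) _ a(4), unfolded fobj_day]] la])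
      (use a in simp_all)
  have dn: "act ?T ((h \<diamondop> l) \<diamondop> k) (\<theta> (Cod S h) (Cod S l) (Cod S k) p q r) =
        \<theta> (Dom S h) (Dom S l) (Dom S k) (act P h p) (act Q l q) (act R k r)"
    if a: "h \<in> Arr S" "l \<in> Arr S" "k \<in> Arr S" "p \<in> carrier (fobj P (Cod S h))" "q \<in> carrier (fobj Q (Cod S l))"
       "r \<in> carrier (fobj R (Cod S k))" for h l k p q r
    unfolding \<theta>_def using a P Q R
    by (simp add: act_norm merge asc_nat[of h l k])
  obtain s where s: "s \<in> Arr PC" "src s = ?PQ \<circledast> R" "tgt s = ?T"
    and v: "\<And>A B C p q r. \<lbrakk>A \<in> Obj S; B \<in> Obj S; C \<in> Obj S; p \<in> carrier (fobj P A); q \<in> carrier (fobj Q B); r \<in> carrier (fobj R C)\<rbrakk> \<Longrightarrow>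
      ap s ((A \<box> B) \<box> C) (tens ?PQ R (A \<box> B) C (tens P Q A B p q) r) = \<theta> A B C p q r"
    using triple_left[where \<theta> = \<theta>, OF P Q R T l1 l2 l3 dn] by blast
  note d = psh_arrD[OF s(1)] and PQ = psh_day[OF P Q]
  have "day_asc K S P Q R = MArr (?PQ \<circledast> R) ?T (\<lambda>X\<in>Obj S. cpt s X)"
    unfolding day_asc_def Let_def marr.inject
  proof (intro conjI refl restrict_ext day_lift_psh_arr[OF PQ R s(1,2)])
    fix X H L f u r
    assume X: "X \<in> Obj S" and a: "H \<in> Obj S" "L \<in> Obj S" "f \<in> Arr S" "Dom S f = X" "Cod S f = H \<box> L"
      and u: "u \<in> carrier (fobj ?PQ H)" and r: "r \<in> carrier (fobj R L)"
    let ?g = "\<lambda>u. act ?T f (ap s (H \<box> L) (tens ?PQ R H L u r))"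
    have HL: "H \<box> L \<in> Obj S" using a by simp
    \<comment> \<open>With \<open>f\<close> and \<open>r\<close> fixed, the inner lift is the linear
      map \<open>?g\<close> in \<open>u\<close>, as the two agree on the generators of
      \<open>P \<circledast> Q\<close>.\<close>
    have "day_lift K S P Q H (day_space K S P ?QR X) (\<lambda>A B g p q. day_in K S P ?QR X A (B \<box> L) (asc S A B L \<cdot> (g \<diamondop> Ide S L) \<cdot> f) p
            (day_in K S Q R (B \<box> L) B L (Ide S (B \<box> L)) q r)) =
        MArr (day_space K S P Q H) (day_space K S P ?QR X) (restrict ?g (carrier (day_space K S P Q H)))"
    proof (rule day_lift_eq[OF P Q a(1)])
      show "module K (day_space K S P ?QR X)" using pshD(1)[OF T X] by simp
      show "linear_on K (day_space K S P Q H) (day_space K S P ?QR X) ?g"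
        by (rule linear_on_comp[OF linear_on_comp[OF linear_tens(1)[OF PQ R a(1,2) r, unfolded fobj_day]]])
          (use d(5)[OF HL] pshD(3)[OF T a(3)] s a in simp_all)
      fix A B g p q
      assume b: "A \<in> Obj S" "B \<in> Obj S" "g \<in> Arr S" "Dom S g = H" "Cod S g = A \<box> B" "p \<in> carrier (fobj P A)" "q \<in> carrier (fobj Q B)"
      show "day_in K S P ?QR X A (B \<box> L) (asc S A B L \<cdot> (g \<diamondop> Ide S L) \<cdot> f) p (day_in K S Q R (B \<box> L) B L (Ide S (B \<box> L)) q r) =
          ?g (day_in K S P Q H A B g p q)"
        unfolding tens_def[symmetric] using X a b r s P Q R v[OF b(1,2) a(2) b(6,7) r]
        by (simp add: day_in_tens act_norm \<theta>_def)
    qed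
    then show "cpt (day_lift K S P Q H (day_space K S P ?QR X) (\<lambda>A B g p q. day_in K S P ?QR X A (B \<box> L) (asc S A B L \<cdot> (g \<diamondop> Ide S L) \<cdot> f) p
            (day_in K S Q R (B \<box> L) B L (Ide S (B \<box> L)) q r))) u = act (tgt s) f (ap s (H \<box> L) (tens ?PQ R H L u r))"
      using u s by simp
  qed (use s in simp_all)
  also have "\<dots> = s" using d(3) s by (cases s) (simp add: extensional_restrict)
  finally show "day_asc K S P Q R \<in> Arr PC" "src (day_asc K S P Q R) = ?PQ \<circledast> R" "tgt (day_asc K S P Q R) = ?T"
    "\<lbrakk>A \<in> Obj S; B \<in> Obj S; C \<in> Obj S; p \<in> carrier (fobj P A); q \<in> carrier (fobj Q B); r \<in> carrier (fobj R C)\<rbrakk> \<Longrightarrow>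
      ap (day_asc K S P Q R) ((A \<box> B) \<box> C) (tens ?PQ R (A \<box> B) C (tens P Q A B p q) r) =
      act ?T (asc S A B C) (tens P ?QR A (B \<box> C) p (tens Q R B C q r))"
    using s v by (simp_all add: \<theta>_def)
qed

text \<open>The inverse associators of \<open>S\<close> define a map in the other direction; on
  triple tensors both composites are actions of an associator composed with its inverse.\<close>

lemma day_asc_inverse:
  fixes P Q R :: "('k,'o,'m,'v) psh"
  assumes P: "psh K S P" and Q: "psh K S Q" and R: "psh K S R"
  shows "\<exists>s. inverse_arrs PC (day_asc K S P Q R) s"
proof -
  let ?QR = "Q \<circledast> R" and ?PQ = "P \<circledast> Q"
  let ?T = "?PQ \<circledast> R"
  note PQ = psh_day[OF P Q] and T = psh_day[OF psh_day[OF P Q] R] and QR = psh_day[OF Q R]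
  define \<theta> where "\<theta> A B C p q r = act ?T (inv_arr S (asc S A B C)) (tens ?PQ R (A \<box> B) C (tens P Q A B p q) r)" for A B C p q r
  have la: "linear_on K (day_space K S ?PQ R ((A \<box> B) \<box> C)) (fobj ?T (A \<box> (B \<box> C))) (act ?T (inv_arr S (asc S A B C)))"
    if "A \<in> Obj S" "B \<in> Obj S" "C \<in> Obj S" for A B C
    using pshD(3)[OF T, of "inv_arr S (asc S A B C)"] that by simp
  have l1: "linear_on K (fobj P A) (fobj ?T (A \<box> (B \<box> C))) (\<lambda>p. \<theta> A B C p q r)"
    if a: "A \<in> Obj S" "B \<in> Obj S" "C \<in> Obj S" "q \<in> carrier (fobj Q B)" "r \<in> carrier (fobj R C)" for A B C q r
    unfolding \<theta>_def
    by (rule linear_on_comp[OF linear_on_comp[OF linear_tens(1)[OF P Q a(1,2,4)] linear_tens(1)[OF PQ R _ a(3,5), unfolded fobj_day]] la])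
      (use a in simp_all)
  have l2: "linear_on K (fobj Q B) (fobj ?T (A \<box> (B \<box> C))) (\<lambda>q. \<theta> A B C p q r)"
    if a: "A \<in> Obj S" "B \<in> Obj S" "C \<in> Obj S" "p \<in> carrier (fobj P A)" "r \<in> carrier (fobj R C)" for A B C p r
    unfolding \<theta>_def
    by (rule linear_on_comp[OF linear_on_comp[OF linear_tens(2)[OF P Q a(1,2,4)] linear_tens(1)[OF PQ R _ a(3,5), unfolded fobj_day]] la])
      (use a in simp_all)
  have l3: "linear_on K (fobj R C) (fobj ?T (A \<box> (B \<box> C))) (\<lambda>r. \<theta> A B C p q r)"
    if a: "A \<in> Obj S" "B \<in> Obj S" "C \<in> Obj S" "p \<in> carrier (fobj P A)" "q \<in> carrier (fobj Q B)" for A B C p q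
    unfolding \<theta>_def by (rule linear_on_comp[OF linear_tens(2)[OF PQ R] la]) (use a P Q in simp_all)
  have dn: "act ?T (h \<diamondop> (l \<diamondop> k)) (\<theta> (Cod S h) (Cod S l) (Cod S k) p q r) =
        \<theta> (Dom S h) (Dom S l) (Dom S k) (act P h p) (act Q l q) (act R k r)"
    if a: "h \<in> Arr S" "l \<in> Arr S" "k \<in> Arr S" "p \<in> carrier (fobj P (Cod S h))" "q \<in> carrier (fobj Q (Cod S l))"
       "r \<in> carrier (fobj R (Cod S k))" for h l k p q r
    unfolding \<theta>_def using a P Q R
    by (simp add: act_norm merge inv_asc_nat[of h l k])
  obtain s where s: "s \<in> Arr PC" "src s = P \<circledast> ?QR" "tgt s = ?T"
    and v: "\<And>A B C p q r. \<lbrakk>A \<in> Obj S; B \<in> Obj S; C \<in> Obj S; p \<in> carrier (fobj P A); q \<in> carrier (fobj Q B); r \<in> carrier (fobj R C)\<rbrakk> \<Longrightarrow>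
      ap s (A \<box> (B \<box> C)) (tens P ?QR A (B \<box> C) p (tens Q R B C q r)) = \<theta> A B C p q r"
    using triple_right[where \<theta> = \<theta>, OF P Q R T l1 l2 l3 dn] by blast
  note a = day_ascD[OF P Q R]
  interpret PS: lin_category K "PC" by (rule lin_category_presheaf)
  have "s \<cdot>\<^bsub>PC\<^esub> day_asc K S P Q R = Ide PC ?T"
  proof (rule day_ext_left[OF P Q R])
    show "s \<cdot>\<^bsub>PC\<^esub> day_asc K S P Q R \<in> Arr PC" using PS.Cmp_Arr(1)[OF a(1) s(1)] s a by simp
    show "Ide PC ?T \<in> Arr PC" by (rule Ide_psh_arr[OF T])
  qed (use P Q R in \<open>simp_all add: s a v \<theta>_def act_norm\<close>)
  moreover have "day_asc K S P Q R \<cdot>\<^bsub>PC\<^esub> s = Ide PC (P \<circledast> ?QR)"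
  proof (rule day_ext_right[OF P Q R])
    show "day_asc K S P Q R \<cdot>\<^bsub>PC\<^esub> s \<in> Arr PC" using PS.Cmp_Arr(1)[OF s(1) a(1)] s a by simp
    show "Ide PC (P \<circledast> ?QR) \<in> Arr PC" by (rule Ide_psh_arr[OF psh_day[OF P QR]])
  qed (use P Q R in \<open>simp_all add: s a v \<theta>_def act_norm\<close>)
  ultimately show ?thesis using a(1-3) s by (auto simp: inverse_arrs_def hom_set_def)
qed

text \<open>Serves the pentagon. The triple criterion leaves an arbitrary element of the innermost
  convolution, and linearity reduces it to a tensor.\<close>

lemma day_ext4:
  fixes P Q R U :: "('k,'o,'m,'v) psh"
  assumes P: "psh K S P" and Q: "psh K S Q" and R: "psh K S R" and U: "psh K S U"
    and s: "s \<in> Arr PC" and s': "s' \<in> Arr PC"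
    and src: "src s = ((P \<circledast> Q) \<circledast> R) \<circledast> U" "src s' = ((P \<circledast> Q) \<circledast> R) \<circledast> U" "tgt s = tgt s'"
    and eq: "\<And>A B C D p q r u. \<lbrakk>A \<in> Obj S; B \<in> Obj S; C \<in> Obj S; D \<in> Obj S; p \<in> carrier (fobj P A); q \<in> carrier (fobj Q B); r \<in> carrier (fobj R C);
        u \<in> carrier (fobj U D)\<rbrakk> \<Longrightarrow>
      ap s (((A \<box> B) \<box> C) \<box> D) (tens ((P \<circledast> Q) \<circledast> R) U ((A \<box> B) \<box> C) D
        (tens (P \<circledast> Q) R (A \<box> B) C (tens P Q A B p q) r) u) =
      ap s' (((A \<box> B) \<box> C) \<box> D) (tens ((P \<circledast> Q) \<circledast> R) U ((A \<box> B) \<box> C) D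
        (tens (P \<circledast> Q) R (A \<box> B) C (tens P Q A B p q) r) u)"
  shows "s = s'"
proof (rule day_ext_left[OF psh_day[OF P Q] R U s s' src])
  note d = psh_arrD[OF s] and d' = psh_arrD[OF s'] and PQ = psh_day[OF P Q]
  note PQR = psh_day[OF PQ R]
  let ?PQ = "P \<circledast> Q"
  let ?PQR = "?PQ \<circledast> R"
  fix H C D v r u
  assume H: "H \<in> Obj S" and C: "C \<in> Obj S" and D: "D \<in> Obj S" and v: "v \<in> carrier (fobj ?PQ H)"
    and r: "r \<in> carrier (fobj R C)" and u: "u \<in> carrier (fobj U D)"
  have o: "(H \<box> C) \<box> D \<in> Obj S" and HC: "H \<box> C \<in> Obj S" using H C D by simp_all
  note lt = linear_on_comp[OF linear_tens(1)[OF PQ R H C r, unfolded fobj_day] linear_tens(1)[OF PQR U HC D u, unfolded fobj_day]]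
  let ?g = "\<lambda>s v. ap s ((H \<box> C) \<box> D) (tens ?PQR U (H \<box> C) D (tens ?PQ R H C v r) u)"
  show "?g s v = ?g s' v"
  proof (rule day_in_ext[OF P Q H, where V = "fobj (tgt s) ((H \<box> C) \<box> D)" and g = "?g s" and g' = "?g s'"])
    show "module K (fobj (tgt s) ((H \<box> C) \<box> D))" by (rule pshD(1)[OF d(2) o])
    show "linear_on K (day_space K S P Q H) (fobj (tgt s) ((H \<box> C) \<box> D)) (?g s)"
      by (rule linear_on_comp[OF lt]) (use d(5)[OF o] src in simp)
    show "linear_on K (day_space K S P Q H) (fobj (tgt s) ((H \<box> C) \<box> D)) (?g s')"
      by (rule linear_on_comp[OF lt]) (use d'(5)[OF o] src in simp)
    show "v \<in> carrier (day_space K S P Q H)" using v by simp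
    fix A B f p q
    assume a: "A \<in> Obj S" "B \<in> Obj S" "f \<in> Arr S" "Dom S f = H" "Cod S f = A \<box> B" "p \<in> carrier (fobj P A)" "q \<in> carrier (fobj Q B)"
    show "?g s (day_in K S P Q H A B f p q) = ?g s' (day_in K S P Q H A B f p q)"
      using a C D r u P Q R U s s' src eq[OF a(1,2) C D a(6,7) r u] by (simp add: day_in_tens act_norm)
  qed
qed

lemma day_arr_simps [simp]:
  "src (day_arr K S s t) = src s \<circledast> src t" "tgt (day_arr K S s t) = tgt s \<circledast> tgt t"
  by (simp_all add: day_arr_def)

lemma psh_Cmp:
  "s \<in> Arr PC \<Longrightarrow> t \<in> Arr PC \<Longrightarrow> src t = tgt s \<Longrightarrow> t \<cdot>\<^bsub>PC\<^esub> s \<in> Arr PC"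
  using lin_category.Cmp_Arr(1)[OF lin_category_presheaf, of s t] by simp

lemma psh_Hom_closed:
  assumes "psh K S P" "psh K S Q"
  shows "s \<in> carrier (Hom PC P Q) \<longleftrightarrow> s \<in> Arr PC \<and> src s = P \<and> tgt s = Q"
  using lin_category.Hom_carrier[OF lin_category_presheaf, of P Q] assms by (simp add: hom_set_def)

lemma psh_Hom_module:
  "psh K S P \<Longrightarrow> psh K S Q \<Longrightarrow> module K (Hom PC P Q)"
  by (rule lin_category.Hom_module[OF lin_category_presheaf]) simp_all

lemma lin_category_day: "lin_category K DC"
proof (rule lin_category.intro[OF field_axioms], rule lin_category_axioms.intro)
  interpret PS: lin_category K "PC" by (rule lin_category_presheaf)
qed (auto simp: lin_category.Hom_module[OF lin_category_presheaf] lin_category.Hom_carrier[OF lin_category_presheaf]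
    lin_category.Ide_in_hom[OF lin_category_presheaf] lin_category.Cmp_linear_right[OF lin_category_presheaf]
    lin_category.Cmp_linear_left[OF lin_category_presheaf] lin_category.Cmp_Ide_right[OF lin_category_presheaf]
    lin_category.Cmp_Ide_left[OF lin_category_presheaf] lin_category.Cmp_assoc[OF lin_category_presheaf] psh_arrD(1,2))

text \<open>Both sides are presheaf maps out of a convolution, so they are compared on tensors,
  where the claim is bilinearity of \<open>tens\<close>.\<close>

lemma day_arr_linear:
  fixes s :: "('k,'o,'m,'v) pshmap" and Q Q' :: "('k,'o,'m,'v) psh"
  assumes s: "s \<in> Arr PC" and Q: "psh K S Q" and Q': "psh K S Q'"
  shows "linear_on K (Hom PC Q Q') (Hom PC (src s \<circledast> Q) (tgt s \<circledast> Q')) (\<lambda>t. day_arr K S s t)"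
    and "linear_on K (Hom PC Q Q') (Hom PC (Q \<circledast> src s) (Q' \<circledast> tgt s)) (\<lambda>t. day_arr K S t s)"
proof -
  note s' = psh_arrD[OF s]
  have d: "psh K S (src s \<circledast> Q)" "psh K S (tgt s \<circledast> Q')" "psh K S (Q \<circledast> src s)" "psh K S (Q' \<circledast> tgt s)"
    using s'(1,2) Q Q' by simp_all
  note m = psh_Hom_module[OF Q Q'] and cl = psh_Hom_closed[OF Q Q']
  note dm = psh_Hom_module[OF d(1,2)] psh_Hom_module[OF d(3,4)] and dcl = psh_Hom_closed[OF d(1,2)] psh_Hom_closed[OF d(3,4)]
  show "linear_on K (Hom PC Q Q') (Hom PC (src s \<circledast> Q) (tgt s \<circledast> Q')) (\<lambda>t. day_arr K S s t)"
  proof (rule linear_onI)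
    fix t assume t: "t \<in> carrier (Hom PC Q Q')"
    then have t': "t \<in> Arr PC" "src t = Q" "tgt t = Q'" by (simp_all add: cl)
    show c: "day_arr K S s t \<in> carrier (Hom PC (src s \<circledast> Q) (tgt s \<circledast> Q'))"
      using t' by (simp add: dcl day_arrD(1)[OF s])
    show "day_arr K S s (k \<odot>\<^bsub>Hom PC Q Q'\<^esub> t) =
        k \<odot>\<^bsub>Hom PC (src s \<circledast> Q) (tgt s \<circledast> Q')\<^esub> day_arr K S s t" if k: "k \<in> carrier K" for k
    proof -
      have kt: "k \<odot>\<^bsub>Hom PC Q Q'\<^esub> t \<in> carrier (Hom PC Q Q')" by (rule module_smult_closed[OF m k t])
      have kd: "k \<odot>\<^bsub>Hom PC (src s \<circledast> Q) (tgt s \<circledast> Q')\<^esub> day_arr K S s t \<in>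
        carrier (Hom PC (src s \<circledast> Q) (tgt s \<circledast> Q'))" by (rule module_smult_closed[OF dm(1) k c])
      show ?thesis
        by (rule day_ext[OF s'(1) Q])
          (use kt[unfolded cl] kd[unfolded dcl] s'(1,2,7) Q Q' t' k linear_on_smult[OF linear_tens(2)[OF s'(2) Q']] in
            \<open>simp_all add: day_arrD(1) s ap_day_arr ap_closed\<close>)
    qed
    fix u assume u: "u \<in> carrier (Hom PC Q Q')"
    then have u': "u \<in> Arr PC" "src u = Q" "tgt u = Q'" by (simp_all add: cl)
    have cu: "day_arr K S s u \<in> carrier (Hom PC (src s \<circledast> Q) (tgt s \<circledast> Q'))"
      using u' by (simp add: dcl day_arrD(1)[OF s])
    have kt: "t \<oplus>\<^bsub>Hom PC Q Q'\<^esub> u \<in> carrier (Hom PC Q Q')" by (rule module_add_closed[OF m t u])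
    have kd: "day_arr K S s t \<oplus>\<^bsub>Hom PC (src s \<circledast> Q) (tgt s \<circledast> Q')\<^esub> day_arr K S s u \<in>
        carrier (Hom PC (src s \<circledast> Q) (tgt s \<circledast> Q'))" by (rule module_add_closed[OF dm(1) c cu])
    show "day_arr K S s (t \<oplus>\<^bsub>Hom PC Q Q'\<^esub> u) =
        day_arr K S s t \<oplus>\<^bsub>Hom PC (src s \<circledast> Q) (tgt s \<circledast> Q')\<^esub> day_arr K S s u"
      by (rule day_ext[OF s'(1) Q])
        (use kt[unfolded cl] kd[unfolded dcl] s'(1,2,7) Q Q' t' u' linear_on_add[OF linear_tens(2)[OF s'(2) Q']] in
            \<open>simp_all add: day_arrD(1) s ap_day_arr ap_closed\<close>)
  qed
  show "linear_on K (Hom PC Q Q') (Hom PC (Q \<circledast> src s) (Q' \<circledast> tgt s)) (\<lambda>t. day_arr K S t s)"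
  proof (rule linear_onI)
    fix t assume t: "t \<in> carrier (Hom PC Q Q')"
    then have t': "t \<in> Arr PC" "src t = Q" "tgt t = Q'" by (simp_all add: cl)
    show c: "day_arr K S t s \<in> carrier (Hom PC (Q \<circledast> src s) (Q' \<circledast> tgt s))"
      using t' by (simp add: dcl day_arrD(1)[OF _ s])
    show "day_arr K S (k \<odot>\<^bsub>Hom PC Q Q'\<^esub> t) s =
        k \<odot>\<^bsub>Hom PC (Q \<circledast> src s) (Q' \<circledast> tgt s)\<^esub> day_arr K S t s" if k: "k \<in> carrier K" for k
    proof -
      have kt: "k \<odot>\<^bsub>Hom PC Q Q'\<^esub> t \<in> carrier (Hom PC Q Q')" by (rule module_smult_closed[OF m k t])
      have kd: "k \<odot>\<^bsub>Hom PC (Q \<circledast> src s) (Q' \<circledast> tgt s)\<^esub> day_arr K S t s \<in>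
        carrier (Hom PC (Q \<circledast> src s) (Q' \<circledast> tgt s))" by (rule module_smult_closed[OF dm(2) k c])
      show ?thesis
        by (rule day_ext[OF Q s'(1)])
          (use kt[unfolded cl] kd[unfolded dcl] s'(1,2,7) Q Q' t' k linear_on_smult[OF linear_tens(1)[OF Q' s'(2)]] in
            \<open>simp_all add: day_arrD(1) s ap_day_arr ap_closed\<close>)
    qed
    fix u assume u: "u \<in> carrier (Hom PC Q Q')"
    then have u': "u \<in> Arr PC" "src u = Q" "tgt u = Q'" by (simp_all add: cl)
    have cu: "day_arr K S u s \<in> carrier (Hom PC (Q \<circledast> src s) (Q' \<circledast> tgt s))"
      using u' by (simp add: dcl day_arrD(1)[OF _ s])
    have kt: "t \<oplus>\<^bsub>Hom PC Q Q'\<^esub> u \<in> carrier (Hom PC Q Q')" by (rule module_add_closed[OF m t u])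
    have kd: "day_arr K S t s \<oplus>\<^bsub>Hom PC (Q \<circledast> src s) (Q' \<circledast> tgt s)\<^esub> day_arr K S u s \<in>
        carrier (Hom PC (Q \<circledast> src s) (Q' \<circledast> tgt s))" by (rule module_add_closed[OF dm(2) c cu])
    show "day_arr K S (t \<oplus>\<^bsub>Hom PC Q Q'\<^esub> u) s =
        day_arr K S t s \<oplus>\<^bsub>Hom PC (Q \<circledast> src s) (Q' \<circledast> tgt s)\<^esub> day_arr K S u s"
      by (rule day_ext[OF Q s'(1)])
        (use kt[unfolded cl] kd[unfolded dcl] s'(1,2,7) Q Q' t' u' linear_on_add[OF linear_tens(1)[OF Q' s'(2)]] in
            \<open>simp_all add: day_arrD(1) s ap_day_arr ap_closed\<close>)
  qed
qed

theorem semigroup_category_day: "semigroup_category K DC"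
proof (rule semigroup_category.intro[OF lin_category_day], rule semigroup_category_axioms.intro, goal_cases)
  case (1 P Q) then show ?case by simp
next
  case (2 s P P' Q Q') then show ?case using day_arr_linear(1)[of s Q Q'] by (auto simp: hom_set_def)
next
  case (3 P P' s Q Q') then show ?case using day_arr_linear(2)[of s P P'] by (auto simp: hom_set_def)
next
  case (4 P Q)
  then have P: "psh K S P" and Q: "psh K S Q" by simp_all
  have "day_arr K S (Ide PC P) (Ide PC Q) = Ide PC (P \<circledast> Q)"
    by (rule day_ext[OF P Q day_arrD(1) Ide_psh_arr])
      (use P Q in \<open>simp_all add: Ide_psh_arr ap_day_arr\<close>)
  then show ?case by simp
next
  case (5 s P P' s' P'' t Q Q' t' Q'')
  then have a: "s \<in> Arr PC" "src s = P" "tgt s = P'" "s' \<in> Arr PC" "src s' = P'" "tgt s' = P''"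
    "t \<in> Arr PC" "src t = Q" "tgt t = Q'" "t' \<in> Arr PC" "src t' = Q'" "tgt t' = Q''"
    by (simp_all add: hom_set_def)
  have P: "psh K S P" and Q: "psh K S Q" using psh_arrD(1)[OF a(1)] psh_arrD(1)[OF a(7)] a by simp_all
  have "day_arr K S (s' \<cdot>\<^bsub>PC\<^esub> s) (t' \<cdot>\<^bsub>PC\<^esub> t) = day_arr K S s' t' \<cdot>\<^bsub>PC\<^esub> day_arr K S s t"
    by (rule day_ext[OF P Q day_arrD(1) psh_Cmp])
      (use a P Q in \<open>simp_all add: psh_Cmp day_arrD(1) ap_day_arr ap_closed\<close>)
  then show ?case by simp
next
  case (6 P Q R) then show ?case by (simp add: hom_set_def day_ascD)
next
  case (7 P Q R) then show ?case using day_asc_inverse[of P Q R] by (simp add: iso_arr_def)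
next
  case (8 s P P' t Q Q' u R R')
  then have a: "s \<in> Arr PC" "src s = P" "tgt s = P'"
    "t \<in> Arr PC" "src t = Q" "tgt t = Q'" "u \<in> Arr PC" "src u = R" "tgt u = R'"
    by (simp_all add: hom_set_def)
  have p: "psh K S P" "psh K S Q" "psh K S R" "psh K S P'" "psh K S Q'" "psh K S R'"
    using psh_arrD(1,2)[OF a(1)] psh_arrD(1,2)[OF a(4)] psh_arrD(1,2)[OF a(7)] a by simp_all
  have "day_asc K S P' Q' R' \<cdot>\<^bsub>PC\<^esub> day_arr K S (day_arr K S s t) u =
      day_arr K S s (day_arr K S t u) \<cdot>\<^bsub>PC\<^esub> day_asc K S P Q R"
    by (rule day_ext_left[OF p(1-3) psh_Cmp psh_Cmp])
      (use a p in \<open>simp_all add: day_arrD(1) day_ascD act_norm\<close>)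
  then show ?case by simp
next
  case (9 P Q R U)
  then have p: "psh K S P" "psh K S Q" "psh K S R" "psh K S U" by simp_all
  have "day_asc K S P Q (R \<circledast> U) \<cdot>\<^bsub>PC\<^esub> day_asc K S (P \<circledast> Q) R U =
      day_arr K S (Ide PC P) (day_asc K S Q R U) \<cdot>\<^bsub>PC\<^esub> day_asc K S P (Q \<circledast> R) U \<cdot>\<^bsub>PC\<^esub>
        day_arr K S (day_asc K S P Q R) (Ide PC U)"
  proof (rule day_ext4[OF p], goal_cases)
    case 1 then show ?case using p by (intro psh_Cmp) (simp_all add: day_ascD)
  next
    case 2 then show ?case using p by (intro psh_Cmp day_arrD(1)) (simp_all add: day_ascD Ide_psh_arr)
  next
    \<comment> \<open>On a fourfold tensor both paths are actions of composites of associators of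
      \<open>S\<close>, which its pentagon equates.\<close>
    case (6 A B C D a b c d)
    then show ?case
      using p by (simp add: day_ascD day_arrD(1) Ide_psh_arr psh_Cmp act_norm pentagon merge)
  qed (use p in \<open>simp_all add: day_ascD\<close>)
  then show ?case by simp
qed

end

section \<open>The Yoneda embedding\<close>

context small_sg
begin

abbreviation y :: "'o \<Rightarrow> ('k,'o,'m,'v) psh" where
  "y A \<equiv> yoneda_psh S A"

abbreviation el :: "'o \<Rightarrow> 'o \<Rightarrow> 'm \<Rightarrow> 'v" where
  "el X A f \<equiv> venc (Hom S X A) f"

lemma lin_functor_id_functor: "lin_functor K S S id_functor"
  by (intro lin_functor.intro lin_functor_axioms.intro lin_category_axioms) (simp_all add: id_functor_def linear_on_id)

lemma psh_y [simp]: "A \<in> Obj S \<Longrightarrow> psh K S (y A)"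
  unfolding yoneda_psh_def
  by (rule psh_hom_psh[OF lin_functor_id_functor]) (simp_all add: fits_Hom id_functor_def)

lemma fobj_y [simp]: "fobj (y A) X = vcopy (Hom S X A)"
  by (simp add: yoneda_psh_def hom_psh_simps id_functor_def)

lemma el_closed [simp]:
  "f \<in> Arr S \<Longrightarrow> Dom S f = X \<Longrightarrow> Cod S f = A \<Longrightarrow> el X A f \<in> carrier (vcopy (Hom S X A))"
  by (intro venc_closed Hom_mem)

lemma vdec_el [simp]:
  "f \<in> Arr S \<Longrightarrow> Dom S f = X \<Longrightarrow> Cod S f = A \<Longrightarrow> vdec (Hom S X A) (el X A f) = f"
  by (intro vdec_venc fits_Hom Hom_mem) auto

lemma elE:
  assumes "p \<in> carrier (vcopy (Hom S X A) :: ('k,'v) module)" "X \<in> Obj S" "A \<in> Obj S"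
  obtains f where "f \<in> Arr S" "Dom S f = X" "Cod S f = A" "p = el X A f"
  using assms by (auto elim!: vcopyE dest: Hom_Arr)

lemma act_y [simp]:
  assumes "f \<in> Arr S" "Dom S f = Cod S h" "Cod S f = A" "h \<in> Arr S" "X = Cod S h"
  shows "act (y A) h (el X A f) = el (Dom S h) A (f \<cdot> h)"
proof -
  let ?I = "id_functor :: ('o,'m,'o,'m) fctr"
  have "act (hom_psh S S ?I A) h (venc (Hom S (fobj ?I (Cod S h)) A) f :: 'v) =
      venc (Hom S (fobj ?I (Dom S h)) A) (f \<cdot> farr ?I h)"
    by (rule act_hom_psh) (use assms in \<open>auto simp: id_functor_def intro!: fits_Hom Hom_mem\<close>)
  then show ?thesis using assms(5) by (simp add: yoneda_psh_def id_functor_def)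
qed

lemma yoneda_simps [simp]:
  "fobj (yoneda S) A = y A" "src (farr (yoneda S) h) = y (Dom S h)" "tgt (farr (yoneda S) h) = y (Cod S h)"
  by (simp_all add: yoneda_def)

lemma ap_yoneda [simp]:
  assumes "h \<in> Arr S" "f \<in> Arr S" "Dom S f = X" "Cod S f = Dom S h" "A = Dom S h"
  shows "ap (farr (yoneda S) h) X (el X A f) = el X (Cod S h) (h \<cdot> f)"
  using assms by (auto simp: yoneda_def Let_def)

lemma linear_el: "X \<in> Obj S \<Longrightarrow> A \<in> Obj S \<Longrightarrow> linear_on K (Hom S X A) (vcopy (Hom S X A)) (el X A)"
  by (intro linear_venc fits_Hom)

lemma linear_unel: "X \<in> Obj S \<Longrightarrow> A \<in> Obj S \<Longrightarrow> linear_on K (vcopy (Hom S X A) :: ('k,'v) module) (Hom S X A) (vdec (Hom S X A))"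
  by (intro linear_vdec fits_Hom Hom_module)

lemma yoneda_arr [simp]:
  assumes h: "h \<in> Arr S"
  shows "farr (yoneda S) h \<in> Arr PC"
proof -
  let ?t = "\<lambda>X\<in>Obj S. MArr (vcopy (Hom S X (Dom S h))) (vcopy (Hom S X (Cod S h)))
      (\<lambda>x\<in>carrier (vcopy (Hom S X (Dom S h)) :: ('k,'v) module). el X (Cod S h) (h \<cdot> vdec (Hom S X (Dom S h)) x))"
  have "MArr (y (Dom S h)) (y (Cod S h)) ?t \<in> Arr PC"
  proof (rule psh_arrI, goal_cases)
    case (6 X)
    then have m: "module K (vcopy (Hom S X (Dom S h)) :: ('k,'v) module)" using pshD(1)[OF psh_y[of "Dom S h"], of X] h by simp
    have "linear_on K (vcopy (Hom S X (Dom S h)) :: ('k,'v) module) (vcopy (Hom S X (Cod S h))) (\<lambda>x. el X (Cod S h) (h \<cdot> vdec (Hom S X (Dom S h)) x))"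
      by (rule linear_on_comp[OF linear_on_comp[OF linear_unel Cmp_lin_right[OF 6 h]] linear_el]) (use h 6 in simp_all)
    then show ?case using 6 by (simp add: linear_on_cong[OF m])
  next
    case (7 k p)
    then obtain f where f: "f \<in> Arr S" "Dom S f = Cod S k" "Cod S f = Dom S h" "p = el (Cod S k) (Dom S h) f"
      using h by (auto elim: elE)
    then show ?case using 7 h by simp
  qed (use h in simp_all)
  then show ?thesis by (simp add: yoneda_def Let_def)
qed

text \<open>The uniqueness half of the Yoneda lemma: each element of \<open>y A\<close> is a
  restriction of the identity.\<close>

lemma yoneda_ext:
  assumes s: "s \<in> Arr PC" and s': "s' \<in> Arr PC" and A: "A \<in> Obj S"
    and "src s = y A" "src s' = y A" "tgt s = tgt s'"
    and eq: "ap s A (el A A (Ide S A)) = ap s' A (el A A (Ide S A))"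
  shows "s = s'"
proof (rule psh_arr_eqI[OF s s'])
  fix X p assume X: "X \<in> Obj S" and "p \<in> carrier (fobj (src s) X)"
  then obtain f where f: "f \<in> Arr S" "Dom S f = X" "Cod S f = A" "p = el X A f" using A assms(4) by (auto elim: elE)
  have e: "el X A f = act (y A) f (el A A (Ide S A))" using f A by simp
  show "ap s X p = ap s' X p"
    unfolding f(4) e using s s' f A assms(4-6) eq by (simp add: ap_act del: act_y)
qed (use assms in simp_all)

lemma lin_functor_yoneda:
  "lin_functor K S DC (yoneda S)"
proof (intro lin_functor.intro lin_functor_axioms.intro lin_category_axioms lin_category_day)
  let ?y = "yoneda S :: ('o, 'm, ('k,'o,'m,'v) psh, ('k,'o,'m,'v) pshmap) fctr"
  show "A \<in> Obj S \<Longrightarrow> fobj ?y A \<in> Obj DC" for A by simp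
  show "farr ?y (Ide S A) = Ide DC (fobj ?y A)" if "A \<in> Obj S" for A
    unfolding day_cat_simps yoneda_simps
    by (rule yoneda_ext[of _ _ A]) (use that in \<open>simp_all add: Ide_psh_arr\<close>)
  show "farr ?y (g \<cdot> f) = farr ?y g \<cdot>\<^bsub>DC\<^esub> farr ?y f" if "f \<in> hom_set S A B" "g \<in> hom_set S B E" for f g A B E
  proof -
    note a = hom_setD[OF that(1)] hom_setD[OF that(2)]
    then have "A \<in> Obj S" by auto
    then show ?thesis
      unfolding day_cat_simps
      by (intro yoneda_ext[of _ _ A] psh_Cmp) (use a in simp_all)
  qed
  show "linear_on K (Hom S A B) (Hom DC (fobj ?y A) (fobj ?y B)) (farr ?y)" if A: "A \<in> Obj S" and B: "B \<in> Obj S" for A B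
    unfolding day_cat_simps yoneda_simps
  proof (rule linear_onI)
    note cl = psh_Hom_closed[OF psh_y[OF A] psh_y[OF B]] and m = psh_Hom_module[OF psh_y[OF A] psh_y[OF B]]
    fix f assume f: "f \<in> carrier (Hom S A B)"
    note f' = Hom_Arr[OF A B f]
    show c: "farr ?y f \<in> carrier (Hom PC (y A) (y B))" using f' by (simp add: cl)
    show "farr ?y (k \<odot>\<^bsub>Hom S A B\<^esub> f) = k \<odot>\<^bsub>Hom PC (y A) (y B)\<^esub> farr ?y f" if k: "k \<in> carrier K" for k
    proof -
      have "k \<odot>\<^bsub>Hom PC (y A) (y B)\<^esub> farr ?y f \<in> carrier (Hom PC (y A) (y B))"
        by (rule module_smult_closed[OF m k c])
      note c' = this[unfolded cl]
      show ?thesis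
        by (rule yoneda_ext[of _ _ A])
          (use A B f' k c' linear_on_smult[OF linear_el[OF A B] k f] in \<open>simp_all add: Hom_smult_Arr\<close>)
    qed
    fix g assume g: "g \<in> carrier (Hom S A B)"
    note g' = Hom_Arr[OF A B g]
    have "farr ?y g \<in> carrier (Hom PC (y A) (y B))" using g' by (simp add: cl)
    from module_add_closed[OF m c this] have "farr ?y f \<oplus>\<^bsub>Hom PC (y A) (y B)\<^esub> farr ?y g \<in> carrier (Hom PC (y A) (y B))" .
    note c' = this[unfolded cl]
    show "farr ?y (f \<oplus>\<^bsub>Hom S A B\<^esub> g) = farr ?y f \<oplus>\<^bsub>Hom PC (y A) (y B)\<^esub> farr ?y g"
      by (rule yoneda_ext[of _ _ A])
        (use A B f' g' c' linear_on_add[OF linear_el[OF A B] f g] in \<open>simp_all add: Hom_add_Arr\<close>)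
  qed
qed

text \<open>Tensoring arrows is bilinear and natural, so it lifts to the convolution, and the lift
  has the defining components of \<open>yoneda_str\<close>.\<close>

lemma yoneda_strD:
  fixes F G :: 'o
  assumes F: "F \<in> Obj S" and G: "G \<in> Obj S"
  defines "J \<equiv> yoneda_str K S F G :: ('k,'o,'m,'v) pshmap"
  shows "J \<in> Arr PC" "src J = y F \<circledast> y G" "tgt J = y (F \<box> G)"
    and "\<lbrakk>a \<in> Arr S; b \<in> Arr S; Dom S a = A; Cod S a = F; Dom S b = B; Cod S b = G\<rbrakk> \<Longrightarrow>
      ap J (A \<box> B) (tens (y F) (y G) A B (el A F a) (el B G b)) = el (A \<box> B) (F \<box> G) (a \<diamondop> b)"
proof -
  let ?T = "y (F \<box> G)"
  define \<theta> where "\<theta> A B a b = el (A \<box> B) (F \<box> G) (vdec (Hom S A F) a \<diamondop> vdec (Hom S B G) b)" for A B and a b :: 'v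
  have FG: "F \<box> G \<in> Obj S" using F G by simp
  obtain s where s: "s \<in> Arr PC" "src s = y F \<circledast> y G" "tgt s = ?T"
    and v: "\<And>A B a b. A \<in> Obj S \<Longrightarrow> B \<in> Obj S \<Longrightarrow> a \<in> carrier (fobj (y F) A) \<Longrightarrow> b \<in> carrier (fobj (y G) B) \<Longrightarrow>
      ap s (A \<box> B) (tens (y F) (y G) A B a b) = \<theta> A B a b"
  proof (rule exE[OF tens_lift[where \<theta> = \<theta>, OF psh_y[OF F] psh_y[OF G] psh_y[OF FG]]])
    fix A B assume o: "A \<in> Obj S" "B \<in> Obj S"
    then have AB: "A \<box> B \<in> Obj S" by simp
    show "linear_on K (fobj (y F) A) (fobj ?T (A \<box> B)) (\<lambda>a. \<theta> A B a b)" if "b \<in> carrier (fobj (y G) B)" for b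
    proof -
      from that o G obtain b' where b: "b' \<in> Arr S" "Dom S b' = B" "Cod S b' = G" "b = el B G b'" by (auto elim!: elE)
      show ?thesis unfolding fobj_y \<theta>_def
        by (rule linear_on_comp[OF linear_on_comp[OF linear_unel[OF o(1) F] tarr_lin_left] linear_el[OF AB FG]]) (use b o F in simp_all)
    qed
    show "linear_on K (fobj (y G) B) (fobj ?T (A \<box> B)) (\<lambda>b. \<theta> A B a b)" if "a \<in> carrier (fobj (y F) A)" for a
    proof -
      from that o F obtain a' where a: "a' \<in> Arr S" "Dom S a' = A" "Cod S a' = F" "a = el A F a'" by (auto elim!: elE)
      show ?thesis unfolding fobj_y \<theta>_def
        by (rule linear_on_comp[OF linear_on_comp[OF linear_unel[OF o(2) G] tarr_lin_right] linear_el[OF AB FG]]) (use a o G in simp_all)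
    qed
  next
    fix h l a b assume a: "h \<in> Arr S" "l \<in> Arr S" "a \<in> carrier (fobj (y F) (Cod S h))" "b \<in> carrier (fobj (y G) (Cod S l))"
    then obtain a' b' where "a' \<in> Arr S" "Dom S a' = Cod S h" "Cod S a' = F" "a = el (Cod S h) F a'"
      "b' \<in> Arr S" "Dom S b' = Cod S l" "Cod S b' = G" "b = el (Cod S l) G b'" using F G by (auto elim!: elE)
    then show "act ?T (h \<diamondop> l) (\<theta> (Cod S h) (Cod S l) a b) = \<theta> (Dom S h) (Dom S l) (act (y F) h a) (act (y G) l b)"
      using a(1,2) by (simp add: \<theta>_def merge)
  qed auto
  have "J = MArr (y F \<circledast> y G) ?T (\<lambda>X\<in>Obj S. cpt s X)"
    unfolding J_def yoneda_str_def marr.inject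
  proof (intro conjI refl restrict_ext day_lift_psh_arr[OF psh_y[OF F] psh_y[OF G] s(1,2)])
    fix X H L f a b assume o: "H \<in> Obj S" "L \<in> Obj S" "f \<in> Arr S" "Dom S f = X" "Cod S f = H \<box> L"
      and ab: "a \<in> carrier (fobj (y F) H)" "b \<in> carrier (fobj (y G) L)"
    then obtain a' b' where "a' \<in> Arr S" "Dom S a' = H" "Cod S a' = F" "a = el H F a'"
      "b' \<in> Arr S" "Dom S b' = L" "Cod S b' = G" "b = el L G b'" using F G by (auto elim!: elE)
    then show "el X (F \<box> G) ((vdec (Hom S H F) a \<diamondop> vdec (Hom S L G) b) \<cdot> f) = act (tgt s) f (ap s (H \<box> L) (tens (y F) (y G) H L a b))"
      unfolding v[OF o(1,2) ab] using o s by (simp add: \<theta>_def)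
  qed (use s in simp_all)
  also have "\<dots> = s" using psh_arrD(3)[OF s(1)] s by (cases s) (simp add: extensional_restrict)
  finally have J: "J = s" .
  show "J \<in> Arr PC" "src J = y F \<circledast> y G" "tgt J = ?T" using s J by simp_all
  show "ap J (A \<box> B) (tens (y F) (y G) A B (el A F a) (el B G b)) = el (A \<box> B) (F \<box> G) (a \<diamondop> b)"
    if a: "a \<in> Arr S" "b \<in> Arr S" "Dom S a = A" "Cod S a = F" "Dom S b = B" "Cod S b = G"
    using a Dom_Obj[OF a(1)] Dom_Obj[OF a(2)] by (simp add: J v \<theta>_def)
qed

text \<open>Yoneda in both variables: the two identities generate the convolution of
  representables.\<close>

lemma tens_el:
  assumes "F \<in> Obj S" "G \<in> Obj S" "a \<in> Arr S" "b \<in> Arr S" "Dom S a = A" "Cod S a = F" "Dom S b = B" "Cod S b = G"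
  shows "tens (y F) (y G) A B (el A F a) (el B G b) =
    act (y F \<circledast> y G) (a \<diamondop> b) (tens (y F) (y G) F G (el F F (Ide S F)) (el G G (Ide S G)))"
  using act_tens[of "y F" "y G" a b F G "el F F (Ide S F)" "el G G (Ide S G)"] assms by auto

text \<open>By Yoneda a map out of \<open>y (F \<box> G)\<close> is an element at
  \<open>F \<box> G\<close>; the inverse corresponds to the tensor of the two identities. One
  composite is checked on tensors, the other on an identity.\<close>

lemma yoneda_str_iso:
  fixes F G :: 'o
  assumes F: "F \<in> Obj S" and G: "G \<in> Obj S"
  shows "\<exists>s. inverse_arrs PC (yoneda_str K S F G :: ('k,'o,'m,'v) pshmap) s \<and>
    ap s (F \<box> G) (el (F \<box> G) (F \<box> G) (Ide S (F \<box> G))) = tens (y F) (y G) F G (el F F (Ide S F)) (el G G (Ide S G))"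
proof -
  let ?D = "y F \<circledast> y G" and ?T = "y (F \<box> G)"
  let ?i = "tens (y F) (y G) F G (el F F (Ide S F)) (el G G (Ide S G))"
  have FG: "F \<box> G \<in> Obj S" using F G by simp
  have D: "psh K S ?D" and T: "psh K S ?T" using F G by simp_all
  have i: "?i \<in> carrier (day_space K S (y F) (y G) (F \<box> G))" using F G by simp
  let ?s = "mk_psh ?T ?D (\<lambda>X c. act ?D (vdec (Hom S X (F \<box> G)) c) ?i)"
  have s: "?s \<in> Arr PC"
  proof (rule mk_psh_arr[OF T D])
    show "linear_on K (fobj ?T X) (fobj ?D X) (\<lambda>c. act ?D (vdec (Hom S X (F \<box> G)) c) ?i)" if X: "X \<in> Obj S" for X
      unfolding fobj_y by (rule linear_on_comp[OF linear_unel[OF X FG] pshD(8)[OF D X FG]]) (use i in simp)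
    fix h p assume h: "h \<in> Arr S" and "p \<in> carrier (fobj ?T (Cod S h))"
    then obtain c where "c \<in> Arr S" "Dom S c = Cod S h" "Cod S c = F \<box> G" "p = el (Cod S h) (F \<box> G) c"
      using FG by (auto elim!: elE)
    then show "act ?D (vdec (Hom S (Dom S h) (F \<box> G)) (act ?T h p)) ?i = act ?D h (act ?D (vdec (Hom S (Cod S h) (F \<box> G)) p) ?i)"
      using h F G i by (simp add: act_act_day)
  qed
  note J = yoneda_strD[OF F G]
  let ?J = "yoneda_str K S F G"
  have v: "ap ?s X (el X (F \<box> G) c) = act ?D c ?i" if "c \<in> Arr S" "Dom S c = X" "Cod S c = F \<box> G" for X c
    using that by (subst mk_psh_simps(3)) auto
  have a: "?s \<cdot>\<^bsub>PC\<^esub> ?J = Ide PC ?D"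
  proof (rule day_ext[OF psh_y[OF F] psh_y[OF G]])
    show "?s \<cdot>\<^bsub>PC\<^esub> ?J \<in> Arr PC" by (rule psh_Cmp[OF J(1) s]) (simp add: J)
    show "Ide PC ?D \<in> Arr PC" by (rule Ide_psh_arr[OF D])
    fix A B p q assume AB: "A \<in> Obj S" "B \<in> Obj S" and "p \<in> carrier (fobj (y F) A)" "q \<in> carrier (fobj (y G) B)"
    with F G obtain a b where ab: "a \<in> Arr S" "Dom S a = A" "Cod S a = F" "p = el A F a"
        "b \<in> Arr S" "Dom S b = B" "Cod S b = G" "q = el B G b" by (auto elim!: elE)
    show "ap (?s \<cdot>\<^bsub>PC\<^esub> ?J) (A \<box> B) (tens (y F) (y G) A B p q) = ap (Ide PC ?D) (A \<box> B) (tens (y F) (y G) A B p q)"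
      using ab AB F G by (simp add: J v tens_el[of F G a b, symmetric])
  qed (simp_all add: J)
  have b: "?J \<cdot>\<^bsub>PC\<^esub> ?s = Ide PC ?T"
  proof (rule yoneda_ext[of _ _ "F \<box> G"])
    show "?J \<cdot>\<^bsub>PC\<^esub> ?s \<in> Arr PC" by (rule psh_Cmp[OF s J(1)]) (simp add: J)
    show "Ide PC ?T \<in> Arr PC" by (rule Ide_psh_arr[OF T])
    show "ap (?J \<cdot>\<^bsub>PC\<^esub> ?s) (F \<box> G) (el (F \<box> G) (F \<box> G) (Ide S (F \<box> G))) =
        ap (Ide PC ?T) (F \<box> G) (el (F \<box> G) (F \<box> G) (Ide S (F \<box> G)))"
      using F G FG i s by (simp add: v act_Ide_day J)
  qed (use FG in \<open>simp_all add: J\<close>)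
  have "inverse_arrs PC ?J ?s" using a b s J by (simp add: inverse_arrs_def hom_set_def)
  moreover have "ap ?s (F \<box> G) (el (F \<box> G) (F \<box> G) (Ide S (F \<box> G))) = ?i"
    using F G FG i by (simp add: v act_Ide_day)
  ultimately show ?thesis by blast
qed

theorem semigroup_functor_yoneda:
  "semigroup_functor K S DC (yoneda S) (yoneda_str K S)"
proof (rule semigroup_functor.intro[OF semigroup_category_axioms semigroup_category_day lin_functor_yoneda], rule semigroup_functor_axioms.intro, goal_cases)
  case (1 F G) then show ?case by (simp add: hom_set_def yoneda_strD)
next
  case (2 F G) then show ?case using yoneda_str_iso[of F G] by (auto simp: iso_arr_def)
next
  case (3 f F F' g G G')
  then have a: "f \<in> Arr S" "Dom S f = F" "Cod S f = F'" "g \<in> Arr S" "Dom S g = G" "Cod S g = G'" by (auto simp: hom_set_def)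
  then have o: "F \<in> Obj S" "G \<in> Obj S" "F' \<in> Obj S" "G' \<in> Obj S" by auto
  have "yoneda_str K S F' G' \<cdot>\<^bsub>PC\<^esub> day_arr K S (farr (yoneda S) f) (farr (yoneda S) g) =
      (farr (yoneda S) (f \<diamondop> g) \<cdot>\<^bsub>PC\<^esub> yoneda_str K S F G :: ('k,'o,'m,'v) pshmap)"
  proof (rule day_ext[OF psh_y[OF o(1)] psh_y[OF o(2)] psh_Cmp psh_Cmp])
    fix A B p q assume AB: "A \<in> Obj S" "B \<in> Obj S" and "p \<in> carrier (fobj (y F) A)" "q \<in> carrier (fobj (y G) B)"
    with o obtain u v where uv: "u \<in> Arr S" "Dom S u = A" "Cod S u = F" "p = el A F u"
        "v \<in> Arr S" "Dom S v = B" "Cod S v = G" "q = el B G v" by (auto elim!: elE)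
    show "ap (yoneda_str K S F' G' \<cdot>\<^bsub>PC\<^esub> day_arr K S (farr (yoneda S) f) (farr (yoneda S) g)) (A \<box> B) (tens (y F) (y G) A B p q) =
        ap (farr (yoneda S) (f \<diamondop> g) \<cdot>\<^bsub>PC\<^esub> yoneda_str K S F G) (A \<box> B) (tens (y F) (y G) A B p q)"
      using uv AB o a by (simp add: yoneda_strD day_arrD(1) ap_day_arr merge)
  qed (use a o in \<open>simp_all add: yoneda_strD day_arrD(1)\<close>)
  then show ?case by simp
next
  case (4 A B C)
  have "farr (yoneda S) (asc S A B C) \<cdot>\<^bsub>PC\<^esub> yoneda_str K S (A \<box> B) C \<cdot>\<^bsub>PC\<^esub>
        day_arr K S (yoneda_str K S A B) (Ide PC (y C)) =
      yoneda_str K S A (B \<box> C) \<cdot>\<^bsub>PC\<^esub> day_arr K S (Ide PC (y A)) (yoneda_str K S B C) \<cdot>\<^bsub>PC\<^esub>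
        day_asc K S (y A) (y B) (y C)"
  proof (rule day_ext_left[OF psh_y[OF 4(1)] psh_y[OF 4(2)] psh_y[OF 4(3)]], goal_cases)
    case 1 then show ?case using 4 by (intro psh_Cmp day_arrD(1)) (simp_all add: yoneda_strD Ide_psh_arr)
  next
    case 2 then show ?case using 4 by (intro psh_Cmp day_arrD(1)) (simp_all add: yoneda_strD Ide_psh_arr day_ascD)
  next
    case (6 A' B' C' p q r)
    with 4 obtain u v w where uv: "u \<in> Arr S" "Dom S u = A'" "Cod S u = A" "p = el A' A u"
        "v \<in> Arr S" "Dom S v = B'" "Cod S v = B" "q = el B' B v" "w \<in> Arr S" "Dom S w = C'" "Cod S w = C" "r = el C' C w"
      by (auto elim!: elE)
    then show ?case
      using 4 6(1-3) asc_nat[of u v w]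
      by (simp add: yoneda_strD day_arrD(1) ap_day_arr Ide_psh_arr psh_Cmp day_ascD ap_act_day)
  qed (use 4 in \<open>simp_all add: yoneda_strD day_ascD\<close>)
  then show ?case by simp
qed

text \<open>A presheaf map is recovered from its value at the identity of \<open>A\<close>, and
  every such value is an arrow into \<open>B\<close>.\<close>

theorem fully_faithful_yoneda:
  "fully_faithful S DC (yoneda S)"
  unfolding fully_faithful_def
proof (intro ballI)
  fix A B assume A: "A \<in> Obj S" and B: "B \<in> Obj S"
  let ?y = "yoneda S :: ('o, 'm, ('k,'o,'m,'v) psh, ('k,'o,'m,'v) pshmap) fctr"
  have "bij_betw (farr ?y) (hom_set S A B) (hom_set PC (y A) (y B))"
    unfolding bij_betw_def
  proof
    show "inj_on (farr ?y) (hom_set S A B)"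
    proof (rule inj_onI)
      fix f g assume "f \<in> hom_set S A B" "g \<in> hom_set S A B" and e: "farr ?y f = farr ?y g"
      then have a: "f \<in> Arr S" "Dom S f = A" "Cod S f = B" "g \<in> Arr S" "Dom S g = A" "Cod S g = B" by (auto simp: hom_set_def)
      have "el A B f = el A B g"
        using arg_cong[OF e, of "\<lambda>s. ap s A (el A A (Ide S A))"] a A by simp
      from arg_cong[OF this, of "vdec (Hom S A B)"] show "f = g" using a by simp
    qed
    show "farr ?y ` hom_set S A B = hom_set PC (y A) (y B)"
    proof (intro equalityI subsetI)
      fix s assume "s \<in> farr ?y ` hom_set S A B"
      then show "s \<in> hom_set PC (y A) (y B)" by (auto simp: hom_set_def)
    next
      fix s :: "('k,'o,'m,'v) pshmap" assume "s \<in> hom_set PC (y A) (y B)"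
      then have s: "s \<in> Arr PC" "src s = y A" "tgt s = y B" by (simp_all add: hom_set_def)
      have "ap s A (el A A (Ide S A)) \<in> carrier (fobj (y B) A)" by (rule ap_closed[OF s(1) A s(3)]) (simp add: s A)
      then obtain f where f: "f \<in> Arr S" "Dom S f = A" "Cod S f = B" "ap s A (el A A (Ide S A)) = el A B f"
        using A B by (auto elim!: elE)
      have "s = farr ?y f"
        by (rule yoneda_ext[OF s(1) _ A]) (use s f A in simp_all)
      then show "s \<in> farr ?y ` hom_set S A B" using f by (auto simp: hom_set_def)
    qed
  qed
  then show "bij_betw (farr ?y) (hom_set S A B) (hom_set DC (fobj ?y A) (fobj ?y B))" by simp
qed

end

section \<open>The unit\<close>

lemma tens_functor_simps [simp]:
  "fobj (rtens_functor S) = rtens S" "fobj (ltens_functor S) = ltens S"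
  "farr (rtens_functor S) h = MArr (rtens S (Dom S h)) (rtens S (Cod S h)) (\<lambda>X\<in>Obj S. Ide S X \<diamondop>\<^bsub>S\<^esub> h)"
  "farr (ltens_functor S) h = MArr (ltens S (Dom S h)) (ltens S (Cod S h)) (\<lambda>X\<in>Obj S. h \<diamondop>\<^bsub>S\<^esub> Ide S X)"
  by (simp_all add: rtens_functor_def ltens_functor_def)

lemma lmod_cat_simps [simp]:
  "Obj (lmod_cat K S) = {\<Phi>. left_module_functor K S \<Phi>}" "Dom (lmod_cat K S) = src" "Cod (lmod_cat K S) = tgt"
  "Ide (lmod_cat K S) F = MArr F F (\<lambda>A\<in>Obj S. Ide S (fobj F A))"
  "Cmp (lmod_cat K S) s t = MArr (src t) (tgt s) (\<lambda>A\<in>Obj S. cpt s A \<cdot>\<^bsub>S\<^esub> cpt t A)"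
  "carrier (Hom (lmod_cat K S) F G) = MArr F G ` lmod_trans S F G"
  "s \<oplus>\<^bsub>Hom (lmod_cat K S) F G\<^esub> t = MArr F G (\<lambda>A\<in>Obj S. cpt s A \<oplus>\<^bsub>Hom S (fobj F A) (fobj G A)\<^esub> cpt t A)"
  "c \<odot>\<^bsub>Hom (lmod_cat K S) F G\<^esub> t = MArr F G (\<lambda>A\<in>Obj S. c \<odot>\<^bsub>Hom S (fobj F A) (fobj G A)\<^esub> cpt t A)"
  by (simp_all add: lmod_cat_def)

lemma rmod_cat_simps [simp]:
  "Obj (rmod_cat K S) = {\<Phi>. right_module_functor K S \<Phi>}" "Dom (rmod_cat K S) = src" "Cod (rmod_cat K S) = tgt"
  "Ide (rmod_cat K S) F = MArr F F (\<lambda>A\<in>Obj S. Ide S (fobj F A))"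
  "Cmp (rmod_cat K S) s t = MArr (src t) (tgt s) (\<lambda>A\<in>Obj S. cpt s A \<cdot>\<^bsub>S\<^esub> cpt t A)"
  "carrier (Hom (rmod_cat K S) F G) = MArr F G ` rmod_trans S F G"
  "s \<oplus>\<^bsub>Hom (rmod_cat K S) F G\<^esub> t = MArr F G (\<lambda>A\<in>Obj S. cpt s A \<oplus>\<^bsub>Hom S (fobj F A) (fobj G A)\<^esub> cpt t A)"
  "c \<odot>\<^bsub>Hom (rmod_cat K S) F G\<^esub> t = MArr F G (\<lambda>A\<in>Obj S. c \<odot>\<^bsub>Hom S (fobj F A) (fobj G A)\<^esub> cpt t A)"
  by (simp_all add: rmod_cat_def)

section \<open>Functoriality of the unit presheaves and stability of balance\<close>

context semigroup_category
begin

lemma lmod_trans_tens: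
  assumes "h \<in> Arr S" shows "(\<lambda>X\<in>Obj S. Ide S X \<diamondop> h) \<in> lmod_trans S (rtens S (Dom S h)) (rtens S (Cod S h))"
proof -
  have "asc S X M (Cod S h) \<cdot> (Ide S (X \<box> M) \<diamondop> h) = (Ide S X \<diamondop> (Ide S M \<diamondop> h)) \<cdot> asc S X M (Dom S h)"
    if "X \<in> Obj S" "M \<in> Obj S" for X M
    using asc_nat[of "Ide S X" "Ide S M" h X X M M "Dom S h" "Cod S h"] that assms by simp
  then show ?thesis using assms by (simp add: lmod_trans_def nat_trans_def hom_set_def merge)
qed

lemma rmod_trans_tens:
  assumes "h \<in> Arr S" shows "(\<lambda>X\<in>Obj S. h \<diamondop> Ide S X) \<in> rmod_trans S (ltens S (Dom S h)) (ltens S (Cod S h))"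
proof -
  have "inv_arr S (asc S (Cod S h) M X) \<cdot> (h \<diamondop> Ide S (M \<box> X)) = ((h \<diamondop> Ide S M) \<diamondop> Ide S X) \<cdot> inv_arr S (asc S (Dom S h) M X)"
    if "X \<in> Obj S" "M \<in> Obj S" for X M
    using inv_asc_nat[of h "Ide S M" "Ide S X" "Dom S h" "Cod S h" M M X X] that assms by simp
  then show ?thesis using assms by (simp add: rmod_trans_def nat_trans_def hom_set_def merge)
qed

lemma lin_functor_rtens_functor: "lin_functor K S (lmod_cat K S) (rtens_functor S)"
proof (intro lin_functor.intro lin_functor_axioms.intro lin_category_axioms lin_category_lmod)
  show "A \<in> Obj S \<Longrightarrow> fobj (rtens_functor S) A \<in> Obj (lmod_cat K S)" for A by (simp add: left_module_functor_rtens)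
  show "A \<in> Obj S \<Longrightarrow> farr (rtens_functor S) (Ide S A) = Ide (lmod_cat K S) (fobj (rtens_functor S) A)" for A
    by (simp cong: restrict_cong)
  show "farr (rtens_functor S) (g \<cdot> f) = farr (rtens_functor S) g \<cdot>\<^bsub>lmod_cat K S\<^esub> farr (rtens_functor S) f"
    if "f \<in> hom_set S A B" "g \<in> hom_set S B E" for f g A B E
    using hom_setD[OF that(1)] hom_setD[OF that(2)] by (simp add: merge cong: restrict_cong)
  show "linear_on K (Hom S A B) (Hom (lmod_cat K S) (fobj (rtens_functor S) A) (fobj (rtens_functor S) B)) (farr (rtens_functor S))"
    if A: "A \<in> Obj S" and B: "B \<in> Obj S" for A B
  proof (rule linear_onI)
    note l = tarr_lin_right[OF Ide_Arr(1) A B Ide_Arr(2,3)]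
    fix f assume f: "f \<in> carrier (Hom S A B)"
    note f' = Hom_Arr[OF A B f]
    show "farr (rtens_functor S) f \<in> carrier (Hom (lmod_cat K S) (fobj (rtens_functor S) A) (fobj (rtens_functor S) B))"
      using lmod_trans_tens[OF f'(1)] f' by simp
    show "farr (rtens_functor S) (c \<odot>\<^bsub>Hom S A B\<^esub> f) = c \<odot>\<^bsub>Hom (lmod_cat K S) (fobj (rtens_functor S) A) (fobj (rtens_functor S) B)\<^esub> farr (rtens_functor S) f"
      if c: "c \<in> carrier K" for c
      using linear_on_smult[OF l c f] f' c by (simp add: Hom_smult_Arr cong: restrict_cong)
    fix g assume g: "g \<in> carrier (Hom S A B)"
    show "farr (rtens_functor S) (f \<oplus>\<^bsub>Hom S A B\<^esub> g) =
        farr (rtens_functor S) f \<oplus>\<^bsub>Hom (lmod_cat K S) (fobj (rtens_functor S) A) (fobj (rtens_functor S) B)\<^esub> farr (rtens_functor S) g"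
      using linear_on_add[OF l f g] f' Hom_Arr[OF A B g] by (simp add: Hom_add_Arr cong: restrict_cong)
  qed
qed

lemma lin_functor_ltens_functor: "lin_functor K S (rmod_cat K S) (ltens_functor S)"
proof (intro lin_functor.intro lin_functor_axioms.intro lin_category_axioms lin_category_rmod)
  show "A \<in> Obj S \<Longrightarrow> fobj (ltens_functor S) A \<in> Obj (rmod_cat K S)" for A by (simp add: right_module_functor_ltens)
  show "A \<in> Obj S \<Longrightarrow> farr (ltens_functor S) (Ide S A) = Ide (rmod_cat K S) (fobj (ltens_functor S) A)" for A
    by (simp cong: restrict_cong)
  show "farr (ltens_functor S) (g \<cdot> f) = farr (ltens_functor S) g \<cdot>\<^bsub>rmod_cat K S\<^esub> farr (ltens_functor S) f"
    if "f \<in> hom_set S A B" "g \<in> hom_set S B E" for f g A B E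
    using hom_setD[OF that(1)] hom_setD[OF that(2)] by (simp add: merge cong: restrict_cong)
  show "linear_on K (Hom S A B) (Hom (rmod_cat K S) (fobj (ltens_functor S) A) (fobj (ltens_functor S) B)) (farr (ltens_functor S))"
    if A: "A \<in> Obj S" and B: "B \<in> Obj S" for A B
  proof (rule linear_onI)
    note l = tarr_lin_left[OF Ide_Arr(1) A B Ide_Arr(2,3)]
    fix f assume f: "f \<in> carrier (Hom S A B)"
    note f' = Hom_Arr[OF A B f]
    show "farr (ltens_functor S) f \<in> carrier (Hom (rmod_cat K S) (fobj (ltens_functor S) A) (fobj (ltens_functor S) B))"
      using rmod_trans_tens[OF f'(1)] f' by simp
    show "farr (ltens_functor S) (c \<odot>\<^bsub>Hom S A B\<^esub> f) = c \<odot>\<^bsub>Hom (rmod_cat K S) (fobj (ltens_functor S) A) (fobj (ltens_functor S) B)\<^esub> farr (ltens_functor S) f"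
      if c: "c \<in> carrier K" for c
      using linear_on_smult[OF l c f] f' c by (simp add: Hom_smult_Arr cong: restrict_cong)
    fix g assume g: "g \<in> carrier (Hom S A B)"
    show "farr (ltens_functor S) (f \<oplus>\<^bsub>Hom S A B\<^esub> g) =
        farr (ltens_functor S) f \<oplus>\<^bsub>Hom (rmod_cat K S) (fobj (ltens_functor S) A) (fobj (ltens_functor S) B)\<^esub> farr (ltens_functor S) g"
      using linear_on_add[OF l f g] f' Hom_Arr[OF A B g] by (simp add: Hom_add_Arr cong: restrict_cong)
  qed
qed

text \<open>Balance equates two linear expressions, one in \<open>s L\<close> and one in
  \<open>t H\<close>, so it passes to sums.\<close>

lemma balanced_add:
  assumes "balanced S F t s" "balanced S F t' s'" "t \<in> lunit S F" "t' \<in> lunit S F" "s \<in> runit S F" "s' \<in> runit S F" "F \<in> Obj S"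
  shows "balanced S F (\<lambda>A\<in>Obj S. t A \<oplus>\<^bsub>Hom S (A \<box> F) A\<^esub> t' A) (\<lambda>A\<in>Obj S. s A \<oplus>\<^bsub>Hom S (F \<box> A) A\<^esub> s' A)"
  unfolding balanced_def
proof (intro ballI)
  note F = assms(7)
  fix H L assume H: "H \<in> Obj S" and L: "L \<in> Obj S"
  note t = lunitD[OF assms(3) F] lunitD[OF assms(4) F] and s = runitD[OF assms(5) F] runitD[OF assms(6) F]
  have l1: "linear_on K (Hom S (F \<box> L) L) (Hom S ((H \<box> F) \<box> L) (H \<box> L)) (\<lambda>u. (Ide S H \<diamondop> u) \<cdot> asc S H F L)"
    by (rule linear_on_comp[OF tarr_lin_right[of "Ide S H" "F \<box> L" L H H]])
      (use Cmp_lin_left[of "H \<box> L" "asc S H F L"] H L F in simp_all)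
  have l2: "linear_on K (Hom S (H \<box> F) H) (Hom S ((H \<box> F) \<box> L) (H \<box> L)) (\<lambda>u. u \<diamondop> Ide S L)"
    by (rule tarr_lin_left) (use H L F in simp_all)
  show "(Ide S H \<diamondop> (\<lambda>A\<in>Obj S. s A \<oplus>\<^bsub>Hom S (F \<box> A) A\<^esub> s' A) L) \<cdot> asc S H F L =
      (\<lambda>A\<in>Obj S. t A \<oplus>\<^bsub>Hom S (A \<box> F) A\<^esub> t' A) H \<diamondop> Ide S L"
    using linear_on_add[OF l1, of "s L" "s' L"] linear_on_add[OF l2, of "t H" "t' H"] H L
      balancedD[OF assms(1) H L] balancedD[OF assms(2) H L]
    by (simp add: s t Hom_mem)
qed

lemma balanced_smult:
  assumes "balanced S F t s" "t \<in> lunit S F" "s \<in> runit S F" "F \<in> Obj S" "c \<in> carrier K"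
  shows "balanced S F (\<lambda>A\<in>Obj S. c \<odot>\<^bsub>Hom S (A \<box> F) A\<^esub> t A) (\<lambda>A\<in>Obj S. c \<odot>\<^bsub>Hom S (F \<box> A) A\<^esub> s A)"
  unfolding balanced_def
proof (intro ballI)
  note F = assms(4)
  fix H L assume H: "H \<in> Obj S" and L: "L \<in> Obj S"
  note t = lunitD[OF assms(2) F] and s = runitD[OF assms(3) F]
  have l1: "linear_on K (Hom S (F \<box> L) L) (Hom S ((H \<box> F) \<box> L) (H \<box> L)) (\<lambda>u. (Ide S H \<diamondop> u) \<cdot> asc S H F L)"
    by (rule linear_on_comp[OF tarr_lin_right[of "Ide S H" "F \<box> L" L H H]])
      (use Cmp_lin_left[of "H \<box> L" "asc S H F L"] H L F in simp_all)
  have l2: "linear_on K (Hom S (H \<box> F) H) (Hom S ((H \<box> F) \<box> L) (H \<box> L)) (\<lambda>u. u \<diamondop> Ide S L)"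
    by (rule tarr_lin_left) (use H L F in simp_all)
  show "(Ide S H \<diamondop> (\<lambda>A\<in>Obj S. c \<odot>\<^bsub>Hom S (F \<box> A) A\<^esub> s A) L) \<cdot> asc S H F L =
      (\<lambda>A\<in>Obj S. c \<odot>\<^bsub>Hom S (A \<box> F) A\<^esub> t A) H \<diamondop> Ide S L"
    using linear_on_smult[OF l1 assms(5), of "s L"] linear_on_smult[OF l2 assms(5), of "t H"] H L
      balancedD[OF assms(1) H L]
    by (simp add: s t Hom_mem)
qed

lemma runit_closed:
  assumes "F \<in> Obj S"
  shows "s \<in> runit S F \<Longrightarrow> s' \<in> runit S F \<Longrightarrow> (\<lambda>A\<in>Obj S. s A \<oplus>\<^bsub>Hom S (F \<box> A) A\<^esub> s' A) \<in> runit S F"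
    and "c \<in> carrier K \<Longrightarrow> s \<in> runit S F \<Longrightarrow> (\<lambda>A\<in>Obj S. c \<odot>\<^bsub>Hom S (F \<box> A) A\<^esub> s A) \<in> runit S F"
  using trans_category.add[OF rmod_trans_category, of "ltens S F" "id_modfun S" s s']
    trans_category.smult[OF rmod_trans_category, of "ltens S F" "id_modfun S" c s]
    right_module_functor_ltens[OF assms] right_module_functor_id by simp_all

lemma lunit_closed:
  assumes "F \<in> Obj S"
  shows "t \<in> lunit S F \<Longrightarrow> t' \<in> lunit S F \<Longrightarrow> (\<lambda>A\<in>Obj S. t A \<oplus>\<^bsub>Hom S (A \<box> F) A\<^esub> t' A) \<in> lunit S F"
    and "c \<in> carrier K \<Longrightarrow> t \<in> lunit S F \<Longrightarrow> (\<lambda>A\<in>Obj S. c \<odot>\<^bsub>Hom S (A \<box> F) A\<^esub> t A) \<in> lunit S F"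
  using trans_category.add[OF lmod_trans_category, of "rtens S F" "id_modfun S" t t']
    trans_category.smult[OF lmod_trans_category, of "rtens S F" "id_modfun S" c t]
    left_module_functor_rtens[OF assms] left_module_functor_id by simp_all

lemma lunit_act:
  assumes "h \<in> Arr S" "t \<in> lunit S (Cod S h)"
  shows "(\<lambda>X\<in>Obj S. t X \<cdot> (Ide S X \<diamondop> h)) \<in> lunit S (Dom S h)"
  using trans_category.cmp[OF lmod_trans_category, of "rtens S (Dom S h)" "rtens S (Cod S h)" "id_modfun S" "\<lambda>X\<in>Obj S. Ide S X \<diamondop> h" t]
    assms lmod_trans_tens[OF assms(1)] by (simp add: left_module_functor_rtens left_module_functor_id cong: restrict_cong)

lemma runit_act:
  assumes "h \<in> Arr S" "s \<in> runit S (Cod S h)"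
  shows "(\<lambda>X\<in>Obj S. s X \<cdot> (h \<diamondop> Ide S X)) \<in> runit S (Dom S h)"
  using trans_category.cmp[OF rmod_trans_category, of "ltens S (Dom S h)" "ltens S (Cod S h)" "id_modfun S" "\<lambda>X\<in>Obj S. h \<diamondop> Ide S X" s]
    assms rmod_trans_tens[OF assms(1)] by (simp add: right_module_functor_ltens right_module_functor_id cong: restrict_cong)

text \<open>Restriction along \<open>h\<close> acts on both members of the pair, and naturality of
  the associator carries \<open>h\<close> from one side of the equation to the other.\<close>

lemma balanced_act:
  assumes h: "h \<in> Arr S" and t: "t \<in> lunit S (Cod S h)" and s: "s \<in> runit S (Cod S h)" and b: "balanced S (Cod S h) t s"
  shows "balanced S (Dom S h) (\<lambda>X\<in>Obj S. t X \<cdot> (Ide S X \<diamondop> h)) (\<lambda>X\<in>Obj S. s X \<cdot> (h \<diamondop> Ide S X))"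
  unfolding balanced_def
proof (intro ballI)
  fix H L assume HL: "H \<in> Obj S" "L \<in> Obj S"
  note t' = lunitD[OF t Cod_Obj[OF h]] and s' = runitD[OF s Cod_Obj[OF h]]
  have "(Ide S H \<diamondop> (s L \<cdot> (h \<diamondop> Ide S L))) \<cdot> asc S H (Dom S h) L =
      (Ide S H \<diamondop> s L) \<cdot> (Ide S H \<diamondop> (h \<diamondop> Ide S L)) \<cdot> asc S H (Dom S h) L"
    using HL h by (simp add: s' merge)
  also have "(Ide S H \<diamondop> (h \<diamondop> Ide S L)) \<cdot> asc S H (Dom S h) L = asc S H (Cod S h) L \<cdot> ((Ide S H \<diamondop> h) \<diamondop> Ide S L)"
    by (rule asc_nat[symmetric]) (use HL h in simp_all)
  also have "(Ide S H \<diamondop> s L) \<cdot> \<dots> = ((Ide S H \<diamondop> s L) \<cdot> asc S H (Cod S h) L) \<cdot> ((Ide S H \<diamondop> h) \<diamondop> Ide S L)"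
    using HL h by (simp add: s')
  also have "\<dots> = (t H \<cdot> (Ide S H \<diamondop> h)) \<diamondop> Ide S L"
    unfolding balancedD[OF b HL] using HL h by (simp add: t' merge)
  finally show "(Ide S H \<diamondop> (\<lambda>X\<in>Obj S. s X \<cdot> (h \<diamondop> Ide S X)) L) \<cdot> asc S H (Dom S h) L =
      (\<lambda>X\<in>Obj S. t X \<cdot> (Ide S X \<diamondop> h)) H \<diamondop> Ide S L" using HL by simp
qed

end

context lin_category
begin

text \<open>Pointwise inverses of a linear natural map are automatically linear and natural, because
  values of the inverse are identified by applying the map to them.\<close>

lemma psh_bij_iso:
  fixes s :: "('k,'o,'m,'v) pshmap"
  assumes s: "s \<in> Arr (presheaf_cat K C)"
    and b: "\<And>X. X \<in> Obj C \<Longrightarrow> bij_betw (ap s X) (carrier (fobj (src s) X)) (carrier (fobj (tgt s) X))"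
  shows "iso_arr (presheaf_cat K C) s"
proof -
  note d = psh_arrD[OF s]
  let ?i = "\<lambda>X. inv_into (carrier (fobj (src s) X)) (ap s X)"
  have i: "?i X q \<in> carrier (fobj (src s) X)" "ap s X (?i X q) = q" if "X \<in> Obj C" "q \<in> carrier (fobj (tgt s) X)" for X q
    using that bij_betw_imp_surj_on[OF b[OF that(1)]] by (auto intro: inv_into_into f_inv_into_f)
  have i': "?i X (ap s X p) = p" if "X \<in> Obj C" "p \<in> carrier (fobj (src s) X)" for X p
    by (rule bij_betw_inv_into_left[OF b[OF that(1)] that(2)])
  have u: "?i X q = p" if "X \<in> Obj C" "p \<in> carrier (fobj (src s) X)" "ap s X p = q" for X p q
    using i'[OF that(1,2)] that(3) by simp
  let ?s = "mk_psh (tgt s) (src s) ?i"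
  have s': "?s \<in> Arr (presheaf_cat K C)"
  proof (rule mk_psh_arr[OF d(2,1)])
    show "linear_on K (fobj (tgt s) X) (fobj (src s) X) (?i X)" if X: "X \<in> Obj C" for X
    proof (rule linear_onI)
      note m = pshD(1)[OF d(1) X] and l = d(5)[OF X]
      fix q assume q: "q \<in> carrier (fobj (tgt s) X)"
      show "?i X q \<in> carrier (fobj (src s) X)" by (rule i[OF X q])
      show "?i X (c \<odot>\<^bsub>fobj (tgt s) X\<^esub> q) = c \<odot>\<^bsub>fobj (src s) X\<^esub> ?i X q" if c: "c \<in> carrier K" for c
        by (rule u[OF X module_smult_closed[OF m c i(1)[OF X q]]])
          (simp add: linear_on_smult[OF l c i(1)[OF X q]] i[OF X q])
      fix r assume r: "r \<in> carrier (fobj (tgt s) X)"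
      show "?i X (q \<oplus>\<^bsub>fobj (tgt s) X\<^esub> r) = ?i X q \<oplus>\<^bsub>fobj (src s) X\<^esub> ?i X r"
        by (rule u[OF X module_add_closed[OF m i(1)[OF X q] i(1)[OF X r]]])
          (simp add: linear_on_add[OF l i(1)[OF X q] i(1)[OF X r]] i[OF X q] i[OF X r])
    qed
    fix h q assume h: "h \<in> Arr C" and q: "q \<in> carrier (fobj (tgt s) (Cod C h))"
    note iq = i[OF Cod_Obj[OF h] q]
    show "?i (Dom C h) (act (tgt s) h q) = act (src s) h (?i (Cod C h) q)"
      by (rule u[OF Dom_Obj[OF h] pshD(5)[OF d(1) h refl iq(1)]]) (simp add: d(8)[OF h iq(1)] iq(2))
  qed
  have "inverse_arrs (presheaf_cat K C) s ?s"
    by (rule psh_inverseI[OF s s']) (use i i' d(7) in simp_all)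
  then show ?thesis by (auto simp: iso_arr_def)
qed

end

section \<open>The two unit presheaves and their comparison\<close>

locale small_rigid = small_sg K S emb + rigid_sg K S
  for K :: "('k,'x) ring_scheme" and S :: "('k,'o,'m,'y) sgcat_scheme"
    and emb :: "(nat + 'k + 'o + 'm) set \<Rightarrow> 'v"
begin

abbreviation HL :: "'o \<Rightarrow> ('k, (('o,'m) modfun, 'o \<Rightarrow> 'm) marr) module" where
  "HL F \<equiv> Hom (lmod_cat K S) (rtens S F) (id_modfun S)"

abbreviation HR :: "'o \<Rightarrow> ('k, (('o,'m) modfun, 'o \<Rightarrow> 'm) marr) module" where
  "HR F \<equiv> Hom (rmod_cat K S) (ltens S F) (id_modfun S)"

abbreviation ul :: "('k,'o,'m,'v) psh" where "ul \<equiv> left_unit_psh K S"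
abbreviation ur :: "('k,'o,'m,'v) psh" where "ur \<equiv> right_unit_psh K S"

text \<open>The element of the left unit presheaf at \<open>F\<close> that encodes a transformation;
  \<open>uld\<close> reads it back.\<close>

definition ule :: "'o \<Rightarrow> ('o \<Rightarrow> 'm) \<Rightarrow> 'v" where
  "ule F t = venc (HL F) (MArr (rtens S F) (id_modfun S) t)"

definition ure :: "'o \<Rightarrow> ('o \<Rightarrow> 'm) \<Rightarrow> 'v" where
  "ure F s = venc (HR F) (MArr (ltens S F) (id_modfun S) s)"

definition uld :: "'o \<Rightarrow> 'v \<Rightarrow> 'o \<Rightarrow> 'm" where "uld F p = cpt (vdec (HL F) p)"

definition partner :: "'o \<Rightarrow> ('o \<Rightarrow> 'm) \<Rightarrow> 'o \<Rightarrow> 'm" where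
  "partner F t = (THE s. s \<in> runit S F \<and> balanced S F t s)"

lemma partnerD:
  assumes "F \<in> Obj S" "t \<in> lunit S F"
  shows "partner F t \<in> runit S F" "balanced S F t (partner F t)"
  using theI'[OF right_partner[OF assms]] by (simp_all add: partner_def)

lemma partner_eqI: "F \<in> Obj S \<Longrightarrow> t \<in> lunit S F \<Longrightarrow> s \<in> runit S F \<Longrightarrow> balanced S F t s \<Longrightarrow> partner F t = s"
  using right_partner[of F t] partnerD[of F t] by blast

lemma fits_HL: "F \<in> Obj S \<Longrightarrow> fits TYPE('v) (HL F)"
  unfolding fits_def lmod_cat_simps by (rule fits_trans) (auto dest: lunitD)

lemma fits_HR: "F \<in> Obj S \<Longrightarrow> fits TYPE('v) (HR F)"
  unfolding fits_def rmod_cat_simps by (rule fits_trans) (auto dest: runitD)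

lemma psh_ul [simp]: "psh K S ul"
  unfolding left_unit_psh_def
  by (rule psh_hom_psh[OF lin_functor_rtens_functor]) (simp_all add: left_module_functor_id fits_HL del: lmod_cat_simps(6-))

lemma psh_ur [simp]: "psh K S ur"
  unfolding right_unit_psh_def
  by (rule psh_hom_psh[OF lin_functor_ltens_functor]) (simp_all add: right_module_functor_id fits_HR del: rmod_cat_simps(6-))

lemma fobj_ul [simp]: "fobj ul F = vcopy (HL F)" and fobj_ur [simp]: "fobj ur F = vcopy (HR F)"
  by (simp_all add: left_unit_psh_def right_unit_psh_def hom_psh_simps)

lemma ule_closed [simp]: "F \<in> Obj S \<Longrightarrow> t \<in> lunit S F \<Longrightarrow> ule F t \<in> carrier (vcopy (HL F))"
  unfolding ule_def by (rule venc_closed) simp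

lemma ure_closed [simp]: "F \<in> Obj S \<Longrightarrow> s \<in> runit S F \<Longrightarrow> ure F s \<in> carrier (vcopy (HR F))"
  unfolding ure_def by (rule venc_closed) simp

lemma uleE:
  assumes "p \<in> carrier (vcopy (HL F) :: ('k,'v) module)" "F \<in> Obj S"
  obtains t where "t \<in> lunit S F" "p = ule F t"
  using assms by (auto elim!: vcopyE simp: ule_def)

lemma ureE:
  assumes "p \<in> carrier (vcopy (HR F) :: ('k,'v) module)" "F \<in> Obj S"
  obtains s where "s \<in> runit S F" "p = ure F s"
  using assms by (auto elim!: vcopyE simp: ure_def)

lemma uld_ule [simp]: "F \<in> Obj S \<Longrightarrow> t \<in> lunit S F \<Longrightarrow> uld F (ule F t) = t"
  unfolding uld_def ule_def by (subst vdec_venc[OF fits_HL]) auto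

lemma uld_lunit: "p \<in> carrier (vcopy (HL F) :: ('k,'v) module) \<Longrightarrow> F \<in> Obj S \<Longrightarrow> uld F p \<in> lunit S F"
  by (auto elim!: uleE)

lemma act_ul:
  assumes "h \<in> Arr S" "F = Cod S h" "t \<in> lunit S F"
  shows "act ul h (ule F t) = ule (Dom S h) (\<lambda>X\<in>Obj S. t X \<cdot> (Ide S X \<diamondop> h))"
proof -
  have "act ul h (venc (Hom (lmod_cat K S) (fobj (rtens_functor S) (Cod S h)) (id_modfun S)) (MArr (rtens S F) (id_modfun S) t) :: 'v) =
      venc (Hom (lmod_cat K S) (fobj (rtens_functor S) (Dom S h)) (id_modfun S)) (MArr (rtens S F) (id_modfun S) t \<cdot>\<^bsub>lmod_cat K S\<^esub> farr (rtens_functor S) h)"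
    unfolding left_unit_psh_def
    by (rule act_hom_psh) (use assms in \<open>simp_all add: fits_HL del: lmod_cat_simps(7-)\<close>)
  then show ?thesis using assms by (simp add: ule_def cong: restrict_cong)
qed

lemma act_ur:
  assumes "h \<in> Arr S" "F = Cod S h" "s \<in> runit S F"
  shows "act ur h (ure F s) = ure (Dom S h) (\<lambda>X\<in>Obj S. s X \<cdot> (h \<diamondop> Ide S X))"
proof -
  have "act ur h (venc (Hom (rmod_cat K S) (fobj (ltens_functor S) (Cod S h)) (id_modfun S)) (MArr (ltens S F) (id_modfun S) s) :: 'v) =
      venc (Hom (rmod_cat K S) (fobj (ltens_functor S) (Dom S h)) (id_modfun S)) (MArr (ltens S F) (id_modfun S) s \<cdot>\<^bsub>rmod_cat K S\<^esub> farr (ltens_functor S) h)"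
    unfolding right_unit_psh_def
    by (rule act_hom_psh) (use assms in \<open>simp_all add: fits_HR del: rmod_cat_simps(7-)\<close>)
  then show ?thesis using assms by (simp add: ure_def cong: restrict_cong)
qed

lemma ule_ops:
  assumes "F \<in> Obj S" "t \<in> lunit S F"
  shows "t' \<in> lunit S F \<Longrightarrow> ule F t \<oplus>\<^bsub>vcopy (HL F)\<^esub> ule F t' = ule F (\<lambda>A\<in>Obj S. t A \<oplus>\<^bsub>Hom S (A \<box> F) A\<^esub> t' A)"
    and "c \<odot>\<^bsub>vcopy (HL F)\<^esub> ule F t = ule F (\<lambda>A\<in>Obj S. c \<odot>\<^bsub>Hom S (A \<box> F) A\<^esub> t A)"
  unfolding ule_def using assms by (simp_all add: vcopy_ops[OF fits_HL] del: lmod_cat_simps(7-)) (simp_all cong: restrict_cong)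

lemma ure_ops:
  assumes "F \<in> Obj S" "s \<in> runit S F"
  shows "s' \<in> runit S F \<Longrightarrow> ure F s \<oplus>\<^bsub>vcopy (HR F)\<^esub> ure F s' = ure F (\<lambda>A\<in>Obj S. s A \<oplus>\<^bsub>Hom S (F \<box> A) A\<^esub> s' A)"
    and "c \<odot>\<^bsub>vcopy (HR F)\<^esub> ure F s = ure F (\<lambda>A\<in>Obj S. c \<odot>\<^bsub>Hom S (F \<box> A) A\<^esub> s A)"
  unfolding ure_def using assms by (simp_all add: vcopy_ops[OF fits_HR] del: rmod_cat_simps(7-)) (simp_all cong: restrict_cong)

text \<open>The sum of partners balances the sum, and partners are unique.\<close>

lemma partner_add:
  assumes "F \<in> Obj S" "t \<in> lunit S F" "t' \<in> lunit S F"
  shows "partner F (\<lambda>A\<in>Obj S. t A \<oplus>\<^bsub>Hom S (A \<box> F) A\<^esub> t' A) = (\<lambda>A\<in>Obj S. partner F t A \<oplus>\<^bsub>Hom S (F \<box> A) A\<^esub> partner F t' A)"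
  by (rule partner_eqI[OF assms(1) lunit_closed(1)[OF assms] runit_closed(1)[OF assms(1)]])
    (use assms balanced_add[of F t _ t'] partnerD in simp_all)

lemma partner_smult:
  assumes "F \<in> Obj S" "c \<in> carrier K" "t \<in> lunit S F"
  shows "partner F (\<lambda>A\<in>Obj S. c \<odot>\<^bsub>Hom S (A \<box> F) A\<^esub> t A) = (\<lambda>A\<in>Obj S. c \<odot>\<^bsub>Hom S (F \<box> A) A\<^esub> partner F t A)"
  by (rule partner_eqI[OF assms(1) lunit_closed(2)[OF assms] runit_closed(2)[OF assms(1)]])
    (use assms balanced_smult[of F t] partnerD in simp_all)

lemma linear_uld:
  assumes F: "F \<in> Obj S" and X: "X \<in> Obj S"
  shows "linear_on K (vcopy (HL F) :: ('k,'v) module) (Hom S (X \<box> F) X) (\<lambda>p. uld F p X)"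
    and "linear_on K (vcopy (HL F) :: ('k,'v) module) (Hom S (F \<box> X) X) (\<lambda>p. partner F (uld F p) X)"
proof -
  note tm = lunitD[OF _ F] and sm = runitD[OF partnerD(1)[OF F] F]
  show "linear_on K (vcopy (HL F) :: ('k,'v) module) (Hom S (X \<box> F) X) (\<lambda>p. uld F p X)"
    by (rule linear_onI) (use F X in \<open>auto elim!: uleE simp: ule_ops lunit_closed tm Hom_mem\<close>)
  show "linear_on K (vcopy (HL F) :: ('k,'v) module) (Hom S (F \<box> X) X) (\<lambda>p. partner F (uld F p) X)"
    by (rule linear_onI) (use F X in \<open>auto elim!: uleE simp: ule_ops lunit_closed sm Hom_mem partner_add[OF F] partner_smult[OF F]\<close>)
qed

lemma partner_act:
  assumes "h \<in> Arr S" "t \<in> lunit S (Cod S h)"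
  shows "partner (Dom S h) (\<lambda>X\<in>Obj S. t X \<cdot> (Ide S X \<diamondop> h)) = (\<lambda>X\<in>Obj S. partner (Cod S h) t X \<cdot> (h \<diamondop> Ide S X))"
  using assms partnerD[OF Cod_Obj[OF assms(1)] assms(2)]
  by (intro partner_eqI lunit_act runit_act balanced_act) simp_all

text \<open>The comparison sends a transformation to its partner. Uniqueness and existence of left
  partners give injectivity and surjectivity; stability of balance gives linearity and
  naturality.\<close>

theorem left_right_unit_iso: "isomorphic_objs DC ul ur"
proof -
  let ?s = "mk_psh ul ur (\<lambda>F p. ure F (partner F (uld F p)))"
  have s: "?s \<in> Arr PC"
  proof (rule mk_psh_arr[OF psh_ul psh_ur])
    fix F assume F: "F \<in> Obj S"
    show "linear_on K (fobj ul F) (fobj ur F) (\<lambda>p. ure F (partner F (uld F p)))"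
      by (rule linear_onI) (use F partnerD[OF F] in \<open>auto elim!: uleE simp: ule_ops ure_ops lunit_closed partner_add[OF F] partner_smult[OF F]\<close>)
  next
    fix h p assume h: "h \<in> Arr S" and "p \<in> carrier (fobj ul (Cod S h))"
    then obtain t where t: "t \<in> lunit S (Cod S h)" "p = ule (Cod S h) t" by (auto elim: uleE)
    show "ure (Dom S h) (partner (Dom S h) (uld (Dom S h) (act ul h p))) = act ur h (ure (Cod S h) (partner (Cod S h) (uld (Cod S h) p)))"
      using h t by (simp add: act_ul act_ur lunit_act partner_act partnerD)
  qed
  have "iso_arr PC ?s"
  proof (rule psh_bij_iso[OF s])
    fix F assume F: "F \<in> Obj S"
    have v: "ap ?s F (ule F t) = ure F (partner F t)" if "t \<in> lunit S F" for t using that F by simp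
    have ui: "s = s'" if "ure F s = ure F s'" "s \<in> runit S F" "s' \<in> runit S F" for s s'
      using inj_onD[OF venc_inj[OF fits_HR[OF F]] that(1)[unfolded ure_def]] that(2,3) by simp
    show "bij_betw (ap ?s F) (carrier (fobj (src ?s) F)) (carrier (fobj (tgt ?s) F))"
      unfolding bij_betw_def
    proof
      show "inj_on (ap ?s F) (carrier (fobj (src ?s) F))"
      proof (rule inj_onI)
        fix p q assume "p \<in> carrier (fobj (src ?s) F)" "q \<in> carrier (fobj (src ?s) F)" and e: "ap ?s F p = ap ?s F q"
        then obtain t t' where t: "t \<in> lunit S F" "p = ule F t" "t' \<in> lunit S F" "q = ule F t'" using F by (auto elim!: uleE)
        have "ure F (partner F t) = ure F (partner F t')" using e v t by simp
        then have "partner F t = partner F t'" by (rule ui) (use F t partnerD in simp_all)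
        then have "t = t'" using left_partner[OF F partnerD(1)[OF F t(1)]] partnerD(2)[OF F] t by metis
        then show "p = q" using t by simp
      qed
      show "ap ?s F ` carrier (fobj (src ?s) F) = carrier (fobj (tgt ?s) F)"
      proof (intro equalityI subsetI)
        fix q assume "q \<in> ap ?s F ` carrier (fobj (src ?s) F)"
        then show "q \<in> carrier (fobj (tgt ?s) F)" using psh_arrD(7)[OF s F] by auto
      next
        fix q assume "q \<in> carrier (fobj (tgt ?s) F)"
        then obtain s where s: "s \<in> runit S F" "q = ure F s" using F by (auto elim!: ureE)
        from left_partner[OF F s(1)] obtain t where t: "t \<in> lunit S F" "balanced S F t s" by blast
        have "partner F t = s" by (rule partner_eqI[OF F t(1) s(1) t(2)])
        then have "ap ?s F (ule F t) = q" using v t s by simp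
        moreover have "ule F t \<in> carrier (fobj (src ?s) F)" using F t by simp
        ultimately show "q \<in> ap ?s F ` carrier (fobj (src ?s) F)" by blast
      qed
    qed
  qed
  then show ?thesis unfolding isomorphic_objs_def using s by (auto simp: hom_set_def intro!: bexI[of _ ?s])
qed

end

section \<open>The unitors\<close>

context small_rigid
begin

text \<open>With a left dual \<open>Z\<close> of \<open>X\<close>, take
  \<open>M = Z \<box> X\<close> and the counit of the pair; the section comes from
  \<open>\<eta>r X\<close> and splits by the second equation of condition (III).\<close>

lemma right_cover:
  assumes "X \<in> Obj S"
  shows "\<exists>M \<epsilon> h. M \<in> Obj S \<and> \<epsilon> \<in> lunit S M \<and> h \<in> Arr S \<and> Dom S h = X \<and> Cod S h = X \<box> M \<and> \<epsilon> X \<cdot> h = Ide S X"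
proof -
  obtain Z \<eta>l \<eta>r \<epsilon>l \<epsilon>r where "sg_adjunction K S Z X \<eta>l \<eta>r \<epsilon>l \<epsilon>r" using duals(2)[OF assms] by blast
  note d = sg_adjunctionD[OF this]
  note r = \<eta>rD[OF d(5)]
  show ?thesis
    by (rule exI[of _ "Z \<box> X"], rule exI[of _ \<epsilon>l], rule exI[of _ "asc S X Z X \<cdot> \<eta>r X"]) (use d in \<open>simp_all add: r\<close>)
qed

text \<open>With a right dual \<open>G\<close> of \<open>X\<close>, take
  \<open>M = X \<box> G\<close>. Condition (IV) makes the right counit the partner of the left one,
  and the first equation of condition (III) splits it.\<close>

lemma left_cover:
  assumes "X \<in> Obj S"
  shows "\<exists>M \<epsilon> h. M \<in> Obj S \<and> \<epsilon> \<in> lunit S M \<and> h \<in> Arr S \<and> Dom S h = X \<and> Cod S h = M \<box> X \<and> partner M \<epsilon> X \<cdot> h = Ide S X"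
proof -
  obtain G \<eta>l \<eta>r \<epsilon>l \<epsilon>r where "sg_adjunction K S X G \<eta>l \<eta>r \<epsilon>l \<epsilon>r" using duals(1)[OF assms] by blast
  note d = sg_adjunctionD[OF this]
  note l = \<eta>lD[OF d(3)]
  have "partner (X \<box> G) \<epsilon>l = \<epsilon>r" by (rule partner_eqI) (use d in simp_all)
  then show ?thesis
    by (intro exI[of _ "X \<box> G"] exI[of _ \<epsilon>l] exI[of _ "inv_arr S (asc S X G X) \<cdot> \<eta>l X"]) (use d in \<open>simp_all add: l\<close>)
qed

text \<open>Compatibility in the first variable is naturality of the transformation; in the second
  it is the definition of the action on the unit presheaf.\<close>

lemma right_unitor_exists:
  assumes P: "psh K S P"
  shows "\<exists>s. s \<in> Arr PC \<and> src s = P \<circledast> ul \<and> tgt s = P \<and>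
    (\<forall>A\<in>Obj S. \<forall>L\<in>Obj S. \<forall>p\<in>carrier (fobj P A). \<forall>q\<in>carrier (fobj ul L). ap s (A \<box> L) (tens P ul A L p q) = act P (uld L q A) p)"
proof (rule tens_lift[OF P psh_ul P])
  fix A L assume a: "A \<in> Obj S" "L \<in> Obj S"
  show "linear_on K (fobj P A) (fobj P (A \<box> L)) (act P (uld L q A))" if q: "q \<in> carrier (fobj ul L)" for q
    using pshD(3)[OF P, of "uld L q A"] lunitD[OF uld_lunit[OF q[unfolded fobj_ul] a(2)] a(2)] a by simp
  show "linear_on K (fobj ul L) (fobj P (A \<box> L)) (\<lambda>q. act P (uld L q A) p)" if p: "p \<in> carrier (fobj P A)" for p
    unfolding fobj_ul by (rule linear_on_comp[OF linear_uld(1) pshD(8)[OF P]]) (use a p in simp_all)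
next
  fix h l p q assume a: "h \<in> Arr S" "l \<in> Arr S" "p \<in> carrier (fobj P (Cod S h))" "q \<in> carrier (fobj ul (Cod S l))"
  then obtain t where t: "t \<in> lunit S (Cod S l)" "q = ule (Cod S l) t" by (auto elim: uleE)
  note t' = lunitD[OF t(1) Cod_Obj[OF a(2)]]
  have "t (Cod S h) \<cdot> (h \<diamondop> l) = h \<cdot> t (Dom S h) \<cdot> (Ide S (Dom S h) \<diamondop> l)"
    using Cmp_eq_assoc[OF t'(5)[OF a(1)], of "Ide S (Dom S h) \<diamondop> l"] a by (simp add: t' merge)
  then show "act P (h \<diamondop> l) (act P (uld (Cod S l) q (Cod S h)) p) = act P (uld (Dom S l) (act ul l q) (Dom S h)) (act P h p)"
    using a t P by (simp add: act_ul lunit_act t' act_norm)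
qed

definition runi :: "('k,'o,'m,'v) psh \<Rightarrow> ('k,'o,'m,'v) pshmap" where
  "runi P = (SOME s. s \<in> Arr PC \<and> src s = P \<circledast> ul \<and> tgt s = P \<and>
    (\<forall>A\<in>Obj S. \<forall>L\<in>Obj S. \<forall>p\<in>carrier (fobj P A). \<forall>q\<in>carrier (fobj ul L). ap s (A \<box> L) (tens P ul A L p q) = act P (uld L q A) p))"

lemma runiD:
  assumes "psh K S P"
  shows "runi P \<in> Arr PC" "src (runi P) = P \<circledast> ul" "tgt (runi P) = P"
    and "A \<in> Obj S \<Longrightarrow> L \<in> Obj S \<Longrightarrow> p \<in> carrier (fobj P A) \<Longrightarrow> t \<in> lunit S L \<Longrightarrow>
      ap (runi P) (A \<box> L) (tens P ul A L p (ule L t)) = act P (t A) p"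
  using someI_ex[OF right_unitor_exists[OF assms]] unfolding runi_def[symmetric] by auto

text \<open>The element of the unit acts from the other side, through its partner; linearity and
  naturality of partners make the family liftable.\<close>

lemma left_unitor_exists:
  assumes P: "psh K S P"
  shows "\<exists>s. s \<in> Arr PC \<and> src s = ul \<circledast> P \<and> tgt s = P \<and>
    (\<forall>L\<in>Obj S. \<forall>A\<in>Obj S. \<forall>q\<in>carrier (fobj ul L). \<forall>p\<in>carrier (fobj P A). ap s (L \<box> A) (tens ul P L A q p) = act P (partner L (uld L q) A) p)"
proof (rule tens_lift[OF psh_ul P P])
  fix L A assume a: "L \<in> Obj S" "A \<in> Obj S"
  show "linear_on K (fobj P A) (fobj P (L \<box> A)) (act P (partner L (uld L q) A))" if q: "q \<in> carrier (fobj ul L)" for q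
    using pshD(3)[OF P, of "partner L (uld L q) A"] runitD[OF partnerD(1)[OF a(1) uld_lunit[OF q[unfolded fobj_ul] a(1)]] a(1)] a by simp
  show "linear_on K (fobj ul L) (fobj P (L \<box> A)) (\<lambda>q. act P (partner L (uld L q) A) p)" if p: "p \<in> carrier (fobj P A)" for p
    unfolding fobj_ul by (rule linear_on_comp[OF linear_uld(2) pshD(8)[OF P]]) (use a p in simp_all)
next
  fix l h q p assume a: "l \<in> Arr S" "h \<in> Arr S" "q \<in> carrier (fobj ul (Cod S l))" "p \<in> carrier (fobj P (Cod S h))"
  then obtain t where t: "t \<in> lunit S (Cod S l)" "q = ule (Cod S l) t" by (auto elim: uleE)
  note s = runitD[OF partnerD(1)[OF Cod_Obj[OF a(1)] t(1)] Cod_Obj[OF a(1)]]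
  have "partner (Cod S l) t (Cod S h) \<cdot> (l \<diamondop> h) = h \<cdot> partner (Cod S l) t (Dom S h) \<cdot> (l \<diamondop> Ide S (Dom S h))"
    using Cmp_eq_assoc[OF s(5)[OF a(2)], of "l \<diamondop> Ide S (Dom S h)"] a by (simp add: s merge)
  then show "act P (l \<diamondop> h) (act P (partner (Cod S l) (uld (Cod S l) q) (Cod S h)) p) =
      act P (partner (Dom S l) (uld (Dom S l) (act ul l q)) (Dom S h)) (act P h p)"
    using a t P by (simp add: act_ul lunit_act partner_act s act_norm)
qed

definition luni :: "('k,'o,'m,'v) psh \<Rightarrow> ('k,'o,'m,'v) pshmap" where
  "luni P = (SOME s. s \<in> Arr PC \<and> src s = ul \<circledast> P \<and> tgt s = P \<and>
    (\<forall>L\<in>Obj S. \<forall>A\<in>Obj S. \<forall>q\<in>carrier (fobj ul L). \<forall>p\<in>carrier (fobj P A). ap s (L \<box> A) (tens ul P L A q p) = act P (partner L (uld L q) A) p))"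

lemma luniD:
  assumes "psh K S P"
  shows "luni P \<in> Arr PC" "src (luni P) = ul \<circledast> P" "tgt (luni P) = P"
    and "A \<in> Obj S \<Longrightarrow> L \<in> Obj S \<Longrightarrow> p \<in> carrier (fobj P A) \<Longrightarrow> t \<in> lunit S L \<Longrightarrow>
      ap (luni P) (L \<box> A) (tens ul P L A (ule L t) p) = act P (partner L t A) p"
  using someI_ex[OF left_unitor_exists[OF assms]] unfolding luni_def[symmetric] by auto

text \<open>
  If \<open>\<epsilon> X \<cdot> h = Ide S X\<close> with \<open>\<epsilon> : - \<box> M \<rightarrow> Id\<close>, then \<open>p \<mapsto> act h (p \<otimes> \<epsilon>)\<close> inverts the right unitor at \<open>X\<close>.
\<close>

lemma runi_iso:
  assumes P: "psh K S P"
  shows "iso_arr PC (runi P)"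
proof (rule psh_bij_iso[OF runiD(1)[OF P]])
  note r = runiD[OF P] and D = psh_day[OF P psh_ul]
  fix X assume X: "X \<in> Obj S"
  obtain M \<epsilon> h where M: "M \<in> Obj S" and \<epsilon>: "\<epsilon> \<in> lunit S M" and h: "h \<in> Arr S" "Dom S h = X" "Cod S h = X \<box> M" and e: "\<epsilon> X \<cdot> h = Ide S X"
    using right_cover[OF X] by blast
  note \<epsilon>' = lunitD[OF \<epsilon> M]
  let ?g = "\<lambda>p. act (P \<circledast> ul) h (tens P ul X M p (ule M \<epsilon>))"
  have lg: "linear_on K (fobj P X) (day_space K S P ul X) ?g"
    by (rule linear_on_comp[OF linear_tens(1)[OF P psh_ul X M]])
      (use pshD(3)[OF D h(1)] \<epsilon> M h in simp_all)
  have "?g (ap (runi P) X u) = u" if "u \<in> carrier (day_space K S P ul X)" for u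
  proof (rule day_in_ext[OF P psh_ul X _ linear_on_id, where g = "\<lambda>u. ?g (ap (runi P) X u)"])
    show "linear_on K (day_space K S P ul X) (day_space K S P ul X) (\<lambda>u. ?g (ap (runi P) X u))"
      by (rule linear_on_comp[OF _ lg]) (use psh_arrD(5)[OF r(1) X] r(2,3) in simp)
    show "module K (day_space K S P ul X)" using pshD(1)[OF D X] by simp
    fix A L f p q
    assume a: "A \<in> Obj S" "L \<in> Obj S" "f \<in> Arr S" "Dom S f = X" "Cod S f = A \<box> L" "p \<in> carrier (fobj P A)" and "q \<in> carrier (fobj ul L)"
    then obtain t where t: "t \<in> lunit S L" "q = ule L t" by (auto elim: uleE)
    note t' = lunitD[OF t(1) a(2)] and pt = partnerD[OF a(2) t(1)]
    note s' = runitD[OF pt(1) a(2)]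
    \<comment> \<open>Restricting \<open>\<epsilon>\<close> along the partner of \<open>t\<close>
      gives the same element as restricting \<open>t\<close> along \<open>\<epsilon>\<close>. The
      exchange brings \<open>t\<close>, and with it the original generator, back into the second
      factor.\<close>
    have c: "act ul (partner L t M) (ule M \<epsilon>) = act ul (\<epsilon> L) (ule L t)"
      using a M \<epsilon> t balanced_commute_left[OF pt(2) a(2) M t(1) pt(1) \<epsilon>]
      by (simp add: act_ul s' \<epsilon>' cong: restrict_cong)
    have "?g (ap (runi P) X (day_in K S P ul X A L f p q)) = act (P \<circledast> ul) (((t A \<diamondop> Ide S M) \<cdot> (f \<diamondop> Ide S M)) \<cdot> h) (tens P ul A M p (ule M \<epsilon>))"
      using a P t \<epsilon> M h X by (simp add: day_in_tens act_norm r t' merge)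
    \<comment> \<open>Balance carries \<open>t\<close> from the factor \<open>A\<close> over to
      \<open>M\<close>, where it meets \<open>\<epsilon>\<close>.\<close>
    also have "((t A \<diamondop> Ide S M) \<cdot> (f \<diamondop> Ide S M)) \<cdot> h = (Ide S A \<diamondop> partner L t M) \<cdot> asc S A L M \<cdot> (f \<diamondop> Ide S M) \<cdot> h"
      using balancedD[OF pt(2) a(1) M, symmetric] a h M by (simp add: s')
    also have "act (P \<circledast> ul) \<dots> (tens P ul A M p (ule M \<epsilon>)) = act (P \<circledast> ul) (asc S A L M \<cdot> (f \<diamondop> Ide S M) \<cdot> h) (tens P ul A (L \<box> M) p (act ul (\<epsilon> L) (ule L t)))"
      unfolding c[symmetric] using a P M h \<epsilon> by (simp add: s' act_norm)
    also have "\<dots> = act (P \<circledast> ul) ((Ide S A \<diamondop> \<epsilon> L) \<cdot> asc S A L M \<cdot> (f \<diamondop> Ide S M) \<cdot> h) (tens P ul A L p (ule L t))"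
      using a P M h t by (simp add: \<epsilon>' act_norm)
    \<comment> \<open>The module condition assembles \<open>\<epsilon> (A \<box> L)\<close>; its
      naturality along \<open>f\<close> then leaves \<open>\<epsilon> X \<cdot> h\<close>, which is
      the identity.\<close>
    also have "(Ide S A \<diamondop> \<epsilon> L) \<cdot> asc S A L M \<cdot> (f \<diamondop> Ide S M) \<cdot> h = (\<epsilon> (A \<box> L) \<cdot> (f \<diamondop> Ide S M)) \<cdot> h"
      using \<epsilon>'(6)[OF a(1,2)] a M h by (simp add: \<epsilon>')
    also have "\<dots> = f" using \<epsilon>'(5)[OF a(3)] a M h e X by (simp add: \<epsilon>')
    finally show "?g (ap (runi P) X (day_in K S P ul X A L f p q)) = day_in K S P ul X A L f p q"
      using a P t by (simp add: day_in_tens)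
  qed (use that in simp_all)
  moreover have "ap (runi P) X (?g p) = p" if "p \<in> carrier (fobj P X)" for p
    using that P M \<epsilon> h X e by (simp add: act_norm r \<epsilon>')
  ultimately show "bij_betw (ap (runi P) X) (carrier (fobj (src (runi P)) X)) (carrier (fobj (tgt (runi P)) X))"
    using psh_arrD(7)[OF r(1) X] linear_on_closed[OF lg] r(2,3) by (intro bij_betw_byWitness[where f' = ?g]) auto
qed

text \<open>Mirrors the argument for the right unitor. The section comes from
  \<open>left_cover\<close>, the partner of \<open>\<epsilon>\<close> does the cancelling, and
  \<open>balanced_commute_right\<close> supplies the exchange of \<open>t\<close> and
  \<open>\<epsilon>\<close>.\<close>

lemma luni_iso:
  assumes P: "psh K S P"
  shows "iso_arr PC (luni P)"
proof (rule psh_bij_iso[OF luniD(1)[OF P]])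
  note r = luniD[OF P] and D = psh_day[OF psh_ul P]
  fix X assume X: "X \<in> Obj S"
  obtain M \<epsilon> h where M: "M \<in> Obj S" and \<epsilon>: "\<epsilon> \<in> lunit S M" and h: "h \<in> Arr S" "Dom S h = X" "Cod S h = M \<box> X" and e: "partner M \<epsilon> X \<cdot> h = Ide S X"
    using left_cover[OF X] by blast
  note \<epsilon>' = lunitD[OF \<epsilon> M] and p\<epsilon> = partnerD[OF M \<epsilon>]
  note e' = runitD[OF p\<epsilon>(1) M]
  let ?g = "\<lambda>p. act (ul \<circledast> P) h (tens ul P M X (ule M \<epsilon>) p)"
  have lg: "linear_on K (fobj P X) (day_space K S ul P X) ?g"
    by (rule linear_on_comp[OF linear_tens(2)[OF psh_ul P M X]])
      (use pshD(3)[OF D h(1)] \<epsilon> M h in simp_all)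
  have "?g (ap (luni P) X u) = u" if "u \<in> carrier (day_space K S ul P X)" for u
  proof (rule day_in_ext[OF psh_ul P X _ linear_on_id, where g = "\<lambda>u. ?g (ap (luni P) X u)"])
    show "linear_on K (day_space K S ul P X) (day_space K S ul P X) (\<lambda>u. ?g (ap (luni P) X u))"
      by (rule linear_on_comp[OF _ lg]) (use psh_arrD(5)[OF r(1) X] r(2,3) in simp)
    show "module K (day_space K S ul P X)" using pshD(1)[OF D X] by simp
    fix L A f q p
    assume a: "L \<in> Obj S" "A \<in> Obj S" "f \<in> Arr S" "Dom S f = X" "Cod S f = L \<box> A" and "q \<in> carrier (fobj ul L)" and p: "p \<in> carrier (fobj P A)"
    then obtain t where t: "t \<in> lunit S L" "q = ule L t" by (auto elim: uleE)
    note t' = lunitD[OF t(1) a(1)] and pt = partnerD[OF a(1) t(1)]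
    note s' = runitD[OF pt(1) a(1)]
    have c: "act ul (t M) (ule M \<epsilon>) = act ul (partner M \<epsilon> L) (ule L t)"
      using a M \<epsilon> t balanced_commute_right[OF p\<epsilon>(2) a(1) M t(1) p\<epsilon>(1) \<epsilon>]
      by (simp add: act_ul t' e' cong: restrict_cong)
    have "?g (ap (luni P) X (day_in K S ul P X L A f q p)) = act (ul \<circledast> P) (((Ide S M \<diamondop> partner L t A) \<cdot> (Ide S M \<diamondop> f)) \<cdot> h) (tens ul P M A (ule M \<epsilon>) p)"
      using a p P t \<epsilon> M h X by (simp add: day_in_tens act_norm r s' merge)
    also have "((Ide S M \<diamondop> partner L t A) \<cdot> (Ide S M \<diamondop> f)) \<cdot> h = (t M \<diamondop> Ide S A) \<cdot> inv_arr S (asc S M L A) \<cdot> (Ide S M \<diamondop> f) \<cdot> h"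
      using balanced_inv[OF pt(2) a(1) pt(1) t(1) M a(2)] a h M by (simp add: t')
    also have "act (ul \<circledast> P) \<dots> (tens ul P M A (ule M \<epsilon>) p) =
        act (ul \<circledast> P) (inv_arr S (asc S M L A) \<cdot> (Ide S M \<diamondop> f) \<cdot> h) (tens ul P (M \<box> L) A (act ul (partner M \<epsilon> L) (ule L t)) p)"
      unfolding c[symmetric] using a p P M h \<epsilon> by (simp add: t' act_norm)
    also have "\<dots> = act (ul \<circledast> P) ((partner M \<epsilon> L \<diamondop> Ide S A) \<cdot> inv_arr S (asc S M L A) \<cdot> (Ide S M \<diamondop> f) \<cdot> h) (tens ul P L A (ule L t) p)"
      using a p P M h t by (simp add: e' act_norm)
    also have "(partner M \<epsilon> L \<diamondop> Ide S A) \<cdot> inv_arr S (asc S M L A) \<cdot> (Ide S M \<diamondop> f) \<cdot> h = (partner M \<epsilon> (L \<box> A) \<cdot> (Ide S M \<diamondop> f)) \<cdot> h"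
      using e'(6)[OF a(2,1)] a M h by (simp add: e')
    also have "\<dots> = f" using e'(5)[OF a(3)] a M h e X by (simp add: e')
    finally show "?g (ap (luni P) X (day_in K S ul P X L A f q p)) = day_in K S ul P X L A f q p"
      using a p P t by (simp add: day_in_tens)
  qed (use that in simp_all)
  moreover have "ap (luni P) X (?g p) = p" if "p \<in> carrier (fobj P X)" for p
    using that P M \<epsilon> h X e by (simp add: act_norm r e')
  ultimately show "bij_betw (ap (luni P) X) (carrier (fobj (src (luni P)) X)) (carrier (fobj (tgt (luni P)) X))"
    using psh_arrD(7)[OF r(1) X] linear_on_closed[OF lg] r(2,3) by (intro bij_betw_byWitness[where f' = ?g]) auto
qed

text \<open>The triangle axiom, evaluated on a tensor whose middle factor is \<open>t\<close>, says
  that \<open>t\<close> acting to its left agrees with its partner acting to its right; this is the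
  balance equation.\<close>

theorem unit_object: "is_unit_object DC ul"
  unfolding is_unit_object_def
proof (rule conjI, simp, rule exI[of _ luni], rule exI[of _ runi], intro conjI ballI)
  fix P assume "P \<in> Obj DC"
  then have P: "psh K S P" by simp
  show "luni P \<in> hom_set DC (ul \<box>\<^bsub>DC\<^esub> P) P" "iso_arr DC (luni P)" using luniD[OF P] luni_iso[OF P] by (simp_all add: hom_set_def)
  show "runi P \<in> hom_set DC (P \<box>\<^bsub>DC\<^esub> ul) P" "iso_arr DC (runi P)" using runiD[OF P] runi_iso[OF P] by (simp_all add: hom_set_def)
  fix Q assume "Q \<in> Obj DC"
  then have Q: "psh K S Q" by simp
  have "day_arr K S (Ide PC P) (luni Q) \<cdot>\<^bsub>PC\<^esub> day_asc K S P ul Q = day_arr K S (runi P) (Ide PC Q)"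
  proof (rule day_ext_left[OF P psh_ul Q psh_Cmp day_arrD(1)], goal_cases)
    case (9 A L B p q r)
    then obtain t where t: "t \<in> lunit S L" "q = ule L t" by (auto elim: uleE)
    note pt = partnerD[OF 9(2) t(1)]
    show ?case
      using 9 P Q t lunitD[OF t(1) 9(2)] runitD[OF pt(1) 9(2)] balancedD[OF pt(2) 9(1,3)]
      by (simp add: day_arrD(1) day_ascD Ide_psh_arr luniD runiD act_norm)
  qed (use P Q in \<open>simp_all add: day_ascD day_arrD(1) Ide_psh_arr luniD runiD\<close>)
  then show "(Ide DC P \<diamondop>\<^bsub>DC\<^esub> luni Q) \<cdot>\<^bsub>DC\<^esub> asc DC P ul Q = runi P \<diamondop>\<^bsub>DC\<^esub> Ide DC Q" by simp
next
  fix s assume "s \<in> Arr DC"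
  then have s: "s \<in> Arr PC" by simp
  note s' = psh_arrD(1,2)[OF s]
  have "luni (tgt s) \<cdot>\<^bsub>PC\<^esub> day_arr K S (Ide PC ul) s = s \<cdot>\<^bsub>PC\<^esub> luni (src s)"
  proof (rule day_ext[OF psh_ul s'(1) psh_Cmp psh_Cmp], goal_cases)
    case (10 L A q p)
    then obtain t where t: "t \<in> lunit S L" "q = ule L t" by (auto elim: uleE)
    then show ?case
      using 10 s s' runitD[OF partnerD(1)[OF 10(1) t(1)] 10(1)]
      by (simp add: day_arrD(1) Ide_psh_arr luniD act_norm)
  qed (use s s' in \<open>simp_all add: day_arrD(1) Ide_psh_arr luniD\<close>)
  then show "luni (Cod DC s) \<cdot>\<^bsub>DC\<^esub> (Ide DC ul \<diamondop>\<^bsub>DC\<^esub> s) = s \<cdot>\<^bsub>DC\<^esub> luni (Dom DC s)" by simp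
  have "runi (tgt s) \<cdot>\<^bsub>PC\<^esub> day_arr K S s (Ide PC ul) = s \<cdot>\<^bsub>PC\<^esub> runi (src s)"
  proof (rule day_ext[OF s'(1) psh_ul psh_Cmp psh_Cmp], goal_cases)
    case (10 A L p q)
    then obtain t where t: "t \<in> lunit S L" "q = ule L t" by (auto elim: uleE)
    then show ?case
      using 10 s s' lunitD[OF t(1) 10(2)]
      by (simp add: day_arrD(1) Ide_psh_arr runiD act_norm)
  qed (use s s' in \<open>simp_all add: day_arrD(1) Ide_psh_arr runiD\<close>)
  then show "runi (Cod DC s) \<cdot>\<^bsub>DC\<^esub> (s \<diamondop>\<^bsub>DC\<^esub> Ide DC ul) = s \<cdot>\<^bsub>DC\<^esub> runi (Dom DC s)" by simp
qed

end

section \<open>Duals of representable presheaves\<close>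

context semigroup_category
begin

lemma \<eta>lI:
  assumes "W \<in> Obj S" "\<eta> \<in> extensional (Obj S)"
    and t: "\<And>X. X \<in> Obj S \<Longrightarrow> \<eta> X \<in> Arr S" "\<And>X. X \<in> Obj S \<Longrightarrow> Dom S (\<eta> X) = X" "\<And>X. X \<in> Obj S \<Longrightarrow> Cod S (\<eta> X) = X \<box> W"
    and "\<And>f. f \<in> Arr S \<Longrightarrow> \<eta> (Cod S f) \<cdot> f = (f \<diamondop> Ide S W) \<cdot> \<eta> (Dom S f)"
    and "\<And>X M. X \<in> Obj S \<Longrightarrow> M \<in> Obj S \<Longrightarrow> asc S X M W \<cdot> \<eta> (X \<box> M) = Ide S X \<diamondop> \<eta> M"
  shows "\<eta> \<in> lmod_trans S (id_modfun S) (rtens S W)"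
  using assms by (simp add: lmod_trans_def nat_trans_def hom_set_def)

lemma \<eta>rI:
  assumes "W \<in> Obj S" "\<eta> \<in> extensional (Obj S)"
    and t: "\<And>X. X \<in> Obj S \<Longrightarrow> \<eta> X \<in> Arr S" "\<And>X. X \<in> Obj S \<Longrightarrow> Dom S (\<eta> X) = X" "\<And>X. X \<in> Obj S \<Longrightarrow> Cod S (\<eta> X) = W \<box> X"
    and "\<And>f. f \<in> Arr S \<Longrightarrow> \<eta> (Cod S f) \<cdot> f = (Ide S W \<diamondop> f) \<cdot> \<eta> (Dom S f)"
    and m: "\<And>X M. X \<in> Obj S \<Longrightarrow> M \<in> Obj S \<Longrightarrow> \<eta> (M \<box> X) = asc S W M X \<cdot> (\<eta> M \<diamondop> Ide S X)"
  shows "\<eta> \<in> rmod_trans S (id_modfun S) (ltens S W)"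
  using assms by (simp add: rmod_trans_def nat_trans_def hom_set_def)

text \<open>States the module condition without inverse associators, so that over the presheaf
  category it can be checked with \<open>day_ascD\<close>.\<close>

lemma runitI_asc:
  assumes "F \<in> Obj S" "s \<in> extensional (Obj S)"
    and t: "\<And>X. X \<in> Obj S \<Longrightarrow> s X \<in> Arr S" "\<And>X. X \<in> Obj S \<Longrightarrow> Dom S (s X) = F \<box> X" "\<And>X. X \<in> Obj S \<Longrightarrow> Cod S (s X) = X"
    and n: "\<And>f. f \<in> Arr S \<Longrightarrow> s (Cod S f) \<cdot> (Ide S F \<diamondop> f) = f \<cdot> s (Dom S f)"
    and m: "\<And>X M. X \<in> Obj S \<Longrightarrow> M \<in> Obj S \<Longrightarrow> s (M \<box> X) \<cdot> asc S F M X = s M \<diamondop> Ide S X"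
  shows "s \<in> runit S F"
proof (rule runitI[OF assms(1,2) t n])
  show "s (M \<box> X) = (s M \<diamondop> Ide S X) \<cdot> inv_arr S (asc S F M X)" if "X \<in> Obj S" "M \<in> Obj S" for X M
    unfolding m[OF that, symmetric] using that assms(1) by (simp add: t)
qed

end

section \<open>Transformations inserting an element of a presheaf\<close>

context small_sg
begin

text \<open>The values follow from those of the associator by applying the inverse and cancelling
  the action of \<open>asc\<close>.\<close>

lemma day_inv_asc:
  assumes P: "psh K S P" and Q: "psh K S Q" and R: "psh K S R"
  shows "inv_arr PC (day_asc K S P Q R) \<in> Arr PC" "src (inv_arr PC (day_asc K S P Q R)) = P \<circledast> (Q \<circledast> R)"
    "tgt (inv_arr PC (day_asc K S P Q R)) = (P \<circledast> Q) \<circledast> R"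
    and "\<lbrakk>A \<in> Obj S; B \<in> Obj S; C \<in> Obj S; p \<in> carrier (fobj P A); q \<in> carrier (fobj Q B); r \<in> carrier (fobj R C)\<rbrakk> \<Longrightarrow>
      ap (inv_arr PC (day_asc K S P Q R)) (A \<box> (B \<box> C)) (tens P (Q \<circledast> R) A (B \<box> C) p (tens Q R B C q r)) =
      act ((P \<circledast> Q) \<circledast> R) (inv_arr S (asc S A B C)) (tens (P \<circledast> Q) R (A \<box> B) C (tens P Q A B p q) r)"
proof -
  note a = day_ascD[OF P Q R]
  have "iso_arr PC (day_asc K S P Q R)" using day_asc_inverse[OF P Q R] by (simp add: iso_arr_def)
  note i = lin_category.inv_arr_Arr[OF lin_category_presheaf this]
  show b: "inv_arr PC (day_asc K S P Q R) \<in> Arr PC" "src (inv_arr PC (day_asc K S P Q R)) = P \<circledast> (Q \<circledast> R)"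
    "tgt (inv_arr PC (day_asc K S P Q R)) = (P \<circledast> Q) \<circledast> R"
    using i a by simp_all
  assume *: "A \<in> Obj S" "B \<in> Obj S" "C \<in> Obj S" "p \<in> carrier (fobj P A)" "q \<in> carrier (fobj Q B)" "r \<in> carrier (fobj R C)"
  let ?i = "inv_arr PC (day_asc K S P Q R)" and ?l = "tens (P \<circledast> Q) R (A \<box> B) C (tens P Q A B p q) r"
    and ?r = "tens P (Q \<circledast> R) A (B \<box> C) p (tens Q R B C q r)"
  have l: "?l \<in> carrier (day_space K S (P \<circledast> Q) R ((A \<box> B) \<box> C))" and r: "?r \<in> carrier (day_space K S P (Q \<circledast> R) (A \<box> (B \<box> C)))"
    using * P Q R by simp_all
  have "act ((P \<circledast> Q) \<circledast> R) (inv_arr S (asc S A B C)) ?l = act ((P \<circledast> Q) \<circledast> R) (inv_arr S (asc S A B C)) (ap (?i \<cdot>\<^bsub>PC\<^esub> day_asc K S P Q R) ((A \<box> B) \<box> C) ?l)"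
    using * l a i P Q R by simp
  also have "\<dots> = act ((P \<circledast> Q) \<circledast> R) (inv_arr S (asc S A B C)) (ap ?i ((A \<box> B) \<box> C) (act (P \<circledast> (Q \<circledast> R)) (asc S A B C) ?r))"
    using * l a P Q R by (simp)
  also have "\<dots> = ap ?i (A \<box> (B \<box> C)) ?r"
    using * r b P Q R by (simp add: act_norm)
  finally show "ap ?i (A \<box> (B \<box> C)) ?r = act ((P \<circledast> Q) \<circledast> R) (inv_arr S (asc S A B C)) ?l" by simp
qed

text \<open>By Yoneda \<open>i\<close> is a map from the representable of \<open>W\<close> to
  \<open>T\<close>; this is the extension of \<open>\<eta>\<close> to presheaves followed by that
  map.\<close>

definition insert_right :: "('k,'o,'m,'v) psh \<Rightarrow> 'o \<Rightarrow> 'v \<Rightarrow> ('o \<Rightarrow> 'm) \<Rightarrow> ('k,'o,'m,'v) psh \<Rightarrow> ('k,'o,'m,'v) pshmap" where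
  "insert_right T W i \<eta> = (\<lambda>Q\<in>Obj DC. mk_psh Q (Q \<circledast> T) (\<lambda>X q. act (Q \<circledast> T) (\<eta> X) (tens Q T X W q i)))"

definition insert_left :: "('k,'o,'m,'v) psh \<Rightarrow> 'o \<Rightarrow> 'v \<Rightarrow> ('o \<Rightarrow> 'm) \<Rightarrow> ('k,'o,'m,'v) psh \<Rightarrow> ('k,'o,'m,'v) pshmap" where
  "insert_left T W i \<eta> = (\<lambda>Q\<in>Obj DC. mk_psh Q (T \<circledast> Q) (\<lambda>X q. act (T \<circledast> Q) (\<eta> X) (tens T Q W X i q)))"

context
  fixes T :: "('k,'o,'m,'v) psh" and W i \<eta>l \<eta>r
  assumes T: "psh K S T" and W: "W \<in> Obj S" and i: "i \<in> carrier (fobj T W)"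
    and \<eta>l: "\<eta>l \<in> lmod_trans S (id_modfun S) (rtens S W)" and \<eta>r: "\<eta>r \<in> rmod_trans S (id_modfun S) (ltens S W)"
begin

lemma insert_rightD:
  assumes Q: "psh K S Q"
  shows "insert_right T W i \<eta>l Q \<in> Arr PC" "src (insert_right T W i \<eta>l Q) = Q" "tgt (insert_right T W i \<eta>l Q) = Q \<circledast> T"
    and "A \<in> Obj S \<Longrightarrow> q \<in> carrier (fobj Q A) \<Longrightarrow> ap (insert_right T W i \<eta>l Q) A q = act (Q \<circledast> T) (\<eta>l A) (tens Q T A W q i)"
proof -
  note l = \<eta>lD[OF \<eta>l W]
  show "insert_right T W i \<eta>l Q \<in> Arr PC"
    unfolding insert_right_def using Q
  proof (simp, intro mk_psh_arr psh_day T)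
    fix X assume X: "X \<in> Obj S"
    show "linear_on K (fobj Q X) (fobj (Q \<circledast> T) X) (\<lambda>q. act (Q \<circledast> T) (\<eta>l X) (tens Q T X W q i))"
      by (rule linear_on_comp[OF linear_tens(1)[OF Q T X W i]]) (use pshD(3)[OF psh_day[OF Q T] l(1)[OF X]] X W in \<open>simp add: l\<close>)
  next
    fix h q assume h: "h \<in> Arr S" "q \<in> carrier (fobj Q (Cod S h))"
    then show "act (Q \<circledast> T) (\<eta>l (Dom S h)) (tens Q T (Dom S h) W (act Q h q) i) =
        act (Q \<circledast> T) h (act (Q \<circledast> T) (\<eta>l (Cod S h)) (tens Q T (Cod S h) W q i))"
      using Q T W i by (simp add: act_norm l)
  qed
qed (use Q in \<open>simp_all add: insert_right_def\<close>)

lemma insert_leftD: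
  assumes Q: "psh K S Q"
  shows "insert_left T W i \<eta>r Q \<in> Arr PC" "src (insert_left T W i \<eta>r Q) = Q" "tgt (insert_left T W i \<eta>r Q) = T \<circledast> Q"
    and "A \<in> Obj S \<Longrightarrow> q \<in> carrier (fobj Q A) \<Longrightarrow> ap (insert_left T W i \<eta>r Q) A q = act (T \<circledast> Q) (\<eta>r A) (tens T Q W A i q)"
proof -
  note l = \<eta>rD[OF \<eta>r W]
  show "insert_left T W i \<eta>r Q \<in> Arr PC"
    unfolding insert_left_def using Q
  proof (simp, intro mk_psh_arr psh_day T)
    fix X assume X: "X \<in> Obj S"
    show "linear_on K (fobj Q X) (fobj (T \<circledast> Q) X) (\<lambda>q. act (T \<circledast> Q) (\<eta>r X) (tens T Q W X i q))"
      by (rule linear_on_comp[OF linear_tens(2)[OF T Q W X i]]) (use pshD(3)[OF psh_day[OF T Q] l(1)[OF X]] X W in \<open>simp add: l\<close>)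
  next
    fix h q assume h: "h \<in> Arr S" "q \<in> carrier (fobj Q (Cod S h))"
    then show "act (T \<circledast> Q) (\<eta>r (Dom S h)) (tens T Q W (Dom S h) i (act Q h q)) =
        act (T \<circledast> Q) h (act (T \<circledast> Q) (\<eta>r (Cod S h)) (tens T Q W (Cod S h) i q))"
      using Q T W i by (simp add: act_norm l)
  qed
qed (use Q in \<open>simp_all add: insert_left_def\<close>)

text \<open>On a tensor over \<open>A\<close> and \<open>B\<close> the module condition becomes the
  one satisfied by \<open>\<eta>l\<close> at these objects.\<close>

lemma insert_right_lmod: "insert_right T W i \<eta>l \<in> lmod_trans DC (id_modfun DC) (rtens DC T)"
proof (rule semigroup_category.\<eta>lI[OF semigroup_category_day])
  note l = \<eta>lD[OF \<eta>l W]
  show "insert_right T W i \<eta>l \<in> extensional (Obj DC)" by (simp add: insert_right_def)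
  show "insert_right T W i \<eta>l (Cod DC s) \<cdot>\<^bsub>DC\<^esub> s = (s \<diamondop>\<^bsub>DC\<^esub> Ide DC T) \<cdot>\<^bsub>DC\<^esub> insert_right T W i \<eta>l (Dom DC s)" if "s \<in> Arr DC" for s
  proof -
    have s: "s \<in> Arr PC" using that by simp
    note s' = psh_arrD(1,2)[OF s]
    have "insert_right T W i \<eta>l (tgt s) \<cdot>\<^bsub>PC\<^esub> s = day_arr K S s (Ide PC T) \<cdot>\<^bsub>PC\<^esub> insert_right T W i \<eta>l (src s)"
      by (rule psh_arr_eqI[OF psh_Cmp psh_Cmp])
        (use s s' T W i in \<open>simp_all add: insert_rightD day_arrD(1) Ide_psh_arr act_norm l\<close>)
    then show ?thesis by simp
  qed
  fix P Q assume "P \<in> Obj DC" "Q \<in> Obj DC"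
  then have P: "psh K S P" and Q: "psh K S Q" by simp_all
  have "day_asc K S P Q T \<cdot>\<^bsub>PC\<^esub> insert_right T W i \<eta>l (P \<circledast> Q) = day_arr K S (Ide PC P) (insert_right T W i \<eta>l Q)"
  proof (rule day_ext[OF P Q psh_Cmp day_arrD(1)], goal_cases)
    case (9 A B p q)
    then show ?case using P Q T W i
      by (simp add: insert_rightD day_arrD(1) day_ascD Ide_psh_arr act_norm l)
  qed (use P Q T in \<open>simp_all add: insert_rightD day_ascD Ide_psh_arr\<close>)
  then show "asc DC P Q T \<cdot>\<^bsub>DC\<^esub> insert_right T W i \<eta>l (P \<box>\<^bsub>DC\<^esub> Q) = Ide DC P \<diamondop>\<^bsub>DC\<^esub> insert_right T W i \<eta>l Q" by simp
qed (use T in \<open>simp_all add: insert_rightD\<close>)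

lemma insert_left_rmod: "insert_left T W i \<eta>r \<in> rmod_trans DC (id_modfun DC) (ltens DC T)"
proof (rule semigroup_category.\<eta>rI[OF semigroup_category_day])
  note l = \<eta>rD[OF \<eta>r W]
  show "insert_left T W i \<eta>r \<in> extensional (Obj DC)" by (simp add: insert_left_def)
  show "insert_left T W i \<eta>r (Cod DC s) \<cdot>\<^bsub>DC\<^esub> s = (Ide DC T \<diamondop>\<^bsub>DC\<^esub> s) \<cdot>\<^bsub>DC\<^esub> insert_left T W i \<eta>r (Dom DC s)" if "s \<in> Arr DC" for s
  proof -
    have s: "s \<in> Arr PC" using that by simp
    note s' = psh_arrD(1,2)[OF s]
    have "insert_left T W i \<eta>r (tgt s) \<cdot>\<^bsub>PC\<^esub> s = day_arr K S (Ide PC T) s \<cdot>\<^bsub>PC\<^esub> insert_left T W i \<eta>r (src s)"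
      by (rule psh_arr_eqI[OF psh_Cmp psh_Cmp])
        (use s s' T W i in \<open>simp_all add: insert_leftD day_arrD(1) Ide_psh_arr act_norm l\<close>)
    then show ?thesis by simp
  qed
  fix Q P assume "P \<in> Obj DC" "Q \<in> Obj DC"
  then have P: "psh K S P" and Q: "psh K S Q" by simp_all
  have "insert_left T W i \<eta>r (P \<circledast> Q) = day_asc K S T P Q \<cdot>\<^bsub>PC\<^esub> day_arr K S (insert_left T W i \<eta>r P) (Ide PC Q)"
  proof (rule day_ext[OF P Q _ psh_Cmp], goal_cases)
    case (8 A B p q)
    then have "\<eta>r (A \<box> B) = asc S W A B \<cdot> (\<eta>r A \<diamondop> Ide S B)"
      using W by (simp add: l(1-3) flip: l(5))
    then show ?case using 8 P Q T W i
      by (simp add: insert_leftD day_arrD(1) day_ascD Ide_psh_arr act_norm l)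
  qed (use P Q T in \<open>simp_all add: insert_leftD day_arrD(1) day_ascD Ide_psh_arr\<close>)
  then show "insert_left T W i \<eta>r (P \<box>\<^bsub>DC\<^esub> Q) = asc DC T P Q \<cdot>\<^bsub>DC\<^esub> (insert_left T W i \<eta>r P \<diamondop>\<^bsub>DC\<^esub> Ide DC Q)" by simp
qed (use T in \<open>simp_all add: insert_leftD\<close>)

text \<open>The unit half of condition (IV) is inherited: on tensors it is the equation assumed in
  \<open>S\<close>, acting on \<open>p\<close>, \<open>i\<close> and \<open>q\<close>.\<close>

lemma insert_balanced:
  assumes b: "\<And>H L. H \<in> Obj S \<Longrightarrow> L \<in> Obj S \<Longrightarrow> Ide S H \<diamondop> \<eta>r L = asc S H W L \<cdot> (\<eta>l H \<diamondop> Ide S L)"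
    and P: "psh K S P" and Q: "psh K S Q"
  shows "day_arr K S (Ide PC P) (insert_left T W i \<eta>r Q) = day_asc K S P T Q \<cdot>\<^bsub>PC\<^esub> day_arr K S (insert_right T W i \<eta>l P) (Ide PC Q)"
proof (rule day_ext[OF P Q day_arrD(1) psh_Cmp], goal_cases)
  case (9 A B p q)
  then show ?case using P Q T W i b[of A B]
    by (simp add: insert_leftD insert_rightD day_arrD(1) day_ascD Ide_psh_arr act_norm \<eta>lD[OF \<eta>l W] \<eta>rD[OF \<eta>r W])
qed (use P Q T in \<open>simp_all add: insert_leftD insert_rightD day_arrD(1) day_ascD Ide_psh_arr\<close>)

end

end

section \<open>Transformations induced by a map to the unit\<close>

context small_rigid
begin

definition counit_left :: "('k,'o,'m,'v) pshmap \<Rightarrow> ('k,'o,'m,'v) psh \<Rightarrow> ('k,'o,'m,'v) pshmap" where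
  "counit_left s = (\<lambda>Q\<in>Obj DC. runi Q \<cdot>\<^bsub>PC\<^esub> day_arr K S (Ide PC Q) s)"

definition counit_right :: "('k,'o,'m,'v) pshmap \<Rightarrow> ('k,'o,'m,'v) psh \<Rightarrow> ('k,'o,'m,'v) pshmap" where
  "counit_right s = (\<lambda>Q\<in>Obj DC. luni Q \<cdot>\<^bsub>PC\<^esub> day_arr K S s (Ide PC Q))"

context
  fixes s V
  assumes s: "s \<in> Arr PC" "src s = V" "tgt s = ul"
begin

lemma psh_V: "psh K S V"
  using psh_arrD(1)[OF s(1)] s by simp

lemma ap_ulE:
  assumes "L \<in> Obj S" "v \<in> carrier (fobj V L)"
  obtains t where "t \<in> lunit S L" "ap s L v = ule L t"
  using uleE[OF _ assms(1)] psh_arrD(7)[OF s(1) assms(1)] assms(2) s by (metis fobj_ul)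

lemma counit_leftD:
  assumes Q: "psh K S Q"
  shows "counit_left s Q \<in> Arr PC" "src (counit_left s Q) = Q \<circledast> V" "tgt (counit_left s Q) = Q"
    and "\<lbrakk>A \<in> Obj S; L \<in> Obj S; q \<in> carrier (fobj Q A); v \<in> carrier (fobj V L); t \<in> lunit S L; ap s L v = ule L t\<rbrakk> \<Longrightarrow>
      ap (counit_left s Q) (A \<box> L) (tens Q V A L q v) = act Q (t A) q"
  unfolding counit_left_def using Q s psh_V
  by (simp_all add: psh_Cmp runiD day_arrD(1) Ide_psh_arr act_norm)

lemma counit_rightD:
  assumes Q: "psh K S Q"
  shows "counit_right s Q \<in> Arr PC" "src (counit_right s Q) = V \<circledast> Q" "tgt (counit_right s Q) = Q"
    and "\<lbrakk>A \<in> Obj S; L \<in> Obj S; q \<in> carrier (fobj Q A); v \<in> carrier (fobj V L); t \<in> lunit S L; ap s L v = ule L t\<rbrakk> \<Longrightarrow>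
      ap (counit_right s Q) (L \<box> A) (tens V Q L A v q) = act Q (partner L t A) q"
  unfolding counit_right_def using Q s psh_V
  by (simp_all add: psh_Cmp luniD day_arrD(1) Ide_psh_arr act_norm)

text \<open>On a tensor of \<open>q\<close> and \<open>v\<close> the map acts on \<open>q\<close> by
  the transformation that \<open>s\<close> assigns to \<open>v\<close>; the module condition is that
  of this transformation.\<close>

lemma counit_left_lunit: "counit_left s \<in> lunit DC V"
proof (rule semigroup_category.lunitI[OF semigroup_category_day])
  show "counit_left s \<in> extensional (Obj DC)" by (simp add: counit_left_def)
  show "counit_left s (Cod DC u) \<cdot>\<^bsub>DC\<^esub> (u \<diamondop>\<^bsub>DC\<^esub> Ide DC V) = u \<cdot>\<^bsub>DC\<^esub> counit_left s (Dom DC u)" if "u \<in> Arr DC" for u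
  proof -
    have u: "u \<in> Arr PC" using that by simp
    note u' = psh_arrD(1,2)[OF u]
    have "counit_left s (tgt u) \<cdot>\<^bsub>PC\<^esub> day_arr K S u (Ide PC V) = u \<cdot>\<^bsub>PC\<^esub> counit_left s (src u)"
    proof (rule day_ext[OF u'(1) psh_V psh_Cmp psh_Cmp], goal_cases)
      case (10 A L q v)
      obtain t where t: "t \<in> lunit S L" "ap s L v = ule L t" using ap_ulE[OF 10(2,4)] .
      then show ?case using 10 u u' psh_V lunitD[OF t(1) 10(2)]
        by (simp add: counit_leftD day_arrD(1) Ide_psh_arr act_norm)
    qed (use u u' psh_V in \<open>simp_all add: counit_leftD day_arrD(1) Ide_psh_arr\<close>)
    then show ?thesis by simp
  qed
  fix P Q assume "P \<in> Obj DC" "Q \<in> Obj DC"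
  then have P: "psh K S P" and Q: "psh K S Q" by simp_all
  have "counit_left s (P \<circledast> Q) = day_arr K S (Ide PC P) (counit_left s Q) \<cdot>\<^bsub>PC\<^esub> day_asc K S P Q V"
  proof (rule day_ext_left[OF P Q psh_V _ psh_Cmp], goal_cases)
    case (8 A B L p q v)
    obtain t where t: "t \<in> lunit S L" "ap s L v = ule L t" using ap_ulE[OF 8(3,6)] .
    then show ?case using 8 P Q psh_V lunitD[OF t(1) 8(3)]
      by (simp add: counit_leftD day_arrD(1) day_ascD Ide_psh_arr act_norm)
  qed (use P Q psh_V in \<open>simp_all add: counit_leftD day_arrD(1) day_ascD Ide_psh_arr\<close>)
  then show "counit_left s (P \<box>\<^bsub>DC\<^esub> Q) = (Ide DC P \<diamondop>\<^bsub>DC\<^esub> counit_left s Q) \<cdot>\<^bsub>DC\<^esub> asc DC P Q V" by simp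
qed (use psh_V in \<open>simp_all add: counit_leftD\<close>)

lemma counit_right_runit: "counit_right s \<in> runit DC V"
proof (rule semigroup_category.runitI_asc[OF semigroup_category_day])
  show "counit_right s \<in> extensional (Obj DC)" by (simp add: counit_right_def)
  show "counit_right s (Cod DC u) \<cdot>\<^bsub>DC\<^esub> (Ide DC V \<diamondop>\<^bsub>DC\<^esub> u) = u \<cdot>\<^bsub>DC\<^esub> counit_right s (Dom DC u)" if "u \<in> Arr DC" for u
  proof -
    have u: "u \<in> Arr PC" using that by simp
    note u' = psh_arrD(1,2)[OF u]
    have "counit_right s (tgt u) \<cdot>\<^bsub>PC\<^esub> day_arr K S (Ide PC V) u = u \<cdot>\<^bsub>PC\<^esub> counit_right s (src u)"
    proof (rule day_ext[OF psh_V u'(1) psh_Cmp psh_Cmp], goal_cases)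
      case (10 L A v q)
      obtain t where t: "t \<in> lunit S L" "ap s L v = ule L t" using ap_ulE[OF 10(1,3)] .
      then show ?case using 10 u u' psh_V runitD[OF partnerD(1)[OF 10(1) t(1)] 10(1)]
        by (simp add: counit_rightD day_arrD(1) Ide_psh_arr act_norm)
    qed (use u u' psh_V in \<open>simp_all add: counit_rightD day_arrD(1) Ide_psh_arr\<close>)
    then show ?thesis by simp
  qed
  fix Q P assume "P \<in> Obj DC" "Q \<in> Obj DC"
  then have P: "psh K S P" and Q: "psh K S Q" by simp_all
  have "counit_right s (P \<circledast> Q) \<cdot>\<^bsub>PC\<^esub> day_asc K S V P Q = day_arr K S (counit_right s P) (Ide PC Q)"
  proof (rule day_ext_left[OF psh_V P Q psh_Cmp day_arrD(1)], goal_cases)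
    case (9 L A B v p q)
    obtain t where t: "t \<in> lunit S L" "ap s L v = ule L t" using ap_ulE[OF 9(1,4)] .
    then show ?case using 9 P Q psh_V runitD[OF partnerD(1)[OF 9(1) t(1)] 9(1)]
      by (simp add: counit_rightD day_arrD(1) day_ascD Ide_psh_arr act_norm)
  qed (use P Q psh_V in \<open>simp_all add: counit_rightD day_arrD(1) day_ascD Ide_psh_arr\<close>)
  then show "counit_right s (P \<box>\<^bsub>DC\<^esub> Q) \<cdot>\<^bsub>DC\<^esub> asc DC V P Q = counit_right s P \<diamondop>\<^bsub>DC\<^esub> Ide DC Q" by simp
qed (use psh_V in \<open>simp_all add: counit_rightD\<close>)

text \<open>Balance between the transformation assigned to \<open>v\<close> and its partner gives
  the counit half of condition (IV) for presheaves.\<close>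

lemma counit_balanced:
  assumes P: "psh K S P" and Q: "psh K S Q"
  shows "day_arr K S (Ide PC P) (counit_right s Q) \<cdot>\<^bsub>PC\<^esub> day_asc K S P V Q = day_arr K S (counit_left s P) (Ide PC Q)"
proof (rule day_ext_left[OF P psh_V Q psh_Cmp day_arrD(1)], goal_cases)
  case (9 A L B p v q)
  obtain t where t: "t \<in> lunit S L" "ap s L v = ule L t" using ap_ulE[OF 9(2,5)] .
  note pt = partnerD[OF 9(2) t(1)]
  show ?case using 9 t P Q psh_V lunitD[OF t(1) 9(2)] runitD[OF pt(1) 9(2)] balancedD[OF pt(2) 9(1,3)]
    by (simp add: counit_leftD counit_rightD day_arrD(1) day_ascD Ide_psh_arr act_norm)
qed (use P Q psh_V in \<open>simp_all add: counit_leftD counit_rightD day_arrD(1) day_ascD Ide_psh_arr\<close>)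

end

end

section \<open>Dual pairs of representable presheaves\<close>

context small_rigid
begin

abbreviation el1 :: "'o \<Rightarrow> 'v" where "el1 A \<equiv> el A A (Ide S A)"

abbreviation el2 :: "'o \<Rightarrow> 'o \<Rightarrow> 'v" where "el2 A B \<equiv> tens (y A) (y B) A B (el1 A) (el1 B)"

text \<open>Yoneda in the second variable: elements of \<open>y G\<close> are restrictions of the
  identity, so the tensors with that identity suffice.\<close>

lemma day_ext_el_right:
  assumes Q: "psh K S Q" and G: "G \<in> Obj S" and s: "s \<in> Arr PC" and s': "s' \<in> Arr PC"
    and src: "src s = Q \<circledast> y G" "src s' = Q \<circledast> y G" "tgt s = tgt s'"
    and eq: "\<And>A q. A \<in> Obj S \<Longrightarrow> q \<in> carrier (fobj Q A) \<Longrightarrow>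
      ap s (A \<box> G) (tens Q (y G) A G q (el1 G)) = ap s' (A \<box> G) (tens Q (y G) A G q (el1 G))"
  shows "s = s'"
proof (rule day_ext[OF Q psh_y[OF G] s s' src])
  fix A B q p assume a: "A \<in> Obj S" "B \<in> Obj S" "q \<in> carrier (fobj Q A)" "p \<in> carrier (fobj (y G) B)"
  then obtain b where b: "b \<in> Arr S" "Dom S b = B" "Cod S b = G" "p = el B G b" using G by (auto elim: elE)
  have e: "tens Q (y G) A B q p = act (Q \<circledast> y G) (Ide S A \<diamondop> b) (tens Q (y G) A G q (el1 G))"
    using tens_act_right[OF Q psh_y[OF G] b(1,2) a(1), of "el1 G" q] a b G by simp
  show "ap s (A \<box> B) (tens Q (y G) A B q p) = ap s' (A \<box> B) (tens Q (y G) A B q p)"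
    unfolding e using a b s s' src Q G eq[OF a(1,3)] by (simp add: ap_act_day)
qed

lemma day_ext_el_left:
  assumes Q: "psh K S Q" and G: "G \<in> Obj S" and s: "s \<in> Arr PC" and s': "s' \<in> Arr PC"
    and src: "src s = y G \<circledast> Q" "src s' = y G \<circledast> Q" "tgt s = tgt s'"
    and eq: "\<And>A q. A \<in> Obj S \<Longrightarrow> q \<in> carrier (fobj Q A) \<Longrightarrow>
      ap s (G \<box> A) (tens (y G) Q G A (el1 G) q) = ap s' (G \<box> A) (tens (y G) Q G A (el1 G) q)"
  shows "s = s'"
proof (rule day_ext[OF psh_y[OF G] Q s s' src])
  fix B A p q assume a: "B \<in> Obj S" "A \<in> Obj S" "p \<in> carrier (fobj (y G) B)" "q \<in> carrier (fobj Q A)"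
  then obtain b where b: "b \<in> Arr S" "Dom S b = B" "Cod S b = G" "p = el B G b" using G by (auto elim: elE)
  have e: "tens (y G) Q B A p q = act (y G \<circledast> Q) (b \<diamondop> Ide S A) (tens (y G) Q G A (el1 G) q)"
    using tens_act_left[OF psh_y[OF G] Q b(1,2) a(2), of "el1 G" q] a b G by simp
  show "ap s (B \<box> A) (tens (y G) Q B A p q) = ap s' (B \<box> A) (tens (y G) Q B A p q)"
    unfolding e using a b s s' src Q G eq[OF a(2,4)] by (simp add: ap_act_day)
qed

text \<open>By Yoneda the element \<open>t\<close> of the unit at \<open>F \<box> G\<close> is a map
  out of \<open>y (F \<box> G)\<close>; precomposing with \<open>yoneda_str\<close> puts it on the
  convolution.\<close>

lemma evaluation_exists:
  assumes F: "F \<in> Obj S" and G: "G \<in> Obj S" and t: "t \<in> lunit S (F \<box> G)"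
  shows "\<exists>s. s \<in> Arr PC \<and> src s = y F \<circledast> y G \<and> tgt s = ul \<and> ap s (F \<box> G) (el2 F G) = ule (F \<box> G) t"
proof -
  let ?J = "yoneda_str K S F G :: ('k,'o,'m,'v) pshmap"
  note J = yoneda_strD[OF F G]
  let ?z = "mk_psh (y (F \<box> G)) ul (\<lambda>X c. act ul (vdec (Hom S X (F \<box> G)) c) (ule (F \<box> G) t))"
  have FG: "F \<box> G \<in> Obj S" using F G by simp
  have z: "?z \<in> Arr PC"
  proof (rule mk_psh_arr[OF psh_y[OF FG] psh_ul])
    show "linear_on K (fobj (y (F \<box> G)) X) (fobj ul X) (\<lambda>c. act ul (vdec (Hom S X (F \<box> G)) c) (ule (F \<box> G) t))"
      if X: "X \<in> Obj S" for X
      unfolding fobj_y by (rule linear_on_comp[OF linear_unel[OF X FG] pshD(8)[OF psh_ul X FG]]) (use t FG in simp)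
    fix h c assume h: "h \<in> Arr S" and "c \<in> carrier (fobj (y (F \<box> G)) (Cod S h))"
    then obtain f where f: "f \<in> Arr S" "Dom S f = Cod S h" "Cod S f = F \<box> G" "c = el (Cod S h) (F \<box> G) f" using FG by (auto elim: elE)
    show "act ul (vdec (Hom S (Dom S h) (F \<box> G)) (act (y (F \<box> G)) h c)) (ule (F \<box> G) t) =
        act ul h (act ul (vdec (Hom S (Cod S h) (F \<box> G)) c) (ule (F \<box> G) t))"
      using h f t FG by (simp add: pshD(7)[OF psh_ul])
  qed
  have "ap (?z \<cdot>\<^bsub>PC\<^esub> ?J) (F \<box> G) (el2 F G) = ule (F \<box> G) t"
    using J F G FG t pshD(6)[OF psh_ul FG, of "ule (F \<box> G) t"] by simp
  moreover have "?z \<cdot>\<^bsub>PC\<^esub> ?J \<in> Arr PC" by (rule psh_Cmp) (use J z in simp_all)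
  ultimately show ?thesis using J by (intro exI[of _ "?z \<cdot>\<^bsub>PC\<^esub> ?J"]) simp
qed

text \<open>The units insert \<open>el2 G F\<close>, the tensor of two identities, and the counits
  evaluate through \<open>ev\<close>. On tensors of \<open>q\<close> with an identity, each
  adjunction equation becomes the action on \<open>q\<close> and the identity of the same equation
  for the dual pair in \<open>S\<close>.\<close>

lemma yoneda_dual:
  assumes a: "sg_adjunction K S F G \<eta>l \<eta>r \<epsilon>l \<epsilon>r"
  shows "is_right_dual K DC (y F) (y G)"
proof -
  note d = sg_adjunctionD[OF a]
  note F = d(1) and G = d(2)
  let ?W = "G \<box> F" and ?V = "F \<box> G" and ?T = "y G \<circledast> y F" and ?U = "y F \<circledast> y G"
  have W: "?W \<in> Obj S" and V: "?V \<in> Obj S" using F G by simp_all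
  note yF = psh_y[OF F] and yG = psh_y[OF G]
  have T: "psh K S ?T" and U: "psh K S ?U" using yF yG by simp_all
  have i: "el2 G F \<in> carrier (fobj ?T ?W)" and j: "el2 F G \<in> carrier (fobj ?U ?V)" using F G by simp_all
  obtain ev where ev: "ev \<in> Arr PC" "src ev = ?U" "tgt ev = ul" "ap ev ?V (el2 F G) = ule ?V \<epsilon>l"
    using evaluation_exists[OF F G d(4)] by blast
  \<comment> \<open>Condition (IV) says that the two counits are balanced, so the right counit built
    from partners acts by the given \<open>\<epsilon>r\<close>.\<close>
  have pe: "partner ?V \<epsilon>l = \<epsilon>r" by (rule partner_eqI[OF V d(4,6,14)])
  let ?nl = "insert_right ?T ?W (el2 G F) \<eta>l" and ?nr = "insert_left ?T ?W (el2 G F) \<eta>r"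
    and ?el = "counit_left ev" and ?er = "counit_right ev"
  note nl = insert_rightD[OF T W i d(3,5)] and nr = insert_leftD[OF T W i d(3,5)]
  note cl = counit_leftD(1-3)[OF ev(1-3)] and cr = counit_rightD(1-3)[OF ev(1-3)]
  have clv: "ap (?el Q) (A \<box> ?V) (tens Q ?U A ?V q (el2 F G)) = act Q (\<epsilon>l A) q"
    if "psh K S Q" "A \<in> Obj S" "q \<in> carrier (fobj Q A)" for Q A q
    by (rule counit_leftD(4)[OF ev(1-3) that(1,2) V that(3) j d(4) ev(4)])
  have crv: "ap (?er Q) (?V \<box> A) (tens ?U Q ?V A (el2 F G) q) = act Q (\<epsilon>r A) q"
    if "psh K S Q" "A \<in> Obj S" "q \<in> carrier (fobj Q A)" for Q A q
    unfolding pe[symmetric] by (rule counit_rightD(4)[OF ev(1-3) that(1,2) V that(3) j d(4) ev(4)])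
  \<comment> \<open>\<open>arr\<close> collects the typing facts and \<open>val\<close> the values
    on tensors; together they reduce every remaining equation to one composite in
    \<open>S\<close>.\<close>
  note arr = nl(1-3) nr(1-3) cl cr day_ascD(1-3) day_inv_asc(1-3) Ide_psh_arr day_arrD(1) psh_Cmp
  note val = nl(4) nr(4) clv crv day_ascD(4) day_inv_asc(4) act_norm
  note \<eta>l' = \<eta>lD[OF d(3) W] and \<eta>r' = \<eta>rD[OF d(5) W] and \<epsilon>l' = lunitD[OF d(4) V] and \<epsilon>r' = runitD[OF d(6) V]
  have "sg_adjunction K DC (y F) (y G) ?nl ?nr ?el ?er"
  proof (rule semigroup_category.sg_adjunctionI[OF semigroup_category_day])
    show "y F \<in> Obj DC" "y G \<in> Obj DC" using yF yG by simp_all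
    show "?nl \<in> lmod_trans DC (id_modfun DC) (rtens DC (y G \<box>\<^bsub>DC\<^esub> y F))"
      using insert_right_lmod[OF T W i d(3,5)] by simp
    show "?nr \<in> rmod_trans DC (id_modfun DC) (ltens DC (y G \<box>\<^bsub>DC\<^esub> y F))"
      using insert_left_rmod[OF T W i d(3,5)] by simp
    show "?el \<in> lunit DC (y F \<box>\<^bsub>DC\<^esub> y G)" using counit_left_lunit[OF ev(1-3)] by simp
    show "?er \<in> runit DC (y F \<box>\<^bsub>DC\<^esub> y G)" using counit_right_runit[OF ev(1-3)] by simp
    show "Ide DC P \<diamondop>\<^bsub>DC\<^esub> ?nr Q = asc DC P (y G \<box>\<^bsub>DC\<^esub> y F) Q \<cdot>\<^bsub>DC\<^esub> (?nl P \<diamondop>\<^bsub>DC\<^esub> Ide DC Q)" if "P \<in> Obj DC" "Q \<in> Obj DC" for P Q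
      using insert_balanced[OF T W i d(3,5,13)] that by simp
    show "(Ide DC P \<diamondop>\<^bsub>DC\<^esub> ?er Q) \<cdot>\<^bsub>DC\<^esub> asc DC P (y F \<box>\<^bsub>DC\<^esub> y G) Q = ?el P \<diamondop>\<^bsub>DC\<^esub> Ide DC Q" if "P \<in> Obj DC" "Q \<in> Obj DC" for P Q
      using counit_balanced[OF ev(1-3)] that by simp
    \<comment> \<open>Both sides start at a representable, so the identity is the only element to
      test; there the claim is the first equation of condition (III) in \<open>S\<close>.\<close>
    have "?er (y F) \<cdot>\<^bsub>PC\<^esub> inv_arr PC (day_asc K S (y F) (y G) (y F)) \<cdot>\<^bsub>PC\<^esub> ?nl (y F) = Ide PC (y F)"
    proof (rule yoneda_ext[OF _ _ F], goal_cases)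
      case 6 then show ?case using F G yF yG V W d(11) by (simp add: arr val \<eta>l' \<epsilon>r')
    qed (use yF yG in \<open>simp_all add: arr\<close>)
    then show "?er (y F) \<cdot>\<^bsub>DC\<^esub> inv_arr DC (asc DC (y F) (y G) (y F)) \<cdot>\<^bsub>DC\<^esub> ?nl (y F) = Ide DC (y F)" by simp
    have "?el (y G) \<cdot>\<^bsub>PC\<^esub> day_asc K S (y G) (y F) (y G) \<cdot>\<^bsub>PC\<^esub> ?nr (y G) = Ide PC (y G)"
    proof (rule yoneda_ext[OF _ _ G], goal_cases)
      case 6 then show ?case using F G yF yG V W d(12) by (simp add: arr val \<eta>r' \<epsilon>l')
    qed (use yF yG in \<open>simp_all add: arr\<close>)
    then show "?el (y G) \<cdot>\<^bsub>DC\<^esub> asc DC (y G) (y F) (y G) \<cdot>\<^bsub>DC\<^esub> ?nr (y G) = Ide DC (y G)" by simp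
  next
    fix Q assume "Q \<in> Obj DC"
    then have Q: "psh K S Q" by simp
    have "(?el (Q \<circledast> y G) \<cdot>\<^bsub>PC\<^esub> day_asc K S (Q \<circledast> y G) (y F) (y G)) \<cdot>\<^bsub>PC\<^esub>
        day_arr K S (inv_arr PC (day_asc K S Q (y G) (y F)) \<cdot>\<^bsub>PC\<^esub> ?nl Q) (Ide PC (y G)) = Ide PC (Q \<circledast> y G)"
    proof (rule day_ext_el_right[OF Q G], goal_cases)
      case (6 A q) then show ?case using F G Q yF yG V W d(7)[of A] by (simp add: arr val \<eta>l' \<epsilon>l')
    qed (use Q yF yG in \<open>simp_all add: arr\<close>)
    then show "(?el (Q \<box>\<^bsub>DC\<^esub> y G) \<cdot>\<^bsub>DC\<^esub> asc DC (Q \<box>\<^bsub>DC\<^esub> y G) (y F) (y G)) \<cdot>\<^bsub>DC\<^esub>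
        ((inv_arr DC (asc DC Q (y G) (y F)) \<cdot>\<^bsub>DC\<^esub> ?nl Q) \<diamondop>\<^bsub>DC\<^esub> Ide DC (y G)) = Ide DC (Q \<box>\<^bsub>DC\<^esub> y G)" by simp
    have "day_arr K S (?el Q \<cdot>\<^bsub>PC\<^esub> day_asc K S Q (y F) (y G)) (Ide PC (y F)) \<cdot>\<^bsub>PC\<^esub>
        inv_arr PC (day_asc K S (Q \<circledast> y F) (y G) (y F)) \<cdot>\<^bsub>PC\<^esub> ?nl (Q \<circledast> y F) = Ide PC (Q \<circledast> y F)"
    proof (rule day_ext_el_right[OF Q F], goal_cases)
      case (6 A q) then show ?case using F G Q yF yG V W d(8)[of A] by (simp add: arr val \<eta>l' \<epsilon>l')
    qed (use Q yF yG in \<open>simp_all add: arr\<close>)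
    then show "((?el Q \<cdot>\<^bsub>DC\<^esub> asc DC Q (y F) (y G)) \<diamondop>\<^bsub>DC\<^esub> Ide DC (y F)) \<cdot>\<^bsub>DC\<^esub>
        inv_arr DC (asc DC (Q \<box>\<^bsub>DC\<^esub> y F) (y G) (y F)) \<cdot>\<^bsub>DC\<^esub> ?nl (Q \<box>\<^bsub>DC\<^esub> y F) = Ide DC (Q \<box>\<^bsub>DC\<^esub> y F)" by simp
    have "(?er (y F \<circledast> Q) \<cdot>\<^bsub>PC\<^esub> inv_arr PC (day_asc K S (y F) (y G) (y F \<circledast> Q))) \<cdot>\<^bsub>PC\<^esub>
        day_arr K S (Ide PC (y F)) (day_asc K S (y G) (y F) Q \<cdot>\<^bsub>PC\<^esub> ?nr Q) = Ide PC (y F \<circledast> Q)"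
    proof (rule day_ext_el_left[OF Q F], goal_cases)
      case (6 A q) then show ?case using F G Q yF yG V W d(9)[of A] by (simp add: arr val \<eta>r' \<epsilon>r')
    qed (use Q yF yG in \<open>simp_all add: arr\<close>)
    then show "(?er (y F \<box>\<^bsub>DC\<^esub> Q) \<cdot>\<^bsub>DC\<^esub> inv_arr DC (asc DC (y F) (y G) (y F \<box>\<^bsub>DC\<^esub> Q))) \<cdot>\<^bsub>DC\<^esub>
        (Ide DC (y F) \<diamondop>\<^bsub>DC\<^esub> (asc DC (y G) (y F) Q \<cdot>\<^bsub>DC\<^esub> ?nr Q)) = Ide DC (y F \<box>\<^bsub>DC\<^esub> Q)" by simp
    have "day_arr K S (Ide PC (y G)) (?er Q \<cdot>\<^bsub>PC\<^esub> inv_arr PC (day_asc K S (y F) (y G) Q)) \<cdot>\<^bsub>PC\<^esub>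
        day_asc K S (y G) (y F) (y G \<circledast> Q) \<cdot>\<^bsub>PC\<^esub> ?nr (y G \<circledast> Q) = Ide PC (y G \<circledast> Q)"
    proof (rule day_ext_el_left[OF Q G], goal_cases)
      case (6 A q) then show ?case using F G Q yF yG V W d(10)[of A] by (simp add: arr val \<eta>r' \<epsilon>r')
    qed (use Q yF yG in \<open>simp_all add: arr\<close>)
    then show "(Ide DC (y G) \<diamondop>\<^bsub>DC\<^esub> (?er Q \<cdot>\<^bsub>DC\<^esub> inv_arr DC (asc DC (y F) (y G) Q))) \<cdot>\<^bsub>DC\<^esub>
        asc DC (y G) (y F) (y G \<box>\<^bsub>DC\<^esub> Q) \<cdot>\<^bsub>DC\<^esub> ?nr (y G \<box>\<^bsub>DC\<^esub> Q) = Ide DC (y G \<box>\<^bsub>DC\<^esub> Q)" by simp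
  qed
  then show ?thesis unfolding is_right_dual_def by blast
qed

theorem rigid_yoneda:
  assumes "F \<in> Obj S"
  shows "rigid_object K DC (y F)"
proof -
  have "\<exists>G. is_right_dual K DC (y F) (y G)" "\<exists>G. is_right_dual K DC (y G) (y F)"
    using duals[OF assms] yoneda_dual by metis+
  then show ?thesis using assms by (auto simp: rigid_object_def)
qed

end

theorem theorem1:
  fixes K :: "('k,'x) ring_scheme"
    and S :: "('k,'o,'m,'y) sgcat_scheme"
    and Shat :: "('k, ('k,'o,'m,'v) psh, ('k,'o,'m,'v) pshmap) sgcat"
  assumes "field K"
    and "semigroup_category K S"
    and small: "Pow ((UNIV :: nat set) <+> carrier K <+> Obj S <+> Arr S) \<lesssim> (UNIV :: 'v set)"
    and "rigid K S"
    and "Shat = day_cat K S"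
  shows "monoidal_category K Shat \<and>
    semigroup_functor K S Shat (yoneda S) (yoneda_str K S) \<and>
    fully_faithful S Shat (yoneda S) \<and>
    fobj (yoneda S) ` Obj S \<subseteq> Obj (rigid_part K Shat) \<and>
    farr (yoneda S) ` Arr S \<subseteq> Arr (rigid_part K Shat) \<and>
    is_unit_object Shat (left_unit_psh K S) \<and>
    isomorphic_objs Shat (left_unit_psh K S) (right_unit_psh K S)"
proof -
  obtain emb :: "(nat + 'k + 'o + 'm) set \<Rightarrow> 'v"
    where "inj_on emb (Pow ((UNIV :: nat set) <+> carrier K <+> Obj S <+> Arr S))"
    using small by (auto simp: lepoll_def)
  then interpret small_rigid K S emb
    using assms(2,4) by (intro small_rigid.intro small_sg.intro small_sg_axioms.intro rigid_sg.intro rigid_sg_axioms.intro)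
  show ?thesis
    unfolding assms(5) monoidal_category_def rigid_part_def full_subcategory_def
    using semigroup_category_day unit_object semigroup_functor_yoneda fully_faithful_yoneda left_right_unit_iso
    by (auto simp: rigid_yoneda)
qed

end
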